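(* Let $N\ge1$ be an integer, $\alpha>0$, and let $H$ be the self-adjoint operator $-\frac{d^2}{dx^2}$ on the infinite star graph with the Exner--Šeba vertex condition, as defined in the context. For each of the four initial-value problems (wave, heat, quantum, cylinder) listed in the context, let $G_S=(G_{Sj}{}^{l}(t,x,y))_{j,l=1}^N$ be the matrix Green function of the problem on the graph, and let $G(t,|x-y|)$ be the scalar Green function of the corresponding problem on the real line. Then for $t>0$ and $x,y>0$, $$G_{Sj}{}^{l}(t,x,y)=\delta_j{}^{l}\,G(t,|x-y|)+\left(\frac2N-\delta_j{}^{l}\right)G(t,x+y)-\frac{2\alpha}{N^2}\int_x^\infty e^{-\alpha(s-x)/N}\,G(t,s+y)\,ds$$ (for the wave problem, as an identity of distributions in $(x,y)\in(0,\infty)^2$).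
   Context: $\delta_j{}^{l}$ is the Kronecker delta. Operator $H$: on $L^2(0,\infty)^N$, $(Hu)_j=-u_j''$ with domain consisting of all $u=(u_1,\dots,u_N)$ with $u_j\in H^2(0,\infty)$ (Sobolev space) satisfying $u_1(0)=\dots=u_N(0)=:u(0)$ and $\sum_{j=1}^N u_j'(0)=\alpha u(0)$. For $\alpha>0$, $H$ is self-adjoint and nonnegative. Initial-value problems for initial data $f=(f_1,\dots,f_N)$: - Wave: $u_{tt}=-Hu$, $u(0,x)=f(x)$, $u_t(0,x)=0$; solution $u(t)=\cos(t\sqrt H)f$. - Heat: $u_t=-Hu$, $u(0,x)=f(x)$; solution $u(t)=e^{-tH}f$. - Quantum: $iu_t=Hu$, $u(0,x)=f(x)$; solution $u(t)=e^{-itH}f$. - Cylinder: $u_{tt}=Hu$, $u(0,x)=f(x)$, $u(t,x)\to0$ as $t\to+\infty$; solution $u(t)=e^{-t\sqrt H}f$. The Green function $G_S$ of a problem is the integral (Schwartz) kernel of its solution operator: for $f\in C_c^\infty((0,\infty))^N$, $$u_j(t,x)=\sum_{l=1}^N\int_0^\infty G_{Sj}{}^{l}(t,x,y)f_l(y)\,dy .$$ The Green functions $G(t,|x-y|)$ on the real line (with $-d^2/dx^2$ on $L^2(\mathbb R)$ in place of $H$) are given for $t>0$ by: wave $G(t,z)=\frac12[\delta(z-t)+\delta(z+t)]$; heat $G(t,z)=(4\pi t)^{-1/2}e^{-z^2/4t}$; quantum $G(t,z)=(4\pi it)^{-1/2}e^{-z^2/4it}$ (principal square root); cylinder $G(t,z)=\frac{t/\pi}{t^2+z^2}$.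 *)

theory Defs
  imports "HOL-Analysis.Analysis"
begin

section \<open>Test functions and distributions on the open half-line and quadrant\<close>

text \<open>
  Test functions on \<open>(0,\<infinity>)\<close> and \<open>(0,\<infinity>)\<^sup>2\<close> are total functions on \<open>\<real>\<close> and \<open>\<real>\<^sup>2\<close> (extended by zero).
\<close>

definition vderiv :: "(real \<Rightarrow> complex) \<Rightarrow> real \<Rightarrow> complex" where
  "vderiv f x = vector_derivative f (at x)"

definition test_fun :: "(real \<Rightarrow> complex) \<Rightarrow> bool" where
  "test_fun f \<longleftrightarrow>
     (\<forall>n x. (vderiv ^^ n) f differentiable (at x)) \<and>
     (\<exists>a>0. \<exists>b. \<forall>x. x \<notin> {a..b} \<longrightarrow> f x = 0)"

definition pderiv1 :: "(real \<Rightarrow> real \<Rightarrow> complex) \<Rightarrow> real \<Rightarrow> real \<Rightarrow> complex" where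
  "pderiv1 \<Phi> x y = vector_derivative (\<lambda>x'. \<Phi> x' y) (at x)"

definition pderiv2 :: "(real \<Rightarrow> real \<Rightarrow> complex) \<Rightarrow> real \<Rightarrow> real \<Rightarrow> complex" where
  "pderiv2 \<Phi> x y = vector_derivative (\<lambda>y'. \<Phi> x y') (at y)"

definition pderivs :: "nat \<Rightarrow> nat \<Rightarrow> (real \<Rightarrow> real \<Rightarrow> complex) \<Rightarrow> real \<Rightarrow> real \<Rightarrow> complex" where
  "pderivs m n \<Phi> = (pderiv1 ^^ m) ((pderiv2 ^^ n) \<Phi>)"

text \<open>
  The third condition below includes that the partial derivatives commute.
\<close>

definition smooth2 :: "(real \<Rightarrow> real \<Rightarrow> complex) \<Rightarrow> bool" where
  "smooth2 \<Phi> \<longleftrightarrow> (\<forall>m n.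
     continuous_on UNIV (\<lambda>(x, y). pderivs m n \<Phi> x y) \<and>
     (\<forall>x y. ((\<lambda>x'. pderivs m n \<Phi> x' y) has_vector_derivative pderivs (Suc m) n \<Phi> x y) (at x)) \<and>
     (\<forall>x y. ((\<lambda>y'. pderivs m n \<Phi> x y') has_vector_derivative pderivs m (Suc n) \<Phi> x y) (at y)))"

definition supported_in :: "real \<Rightarrow> real \<Rightarrow> (real \<Rightarrow> real \<Rightarrow> complex) \<Rightarrow> bool" where
  "supported_in a b \<Phi> \<longleftrightarrow> (\<forall>x y. (x, y) \<notin> {a..b} \<times> {a..b} \<longrightarrow> \<Phi> x y = 0)"

definition test_fun2 :: "(real \<Rightarrow> real \<Rightarrow> complex) \<Rightarrow> bool" where
  "test_fun2 \<Phi> \<longleftrightarrow> smooth2 \<Phi> \<and> (\<exists>a>0. \<exists>b. supported_in a b \<Phi>)"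

definition distribution2 :: "((real \<Rightarrow> real \<Rightarrow> complex) \<Rightarrow> complex) \<Rightarrow> bool" where
  "distribution2 T \<longleftrightarrow>
     (\<forall>\<Phi> \<Psi>. test_fun2 \<Phi> \<longrightarrow> test_fun2 \<Psi> \<longrightarrow> T (\<lambda>x y. \<Phi> x y + \<Psi> x y) = T \<Phi> + T \<Psi>) \<and>
     (\<forall>c \<Phi>. test_fun2 \<Phi> \<longrightarrow> T (\<lambda>x y. c * \<Phi> x y) = c * T \<Phi>) \<and>
     (\<forall>\<Phi> :: nat \<Rightarrow> real \<Rightarrow> real \<Rightarrow> complex.
        (\<forall>k. test_fun2 (\<Phi> k)) \<longrightarrow>
        (\<exists>a>0. \<exists>b. \<forall>k. supported_in a b (\<Phi> k)) \<longrightarrow>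
        (\<forall>m n. uniform_limit UNIV (\<lambda>k (x, y). pderivs m n (\<Phi> k) x y) (\<lambda>_. 0) sequentially) \<longrightarrow>
        (\<lambda>k. T (\<Phi> k)) \<longlonglongrightarrow> 0)"

section \<open>The space \<open>L\<^sup>2(0,\<infinity>)\<^sup>N\<close>\<close>

text \<open>
  Elements of \<open>L\<^sup>2(0,\<infinity>)\<^sup>N\<close> are represented by functions \<open>u\<close> of the edge index \<open>j \<in> {1..N}\<close> and of
  the position \<open>x > 0\<close>; values at other arguments are irrelevant, and every notion below is
  invariant under changes on null sets.
\<close>

definition in_L2 :: "(real \<Rightarrow> complex) \<Rightarrow> bool" where
  "in_L2 g \<longleftrightarrow> set_borel_measurable lborel {0<..} g \<and>
     set_integrable lborel {0<..} (\<lambda>x. (cmod (g x))\<^sup>2)"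

definition in_L2N :: "nat \<Rightarrow> (nat \<Rightarrow> real \<Rightarrow> complex) \<Rightarrow> bool" where
  "in_L2N N u \<longleftrightarrow> (\<forall>j\<in>{1..N}. in_L2 (u j))"

definition L2_norm :: "nat \<Rightarrow> (nat \<Rightarrow> real \<Rightarrow> complex) \<Rightarrow> real" where
  "L2_norm N u = sqrt (\<Sum>j=1..N. LBINT x:{0<..}. (cmod (u j x))\<^sup>2)"

definition L2_tendsto ::
  "nat \<Rightarrow> (real \<Rightarrow> nat \<Rightarrow> real \<Rightarrow> complex) \<Rightarrow> (nat \<Rightarrow> real \<Rightarrow> complex) \<Rightarrow> real filter \<Rightarrow> bool" where
  "L2_tendsto N u v F \<longleftrightarrow> in_L2N N v \<and> (\<forall>\<^sub>F t in F. in_L2N N (u t)) \<and>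
     ((\<lambda>t. L2_norm N (\<lambda>j x. u t j x - v j x)) \<longlongrightarrow> 0) F"

definition L2_has_deriv ::
  "nat \<Rightarrow> (real \<Rightarrow> nat \<Rightarrow> real \<Rightarrow> complex) \<Rightarrow> (nat \<Rightarrow> real \<Rightarrow> complex) \<Rightarrow> real \<Rightarrow> bool" where
  "L2_has_deriv N u v t \<longleftrightarrow> in_L2N N (u t) \<and>
     L2_tendsto N (\<lambda>s j x. (u s j x - u t j x) / of_real (s - t)) v (at t)"

section \<open>The Hamiltonian on the star graph\<close>

definition weak_deriv :: "(real \<Rightarrow> complex) \<Rightarrow> (real \<Rightarrow> complex) \<Rightarrow> bool" where
  "weak_deriv g h \<longleftrightarrow> in_L2 g \<and> in_L2 h \<and>
     (\<forall>\<phi>. test_fun \<phi> \<longrightarrow> (LBINT x:{0<..}. g x * vderiv \<phi> x) = - (LBINT x:{0<..}. h x * \<phi> x))"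

definition sobolev_H2 :: "(real \<Rightarrow> complex) \<Rightarrow> bool" where
  "sobolev_H2 g \<longleftrightarrow> (\<exists>g1 g2. weak_deriv g g1 \<and> weak_deriv g1 g2)"

text \<open>The value at \<open>0\<close> of (the representative continuous up to \<open>0\<close> of) a function on \<open>(0,\<infinity>)\<close>.\<close>

definition trace_at_0 :: "(real \<Rightarrow> complex) \<Rightarrow> complex \<Rightarrow> bool" where
  "trace_at_0 g c \<longleftrightarrow>
     (\<exists>G. continuous_on {0..} G \<and> (AE x in lborel. 0 < x \<longrightarrow> G x = g x) \<and> G 0 = c)"

definition star_domain :: "nat \<Rightarrow> real \<Rightarrow> (nat \<Rightarrow> real \<Rightarrow> complex) \<Rightarrow> bool" where
  "star_domain N \<alpha> u \<longleftrightarrow>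
     (\<forall>j\<in>{1..N}. sobolev_H2 (u j)) \<and>
     (\<exists>u0 d. (\<forall>j\<in>{1..N}. trace_at_0 (u j) u0) \<and>
        (\<forall>j\<in>{1..N}. \<exists>u'. weak_deriv (u j) u' \<and> trace_at_0 u' (d j)) \<and>
        (\<Sum>j=1..N. d j) = of_real \<alpha> * u0)"

text \<open>\<open>star_H N \<alpha> u w\<close> says that \<open>u\<close> is in the domain of \<open>H\<close> and \<open>H u = w\<close>.\<close>

definition star_H ::
  "nat \<Rightarrow> real \<Rightarrow> (nat \<Rightarrow> real \<Rightarrow> complex) \<Rightarrow> (nat \<Rightarrow> real \<Rightarrow> complex) \<Rightarrow> bool" where
  "star_H N \<alpha> u w \<longleftrightarrow> star_domain N \<alpha> u \<and>
     (\<forall>j\<in>{1..N}. \<exists>u'. weak_deriv (u j) u' \<and> weak_deriv u' (\<lambda>x. - w j x))"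

section \<open>The four initial-value problems\<close>

text \<open>
  Solutions are \<open>L\<^sup>2\<close>-valued functions of \<open>t > 0\<close>; initial conditions are limits in \<open>L\<^sup>2\<close> as
  \<open>t \<rightarrow> 0\<close> from the right.
\<close>

definition wave_solution ::
  "nat \<Rightarrow> real \<Rightarrow> (nat \<Rightarrow> real \<Rightarrow> complex) \<Rightarrow> (real \<Rightarrow> nat \<Rightarrow> real \<Rightarrow> complex) \<Rightarrow> bool" where
  "wave_solution N \<alpha> f u \<longleftrightarrow>
     (\<exists>ut utt.
        (\<forall>t>0. L2_has_deriv N u (ut t) t \<and> L2_has_deriv N ut (utt t) t \<and>
           star_H N \<alpha> (u t) (\<lambda>j x. - utt t j x)) \<and>
        L2_tendsto N u f (at_right 0) \<and> L2_tendsto N ut (\<lambda>j x. 0) (at_right 0))"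

definition heat_solution ::
  "nat \<Rightarrow> real \<Rightarrow> (nat \<Rightarrow> real \<Rightarrow> complex) \<Rightarrow> (real \<Rightarrow> nat \<Rightarrow> real \<Rightarrow> complex) \<Rightarrow> bool" where
  "heat_solution N \<alpha> f u \<longleftrightarrow>
     (\<exists>ut. \<forall>t>0. L2_has_deriv N u (ut t) t \<and> star_H N \<alpha> (u t) (\<lambda>j x. - ut t j x)) \<and>
     L2_tendsto N u f (at_right 0)"

definition quantum_solution ::
  "nat \<Rightarrow> real \<Rightarrow> (nat \<Rightarrow> real \<Rightarrow> complex) \<Rightarrow> (real \<Rightarrow> nat \<Rightarrow> real \<Rightarrow> complex) \<Rightarrow> bool" where
  "quantum_solution N \<alpha> f u \<longleftrightarrow>
     (\<exists>ut. \<forall>t>0. L2_has_deriv N u (ut t) t \<and> star_H N \<alpha> (u t) (\<lambda>j x. \<i> * ut t j x)) \<and>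
     L2_tendsto N u f (at_right 0)"

definition cylinder_solution ::
  "nat \<Rightarrow> real \<Rightarrow> (nat \<Rightarrow> real \<Rightarrow> complex) \<Rightarrow> (real \<Rightarrow> nat \<Rightarrow> real \<Rightarrow> complex) \<Rightarrow> bool" where
  "cylinder_solution N \<alpha> f u \<longleftrightarrow>
     (\<exists>ut utt. \<forall>t>0. L2_has_deriv N u (ut t) t \<and> L2_has_deriv N ut (utt t) t \<and>
        star_H N \<alpha> (u t) (utt t)) \<and>
     L2_tendsto N u f (at_right 0) \<and> L2_tendsto N u (\<lambda>j x. 0) at_top"

section \<open>Green functions\<close>

text \<open>
  In both definitions \<open>S f u\<close> means that \<open>u\<close> solves the problem with initial data \<open>f\<close>.
  Existence of a solution for every test datum, and its uniqueness (a.e., for each \<open>t\<close>), are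
  part of the definitions, so that there is a solution operator of which the kernel is taken.
  As kernels are otherwise only determined up to null sets, a Green function given by an actual
  function is taken to be its continuous representative.
\<close>

definition green_function ::
  "nat \<Rightarrow> ((nat \<Rightarrow> real \<Rightarrow> complex) \<Rightarrow> (real \<Rightarrow> nat \<Rightarrow> real \<Rightarrow> complex) \<Rightarrow> bool) \<Rightarrow>
   (nat \<Rightarrow> nat \<Rightarrow> real \<Rightarrow> real \<Rightarrow> real \<Rightarrow> complex) \<Rightarrow> bool" where
  "green_function N S K \<longleftrightarrow>
     (\<forall>j\<in>{1..N}. \<forall>l\<in>{1..N}. \<forall>t>0.
        continuous_on ({0<..} \<times> {0<..}) (\<lambda>(x, y). K j l t x y)) \<and>
     (\<forall>f. (\<forall>l\<in>{1..N}. test_fun (f l)) \<longrightarrow>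
        (\<exists>u. S f u) \<and>
        (\<forall>u. S f u \<longrightarrow> (\<forall>t>0. \<forall>j\<in>{1..N}. AE x in lborel. 0 < x \<longrightarrow>
           u t j x = (\<Sum>l=1..N. LBINT y:{0<..}. K j l t x y * f l y))))"

definition green_distribution ::
  "nat \<Rightarrow> ((nat \<Rightarrow> real \<Rightarrow> complex) \<Rightarrow> (real \<Rightarrow> nat \<Rightarrow> real \<Rightarrow> complex) \<Rightarrow> bool) \<Rightarrow>
   (nat \<Rightarrow> nat \<Rightarrow> real \<Rightarrow> (real \<Rightarrow> real \<Rightarrow> complex) \<Rightarrow> complex) \<Rightarrow> bool" where
  "green_distribution N S T \<longleftrightarrow>
     (\<forall>j\<in>{1..N}. \<forall>l\<in>{1..N}. \<forall>t>0. distribution2 (T j l t)) \<and>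
     (\<forall>f. (\<forall>l\<in>{1..N}. test_fun (f l)) \<longrightarrow>
        (\<exists>u. S f u) \<and>
        (\<forall>u. S f u \<longrightarrow> (\<forall>t>0. \<forall>j\<in>{1..N}. \<forall>\<phi>. test_fun \<phi> \<longrightarrow>
           (LBINT x:{0<..}. u t j x * \<phi> x) = (\<Sum>l=1..N. T j l t (\<lambda>x y. \<phi> x * f l y)))))"

section \<open>Green functions on the real line\<close>

definition heat_line :: "real \<Rightarrow> real \<Rightarrow> complex" where
  "heat_line t z = of_real ((4 * pi * t) powr (-1/2) * exp (- z\<^sup>2 / (4 * t)))"

definition quantum_line :: "real \<Rightarrow> real \<Rightarrow> complex" where
  "quantum_line t z =
     exp (- (of_real z)\<^sup>2 / (4 * \<i> * of_real t)) / csqrt (4 * of_real pi * \<i> * of_real t)"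

definition cylinder_line :: "real \<Rightarrow> real \<Rightarrow> complex" where
  "cylinder_line t z = of_real ((t / pi) / (t\<^sup>2 + z\<^sup>2))"

text \<open>
  The distribution \<open>G(t,\<cdot>) = 1/2 [\<delta>(z - t) + \<delta>(z + t)]\<close>, as a functional \<open>\<psi> \<mapsto> \<integral> G(t,z) \<psi>(z) dz\<close>.
\<close>

definition wave_line :: "real \<Rightarrow> (real \<Rightarrow> complex) \<Rightarrow> complex" where
  "wave_line t \<psi> = (\<psi> t + \<psi> (- t)) / 2"

section \<open>The right-hand side of the formula for the star graph\<close>

definition star_formula ::
  "nat \<Rightarrow> real \<Rightarrow> (real \<Rightarrow> real \<Rightarrow> complex) \<Rightarrow> nat \<Rightarrow> nat \<Rightarrow> real \<Rightarrow> real \<Rightarrow> real \<Rightarrow> complex" where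
  "star_formula N \<alpha> G j l t x y =
     of_bool (j = l) * G t \<bar>x - y\<bar>
     + (2 / of_nat N - of_bool (j = l)) * G t (x + y)
     - of_real (2 * \<alpha> / (real N)\<^sup>2) *
         (LBINT s:{x..}. of_real (exp (- \<alpha> * (s - x) / real N)) * G t (s + y))"

text \<open>
  The same expression for a distribution \<open>G t\<close> on the line, given as a functional and paired with
  \<open>\<Phi>(x,y)\<close>. For fixed \<open>x\<close> (and \<open>s\<close>) the pairing over \<open>y\<close> is transported to \<open>z = x - y\<close>,
  \<open>z = x + y\<close> and \<open>z = s + y\<close>, respectively; \<open>G(t,\<bar>x - y\<bar>)\<close> is \<open>G(t,x - y)\<close> as \<open>G t\<close> is even.
\<close>

definition star_formula_dist ::
  "nat \<Rightarrow> real \<Rightarrow> (real \<Rightarrow> (real \<Rightarrow> complex) \<Rightarrow> complex) \<Rightarrow> nat \<Rightarrow> nat \<Rightarrow> real \<Rightarrow>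
   (real \<Rightarrow> real \<Rightarrow> complex) \<Rightarrow> complex" where
  "star_formula_dist N \<alpha> G j l t \<Phi> =
     of_bool (j = l) * (LBINT x:{0<..}. G t (\<lambda>z. \<Phi> x (x - z)))
     + (2 / of_nat N - of_bool (j = l)) * (LBINT x:{0<..}. G t (\<lambda>z. \<Phi> x (z - x)))
     - of_real (2 * \<alpha> / (real N)\<^sup>2) *
         (LBINT x:{0<..}. LBINT s:{x..}.
            of_real (exp (- \<alpha> * (s - x) / real N)) * G t (\<lambda>z. \<Phi> x (z - s)))"

end

(* A datum f on the star graph extends to the line so that the evolution on the line restricts to
   the one on the graph: the average of the edges satisfies the Robin condition u' = (alpha/N) u at
   the vertex, the deviations from it a Dirichlet condition. Reflection for the Dirichlet part, and
   reflection together with an exponential tail for the Robin part, give the extension; writing out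
   its evolution yields the formula.

   Uniqueness follows from duality: H is symmetric, so the pairing of a solution u at time s with
   the explicit solution at time t - s is constant in s (for the second-order problems, the pairing
   satisfies a wave equation in the two times). Test functions separate points, so u agrees with the
   explicit solution almost everywhere.

   Continuous kernels are determined by their action on test functions. For the wave problem this
   becomes the density of tensor products, which are obtained from a test function of two variables
   by mollifying in one variable and replacing the integral by Riemann sums. *)

theory Submission
  imports Defs "HOL-Probability.Probability" "HOL-Complex_Analysis.Complex_Analysis"
    "HOL-Real_Asymp.Real_Asymp"
begin

section \<open>Smooth functions\<close>

text \<open>A half-line function keeps the condition h'(0) = \<kappa> h(0) under the evolution on
  the line if h' - \<kappa> h is odd initially: the evolution commutes with differentiation, and odd
  data stay 0 at the origin. For given values f on the positive axis, with \<kappa> = \<alpha>/N and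
  E = \<open>exp_tail\<close>, this first-order equation is solved by h(z) = f(z) + f(-z) - 2
  \<kappa> E(-z); the relation E' = f - \<kappa> E is what makes the tail cancel. Combining this
  average with the odd Dirichlet part produces the coefficients 2/N and 2 \<alpha> / N^2.

  The functional calculus of H is avoided. All four problems are treated through explicit solutions
  that share one list of properties of the evolution on the line (\<open>line_evolution\<close>). An
  arbitrary solution is only weakly regular, but it is always paired with an explicit one, which is
  smooth in x and O(1/(1+x)); integration by parts is therefore only ever done against smooth
  functions.\<close>

definition smooth :: "(real \<Rightarrow> complex) \<Rightarrow> bool" where
  "smooth f \<longleftrightarrow> (\<forall>n x. (vderiv ^^ n) f differentiable (at x))"

text \<open>An existential derivative at every stage makes closure under products and affine
  substitutions an induction on the order, with no Leibniz formula for
  \<open>vderiv ^^ n\<close>.\<close>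

fun times_diff :: "nat \<Rightarrow> (real \<Rightarrow> complex) \<Rightarrow> bool" where
  "times_diff 0 f = True"
| "times_diff (Suc n) f = (\<exists>f'. (\<forall>x. (f has_vector_derivative f' x) (at x)) \<and> times_diff n f')"

lemma vderiv_eq: "(\<And>x. (f has_vector_derivative f' x) (at x)) \<Longrightarrow> vderiv f = f'"
  by (auto simp: vderiv_def vector_derivative_at)

lemma smooth_has_vderiv:
  "smooth f \<Longrightarrow> ((vderiv ^^ n) f has_vector_derivative (vderiv ^^ Suc n) f x) (at x)"
  by (simp add: smooth_def vderiv_def vector_derivative_works[symmetric])

lemma smooth_vderiv_at: "smooth f \<Longrightarrow> (f has_vector_derivative vderiv f x) (at x)"
  using smooth_has_vderiv[of f 0] by simp

lemma smooth_vderiv [simp, intro]: "smooth f \<Longrightarrow> smooth (vderiv f)"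
  by (metis smooth_def funpow_Suc_right o_apply)

lemma smooth_iff_times_diff: "smooth f \<longleftrightarrow> (\<forall>n. times_diff n f)"
proof
  have "smooth f \<Longrightarrow> times_diff n f" for n
    by (induction n arbitrary: f) (auto intro: smooth_vderiv_at)
  then show "smooth f \<Longrightarrow> \<forall>n. times_diff n f" by blast
next
  have *: "(\<forall>x. f differentiable at x) \<and> (\<forall>k. times_diff k (vderiv f))" if t: "\<forall>k. times_diff k f" for f
  proof -
    have "\<exists>f'. (\<forall>x. (f has_vector_derivative f' x) (at x)) \<and> times_diff k f'" for k
      using t[rule_format, of "Suc k"] by simp
    then show ?thesis
      by (metis vderiv_eq differentiableI_vector)
  qed
  have "\<forall>k. times_diff k f \<Longrightarrow> \<forall>x. (vderiv ^^ n) f differentiable at x" for n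
    by (induction n arbitrary: f) (use * in \<open>auto simp: funpow_swap1\<close>)
  then show "\<forall>n. times_diff n f \<Longrightarrow> smooth f" unfolding smooth_def by blast
qed

text \<open>Iterated derivatives are computed by exhibiting a sequence \<open>H\<close> in which
  each member has the next one as derivative; smoothness and the formula for
  \<open>vderiv ^^ n\<close> then come together.\<close>

lemma
  assumes "\<And>n x. (H n has_vector_derivative H (Suc n) x) (at x)"
  shows smooth_sequenceI: "smooth (H 0)" and vderiv_sequence: "(vderiv ^^ n) (H 0) = H n"
proof -
  have eq: "(vderiv ^^ n) (H 0) = H n" for n
    by (induction n) (auto simp: vderiv_eq[OF assms])
  then show "(vderiv ^^ n) (H 0) = H n" .
  show "smooth (H 0)" unfolding smooth_def eq using assms differentiableI_vector by blast
qed

lemma times_diff_Suc: "times_diff (Suc n) f \<Longrightarrow> times_diff n f"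
proof (induction n arbitrary: f)
  case (Suc n)
  from Suc.prems obtain f' where "\<forall>x. (f has_vector_derivative f' x) (at x)" "times_diff (Suc n) f'"
    by (metis times_diff.simps(2))
  then show ?case using Suc.IH[of f'] by auto
qed simp

lemma times_diff_add:
  "times_diff n f \<Longrightarrow> times_diff n g \<Longrightarrow> times_diff n (\<lambda>z. f z + g z)"
proof (induction n arbitrary: f g)
  case (Suc n)
  from Suc.prems obtain f' g' where
    d: "\<And>x. (f has_vector_derivative f' x) (at x)" "\<And>x. (g has_vector_derivative g' x) (at x)"
    and "times_diff n f'" "times_diff n g'" by auto
  then show ?case
    by (auto intro!: exI[of _ "\<lambda>z. f' z + g' z"] has_vector_derivative_add Suc.IH)
qed simp

lemma times_diff_mult:
  "times_diff n f \<Longrightarrow> times_diff n g \<Longrightarrow> times_diff n (\<lambda>z. f z * g z)"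
proof (induction n arbitrary: f g)
  case (Suc n)
  from Suc.prems obtain f' g' where
    d: "\<And>x. (f has_vector_derivative f' x) (at x)" "\<And>x. (g has_vector_derivative g' x) (at x)"
    and "times_diff n f'" "times_diff n g'" by auto
  moreover have "times_diff n f" "times_diff n g" using Suc.prems times_diff_Suc by blast+
  ultimately show ?case
    by (auto intro!: exI[of _ "\<lambda>z. f z * g' z + f' z * g z"] has_vector_derivative_mult
        times_diff_add Suc.IH)
qed simp

lemma times_diff_affine: "times_diff n f \<Longrightarrow> times_diff n (\<lambda>z. f (a * z + b))"
proof -
  have const: "times_diff k (\<lambda>_. c)" for k c
    by (induction k arbitrary: c) (auto intro!: exI[of _ "\<lambda>_. 0"])
  show "times_diff n f \<Longrightarrow> times_diff n (\<lambda>z. f (a * z + b))"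
  proof (induction n arbitrary: f)
    case (Suc n)
    then obtain f' where d: "\<And>x. (f has_vector_derivative f' x) (at x)" and t: "times_diff n f'"
      by auto
    have "((\<lambda>z. f (a * z + b)) has_vector_derivative of_real a * f' (a * x + b)) (at x)" for x
    proof -
      have "((f \<circ> (\<lambda>z. a * z + b)) has_vector_derivative a *\<^sub>R f' (a * x + b)) (at x)"
        by (rule vector_diff_chain_at) (auto intro!: derivative_eq_intros d
            simp: has_real_derivative_iff_has_vector_derivative[symmetric])
      then show ?thesis by (simp add: o_def scaleR_conv_of_real)
    qed
    moreover have "times_diff n (\<lambda>x. of_real a * f' (a * x + b))"
      using times_diff_mult[OF const Suc.IH[OF t]] .
    ultimately show ?case by (auto intro!: exI[of _ "\<lambda>x. of_real a * f' (a * x + b)"])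
  qed simp
qed

lemma smooth_const [simp, intro]: "smooth (\<lambda>_. c)"
  using times_diff_affine[of _ "\<lambda>_. c"] smooth_sequenceI[of "\<lambda>n _. if n = 0 then c else 0"]
  by simp

lemma smooth_add [intro]: "smooth f \<Longrightarrow> smooth g \<Longrightarrow> smooth (\<lambda>z. f z + g z)"
  by (simp add: smooth_iff_times_diff times_diff_add)

lemma smooth_mult [intro]: "smooth f \<Longrightarrow> smooth g \<Longrightarrow> smooth (\<lambda>z. f z * g z)"
  by (simp add: smooth_iff_times_diff times_diff_mult)

lemma smooth_diff [intro]: "smooth f \<Longrightarrow> smooth g \<Longrightarrow> smooth (\<lambda>z. f z - g z)"
  using smooth_add[of f "\<lambda>z. (-1) * g z"] smooth_mult[OF smooth_const[of "-1"]] by simp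

lemma smooth_affine: "smooth f \<Longrightarrow> smooth (\<lambda>z. f (a * z + b))"
  by (simp add: smooth_iff_times_diff times_diff_affine)

lemma smooth_reflect: "smooth f \<Longrightarrow> smooth (\<lambda>z. f (- z))"
  using smooth_affine[of f "-1" 0] by simp

lemma smooth_vderiv_n [intro]: "smooth f \<Longrightarrow> smooth ((vderiv ^^ n) f)"
  by (induction n) auto

lemma smooth_continuous: "smooth f \<Longrightarrow> continuous_on S f"
  by (meson continuous_at_imp_continuous_on has_vector_derivative_continuous smooth_vderiv_at)

lemma smooth_isCont: "smooth f \<Longrightarrow> isCont f x"
  using has_vector_derivative_continuous smooth_vderiv_at by blast

lemma smooth_borel [measurable_dest]: "smooth f \<Longrightarrow> f \<in> borel_measurable borel"
  by (simp add: smooth_continuous borel_measurable_continuous_onI)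

lemma vderiv_n_add:
  "smooth f \<Longrightarrow> smooth g \<Longrightarrow> (vderiv ^^ n) (\<lambda>z. f z + g z) = (\<lambda>z. (vderiv ^^ n) f z + (vderiv ^^ n) g z)"
  using vderiv_sequence[of "\<lambda>n z. (vderiv ^^ n) f z + (vderiv ^^ n) g z" n]
  by (simp add: has_vector_derivative_add smooth_has_vderiv del: funpow.simps(2))

lemma vderiv_n_cmult:
  "smooth f \<Longrightarrow> (vderiv ^^ n) (\<lambda>z. c * f z) = (\<lambda>z. c * (vderiv ^^ n) f z)"
  using vderiv_sequence[of "\<lambda>n z. c * (vderiv ^^ n) f z" n]
  by (simp add: has_vector_derivative_mult_right smooth_has_vderiv del: funpow.simps(2))

lemma vderiv_n_affine:
  assumes "smooth f"
  shows "(vderiv ^^ n) (\<lambda>z. f (a * z + b)) = (\<lambda>z. of_real a ^ n * (vderiv ^^ n) f (a * z + b))"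
proof -
  have "((\<lambda>z. of_real a ^ n * (vderiv ^^ n) f (a * z + b)) has_vector_derivative
          of_real a ^ Suc n * (vderiv ^^ Suc n) f (a * x + b)) (at x)" for n x
  proof -
    have "(((vderiv ^^ n) f \<circ> (\<lambda>z. a * z + b)) has_vector_derivative a *\<^sub>R (vderiv ^^ Suc n) f (a * x + b)) (at x)"
      by (rule vector_diff_chain_at) (auto intro!: derivative_eq_intros smooth_has_vderiv[OF assms, of n, simplified]
            simp: has_real_derivative_iff_has_vector_derivative[symmetric])
    from has_vector_derivative_mult_right[OF this, of "of_real a ^ n"]
    show ?thesis by (simp add: o_def scaleR_conv_of_real mult_ac)
  qed
  from vderiv_sequence[of "\<lambda>n z. of_real a ^ n * (vderiv ^^ n) f (a * z + b)", OF this, of n] show ?thesis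
    by simp
qed

lemma vderiv_n_reflect:
  assumes "smooth f"
  shows "(vderiv ^^ n) (\<lambda>z. f (- z)) = (\<lambda>z. (-1) ^ n * (vderiv ^^ n) f (- z))"
  using vderiv_n_affine[OF assms, of n "-1" 0] by simp

lemma vderiv_add: "smooth f \<Longrightarrow> smooth g \<Longrightarrow> vderiv (\<lambda>z. f z + g z) = (\<lambda>z. vderiv f z + vderiv g z)"
  using vderiv_n_add[of f g 1] by simp

lemma vderiv_cmult: "smooth f \<Longrightarrow> vderiv (\<lambda>z. c * f z) = (\<lambda>z. c * vderiv f z)"
  using vderiv_n_cmult[of f 1] by simp

lemma vderiv_reflect: "smooth f \<Longrightarrow> vderiv (\<lambda>z. f (- z)) = (\<lambda>z. - vderiv f (- z))"
  using vderiv_n_reflect[of f 1] by simp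

lemma vderiv_mult:
  "smooth f \<Longrightarrow> smooth g \<Longrightarrow> vderiv (\<lambda>z. f z * g z) = (\<lambda>z. f z * vderiv g z + vderiv f z * g z)"
  by (rule vderiv_eq) (auto intro!: has_vector_derivative_mult smooth_vderiv_at)

section \<open>Test functions and their supports\<close>

lemma test_fun_iff: "test_fun f \<longleftrightarrow> smooth f \<and> (\<exists>a>0. \<exists>b. \<forall>x. x \<notin> {a..b} \<longrightarrow> f x = 0)"
  by (simp add: test_fun_def smooth_def)

lemma test_fun_smooth: "test_fun f \<Longrightarrow> smooth f"
  by (simp add: test_fun_iff)

lemma test_fun_supportE:
  assumes "test_fun f" obtains a b where "0 < a" "a \<le> b" "\<And>x. x \<notin> {a..b} \<Longrightarrow> f x = 0"
proof -
  obtain a b where "0 < a" "\<forall>x. x \<notin> {a..b} \<longrightarrow> f x = 0" using assms by (auto simp: test_fun_iff)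
  then show ?thesis by (intro that[of a "max a b"]) (auto simp: le_max_iff_disj)
qed

lemma test_funI: "smooth f \<Longrightarrow> 0 < a \<Longrightarrow> (\<And>x. x \<notin> {a..b} \<Longrightarrow> f x = 0) \<Longrightarrow> test_fun f"
  by (auto simp: test_fun_iff)

lemma vderiv_zero_outside:
  assumes "\<And>x. x \<notin> {a..b} \<Longrightarrow> f x = 0" "x \<notin> {a..b}" shows "vderiv f x = 0"
proof -
  have "(f has_vector_derivative 0) (at x)"
    by (rule has_vector_derivative_transform_within_open[where f = "\<lambda>_. 0" and S = "- {a..b}"])
       (use assms in auto)
  then show ?thesis by (simp add: vderiv_def vector_derivative_at)
qed

lemma vderiv_n_zero_outside:
  assumes "\<And>x. x \<notin> {a..b} \<Longrightarrow> f x = 0" "x \<notin> {a..b}" shows "(vderiv ^^ n) f x = 0"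
  using assms(2) by (induction n arbitrary: x) (auto simp: assms(1) intro!: vderiv_zero_outside[of a b])

lemma test_fun_vderiv: "test_fun f \<Longrightarrow> test_fun (vderiv f)"
  unfolding test_fun_iff using vderiv_zero_outside by blast

lemma test_fun_zero [simp, intro]: "test_fun (\<lambda>_. 0)"
  by (rule test_funI[of _ 1]) auto

subsection \<open>A smooth step\<close>

text \<open>The functions p(1/x) exp(-1/x), extended by zero to x \<le> 0, form a class closed under
  differentiation: with w = 1/x the prefactor p becomes w^2 (p - p'). Smoothness of all members
  follows from this one formula.\<close>

definition flat :: "real poly \<Rightarrow> real \<Rightarrow> real" where
  "flat p x = (if x > 0 then poly p (1 / x) * exp (- (1 / x)) else 0)"

lemma poly_times_exp_minus_tendsto: "((\<lambda>w::real. poly p w * exp (- w)) \<longlongrightarrow> 0) at_top"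
proof -
  have "((\<lambda>w::real. coeff p i * w ^ i * exp (- w)) \<longlongrightarrow> 0) at_top" for i
    using tendsto_mult_right_zero[OF tendsto_power_div_exp_0[of i], of "coeff p i"]
    by (simp add: exp_minus field_simps)
  then have "((\<lambda>w::real. \<Sum>i\<le>degree p. coeff p i * w ^ i * exp (- w)) \<longlongrightarrow> (\<Sum>i\<le>degree p. 0)) at_top"
    by (intro tendsto_sum)
  then show ?thesis by (simp add: poly_altdef sum_distrib_right)
qed

lemma flat_tendsto_0: "(flat p \<longlongrightarrow> 0) (at 0)"
proof -
  have "((\<lambda>x. poly p (inverse x) * exp (- inverse x)) \<longlongrightarrow> 0) (at_right 0)"
    using filterlim_compose[OF poly_times_exp_minus_tendsto[of p] filterlim_inverse_at_top_right] .
  then have "(flat p \<longlongrightarrow> 0) (at_right 0)"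
    by (rule Lim_transform_eventually)
       (auto simp: flat_def eventually_at_filter inverse_eq_divide)
  moreover have "(flat p \<longlongrightarrow> 0) (at_left 0)"
    by (rule tendsto_eventually) (auto simp: flat_def eventually_at_filter)
  ultimately show ?thesis by (simp add: filterlim_split_at)
qed

lemma flat_deriv:
  "(flat p has_real_derivative flat ([:0, 0, 1:] * (p - pderiv p)) x) (at x)"
proof -
  consider "x < 0" | "x = 0" | "x > 0" by linarith
  then show ?thesis
  proof cases
    case 1
    have "(flat p has_real_derivative 0) (at x)"
      by (rule has_field_derivative_transform_within_open[of "\<lambda>_. 0" _ _ "{..<0}"])
         (use 1 in \<open>auto simp: flat_def\<close>)
    with 1 show ?thesis by (simp add: flat_def)
  next
    case 2
    \<comment> \<open>Dividing by h multiplies the polynomial in 1/h by its variable, so the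
      difference quotient is again a function of the class, with
      \<open>[:0, 1:] * p\<close>.\<close>
    have "((\<lambda>h. (flat p (0 + h) - flat p 0) / h) \<longlongrightarrow> 0) (at 0)"
      by (rule Lim_transform_eventually[OF flat_tendsto_0[of "[:0, 1:] * p"]])
         (auto simp: flat_def eventually_at_filter)
    with 2 show ?thesis unfolding DERIV_def by (simp add: flat_def)
  next
    case 3
    have "((\<lambda>x. poly p (1 / x) * exp (- (1 / x))) has_real_derivative
        flat ([:0, 0, 1:] * (p - pderiv p)) x) (at x)"
      using 3 by (auto intro!: derivative_eq_intros simp: flat_def field_simps power2_eq_square)
    then show ?thesis
      by (rule has_field_derivative_transform_within_open[of _ _ _ "{0<..}"])
         (use 3 in \<open>auto simp: flat_def\<close>)
  qed
qed

lemma smooth_flat: "smooth (\<lambda>x. of_real (flat p x))"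
proof -
  define H where "H n x = complex_of_real (flat (((\<lambda>p. [:0, 0, 1:] * (p - pderiv p)) ^^ n) p) x)" for n x
  have "(H n has_vector_derivative H (Suc n) x) (at x)" for n x
    unfolding H_def funpow.simps o_apply
    by (rule has_vector_derivative_of_real)
       (use flat_deriv in \<open>simp add: has_real_derivative_iff_has_vector_derivative\<close>)
  from smooth_sequenceI[of H, OF this] show ?thesis unfolding H_def by simp
qed

text \<open>The flat functions at 0 and, reflected, at 1 are multiplied and the product is
  normalised. The clause \<open>\<rho> x = of_real (cmod (\<rho> x))\<close> encodes that the
  complex-valued \<open>\<rho>\<close> is real and nonnegative.\<close>

lemma ex_smooth_mollifier:
  obtains \<rho> :: "real \<Rightarrow> complex" where "smooth \<rho>" "\<And>x. x \<notin> {0..1} \<Longrightarrow> \<rho> x = 0"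
    "\<And>x. \<rho> x = of_real (cmod (\<rho> x))" "integrable lborel \<rho>" "(LBINT x. \<rho> x) = 1"
proof -
  define r where "r x = flat 1 x * flat 1 (1 - x)" for x
  have nn: "r x \<ge> 0" for x by (simp add: r_def flat_def)
  have out: "r x = 0" if "x \<notin> {0..1}" for x using that by (auto simp: r_def flat_def)
  have sm: "smooth (\<lambda>x. of_real (r x))"
    using smooth_mult[OF smooth_flat[of 1] smooth_affine[OF smooth_flat[of 1], of "-1" 1]]
    by (simp add: r_def algebra_simps)
  have cont: "continuous_on {0..1} r"
    using continuous_on_Re[OF smooth_continuous[OF sm, of "{0..1}"]] by simp
  have int: "integrable lborel r"
    using borel_integrable_atLeastAtMost'[OF cont] unfolding set_integrable_def
    by (rule Bochner_Integration.integrable_cong[OF refl, THEN iffD1, rotated]) (use out in \<open>force simp: indicator_def\<close>)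
  define c where "c = (LBINT x. r x)"
  \<comment> \<open>The product is positive on the open unit interval, which has positive
    measure.\<close>
  have "c \<noteq> 0"
  proof
    assume "c = 0"
    then have "AE x in lborel. r x = 0"
      using integral_nonneg_eq_0_iff_AE[OF int] nn by (simp add: c_def)
    then have "AE x in lborel. x \<notin> {0<..<1::real}"
      by eventually_elim (auto simp: r_def flat_def)
    then have "emeasure lborel {0<..<1::real} = 0"
      using AE_iff_null_sets[of "{0<..<1::real}" lborel] by auto
    then show False by simp
  qed
  moreover have "c \<ge> 0" unfolding c_def by (simp add: nn)
  ultimately have c: "c > 0" by simp
  show ?thesis
  proof (rule that[of "\<lambda>x. of_real (r x / c)"])
    show "smooth (\<lambda>x. of_real (r x / c))"
      using smooth_mult[OF smooth_const[of "of_real (1 / c)"] sm] by simp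
    show "integrable lborel (\<lambda>x. complex_of_real (r x / c))"
      using int by (intro integrable_of_real) auto
    show "(LBINT x. complex_of_real (r x / c)) = 1"
      using c by (subst integral_complex_of_real) (simp add: c_def)
    show "complex_of_real (r x / c) = complex_of_real (cmod (complex_of_real (r x / c)))" for x
      using nn[of x] c by (simp only: norm_of_real abs_of_nonneg divide_nonneg_pos)
  qed (use out in auto)
qed

text \<open>The primitive of the mollifier. The clauses on \<open>vderiv \<theta>\<close> are
  recorded because the derivative of a cut-off, rescaled towards 0, later acts as a delta function
  that reads off a trace.\<close>

lemma ex_smooth_step:
  obtains \<theta> :: "real \<Rightarrow> complex" where "smooth \<theta>" "\<And>x. x \<le> 0 \<Longrightarrow> \<theta> x = 0" "\<And>x. x \<ge> 1 \<Longrightarrow> \<theta> x = 1"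
    "\<And>x. cmod (\<theta> x) \<le> 1" "\<And>x. x \<notin> {0..1} \<Longrightarrow> vderiv \<theta> x = 0" "integrable lborel (vderiv \<theta>)"
    "(LBINT x. vderiv \<theta> x) = 1" "\<And>x. cmod (1 - \<theta> x) \<le> 1"
proof -
  obtain \<rho> where \<rho>: "smooth \<rho>" "\<And>x. x \<notin> {0..1} \<Longrightarrow> \<rho> x = 0"
    "\<And>x. \<rho> x = of_real (cmod (\<rho> x))" "integrable lborel \<rho>" "(LBINT x. \<rho> x) = 1"
    using ex_smooth_mollifier by metis
  define \<theta> where "\<theta> x = (LBINT s:{..x}. \<rho> s)" for x
  define q where "q x = (LBINT s:{..x}. cmod (\<rho> s))" for x
  have int: "set_integrable lborel S \<rho>" if "S \<in> sets lborel" for S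
    unfolding set_integrable_def using \<rho>(4) that by (intro integrable_mult_indicator)
  have intn: "set_integrable lborel S (\<lambda>s. cmod (\<rho> s))" if "S \<in> sets lborel" for S
    using set_integrable_norm[OF int[OF that]] .
  have \<theta>q: "\<theta> x = of_real (q x)" for x
    unfolding \<theta>_def q_def set_integral_complex_of_real[symmetric] by (simp add: \<rho>(3)[symmetric])
  have tot: "(LBINT s. cmod (\<rho> s)) = 1"
  proof -
    have "complex_of_real (LBINT s. cmod (\<rho> s)) = (LBINT s. \<rho> s)"
      unfolding integral_complex_of_real[symmetric] by (simp add: \<rho>(3)[symmetric])
    then show ?thesis using \<rho>(5) by (simp only: of_real_eq_1_iff)
  qed
  have q01: "0 \<le> q x" "q x \<le> 1" for x
  proof -
    show "0 \<le> q x" unfolding q_def set_lebesgue_integral_def by (rule Bochner_Integration.integral_nonneg) auto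
    have "q x \<le> (LBINT s. cmod (\<rho> s))" unfolding q_def set_lebesgue_integral_def
      using intn[of "{..x}"] \<rho>(4) by (intro integral_mono) (auto simp: set_integrable_def indicator_def)
    then show "q x \<le> 1" by (simp add: tot)
  qed
  have \<theta>0: "\<theta> x = 0" if "x \<le> 0" for x
  proof -
    \<comment> \<open>The support condition leaves the value at 0 open; continuity from the left
      settles it.\<close>
    have "\<rho> 0 = 0"
    proof (rule tendsto_unique[of "at_left 0"])
      show "(\<rho> \<longlongrightarrow> \<rho> 0) (at_left 0)" using smooth_isCont[OF \<rho>(1), of 0]
        by (simp add: isCont_def filterlim_at_split)
      show "(\<rho> \<longlongrightarrow> 0) (at_left 0)"
        by (rule tendsto_eventually) (auto simp: eventually_at_filter \<rho>(2))
    qed simp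
    then have "indicator {..x} s *\<^sub>R \<rho> s = 0" for s
      using \<rho>(2)[of s] that by (cases "s = 0") (auto simp: indicator_def)
    then have "(\<lambda>s. indicator {..x} s *\<^sub>R \<rho> s) = (\<lambda>_. 0)" by blast
    then show ?thesis unfolding \<theta>_def set_lebesgue_integral_def by (simp only: integral_zero)
  qed
  have \<theta>1: "\<theta> x = 1" if "x \<ge> 1" for x
  proof -
    have "\<theta> x = (LBINT s. \<rho> s)" unfolding \<theta>_def set_lebesgue_integral_def
    proof (rule Bochner_Integration.integral_cong[OF refl])
      show "indicator {..x} s *\<^sub>R \<rho> s = \<rho> s" for s
        using \<rho>(2)[of s] that by (cases "s \<le> x") auto
    qed
    then show ?thesis by (simp add: \<rho>(5))
  qed
  have d: "(\<theta> has_vector_derivative \<rho> x) (at x)" for x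
  proof -
    have split: "\<theta> y = \<theta> (x - 1) + integral {x - 1..y} \<rho>" if "y \<in> {x - 1..x + 1}" for y
    proof -
      have "\<theta> y = (LBINT s:{..x - 1} \<union> {x - 1<..y}. \<rho> s)"
        unfolding \<theta>_def using that by (intro arg_cong[where f = "\<lambda>A. set_lebesgue_integral lborel A \<rho>"]) auto
      also have "\<dots> = \<theta> (x - 1) + (LBINT s:{x - 1<..y}. \<rho> s)"
        unfolding \<theta>_def by (rule set_integral_Un) (auto intro: int)
      also have "(LBINT s:{x - 1<..y}. \<rho> s) = integral {x - 1<..y} \<rho>"
        by (rule set_borel_integral_eq_integral(2)[OF int]) simp
      also have "\<dots> = integral {x - 1..y} \<rho>"
        by (rule integral_spike_set) (auto intro: negligible_subset[of "{x - 1}"])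
      finally show ?thesis .
    qed
    have "((\<lambda>y. integral {x - 1..y} \<rho>) has_vector_derivative \<rho> x) (at x within {x - 1..x + 1})"
      by (rule integral_has_vector_derivative) (auto intro: smooth_continuous \<rho>(1))
    then have "((\<lambda>y. integral {x - 1..y} \<rho>) has_vector_derivative \<rho> x) (at x)"
      by (simp add: at_within_Icc_at)
    then have "((\<lambda>y. \<theta> (x - 1) + integral {x - 1..y} \<rho>) has_vector_derivative \<rho> x) (at x)"
      by (auto intro!: derivative_eq_intros)
    then show ?thesis
      by (rule has_vector_derivative_transform_within_open[of _ _ _ "{x - 1<..<x + 1}"])
         (auto intro!: split[symmetric])
  qed
  then have vd: "vderiv \<theta> = \<rho>" by (rule vderiv_eq)
  have "smooth \<theta>"
  proof -
    define H where "H n = (case n of 0 \<Rightarrow> \<theta> | Suc m \<Rightarrow> (vderiv ^^ m) \<rho>)" for n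
    have "(H n has_vector_derivative H (Suc n) x) (at x)" for n x
      using smooth_has_vderiv[OF \<rho>(1), of "n - 1"] d by (cases n) (auto simp: H_def)
    from smooth_sequenceI[of H, OF this] show ?thesis by (simp add: H_def)
  qed
  moreover have "cmod (1 - \<theta> x) \<le> 1" "cmod (\<theta> x) \<le> 1" for x
    using q01[of x] unfolding \<theta>q of_real_1[symmetric, where 'a = complex] of_real_diff[symmetric] norm_of_real
    by auto
  ultimately show ?thesis
    by (intro that[of \<theta>]) (use \<theta>0 \<theta>1 \<rho>(1,2,4,5) in \<open>simp_all add: vd\<close>)
qed

section \<open>Square-integrable functions on the half-line\<close>

text \<open>Filters for which convergence can be tested along sequences. Dominated convergence is a
  statement about sequences, and this is the property that carries it to \<open>at t\<close>,
  \<open>at_right 0\<close> and \<open>at_top\<close>.\<close>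

definition sequential :: "'a filter \<Rightarrow> bool" where
  "sequential F \<longleftrightarrow> (\<forall>P. (\<forall>X. filterlim X F sequentially \<longrightarrow> (\<forall>\<^sub>F n in sequentially. P (X n))) \<longrightarrow>
     eventually P F)"

lemma sequential_at [simp, intro]: "sequential (at (a::real) within S)"
  unfolding sequential_def
  by (auto intro!: sequentially_imp_eventually_within simp: filterlim_at)

lemma sequential_at_top [simp, intro]: "sequential (at_top :: real filter)"
  unfolding sequential_def
proof (intro allI impI)
  fix P assume P: "\<forall>X::nat \<Rightarrow> real. filterlim X at_top sequentially \<longrightarrow> (\<forall>\<^sub>F n in sequentially. P (X n))"
  have "eventually (\<lambda>x. P (inverse x)) (at_right (0::real))"
  proof (rule sequentially_imp_eventually_within, intro allI impI)
    fix X :: "nat \<Rightarrow> real" assume X: "(\<forall>n. X n \<in> {0<..} \<and> X n \<noteq> 0) \<and> X \<longlonglongrightarrow> 0"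
    then have "filterlim X (at_right 0) sequentially" by (auto simp: filterlim_at)
    from filterlim_compose[OF filterlim_inverse_at_top_right this]
    show "\<forall>\<^sub>F n in sequentially. P (inverse (X n))" using P by auto
  qed
  then show "eventually P at_top" by (subst eventually_at_top_to_right)
qed

lemma sequential_tendstoI:
  assumes "sequential F" "\<And>X. filterlim X F sequentially \<Longrightarrow> (\<lambda>n. f (X n)) \<longlonglongrightarrow> l"
  shows "(f \<longlongrightarrow> l) F"
  unfolding tendsto_def
proof (intro allI impI)
  fix S assume S: "open S" "l \<in> S"
  have "\<forall>\<^sub>F n in sequentially. f (X n) \<in> S" if "filterlim X F sequentially" for X
    using topological_tendstoD[OF assms(2)[OF that] S] .
  then show "\<forall>\<^sub>F x in F. f x \<in> S"
    using assms(1)[unfolded sequential_def, rule_format, of "\<lambda>x. f x \<in> S"] by blast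
qed

lemma integral_dominated_convergence_filter:
  fixes s :: "'c \<Rightarrow> 'a \<Rightarrow> 'b::{banach, second_countable_topology}" and w :: "'a \<Rightarrow> real"
  assumes F: "sequential F" and [measurable]: "f \<in> borel_measurable M"
    and meas: "\<forall>\<^sub>F t in F. s t \<in> borel_measurable M" and w: "integrable M w"
    and lim: "AE x in M. ((\<lambda>t. s t x) \<longlongrightarrow> f x) F"
    and bound: "\<forall>\<^sub>F t in F. AE x in M. norm (s t x) \<le> w x"
  shows "((\<lambda>t. integral\<^sup>L M (s t)) \<longlongrightarrow> integral\<^sup>L M f) F"
proof (rule sequential_tendstoI[OF F])
  fix X :: "nat \<Rightarrow> 'c" assume X: "filterlim X F sequentially"
  have "\<forall>\<^sub>F n in sequentially. s (X n) \<in> borel_measurable M \<and> (AE x in M. norm (s (X n) x) \<le> w x)"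
    using filterlim_iff[THEN iffD1, OF X, rule_format, OF meas]
      filterlim_iff[THEN iffD1, OF X, rule_format, OF bound] by eventually_elim auto
  then obtain n0 where n0: "\<And>n. n \<ge> n0 \<Longrightarrow> s (X n) \<in> borel_measurable M \<and> (AE x in M. norm (s (X n) x) \<le> w x)"
    by (auto simp: eventually_sequentially)
  show "(\<lambda>n. integral\<^sup>L M (s (X n))) \<longlonglongrightarrow> integral\<^sup>L M f"
  proof (rule LIMSEQ_offset, rule integral_dominated_convergence[OF _ _ w])
    show "AE x in M. (\<lambda>n. s (X (n + n0)) x) \<longlonglongrightarrow> f x"
      using lim
    proof eventually_elim
      case (elim x)
      show ?case
        by (rule LIMSEQ_ignore_initial_segment) (rule filterlim_compose[OF elim X])
    qed
  qed (use n0 in auto)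
qed

lemma integrable_Lorentz: "integrable lborel (\<lambda>x::real. 1 / (1 + x\<^sup>2))"
  using integrable_inverse_1_plus_square unfolding set_integrable_def by (simp add: inverse_eq_divide)

lemma in_L2_measurable: "in_L2 g \<Longrightarrow> (\<lambda>x. indicator {0<..} x *\<^sub>R g x) \<in> borel_measurable borel"
  by (simp add: in_L2_def set_borel_measurable_def)

lemma in_L2_square: "in_L2 g \<Longrightarrow> integrable lborel (\<lambda>x. indicator {0<..} x *\<^sub>R (cmod (g x))\<^sup>2)"
  by (simp add: in_L2_def set_integrable_def)

lemma in_L2_mult_integrable:
  assumes f: "in_L2 f" and g: "in_L2 g"
  shows "set_integrable lborel {0<..} (\<lambda>x. f x * g x)"
  unfolding set_integrable_def
proof (rule Bochner_Integration.integrable_bound)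
  show "integrable lborel (\<lambda>x. indicator {0<..} x *\<^sub>R (cmod (f x))\<^sup>2 + indicator {0<..} x *\<^sub>R (cmod (g x))\<^sup>2)"
    by (intro Bochner_Integration.integrable_add in_L2_square f g)
  have "(\<lambda>x. (indicator {0<..} x *\<^sub>R f x) * (indicator {0<..} x *\<^sub>R g x)) \<in> borel_measurable lborel"
    using in_L2_measurable[OF f] in_L2_measurable[OF g] by (intro borel_measurable_times) simp_all
  moreover have "(\<lambda>x. (indicator {0<..} x *\<^sub>R f x) * (indicator {0<..} x *\<^sub>R g x)) =
    (\<lambda>x. indicator {0<..} x *\<^sub>R (f x * g x))"
    by (auto simp: indicator_def)
  ultimately show "(\<lambda>x. indicator {0<..} x *\<^sub>R (f x * g x)) \<in> borel_measurable lborel"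
    by (simp only:)
  have "cmod (f x) * cmod (g x) \<le> (cmod (f x))\<^sup>2 + (cmod (g x))\<^sup>2" for x
    using zero_le_power2[of "cmod (f x) - cmod (g x)"] zero_le_power2[of "cmod (f x)"]
      zero_le_power2[of "cmod (g x)"] unfolding power2_diff by linarith
  then show "AE x in lborel. norm (indicator {0<..} x *\<^sub>R (f x * g x))
    \<le> norm (indicator {0<..} x *\<^sub>R (cmod (f x))\<^sup>2 + indicator {0<..} x *\<^sub>R (cmod (g x))\<^sup>2)"
    by (auto simp: indicator_def norm_mult)
qed

lemma in_L2_Cauchy_Schwarz:
  assumes f: "in_L2 f" and g: "in_L2 g"
  shows "cmod (LBINT x:{0<..}. f x * g x) \<le>
    sqrt (LBINT x:{0<..}. (cmod (f x))\<^sup>2) * sqrt (LBINT x:{0<..}. (cmod (g x))\<^sup>2)"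
proof -
  define A B I where "A = (LBINT x:{0<..}. (cmod (f x))\<^sup>2)" and "B = (LBINT x:{0<..}. (cmod (g x))\<^sup>2)"
    and "I = (LBINT x:{0<..}. cmod (f x) * cmod (g x))"
  have iA: "set_integrable lborel {0<..} (\<lambda>x. (cmod (f x))\<^sup>2)"
    and iB: "set_integrable lborel {0<..} (\<lambda>x. (cmod (g x))\<^sup>2)" using f g by (auto simp: in_L2_def)
  have iI: "set_integrable lborel {0<..} (\<lambda>x. cmod (f x) * cmod (g x))"
    using set_integrable_norm[OF in_L2_mult_integrable[OF f g]] by (simp add: norm_mult)
  have nn: "A \<ge> 0" "B \<ge> 0" "I \<ge> 0" unfolding A_def B_def I_def set_lebesgue_integral_def
    by (auto intro!: Bochner_Integration.integral_nonneg)
  \<comment> \<open>The discriminant argument. It is applied at the minimiser \<open>I / A\<close>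
    or, if A = 0, at a value of l that would make the quadratic equal to -1.\<close>
  have quad: "l\<^sup>2 * A - 2 * l * I + B \<ge> 0" for l
  proof -
    have "0 \<le> (LBINT x:{0<..}. (l * cmod (f x) - cmod (g x))\<^sup>2)"
      unfolding set_lebesgue_integral_def by (auto intro!: Bochner_Integration.integral_nonneg)
    also have "\<dots> = (LBINT x:{0<..}. (l\<^sup>2 * (cmod (f x))\<^sup>2 - (2 * l) * (cmod (f x) * cmod (g x))) + (cmod (g x))\<^sup>2)"
      by (intro set_lebesgue_integral_cong) (auto simp: power2_diff power_mult_distrib)
    also have "\<dots> = l\<^sup>2 * A - 2 * l * I + B"
      unfolding A_def B_def I_def using iA iB iI
      by (subst set_integral_add(2)) (auto intro!: set_integral_diff(1) simp: set_integral_diff(2) set_integrable_mult_right)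
    finally show ?thesis .
  qed
  have "I\<^sup>2 \<le> A * B"
  proof (cases "A = 0")
    case True
    have "I = 0"
    proof (rule ccontr)
      assume "I \<noteq> 0"
      then have "I > 0" using nn by simp
      with quad[of "(B + 1) / (2 * I)"] True show False by (simp add: field_simps)
    qed
    with nn show ?thesis by simp
  next
    case False
    then have "A > 0" using nn by simp
    with quad[of "I / A"] have "0 \<le> B - I\<^sup>2 / A" by (simp add: field_simps power2_eq_square)
    with \<open>A > 0\<close> show ?thesis by (simp add: field_simps)
  qed
  then have "I \<le> sqrt A * sqrt B"
    using nn by (simp add: real_le_rsqrt real_sqrt_mult[symmetric])
  moreover have "cmod (LBINT x:{0<..}. f x * g x) \<le> I"
    using set_integral_norm_bound[OF in_L2_mult_integrable[OF f g]] by (simp add: I_def norm_mult)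
  ultimately show ?thesis unfolding A_def B_def by linarith
qed

lemma in_L2_cmult: "in_L2 g \<Longrightarrow> in_L2 (\<lambda>x. c * g x)"
  using borel_measurable_times[of "\<lambda>_. c" lborel "\<lambda>x. indicator {0<..} x *\<^sub>R g x"]
  unfolding in_L2_def set_borel_measurable_def
  by (simp add: norm_mult power_mult_distrib set_integrable_mult_right)

lemma in_L2_add:
  assumes f: "in_L2 f" and g: "in_L2 g" shows "in_L2 (\<lambda>x. f x + g x)"
proof -
  have m: "(\<lambda>x. indicator {0<..} x *\<^sub>R (f x + g x)) \<in> borel_measurable borel"
    using borel_measurable_add[OF in_L2_measurable[OF f] in_L2_measurable[OF g]]
    by (simp add: scaleR_add_right)
  have "integrable lborel (\<lambda>x. indicator {0<..} x *\<^sub>R (cmod (f x + g x))\<^sup>2)"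
  proof (rule Bochner_Integration.integrable_bound)
    show "integrable lborel (\<lambda>x. 2 * (indicator {0<..} x *\<^sub>R (cmod (f x))\<^sup>2) + 2 * (indicator {0<..} x *\<^sub>R (cmod (g x))\<^sup>2))"
      by (intro Bochner_Integration.integrable_add integrable_mult_right in_L2_square f g)
    have eq: "(\<lambda>x. indicator {0<..} x *\<^sub>R (cmod (f x + g x))\<^sup>2) = (\<lambda>x. (cmod (indicator {0<..} x *\<^sub>R (f x + g x)))\<^sup>2)"
      by (auto simp: indicator_def)
    show "(\<lambda>x. indicator {0<..} x *\<^sub>R (cmod (f x + g x))\<^sup>2) \<in> borel_measurable lborel"
      unfolding eq using measurable_compose[OF m borel_measurable_norm] by (intro borel_measurable_power) simp
    have "(cmod (f x + g x))\<^sup>2 \<le> 2 * (cmod (f x))\<^sup>2 + 2 * (cmod (g x))\<^sup>2" for x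
    proof -
      have "(cmod (f x + g x))\<^sup>2 \<le> (cmod (f x) + cmod (g x))\<^sup>2"
        by (intro power_mono norm_triangle_ineq) auto
      also have "\<dots> \<le> 2 * (cmod (f x))\<^sup>2 + 2 * (cmod (g x))\<^sup>2"
        using zero_le_power2[of "cmod (f x) - cmod (g x)"] unfolding power2_diff power2_sum by linarith
      finally show ?thesis .
    qed
    then show "AE x in lborel. norm (indicator {0<..} x *\<^sub>R (cmod (f x + g x))\<^sup>2) \<le>
      norm (2 * (indicator {0<..} x *\<^sub>R (cmod (f x))\<^sup>2) + 2 * (indicator {0<..} x *\<^sub>R (cmod (g x))\<^sup>2))"
      by (auto simp: indicator_def)
  qed
  with m show ?thesis by (simp add: in_L2_def set_integrable_def set_borel_measurable_def)
qed

lemma in_L2_diff: "in_L2 f \<Longrightarrow> in_L2 g \<Longrightarrow> in_L2 (\<lambda>x. f x - g x)"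
  using in_L2_add[OF _ in_L2_cmult[of g "-1"]] by simp

lemma in_L2_minus: "in_L2 g \<Longrightarrow> in_L2 (\<lambda>x. - g x)"
  using in_L2_cmult[of g "-1"] by simp

lemma half_line_weight_integrable: "integrable lborel (\<lambda>x::real. indicator {0<..} x *\<^sub>R (C / (1 + x))\<^sup>2)"
proof (rule Bochner_Integration.integrable_bound)
  show "integrable lborel (\<lambda>x::real. C\<^sup>2 * (1 / (1 + x\<^sup>2)))"
    by (intro integrable_mult_right integrable_Lorentz)
  have "(C / (1 + x))\<^sup>2 \<le> C\<^sup>2 / (1 + x\<^sup>2)" if "x > 0" for x :: real
    unfolding power_divide using that
    by (intro divide_left_mono) (auto simp: power2_sum intro!: mult_pos_pos add_pos_nonneg)
  then show "AE x in lborel. norm (indicator {0<..} x *\<^sub>R (C / (1 + x))\<^sup>2) \<le> norm (C\<^sup>2 * (1 / (1 + x\<^sup>2)))"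
    by (auto simp: indicator_def)
qed auto

text \<open>The weight 1/(1+x) is square integrable on the half-line. The estimates for the explicit
  solutions are stated with it, since it gives membership in L2 and a majorant for dominated
  convergence at the same time.\<close>

lemma in_L2_weightI:
  assumes [measurable]: "g \<in> borel_measurable borel" and b: "\<And>x. x > 0 \<Longrightarrow> cmod (g x) \<le> C / (1 + x)"
  shows "in_L2 g"
  unfolding in_L2_def set_integrable_def set_borel_measurable_def
proof
  show "(\<lambda>x. indicator {0<..} x *\<^sub>R g x) \<in> borel_measurable lborel" by simp
  show "integrable lborel (\<lambda>x. indicator {0<..} x *\<^sub>R (cmod (g x))\<^sup>2)"
    by (rule Bochner_Integration.integrable_bound[OF half_line_weight_integrable[of C]])
       (auto simp: indicator_def intro!: power_mono b[unfolded abs_divide])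
qed

lemma test_fun_in_L2: assumes "test_fun f" shows "in_L2 f"
proof -
  obtain a b where ab: "0 < a" "a \<le> b" "\<And>x. x \<notin> {a..b} \<Longrightarrow> f x = 0" using test_fun_supportE[OF assms] by blast
  have "compact (f ` {a..b})"
    by (intro compact_continuous_image smooth_continuous test_fun_smooth assms) simp
  then obtain B where B: "\<And>x. x \<in> {a..b} \<Longrightarrow> cmod (f x) \<le> B"
    by (meson bounded_iff compact_imp_bounded image_eqI)
  show ?thesis
  proof (rule in_L2_weightI[of _ "B * (1 + b)"])
    show "f \<in> borel_measurable borel" using smooth_borel test_fun_smooth assms by blast
    fix x :: real assume x: "x > 0"
    have "B \<ge> 0" using order_trans[OF norm_ge_zero B[of a]] ab by auto
    show "cmod (f x) \<le> B * (1 + b) / (1 + x)"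
    proof (cases "x \<in> {a..b}")
      case True
      then have "cmod (f x) * (1 + x) \<le> B * (1 + b)"
        using x B[OF True] True \<open>B \<ge> 0\<close> by (intro mult_mono) auto
      then show ?thesis using x by (simp add: field_simps)
    qed (use ab x \<open>B \<ge> 0\<close> in auto)
  qed
qed

subsection \<open>Convergence and differentiation of pairings\<close>

text \<open>Bilinear, without complex conjugation: H has real coefficients and is symmetric for this
  form too, and pairing with a test function is then the action as a distribution.\<close>

definition pairing :: "nat \<Rightarrow> (nat \<Rightarrow> real \<Rightarrow> complex) \<Rightarrow> (nat \<Rightarrow> real \<Rightarrow> complex) \<Rightarrow> complex" where
  "pairing N u v = (\<Sum>j=1..N. LBINT x:{0<..}. u j x * v j x)"

lemma L2_norm_nonneg: "L2_norm N w \<ge> 0"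
  by (auto simp: L2_norm_def set_lebesgue_integral_def intro!: sum_nonneg Bochner_Integration.integral_nonneg)

lemma component_le_L2_norm:
  assumes "j \<in> {1..N}"
  shows "sqrt (LBINT x:{0<..}. (cmod (w j x))\<^sup>2) \<le> L2_norm N w"
  unfolding L2_norm_def using assms
  by (intro real_sqrt_le_mono member_le_sum[of j "{1..N}" "\<lambda>j. LBINT x:{0<..}. (cmod (w j x))\<^sup>2"])
     (auto simp: set_lebesgue_integral_def intro!: Bochner_Integration.integral_nonneg)

lemma pairing_bound:
  assumes "in_L2N N u" "in_L2N N v"
  shows "cmod (pairing N u v) \<le> N * (L2_norm N u * L2_norm N v)"
proof -
  have "cmod (LBINT x:{0<..}. u j x * v j x) \<le> L2_norm N u * L2_norm N v" if "j \<in> {1..N}" for j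
  proof -
    have "cmod (LBINT x:{0<..}. u j x * v j x) \<le>
      sqrt (LBINT x:{0<..}. (cmod (u j x))\<^sup>2) * sqrt (LBINT x:{0<..}. (cmod (v j x))\<^sup>2)"
      using that assms by (intro in_L2_Cauchy_Schwarz) (auto simp: in_L2N_def)
    also have "\<dots> \<le> L2_norm N u * L2_norm N v"
      by (intro mult_mono component_le_L2_norm that)
         (auto simp: L2_norm_nonneg set_lebesgue_integral_def intro!: Bochner_Integration.integral_nonneg)
    finally show ?thesis .
  qed
  then have "cmod (pairing N u v) \<le> (\<Sum>j=1..N. L2_norm N u * L2_norm N v)"
    unfolding pairing_def by (intro sum_norm_le) auto
  then show ?thesis by simp
qed

lemma in_L2N_diff: "in_L2N N u \<Longrightarrow> in_L2N N v \<Longrightarrow> in_L2N N (\<lambda>j x. u j x - v j x)"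
  by (simp add: in_L2N_def in_L2_diff)

lemma in_L2N_add: "in_L2N N u \<Longrightarrow> in_L2N N v \<Longrightarrow> in_L2N N (\<lambda>j x. u j x + v j x)"
  by (simp add: in_L2N_def in_L2_add)

lemma in_L2N_cmult: "in_L2N N u \<Longrightarrow> in_L2N N (\<lambda>j x. c * u j x)"
  by (simp add: in_L2N_def in_L2_cmult)

lemma in_L2N_minus: "in_L2N N u \<Longrightarrow> in_L2N N (\<lambda>j x. - u j x)"
  by (simp add: in_L2N_def in_L2_minus)

lemma pairing_add_left:
  "in_L2N N u \<Longrightarrow> in_L2N N u' \<Longrightarrow> in_L2N N v \<Longrightarrow>
    pairing N (\<lambda>j x. u j x + u' j x) v = pairing N u v + pairing N u' v"
  unfolding pairing_def in_L2N_def
  by (simp add: distrib_right set_integral_add in_L2_mult_integrable sum.distrib)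

lemma pairing_commute: "pairing N u v = pairing N v u"
  by (simp add: pairing_def mult.commute)

lemma pairing_add_right:
  "in_L2N N u \<Longrightarrow> in_L2N N v \<Longrightarrow> in_L2N N v' \<Longrightarrow>
    pairing N u (\<lambda>j x. v j x + v' j x) = pairing N u v + pairing N u v'"
  by (simp add: pairing_commute[of N u] pairing_add_left)

lemma pairing_cmult_left [simp]: "pairing N (\<lambda>j x. c * u j x) v = c * pairing N u v"
  by (simp add: pairing_def mult.assoc sum_distrib_left)

lemma pairing_cmult_right [simp]: "pairing N u (\<lambda>j x. c * v j x) = c * pairing N u v"
  by (simp add: pairing_commute[of N u])

lemma pairing_minus_left [simp]: "pairing N (\<lambda>j x. - u j x) v = - pairing N u v"
  using pairing_cmult_left[of N "-1" u v] by simp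

lemma pairing_minus_right [simp]: "pairing N u (\<lambda>j x. - v j x) = - pairing N u v"
  using pairing_cmult_right[of N u "-1" v] by simp

lemma pairing_diff_left:
  "in_L2N N u \<Longrightarrow> in_L2N N u' \<Longrightarrow> in_L2N N v \<Longrightarrow>
    pairing N (\<lambda>j x. u j x - u' j x) v = pairing N u v - pairing N u' v"
  using pairing_add_left[of N u "\<lambda>j x. - u' j x" v] by (simp add: in_L2N_minus)

lemma pairing_diff_right:
  "in_L2N N u \<Longrightarrow> in_L2N N v \<Longrightarrow> in_L2N N v' \<Longrightarrow>
    pairing N u (\<lambda>j x. v j x - v' j x) = pairing N u v - pairing N u v'"
  by (simp add: pairing_commute[of N u] pairing_diff_left)

lemma pairing_zero_left [simp]: "pairing N (\<lambda>j x. 0) v = 0"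
  by (simp add: pairing_def)

lemma pairing_zero_right [simp]: "pairing N u (\<lambda>j x. 0) = 0"
  by (simp add: pairing_def)

lemma pairing_tendsto:
  assumes u: "L2_tendsto N u a F" and v: "L2_tendsto N v b F"
  shows "((\<lambda>t. pairing N (u t) (v t)) \<longlongrightarrow> pairing N a b) F"
proof -
  define du dv where "du t = (\<lambda>j x. u t j x - a j x)" and "dv t = (\<lambda>j x. v t j x - b j x)" for t
  have a: "in_L2N N a" and b: "in_L2N N b" using u v by (auto simp: L2_tendsto_def)
  have lim: "((\<lambda>t. L2_norm N (du t)) \<longlongrightarrow> 0) F" "((\<lambda>t. L2_norm N (dv t)) \<longlongrightarrow> 0) F"
    using u v by (auto simp: L2_tendsto_def du_def dv_def)
  have eq: "\<forall>\<^sub>F t in F. cmod (pairing N (u t) (v t) - pairing N a b) \<le>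
     N * (L2_norm N (du t) * L2_norm N (dv t)) + N * (L2_norm N (du t) * L2_norm N b)
       + N * (L2_norm N a * L2_norm N (dv t))"
  proof -
    have "\<forall>\<^sub>F t in F. in_L2N N (u t) \<and> in_L2N N (v t)"
      using u v by (auto simp: L2_tendsto_def eventually_conj)
    then show ?thesis
    proof eventually_elim
      case (elim t)
      then have d: "in_L2N N (du t)" "in_L2N N (dv t)"
        using a b by (auto simp: du_def dv_def in_L2N_diff)
      have "pairing N (u t) (v t) = pairing N (\<lambda>j x. du t j x + a j x) (\<lambda>j x. dv t j x + b j x)"
        by (simp add: du_def dv_def)
      also have "\<dots> = pairing N (du t) (dv t) + pairing N (du t) b + pairing N a (dv t) + pairing N a b"
        using d a b by (simp add: pairing_add_left pairing_add_right in_L2N_add)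
      finally have "pairing N (u t) (v t) - pairing N a b =
        pairing N (du t) (dv t) + pairing N (du t) b + pairing N a (dv t)" by simp
      then show ?case
        using pairing_bound[OF d] pairing_bound[OF d(1) b] pairing_bound[OF a d(2)]
        by (smt (verit) norm_triangle_ineq)
    qed
  qed
  have "((\<lambda>t. N * (L2_norm N (du t) * L2_norm N (dv t)) + N * (L2_norm N (du t) * L2_norm N b)
       + N * (L2_norm N a * L2_norm N (dv t))) \<longlongrightarrow> real N * (0 * 0) + N * (0 * L2_norm N b) + N * (L2_norm N a * 0)) F"
    by (intro tendsto_intros lim)
  then have "((\<lambda>t. pairing N (u t) (v t) - pairing N a b) \<longlongrightarrow> 0) F"
    by (intro Lim_null_comparison[OF eq]) simp
  then show ?thesis by (simp add: LIM_zero_iff)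
qed

lemma L2_norm_cmult: "L2_norm N (\<lambda>j x. c * w j x) = cmod c * L2_norm N w"
  by (simp add: L2_norm_def norm_mult power_mult_distrib sum_distrib_left[symmetric] real_sqrt_mult)

text \<open>From |a + b|^2 \<le> 2|a|^2 + 2|b|^2 pointwise; the factor 2 is harmless in the
  continuity argument below.\<close>

lemma L2_norm_square_add_le:
  assumes "in_L2N N u" "in_L2N N v"
  shows "(L2_norm N (\<lambda>j x. u j x + v j x))\<^sup>2 \<le> 2 * (L2_norm N u)\<^sup>2 + 2 * (L2_norm N v)\<^sup>2"
proof -
  have sq: "(L2_norm N w)\<^sup>2 = (\<Sum>j=1..N. LBINT x:{0<..}. (cmod (w j x))\<^sup>2)" for w
    unfolding L2_norm_def
    by (auto simp: set_lebesgue_integral_def intro!: real_sqrt_pow2 sum_nonneg Bochner_Integration.integral_nonneg)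
  have "(LBINT x:{0<..}. (cmod (u j x + v j x))\<^sup>2) \<le>
      2 * (LBINT x:{0<..}. (cmod (u j x))\<^sup>2) + 2 * (LBINT x:{0<..}. (cmod (v j x))\<^sup>2)"
    if "j \<in> {1..N}" for j
  proof -
    have L: "in_L2 (u j)" "in_L2 (v j)" using that assms by (auto simp: in_L2N_def)
    have i: "set_integrable lborel {0<..} (\<lambda>x. 2 * (cmod (u j x))\<^sup>2)"
      "set_integrable lborel {0<..} (\<lambda>x. 2 * (cmod (v j x))\<^sup>2)"
      using L by (auto simp: in_L2_def)
    have "(LBINT x:{0<..}. (cmod (u j x + v j x))\<^sup>2) \<le>
      (LBINT x:{0<..}. 2 * (cmod (u j x))\<^sup>2 + 2 * (cmod (v j x))\<^sup>2)"
    proof (rule set_integral_mono)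
      show "set_integrable lborel {0<..} (\<lambda>x. (cmod (u j x + v j x))\<^sup>2)"
        using in_L2_add[OF L] by (simp add: in_L2_def)
      show "set_integrable lborel {0<..} (\<lambda>x. 2 * (cmod (u j x))\<^sup>2 + 2 * (cmod (v j x))\<^sup>2)"
        using i by (rule set_integral_add(1))
      fix x
      have "(cmod (u j x + v j x))\<^sup>2 \<le> (cmod (u j x) + cmod (v j x))\<^sup>2"
        by (intro power_mono norm_triangle_ineq) auto
      also have "\<dots> \<le> 2 * (cmod (u j x))\<^sup>2 + 2 * (cmod (v j x))\<^sup>2"
        using zero_le_power2[of "cmod (u j x) - cmod (v j x)"] unfolding power2_diff power2_sum by linarith
      finally show "(cmod (u j x + v j x))\<^sup>2 \<le> 2 * (cmod (u j x))\<^sup>2 + 2 * (cmod (v j x))\<^sup>2" .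
    qed
    also have "\<dots> = 2 * (LBINT x:{0<..}. (cmod (u j x))\<^sup>2) + 2 * (LBINT x:{0<..}. (cmod (v j x))\<^sup>2)"
      by (simp add: set_integral_add(2)[OF i])
    finally show ?thesis .
  qed
  then show ?thesis unfolding sq sum_distrib_left sum.distrib[symmetric] by (intro sum_mono)
qed

section \<open>Derivatives of functions of time with values in L2\<close>

lemma L2_has_deriv_in_L2N:
  assumes "L2_has_deriv N u u' t" shows "\<forall>\<^sub>F s in nhds t. in_L2N N (u s)"
proof -
  have ut: "in_L2N N (u t)" and ev: "\<forall>\<^sub>F s in at t. in_L2N N (\<lambda>j x. (u s j x - u t j x) / of_real (s - t))"
    using assms by (auto simp: L2_has_deriv_def L2_tendsto_def)
  have "\<forall>\<^sub>F s in at t. in_L2N N (u s)"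
    using ev eventually_neq_at_within[of t t]
  proof eventually_elim
    case (elim s)
    from in_L2N_add[OF ut in_L2N_cmult[OF elim(1), of "of_real (s - t)"]] elim(2) show ?case by simp
  qed
  with ut show ?thesis by (simp add: eventually_nhds_conv_at)
qed

text \<open>The increment u(s) - u(t) is s - t times a difference quotient whose norm stays
  bounded.\<close>

lemma L2_has_deriv_continuous:
  assumes "L2_has_deriv N u u' t" shows "L2_tendsto N u (u t) (at t)"
  unfolding L2_tendsto_def
proof (intro conjI)
  define q where "q s = (\<lambda>j x. (u s j x - u t j x) / of_real (s - t))" for s
  show ut: "in_L2N N (u t)" and "\<forall>\<^sub>F s in at t. in_L2N N (u s)"
    using L2_has_deriv_in_L2N[OF assms] by (auto simp: eventually_nhds_conv_at)
  have u': "in_L2N N u'" and ev: "\<forall>\<^sub>F s in at t. in_L2N N (q s)"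
    and lim: "((\<lambda>s. L2_norm N (\<lambda>j x. q s j x - u' j x)) \<longlongrightarrow> 0) (at t)"
    using assms by (auto simp: L2_has_deriv_def L2_tendsto_def q_def)
  have bound: "\<forall>\<^sub>F s in at t. norm ((L2_norm N (\<lambda>j x. u s j x - u t j x))\<^sup>2) \<le>
     (s - t)\<^sup>2 * (2 * (L2_norm N (\<lambda>j x. q s j x - u' j x))\<^sup>2 + 2 * (L2_norm N u')\<^sup>2)"
    using ev eventually_neq_at_within[of t t]
  proof eventually_elim
    case (elim s)
    have "L2_norm N (\<lambda>j x. u s j x - u t j x) = L2_norm N (\<lambda>j x. of_real (s - t) * q s j x)"
      using elim(2) by (simp add: q_def)
    also have "\<dots> = \<bar>s - t\<bar> * L2_norm N (q s)"
      by (simp only: L2_norm_cmult norm_of_real)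
    also have "\<dots>\<^sup>2 \<le> (s - t)\<^sup>2 * (2 * (L2_norm N (\<lambda>j x. q s j x - u' j x))\<^sup>2 + 2 * (L2_norm N u')\<^sup>2)"
      using L2_norm_square_add_le[OF in_L2N_diff[OF elim(1) u'] u']
      by (simp add: power_mult_distrib mult_left_mono)
    finally show ?case by simp
  qed
  have "((\<lambda>s. (s - t)\<^sup>2 * (2 * (L2_norm N (\<lambda>j x. q s j x - u' j x))\<^sup>2 + 2 * (L2_norm N u')\<^sup>2))
     \<longlongrightarrow> (t - t)\<^sup>2 * (2 * 0\<^sup>2 + 2 * (L2_norm N u')\<^sup>2)) (at t)"
    by (intro tendsto_intros lim)
  then have "((\<lambda>s. (L2_norm N (\<lambda>j x. u s j x - u t j x))\<^sup>2) \<longlongrightarrow> 0) (at t)"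
    using Lim_null_comparison[OF bound] by simp
  from tendsto_real_sqrt[OF this]
  show "((\<lambda>s. L2_norm N (\<lambda>j x. u s j x - u t j x)) \<longlongrightarrow> 0) (at t)"
    by (simp add: L2_norm_nonneg)
qed

lemma L2_tendsto_const: "in_L2N N v \<Longrightarrow> L2_tendsto N (\<lambda>_. v) v F"
  by (simp add: L2_tendsto_def L2_norm_def)

lemma L2_tendsto_compose:
  assumes "L2_tendsto N u v F" "filterlim g F G" shows "L2_tendsto N (\<lambda>s. u (g s)) v G"
  using assms filterlim_compose[of "\<lambda>t. L2_norm N (\<lambda>j x. u t j x - v j x)" "nhds 0" F g G]
  by (auto simp: L2_tendsto_def filterlim_iff)

lemma L2_tendsto_mono: "L2_tendsto N u v F \<Longrightarrow> G \<le> F \<Longrightarrow> L2_tendsto N u v G"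
  using L2_tendsto_compose[of N u v F "\<lambda>x. x" G] by (simp add: filterlim_def)

lemma L2_tendsto_cmult:
  assumes "L2_tendsto N u v F" shows "L2_tendsto N (\<lambda>t j x. c * u t j x) (\<lambda>j x. c * v j x) F"
proof -
  have "((\<lambda>t. cmod c * L2_norm N (\<lambda>j x. u t j x - v j x)) \<longlongrightarrow> 0) F"
    using assms by (intro tendsto_mult_right_zero) (simp add: L2_tendsto_def)
  then have "((\<lambda>t. L2_norm N (\<lambda>j x. c * u t j x - c * v j x)) \<longlongrightarrow> 0) F"
    by (simp only: L2_norm_cmult right_diff_distrib[symmetric])
  then show ?thesis
    using assms by (auto simp: L2_tendsto_def in_L2N_cmult elim: eventually_mono)
qed

lemma has_vector_derivative_iff_tendsto:
  fixes f :: "real \<Rightarrow> 'a::real_normed_vector"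
  shows "(f has_vector_derivative D) (at t) \<longleftrightarrow> ((\<lambda>s. (f s - f t) /\<^sub>R (s - t)) \<longlongrightarrow> D) (at t)"
proof -
  have "(f has_vector_derivative D) (at t) \<longleftrightarrow>
      ((\<lambda>s. norm (f s - f t - (s - t) *\<^sub>R D) / norm (s - t)) \<longlongrightarrow> 0) (at t)"
    by (simp add: has_vector_derivative_def has_derivative_iff_norm bounded_linear_scaleR_left)
  also have "\<dots> \<longleftrightarrow> ((\<lambda>s. norm ((f s - f t) /\<^sub>R (s - t) - D)) \<longlongrightarrow> 0) (at t)"
  proof (rule filterlim_cong[OF refl refl])
    show "\<forall>\<^sub>F s in at t. norm (f s - f t - (s - t) *\<^sub>R D) / norm (s - t) = norm ((f s - f t) /\<^sub>R (s - t) - D)"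
      using eventually_neq_at_within[of t t]
    proof eventually_elim
      case (elim s)
      then have "(f s - f t) /\<^sub>R (s - t) - D = (f s - f t - (s - t) *\<^sub>R D) /\<^sub>R (s - t)"
        by (simp add: scaleR_diff_right)
      then show ?case by (simp add: divide_inverse mult.commute)
    qed
  qed
  also have "\<dots> \<longleftrightarrow> ((\<lambda>s. (f s - f t) /\<^sub>R (s - t)) \<longlongrightarrow> D) (at t)"
    by (simp add: tendsto_norm_zero_iff LIM_zero_iff)
  finally show ?thesis .
qed

lemma pairing_has_deriv:
  assumes u: "L2_has_deriv N u u' t" and v: "L2_has_deriv N v v' t"
  shows "((\<lambda>s. pairing N (u s) (v s)) has_vector_derivative (pairing N u' (v t) + pairing N (u t) v')) (at t)"
proof -
  define q where "q w s = (\<lambda>j x. (w s j x - w t j x) / of_real (s - t))" for w :: "real \<Rightarrow> nat \<Rightarrow> real \<Rightarrow> complex" and s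
  have qu: "L2_tendsto N (q u) u' (at t)" and qv: "L2_tendsto N (q v) v' (at t)"
    and ut: "in_L2N N (u t)" using u v unfolding L2_has_deriv_def q_def by blast+
  \<comment> \<open>The increment is split as (u(s) - u(t)) v(s) + u(t) (v(s) - v(t)); the first
    term requires continuity of v at t.\<close>
  have "((\<lambda>s. pairing N (q u s) (v s) + pairing N (u t) (q v s)) \<longlongrightarrow> pairing N u' (v t) + pairing N (u t) v') (at t)"
    by (intro tendsto_add pairing_tendsto qu qv L2_has_deriv_continuous[OF v] L2_tendsto_const ut)
  moreover have "\<forall>\<^sub>F s in at t. pairing N (q u s) (v s) + pairing N (u t) (q v s) =
      (pairing N (u s) (v s) - pairing N (u t) (v t)) /\<^sub>R (s - t)"
    using L2_has_deriv_in_L2N[OF u, unfolded eventually_nhds_conv_at, THEN conjunct1]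
      L2_has_deriv_in_L2N[OF v, unfolded eventually_nhds_conv_at, THEN conjunct1] eventually_neq_at_within[of t t]
  proof eventually_elim
    case (elim s)
    have vt: "in_L2N N (v t)" using v by (simp add: L2_has_deriv_def)
    have q: "q w s = (\<lambda>j x. inverse (of_real (s - t)) * (w s j x - w t j x))" for w
      by (simp add: q_def field_simps)
    show ?case unfolding q pairing_cmult_left pairing_cmult_right
        pairing_diff_left[OF elim(1) ut elim(2)] pairing_diff_right[OF ut elim(2) vt]
      by (simp add: scaleR_conv_of_real algebra_simps)
  qed
  ultimately have "((\<lambda>s. (pairing N (u s) (v s) - pairing N (u t) (v t)) /\<^sub>R (s - t)) \<longlongrightarrow>
      pairing N u' (v t) + pairing N (u t) v') (at t)"
    by (rule Lim_transform_eventually)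
  then show ?thesis by (simp add: has_vector_derivative_iff_tendsto)
qed

text \<open>With \<open>\<sigma> = -1\<close> this reverses time in the duality arguments, with
  \<open>\<sigma> = 1\<close> it shifts time along a characteristic.\<close>

lemma L2_has_deriv_affine:
  assumes v: "L2_has_deriv N v v' (c + \<sigma> * t)" and \<sigma>: "\<sigma> \<noteq> 0"
  shows "L2_has_deriv N (\<lambda>s. v (c + \<sigma> * s)) (\<lambda>j x. of_real \<sigma> * v' j x) t"
proof -
  have g: "filterlim (\<lambda>s. c + \<sigma> * s) (at (c + \<sigma> * t)) (at t)"
    using \<sigma> eventually_neq_at_within[of t t] by (auto simp: filterlim_at intro!: tendsto_eq_intros elim: eventually_mono)
  let ?q = "\<lambda>s j x. (v s j x - v (c + \<sigma> * t) j x) / of_real (s - (c + \<sigma> * t))"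
  have L: "L2_tendsto N (\<lambda>s. ?q (c + \<sigma> * s)) v' (at t)"
    using L2_tendsto_compose[OF v[unfolded L2_has_deriv_def, THEN conjunct2] g] .
  have eq: "(\<lambda>j x. (v (c + \<sigma> * s) j x - v (c + \<sigma> * t) j x) / of_real (s - t)) =
      (\<lambda>j x. of_real \<sigma> * ?q (c + \<sigma> * s) j x)" for s
  proof (intro ext)
    fix j x
    have "complex_of_real (c + \<sigma> * s - (c + \<sigma> * t)) = of_real \<sigma> * of_real (s - t)"
      by (simp add: algebra_simps)
    then show "(v (c + \<sigma> * s) j x - v (c + \<sigma> * t) j x) / of_real (s - t) = of_real \<sigma> * ?q (c + \<sigma> * s) j x"
      using \<sigma> by simp
  qed
  have "L2_tendsto N (\<lambda>s j x. of_real \<sigma> * ?q (c + \<sigma> * s) j x) (\<lambda>j x. of_real \<sigma> * v' j x) (at t)"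
    using L2_tendsto_cmult[OF L] .
  then show ?thesis
    using v unfolding L2_has_deriv_def eq by simp
qed

section \<open>Test functions separate points\<close>

lemma set_integral_empty: "set_lebesgue_integral M {} f = 0"
  by (simp add: set_lebesgue_integral_def)

text \<open>The positive and the negative part of f are densities of finite measures that agree on
  all rays and hence coincide. Uniqueness of densities makes the two parts equal almost everywhere,
  and one of them is always 0.\<close>

lemma AE_zero_of_tail_integrals:
  fixes f :: "real \<Rightarrow> real"
  assumes f: "integrable lborel f" and zero: "\<And>x. (LBINT s:{x<..}. f s) = 0"
  shows "AE x in lborel. f x = 0"
proof -
  have em: "emeasure (density lborel (\<lambda>x. ennreal (h x))) {x<..} = ennreal (LBINT s:{x<..}. max 0 (h s))"
    if h: "integrable lborel h" for h :: "real \<Rightarrow> real" and x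
  proof -
    have i: "integrable lborel (\<lambda>s. indicator {x<..} s * max 0 (h s))"
      using integrable_mult_indicator[of "{x<..}" lborel "\<lambda>s. max 0 (h s)"] h by simp
    have "emeasure (density lborel (\<lambda>x. ennreal (h x))) {x<..} = (\<integral>\<^sup>+s. ennreal (indicator {x<..} s * max 0 (h s)) \<partial>lborel)"
      using h by (subst emeasure_density)
        (auto intro!: nn_integral_cong simp: indicator_def max_def ennreal_neg split: if_splits)
    also have "\<dots> = ennreal (LBINT s:{x<..}. max 0 (h s))"
      unfolding set_lebesgue_integral_def by (subst nn_integral_eq_integral[OF i]) auto
    finally show ?thesis .
  qed
  have "(LBINT s:{x<..}. max 0 (f s)) = (LBINT s:{x<..}. max 0 (- f s))" for x
  proof -
    have "set_integrable lborel {x<..} (\<lambda>s. max 0 (f s))" "set_integrable lborel {x<..} (\<lambda>s. max 0 (- f s))"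
      unfolding set_integrable_def by (intro integrable_mult_indicator; use f in simp)+
    from set_integral_diff(2)[OF this] zero[of x] show ?thesis
      by (simp add: max_def if_distrib cong: if_cong)
  qed
  then have "density lborel (\<lambda>x. ennreal (f x)) = density lborel (\<lambda>x. ennreal (- f x))"
    using f by (intro measure_eqI_lessThan) (auto simp: em)
  then have "AE x in lborel. ennreal (f x) = ennreal (- f x)"
    using f by (intro sigma_finite_measure.density_unique[OF sigma_finite_lborel]) auto
  then show ?thesis
  proof eventually_elim
    case (elim x)
    then show ?case by (cases "f x > 0") (auto simp: ennreal_neg)
  qed
qed

lemma test_fun_interval_integral:
  assumes int: "\<And>a b. 0 < a \<Longrightarrow> set_integrable lborel {a..b} g"
    and zero: "\<And>\<psi>. test_fun \<psi> \<Longrightarrow> (LBINT x:{0<..}. g x * \<psi> x) = 0"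
    and ab: "0 < a" "a \<le> b"
  shows "(LBINT x:{a<..b}. g x) = 0"
proof -
  obtain \<theta> where \<theta>: "smooth \<theta>" "\<And>x. x \<le> 0 \<Longrightarrow> \<theta> x = 0" "\<And>x. x \<ge> 1 \<Longrightarrow> \<theta> x = 1"
    "\<And>x. cmod (\<theta> x) \<le> 1" "\<And>x. cmod (1 - \<theta> x) \<le> 1" by (rule ex_smooth_step) blast
  \<comment> \<open>A step up at a times a step down at b, both of width 1/(n+1). Since
    \<open>\<theta>\<close> vanishes at 0, the pointwise limit is the indicator of the half-open
    interval at the end points as well.\<close>
  define \<xi> where "\<xi> n x = \<theta> (real (Suc n) * (x - a)) * (1 - \<theta> (real (Suc n) * (x - b)))" for n x
  have sm: "smooth (\<xi> n)" for n
    unfolding \<xi>_def right_diff_distrib using smooth_affine[OF \<theta>(1), of "real (Suc n)" "- (real (Suc n) * a)"]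
      smooth_affine[OF \<theta>(1), of "real (Suc n)" "- (real (Suc n) * b)"]
    by (intro smooth_mult smooth_diff smooth_const) (simp_all del: of_nat_Suc)
  have supp: "\<xi> n x = 0" if "x \<notin> {a..b + 1}" for n x
  proof (cases "x < a")
    case True
    then have "real (Suc n) * (x - a) \<le> 0" by (simp add: mult_nonneg_nonpos)
    then show ?thesis by (simp add: \<xi>_def \<theta>(2) del: of_nat_Suc)
  next
    case False
    then have "x - b \<ge> 1" using that by auto
    then have "1 * 1 \<le> real (Suc n) * (x - b)" by (intro mult_mono) auto
    then have "1 \<le> real (Suc n) * (x - b)" by (simp del: of_nat_Suc)
    then show ?thesis by (simp add: \<xi>_def \<theta>(3) del: of_nat_Suc)
  qed
  have bound: "cmod (\<xi> n x) \<le> 1" for n x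
    unfolding \<xi>_def norm_mult using \<theta>(4,5) by (intro mult_le_one) auto
  have lim: "(\<lambda>n. \<xi> n x) \<longlonglongrightarrow> indicator {a<..b} x" for x
  proof -
    have ev: "\<forall>\<^sub>F n in sequentially. \<theta> (real (Suc n) * (x - c)) = (if x > c then 1 else 0)" for c
    proof (cases "x > c")
      case True
      have "filterlim (\<lambda>n. (x - c) * real (Suc n)) at_top sequentially"
        using True filterlim_compose[OF filterlim_real_sequentially filterlim_Suc]
        by (intro filterlim_tendsto_pos_mult_at_top[OF tendsto_const]) (simp_all del: of_nat_Suc)
      then have "\<forall>\<^sub>F n in sequentially. 1 \<le> (x - c) * real (Suc n)" by (simp add: filterlim_at_top)
      then show ?thesis by eventually_elim (use True \<theta>(3) in \<open>simp add: mult.commute del: of_nat_Suc\<close>)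
    next
      case False
      then have "real (Suc n) * (x - c) \<le> 0" for n by (simp add: mult_nonneg_nonpos)
      then show ?thesis using False \<theta>(2) by (simp del: of_nat_Suc)
    qed
    have "\<forall>\<^sub>F n in sequentially. \<xi> n x = indicator {a<..b} x"
      using ev[of a] ev[of b]
      by eventually_elim (use ab in \<open>auto simp: \<xi>_def indicator_def simp del: of_nat_Suc\<close>)
    then show ?thesis by (rule tendsto_eventually)
  qed
  have i: "set_integrable lborel {a..b + 1} g" using int ab by blast
  have "(\<lambda>n. LBINT x. (indicator {a..b + 1} x *\<^sub>R g x) * \<xi> n x) \<longlonglongrightarrow>
     (LBINT x. (indicator {a..b + 1} x *\<^sub>R g x) * indicator {a<..b} x)"
  proof (rule integral_dominated_convergence)
    show "integrable lborel (\<lambda>x. cmod (indicator {a..b + 1} x *\<^sub>R g x))"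
      using i unfolding set_integrable_def by (rule integrable_norm)
    show "AE x in lborel. (\<lambda>n. (indicator {a..b + 1} x *\<^sub>R g x) * \<xi> n x) \<longlonglongrightarrow>
        (indicator {a..b + 1} x *\<^sub>R g x) * indicator {a<..b} x"
      by (intro AE_I2 tendsto_mult tendsto_const lim)
    show "AE x in lborel. norm ((indicator {a..b + 1} x *\<^sub>R g x) * \<xi> n x) \<le> cmod (indicator {a..b + 1} x *\<^sub>R g x)" for n
      unfolding norm_mult using bound by (intro AE_I2 mult_left_le) auto
  qed (intro borel_measurable_times;
       use borel_measurable_integrable[OF i[unfolded set_integrable_def]] smooth_borel[OF sm] in simp)+
  moreover have "(LBINT x. (indicator {a..b + 1} x *\<^sub>R g x) * \<xi> n x) = 0" for n
  proof -
    have "test_fun (\<xi> n)" using test_funI[OF sm ab(1) supp] .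
    from zero[OF this] have "(LBINT x. indicator {0<..} x *\<^sub>R (g x * \<xi> n x)) = 0"
      by (simp add: set_lebesgue_integral_def)
    moreover have "indicator {0<..} x *\<^sub>R (g x * \<xi> n x) = (indicator {a..b + 1} x *\<^sub>R g x) * \<xi> n x" for x
      using supp[of x n] ab by (auto simp: indicator_def)
    ultimately show ?thesis by simp
  qed
  moreover have "(LBINT x. (indicator {a..b + 1} x *\<^sub>R g x) * indicator {a<..b} x) = (LBINT x:{a<..b}. g x)"
    unfolding set_lebesgue_integral_def
    by (rule Bochner_Integration.integral_cong) (auto simp: indicator_def)
  ultimately show ?thesis using LIMSEQ_unique[OF _ tendsto_const] by simp
qed

lemma test_fun_AE_zero:
  assumes int: "\<And>a b. 0 < a \<Longrightarrow> set_integrable lborel {a..b} g"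
    and zero: "\<And>\<psi>. test_fun \<psi> \<Longrightarrow> (LBINT x:{0<..}. g x * \<psi> x) = 0"
  shows "AE x in lborel. 0 < x \<longrightarrow> g x = 0"
proof -
  have iab: "set_integrable lborel {a<..b} g" if "0 < a" for a b
    by (rule set_integrable_subset[OF int[OF that, of b]]) auto
  \<comment> \<open>L stands for \<open>Re\<close> or \<open>Im\<close>. The cut-off to {a<..b}
    gives an integrable function on the line whose tail integrals are interval integrals.\<close>
  have part: "AE x in lborel. indicator {a<..b} x * L (g x) = 0"
    if ab: "0 < a" and L: "bounded_linear L" for a b and L :: "complex \<Rightarrow> real"
  proof (rule AE_zero_of_tail_integrals)
    have eq: "indicator S x * L (g x) = L (indicator S x *\<^sub>R g x)" for S x
      using L by (simp add: linear_cmul bounded_linear.linear)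
    show "integrable lborel (\<lambda>x. indicator {a<..b} x * L (g x))"
      unfolding eq using integrable_bounded_linear[OF L] iab[OF ab, of b] by (simp add: set_integrable_def)
    fix x
    have "(LBINT s:{x<..}. indicator {a<..b} s * L (g s)) = (LBINT s. L (indicator {max a x<..b} s *\<^sub>R g s))"
      unfolding set_lebesgue_integral_def eq[symmetric]
      by (rule Bochner_Integration.integral_cong) (auto simp: indicator_def)
    also have "\<dots> = L (LBINT s:{max a x<..b}. g s)"
      unfolding set_lebesgue_integral_def
      using iab[of "max a x" b] ab by (intro integral_bounded_linear[OF L]) (auto simp: set_integrable_def)
    also have "(LBINT s:{max a x<..b}. g s) = 0"
    proof (cases "max a x \<le> b")
      case True
      then show ?thesis using test_fun_interval_integral[OF int zero, of "max a x" b] ab by auto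
    next
      case False
      then have "{max a x<..b} = {}" by auto
      then show ?thesis by (simp only: set_integral_empty)
    qed
    finally show "(LBINT s:{x<..}. indicator {a<..b} s * L (g s)) = 0"
      using L by (simp add: linear_0 bounded_linear.linear)
  qed
  have "AE x in lborel. \<forall>n. indicator {1 / real (Suc n)<..real n} x * Re (g x) = 0 \<and>
      indicator {1 / real (Suc n)<..real n} x * Im (g x) = 0"
    unfolding AE_all_countable
    by (intro allI AE_conjI part bounded_linear_Re bounded_linear_Im) auto
  then show ?thesis
  proof eventually_elim
    case (elim x)
    show ?case
    proof
      assume x: "0 < x"
      obtain n1 where n1: "inverse (real (Suc n1)) < x" using reals_Archimedean[OF x] by blast
      obtain n2 :: nat where n2: "x \<le> real n2" using real_arch_simple by blast
      define n where "n = max n1 n2"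
      have "1 / real (Suc n) \<le> 1 / real (Suc n1)" by (intro divide_left_mono) (auto simp: n_def)
      also have "\<dots> < x" using n1 by (simp add: inverse_eq_divide)
      finally have "x \<in> {1 / real (Suc n)<..real n}" using n2 by (auto simp: n_def)
      with elim[rule_format, of n] show "g x = 0" by (simp add: complex_eq_iff del: of_nat_Suc)
    qed
  qed
qed

lemma in_L2_locally_integrable:
  assumes "in_L2 g" "0 < a" shows "set_integrable lborel {a..b} g"
  unfolding set_integrable_def
proof (rule Bochner_Integration.integrable_bound)
  show "integrable lborel (\<lambda>x. indicator {a..b} x + indicator {0<..} x *\<^sub>R (cmod (g x))\<^sup>2 :: real)"
    using in_L2_square[OF assms(1)]
    by (intro Bochner_Integration.integrable_add integrable_real_indicator) (auto simp: emeasure_lborel_Icc_eq)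
  have "(\<lambda>x. indicator {a..b} x *\<^sub>R (indicator {0<..} x *\<^sub>R g x)) \<in> borel_measurable lborel"
    using borel_measurable_scaleR[OF _ in_L2_measurable[OF assms(1)], of "indicator {a..b}"] by simp
  moreover have "(\<lambda>x. indicator {a..b} x *\<^sub>R (indicator {0<..} x *\<^sub>R g x)) = (\<lambda>x. indicator {a..b} x *\<^sub>R g x)"
    using assms(2) by (auto simp: indicator_def)
  ultimately show "(\<lambda>x. indicator {a..b} x *\<^sub>R g x) \<in> borel_measurable lborel" by (simp only:)
  have "cmod z \<le> 1 + (cmod z)\<^sup>2" for z
    using zero_le_power2[of "cmod z - 1"] unfolding power2_diff by (simp, smt (verit) norm_ge_zero)
  then show "AE x in lborel. norm (indicator {a..b} x *\<^sub>R g x) \<le>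
      norm (indicator {a..b} x + indicator {0<..} x *\<^sub>R (cmod (g x))\<^sup>2 :: real)"
    using assms(2) by (auto simp: indicator_def)
qed

lemma in_L2_AE_eqI:
  assumes g: "in_L2 g" and h: "in_L2 h"
    and eq: "\<And>\<psi>. test_fun \<psi> \<Longrightarrow> (LBINT x:{0<..}. g x * \<psi> x) = (LBINT x:{0<..}. h x * \<psi> x)"
  shows "AE x in lborel. 0 < x \<longrightarrow> g x = h x"
proof -
  have "AE x in lborel. 0 < x \<longrightarrow> g x - h x = 0"
  proof (rule test_fun_AE_zero)
    show "(LBINT x:{0<..}. (g x - h x) * \<psi> x) = 0" if "test_fun \<psi>" for \<psi>
      using eq[OF that] set_integral_diff(2)[OF in_L2_mult_integrable[OF g test_fun_in_L2[OF that]]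
          in_L2_mult_integrable[OF h test_fun_in_L2[OF that]]] by (simp add: left_diff_distrib)
  qed (intro in_L2_locally_integrable in_L2_diff g h)
  then show ?thesis by simp
qed

section \<open>Weak derivatives and the symmetry of the Hamiltonian\<close>

lemma weak_deriv_unique:
  assumes "weak_deriv g h" "weak_deriv g h'"
  shows "AE x in lborel. 0 < x \<longrightarrow> h x = h' x"
  using assms by (intro in_L2_AE_eqI) (auto simp: weak_deriv_def)

text \<open>\<open>star_domain\<close> and \<open>star_H\<close> choose the weak derivative
  independently. The two choices are equal almost everywhere, and this carries the trace from one to
  the other.\<close>

lemma trace_at_0_cong_AE:
  assumes "trace_at_0 g c" "AE x in lborel. 0 < x \<longrightarrow> g x = h x"
  shows "trace_at_0 h c"
proof -
  obtain G where G: "continuous_on {0..} G" "AE x in lborel. 0 < x \<longrightarrow> G x = g x" "G 0 = c"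
    using assms(1) by (auto simp: trace_at_0_def)
  have "AE x in lborel. 0 < x \<longrightarrow> G x = h x" using G(2) assms(2) by eventually_elim auto
  with G show ?thesis by (auto simp: trace_at_0_def)
qed

section \<open>Integration by parts with a boundary term at 0\<close>

lemma in_L2_mult_tendsto:
  assumes f: "in_L2 f" and h: "in_L2 h" and k: "\<And>n. k n \<in> borel_measurable borel"
    and l: "l \<in> borel_measurable borel"
    and bound: "\<And>n x. cmod (k n x) \<le> K" and lim: "\<And>x. x > 0 \<Longrightarrow> (\<lambda>n. k n x) \<longlonglongrightarrow> l x"
  shows "(\<lambda>n. LBINT x:{0<..}. f x * h x * k n x) \<longlonglongrightarrow> (LBINT x:{0<..}. f x * h x * l x)"
proof -
  note i = in_L2_mult_integrable[OF f h, unfolded set_integrable_def]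
  have m: "(\<lambda>x. indicator {0<..} x *\<^sub>R (f x * h x * q x)) \<in> borel_measurable lborel"
    if "q \<in> borel_measurable borel" for q
    using borel_measurable_times[OF borel_measurable_integrable[OF i], of q] that
    by (simp add: mult.assoc)
  show ?thesis unfolding set_lebesgue_integral_def
  proof (rule integral_dominated_convergence)
    show "integrable lborel (\<lambda>x. K * cmod (indicator {0<..} x *\<^sub>R (f x * h x)))"
      using i by (intro integrable_mult_right integrable_norm)
    show "AE x in lborel. (\<lambda>n. indicator {0<..} x *\<^sub>R (f x * h x * k n x)) \<longlonglongrightarrow> indicator {0<..} x *\<^sub>R (f x * h x * l x)"
      by (auto simp: indicator_def intro!: tendsto_intros lim)
    show "AE x in lborel. norm (indicator {0<..} x *\<^sub>R (f x * h x * k n x)) \<le> K * cmod (indicator {0<..} x *\<^sub>R (f x * h x))" for n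
      using bound by (auto simp: indicator_def norm_mult mult.commute[of K] intro!: mult_left_mono)
  qed (rule m[OF l], rule m[OF k])
qed

lemma in_L2_mult_bounded:
  assumes h: "in_L2 h" and k: "k \<in> borel_measurable borel" and bound: "\<And>x. cmod (k x) \<le> B"
  shows "in_L2 (\<lambda>x. h x * k x)"
  unfolding in_L2_def set_borel_measurable_def set_integrable_def
proof
  have "(\<lambda>x. (indicator {0<..} x *\<^sub>R h x) * k x) \<in> borel_measurable lborel"
    using in_L2_measurable[OF h] k by (intro borel_measurable_times) simp_all
  then show m: "(\<lambda>x. indicator {0<..} x *\<^sub>R (h x * k x)) \<in> borel_measurable lborel"
    by simp
  show "integrable lborel (\<lambda>x. indicator {0<..} x *\<^sub>R (cmod (h x * k x))\<^sup>2)"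
  proof (rule Bochner_Integration.integrable_bound)
    show "integrable lborel (\<lambda>x. B\<^sup>2 * (indicator {0<..} x *\<^sub>R (cmod (h x))\<^sup>2))"
      by (intro integrable_mult_right in_L2_square h)
    have eq: "(\<lambda>x. indicator {0<..} x *\<^sub>R (cmod (h x * k x))\<^sup>2) = (\<lambda>x. (cmod (indicator {0<..} x *\<^sub>R (h x * k x)))\<^sup>2)"
      by (auto simp: indicator_def)
    show "(\<lambda>x. indicator {0<..} x *\<^sub>R (cmod (h x * k x))\<^sup>2) \<in> borel_measurable lborel"
      unfolding eq using measurable_compose[OF m borel_measurable_norm] by (intro borel_measurable_power) simp
    have "(cmod (h x * k x))\<^sup>2 \<le> B\<^sup>2 * (cmod (h x))\<^sup>2" for x
      unfolding norm_mult power_mult_distrib mult.commute[of "B\<^sup>2"]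
      by (intro mult_left_mono power_mono bound) auto
    then show "AE x in lborel. norm (indicator {0<..} x *\<^sub>R (cmod (h x * k x))\<^sup>2) \<le>
        norm (B\<^sup>2 * (indicator {0<..} x *\<^sub>R (cmod (h x))\<^sup>2))"
      by (auto simp: indicator_def)
  qed
qed

text \<open>The rescaled mollifier is an approximate delta function supported between 1/(n+1) and
  2/(n+1), hence inside the half-line, where g agrees almost everywhere with its continuous
  representative. The substitution y = (n+1)x - 1 makes dominated convergence applicable.\<close>

lemma trace_concentration:
  assumes tr: "trace_at_0 g c" and g: "in_L2 g" and v: "continuous_on UNIV v"
    and \<rho>: "integrable lborel \<rho>" "\<And>x. x \<notin> {0..1} \<Longrightarrow> \<rho> x = 0" "(LBINT x. \<rho> x) = (1::complex)"
  shows "(\<lambda>n. LBINT x:{0<..}. g x * (of_nat (Suc n) * \<rho> (real (Suc n) * x - 1) * v x)) \<longlonglongrightarrow> c * v 0"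
proof -
  obtain G where G: "continuous_on {0..} G" "AE x in lborel. 0 < x \<longrightarrow> G x = g x" "G 0 = c"
    using tr by (auto simp: trace_at_0_def)
  define P where "P x = indicator {0..} x *\<^sub>R (G x * v x)" for x
  have contGv: "continuous_on {0..} (\<lambda>x. G x * v x)"
    by (intro continuous_intros G continuous_on_subset[OF v]) simp
  have P_meas [measurable]: "P \<in> borel_measurable borel"
    unfolding P_def by (rule borel_measurable_continuous_on_indicator[OF _ contGv]) simp
  have [measurable]: "\<rho> \<in> borel_measurable borel" "v \<in> borel_measurable borel"
    using \<rho>(1) v by (auto intro: borel_measurable_continuous_onI)
  have "compact ((\<lambda>x. G x * v x) ` {0..2})"
    by (rule compact_continuous_image[OF continuous_on_subset[OF contGv]]) auto
  then obtain B where B: "\<And>x. x \<in> {0..2} \<Longrightarrow> cmod (G x * v x) \<le> B"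
    by (meson bounded_iff compact_imp_bounded image_eqI)
  have eq: "(LBINT x:{0<..}. g x * (of_nat (Suc n) * \<rho> (real (Suc n) * x - 1) * v x)) =
      (LBINT y. \<rho> y * P ((y + 1) / real (Suc n)))" for n
  proof -
    have "(LBINT x:{0<..}. g x * (of_nat (Suc n) * \<rho> (real (Suc n) * x - 1) * v x)) =
      (LBINT x. of_nat (Suc n) * \<rho> (real (Suc n) * x - 1) * P x)"
      unfolding set_lebesgue_integral_def
    proof (rule integral_cong_AE)
      have "(\<lambda>x. (indicator {0<..} x *\<^sub>R g x) * (of_nat (Suc n) * \<rho> (real (Suc n) * x - 1) * v x)) \<in> borel_measurable lborel"
        using in_L2_measurable[OF g] by (intro borel_measurable_times) auto
      then show "(\<lambda>x. indicator {0<..} x *\<^sub>R (g x * (of_nat (Suc n) * \<rho> (real (Suc n) * x - 1) * v x))) \<in> borel_measurable lborel"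
        by (simp del: of_nat_Suc)
      show "AE x in lborel. indicator {0<..} x *\<^sub>R (g x * (of_nat (Suc n) * \<rho> (real (Suc n) * x - 1) * v x)) =
          of_nat (Suc n) * \<rho> (real (Suc n) * x - 1) * P x"
        using G(2)
      proof eventually_elim
        case (elim x)
        show ?case
        proof (cases "x > 0")
          case False
          then have "real (Suc n) * x \<le> 0" by (simp add: mult_nonneg_nonpos)
          then have "\<rho> (real (Suc n) * x - 1) = 0" by (intro \<rho>(2)) auto
          then show ?thesis by simp
        qed (use elim in \<open>simp add: P_def del: of_nat_Suc\<close>)
      qed
    qed simp
    also have "\<dots> = \<bar>1 / real (Suc n)\<bar> *\<^sub>R (LBINT y. of_nat (Suc n) * \<rho> (real (Suc n) * (1 / real (Suc n) + (1 / real (Suc n)) * y) - 1) *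
        P (1 / real (Suc n) + (1 / real (Suc n)) * y))"
      by (rule lborel_integral_real_affine) simp
    also have "\<dots> = (LBINT y. \<rho> y * P ((y + 1) / real (Suc n)))"
    proof -
      have a: "real (Suc n) * (1 / real (Suc n) + (1 / real (Suc n)) * y) - 1 = y"
        "1 / real (Suc n) + (1 / real (Suc n)) * y = (y + 1) / real (Suc n)" for y
        by (auto simp: field_simps)
      show ?thesis unfolding a by (simp add: scaleR_conv_of_real mult.assoc del: of_nat_Suc)
    qed
    finally show ?thesis .
  qed
  have "(\<lambda>n. LBINT y. \<rho> y * P ((y + 1) / real (Suc n))) \<longlonglongrightarrow> (LBINT y. \<rho> y * (c * v 0))"
  proof (rule integral_dominated_convergence)
    show "integrable lborel (\<lambda>y. cmod (\<rho> y) * B)" using \<rho>(1) by auto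
    show "AE y in lborel. (\<lambda>n. \<rho> y * P ((y + 1) / real (Suc n))) \<longlonglongrightarrow> \<rho> y * (c * v 0)"
    proof (rule AE_I2)
      fix y :: real
      show "(\<lambda>n. \<rho> y * P ((y + 1) / real (Suc n))) \<longlonglongrightarrow> \<rho> y * (c * v 0)"
      proof (cases "y \<in> {0..1}")
        case True
        have "(\<lambda>n. (y + 1) / real (Suc n)) \<longlonglongrightarrow> 0"
          using LIMSEQ_Suc[OF lim_const_over_n[of "y + 1"]] by simp
        then have "(\<lambda>n. G ((y + 1) / real (Suc n)) * v ((y + 1) / real (Suc n))) \<longlonglongrightarrow> G 0 * v 0"
          using True by (intro continuous_on_tendsto_compose[OF contGv]) (auto simp: field_simps)
        then show ?thesis using True G(3) by (intro tendsto_intros) (simp add: P_def del: of_nat_Suc)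
      qed (use \<rho>(2) in auto)
    qed
    show "AE y in lborel. norm (\<rho> y * P ((y + 1) / real (Suc n))) \<le> cmod (\<rho> y) * B" for n
    proof (rule AE_I2)
      fix y :: real
      show "norm (\<rho> y * P ((y + 1) / real (Suc n))) \<le> cmod (\<rho> y) * B"
      proof (cases "y \<in> {0..1}")
        case True
        then have "(y + 1) / real (Suc n) \<in> {0..2}" by (auto simp: field_simps)
        then have "cmod (P ((y + 1) / real (Suc n))) \<le> B" using B by (simp add: P_def del: of_nat_Suc)
        then show ?thesis by (simp add: norm_mult mult_left_mono del: of_nat_Suc)
      qed (use \<rho>(2) in auto)
    qed
  qed (use \<rho>(1) in auto)
  then show ?thesis unfolding eq using \<rho>(3) by simp
qed

text \<open>The weak derivative can be tested only with functions vanishing near 0 and near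
  infinity, so v is multiplied by a cut-off \<open>\<xi> n\<close>. Its derivative is
  \<open>\<mu> n - \<nu> n\<close>: the part \<open>\<mu> n\<close> concentrates at 0 and yields the
  boundary term c v(0), while \<open>\<nu> n\<close> stays bounded and moves off to
  infinity.\<close>

lemma weak_by_parts:
  assumes g: "weak_deriv g g'" and tr: "trace_at_0 g c"
    and v: "smooth v" "in_L2 v" "in_L2 (vderiv v)"
  shows "(LBINT x:{0<..}. g' x * v x) + (LBINT x:{0<..}. g x * vderiv v x) = - (c * v 0)"
proof -
  obtain \<theta> where \<theta>: "smooth \<theta>" "\<And>x. x \<le> 0 \<Longrightarrow> \<theta> x = 0" "\<And>x. x \<ge> 1 \<Longrightarrow> \<theta> x = 1"
    "\<And>x. cmod (\<theta> x) \<le> 1" "\<And>x. cmod (1 - \<theta> x) \<le> 1"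
    and \<rho>: "\<And>x. x \<notin> {0..1} \<Longrightarrow> vderiv \<theta> x = 0" "integrable lborel (vderiv \<theta>)" "(LBINT x. vderiv \<theta> x) = 1"
    by (rule ex_smooth_step) blast
  have L2: "in_L2 g" "in_L2 g'" using g by (auto simp: weak_deriv_def)
  \<comment> \<open>With m \<ge> 2 the rising part of the cut-off lies in x \<le> 1 and the falling
    part in x \<ge> 2, so they do not interact. The offset by two matches
    \<open>trace_concentration\<close> after one shift of its index.\<close>
  define m :: "nat \<Rightarrow> real" where "m n = real (Suc (Suc n))" for n
  have m: "m n \<ge> 2" for n by (simp add: m_def)
  define \<xi> where "\<xi> n x = \<theta> (m n * x - 1) * (1 - \<theta> (x / m n - 1))" for n x
  define \<nu> where "\<nu> n x = of_real (1 / m n) * vderiv \<theta> (x / m n - 1)" for n x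
  define \<mu> where "\<mu> n x = of_real (m n) * vderiv \<theta> (m n * x - 1)" for n x
  have d1: "((\<lambda>x. \<theta> (a * x - 1)) has_vector_derivative of_real a * vderiv \<theta> (a * x - 1)) (at x)" for a x
    using smooth_vderiv_at[OF smooth_affine[OF \<theta>(1), of a "-1"], of x] vderiv_n_affine[OF \<theta>(1), of 1 a "-1"] by simp
  have sm\<theta>: "smooth (\<lambda>x. \<theta> (a * x - 1))" for a using smooth_affine[OF \<theta>(1), of a "-1"] by simp
  have sm\<theta>': "smooth (\<lambda>x. vderiv \<theta> (a * x - 1))" for a using smooth_affine[OF smooth_vderiv[OF \<theta>(1)], of a "-1"] by simp
  have sm\<xi>: "smooth (\<xi> n)" and sm\<nu>: "smooth (\<nu> n)" and sm\<mu>: "smooth (\<mu> n)" for n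
    unfolding \<xi>_def \<nu>_def \<mu>_def using sm\<theta>[of "m n"] sm\<theta>[of "1 / m n"] sm\<theta>'[of "m n"] sm\<theta>'[of "1 / m n"]
    by (intro smooth_mult smooth_diff smooth_const; simp)+
  have small: "\<theta> (x / m n - 1) = 0" if "x \<le> 1" for x n
    using that m[of n] by (intro \<theta>(2)) (auto simp: field_simps)
  have large: "\<theta> (m n * x - 1) = 1" if "x \<ge> 1" for x n
  proof -
    have "2 * 1 \<le> m n * x" using that m[of n] by (intro mult_mono) auto
    then show ?thesis by (intro \<theta>(3)) simp
  qed
  have \<mu>0: "\<mu> n x = 0" if "x > 1" for n x
  proof -
    have "2 * 1 < m n * x" using that m[of n] by (intro mult_le_less_imp_less) auto
    then show ?thesis unfolding \<mu>_def by (simp add: \<rho>(1))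
  qed
  have \<nu>0: "\<nu> n x = 0" if "x < 1" for n x
    using that m[of n] unfolding \<nu>_def by (simp add: \<rho>(1) field_simps)
  have deriv: "vderiv (\<xi> n) x = \<mu> n x - \<nu> n x" for n x
  proof -
    have "(\<xi> n has_vector_derivative \<theta> (m n * x - 1) * (0 - \<nu> n x) + \<mu> n x * (1 - \<theta> (x / m n - 1))) (at x)"
      unfolding \<xi>_def \<mu>_def \<nu>_def using d1[of "m n" x] d1[of "1 / m n" x]
      by (intro has_vector_derivative_mult has_vector_derivative_diff has_vector_derivative_const) auto
    then have "vderiv (\<xi> n) x = \<theta> (m n * x - 1) * (0 - \<nu> n x) + \<mu> n x * (1 - \<theta> (x / m n - 1))"
      by (simp add: vderiv_def vector_derivative_at)
    then show ?thesis
      using small[of x n] large[of x n] \<mu>0[of x n] \<nu>0[of x n] by (cases x "1::real" rule: linorder_cases) auto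
  qed
  have test: "test_fun (\<lambda>x. v x * \<xi> n x)" for n
  proof (rule test_funI[of _ "1 / m n" "2 * m n"])
    show "smooth (\<lambda>x. v x * \<xi> n x)" using v sm\<xi> by blast
    show "0 < 1 / m n" using m[of n] by auto
    fix x assume "x \<notin> {1 / m n..2 * m n}"
    then have "m n * x - 1 \<le> 0 \<or> x / m n - 1 \<ge> 1" using m[of n] by (auto simp: field_simps)
    then show "v x * \<xi> n x = 0" using \<theta>(2,3) by (auto simp: \<xi>_def)
  qed
  have K: "\<exists>K. \<forall>x. cmod (vderiv \<theta> x) \<le> K"
  proof -
    have "compact (vderiv \<theta> ` {0..1})"
      by (intro compact_continuous_image smooth_continuous smooth_vderiv \<theta>) simp
    then obtain B where "\<And>x. x \<in> {0..1} \<Longrightarrow> cmod (vderiv \<theta> x) \<le> B"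
      by (meson bounded_iff compact_imp_bounded image_eqI)
    then have "cmod (vderiv \<theta> x) \<le> max B 0" for x using \<rho>(1)[of x] by (cases "x \<in> {0..1}") fastforce+
    then show ?thesis by blast
  qed
  then obtain K where K: "\<And>x. cmod (vderiv \<theta> x) \<le> K" by blast
  have K0: "K \<ge> 0" using order_trans[OF norm_ge_zero K] .
  have m_lim: "filterlim m at_top sequentially"
    unfolding m_def by (intro filterlim_compose[OF filterlim_real_sequentially] filterlim_compose[OF filterlim_Suc filterlim_Suc])
  have \<xi>_lim: "(\<lambda>n. \<xi> n x) \<longlonglongrightarrow> 1" if "x > 0" for x
  proof (rule tendsto_eventually)
    have "\<forall>\<^sub>F n in sequentially. m n \<ge> max x (2 / x)"
      using m_lim unfolding filterlim_at_top by blast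
    then show "\<forall>\<^sub>F n in sequentially. \<xi> n x = 1"
    proof eventually_elim
      case (elim n)
      then have "m n * x - 1 \<ge> 1" "x / m n - 1 \<le> 0" using that m[of n] by (auto simp: field_simps)
      then show ?case using \<theta>(2,3) by (simp add: \<xi>_def)
    qed
  qed
  have \<nu>_lim: "(\<lambda>n. \<nu> n x) \<longlonglongrightarrow> 0" if "x > 0" for x
  proof (rule tendsto_eventually)
    have "\<forall>\<^sub>F n in sequentially. m n > x" using m_lim by (simp add: filterlim_at_top_dense)
    then show "\<forall>\<^sub>F n in sequentially. \<nu> n x = 0"
    proof eventually_elim
      case (elim n)
      then have "x / m n - 1 < 0" using m[of n] by (auto simp: field_simps)
      then show ?case using \<rho>(1) by (simp add: \<nu>_def)
    qed
  qed
  have \<xi>_bd: "cmod (\<xi> n x) \<le> 1" for n x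
    unfolding \<xi>_def norm_mult using \<theta>(4,5) by (intro mult_le_one) auto
  have \<nu>_bd: "cmod (\<nu> n x) \<le> K" for n x
  proof -
    have "cmod (\<nu> n x) = (1 / m n) * cmod (vderiv \<theta> (x / m n - 1))"
      using m[of n] by (simp add: \<nu>_def norm_mult norm_divide)
    also have "\<dots> \<le> 1 * K" using m[of n] K by (intro mult_mono) auto
    finally show ?thesis by simp
  qed
  have l1: "(\<lambda>n. LBINT x:{0<..}. g' x * v x * \<xi> n x) \<longlonglongrightarrow> (LBINT x:{0<..}. g' x * v x * 1)"
    by (rule in_L2_mult_tendsto[OF L2(2) v(2) smooth_borel[OF sm\<xi>] _ \<xi>_bd \<xi>_lim]) auto
  have l2: "(\<lambda>n. LBINT x:{0<..}. g x * vderiv v x * \<xi> n x) \<longlonglongrightarrow> (LBINT x:{0<..}. g x * vderiv v x * 1)"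
    by (rule in_L2_mult_tendsto[OF L2(1) v(3) smooth_borel[OF sm\<xi>] _ \<xi>_bd \<xi>_lim]) auto
  have l3: "(\<lambda>n. LBINT x:{0<..}. g x * v x * \<nu> n x) \<longlonglongrightarrow> (LBINT x:{0<..}. g x * v x * 0)"
    by (rule in_L2_mult_tendsto[OF L2(1) v(2) smooth_borel[OF sm\<nu>] _ \<nu>_bd \<nu>_lim]) auto
  have l4: "(\<lambda>n. LBINT x:{0<..}. g x * (\<mu> n x * v x)) \<longlonglongrightarrow> c * v 0"
    using LIMSEQ_Suc[OF trace_concentration[OF tr L2(1) smooth_continuous[OF v(1)] \<rho>(2,1,3)]]
    by (simp add: \<mu>_def m_def del: of_nat_Suc)
  have eq: "(LBINT x:{0<..}. g x * (\<mu> n x * v x)) - (LBINT x:{0<..}. g x * v x * \<nu> n x)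
      + (LBINT x:{0<..}. g x * vderiv v x * \<xi> n x) = - (LBINT x:{0<..}. g' x * v x * \<xi> n x)" for n
  proof -
    have i2: "set_integrable lborel {0<..} (\<lambda>x. g x * v x * \<nu> n x)"
      using in_L2_mult_integrable[OF L2(1) in_L2_mult_bounded[OF v(2) smooth_borel[OF sm\<nu>] \<nu>_bd]] by (simp add: mult.assoc)
    have i3: "set_integrable lborel {0<..} (\<lambda>x. g x * vderiv v x * \<xi> n x)"
      using in_L2_mult_integrable[OF L2(1) in_L2_mult_bounded[OF v(3) smooth_borel[OF sm\<xi>] \<xi>_bd]] by (simp add: mult.assoc)
    have \<mu>_bd: "cmod (\<mu> n x) \<le> m n * K" for x
      using m[of n] K by (simp add: \<mu>_def norm_mult mult_left_mono)
    have i1: "set_integrable lborel {0<..} (\<lambda>x. g x * (\<mu> n x * v x))"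
      using in_L2_mult_integrable[OF L2(1) in_L2_mult_bounded[OF v(2) smooth_borel[OF sm\<mu>] \<mu>_bd]] by (simp add: ac_simps)
    have "(LBINT x:{0<..}. g x * vderiv (\<lambda>x. v x * \<xi> n x) x) = - (LBINT x:{0<..}. g' x * (v x * \<xi> n x))"
      using g test[of n] by (simp add: weak_deriv_def)
    moreover have "(LBINT x:{0<..}. g x * vderiv (\<lambda>x. v x * \<xi> n x) x) =
       (LBINT x:{0<..}. (g x * (\<mu> n x * v x) - g x * v x * \<nu> n x) + g x * vderiv v x * \<xi> n x)"
      by (simp add: vderiv_mult[OF v(1) sm\<xi>] deriv algebra_simps)
    ultimately show ?thesis
      unfolding set_integral_add(2)[OF set_integral_diff(1)[OF i1 i2] i3] set_integral_diff(2)[OF i1 i2]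
      by (simp add: mult.assoc)
  qed
  have "c * v 0 - (LBINT x:{0<..}. g x * v x * 0) + (LBINT x:{0<..}. g x * vderiv v x * 1) =
      - (LBINT x:{0<..}. g' x * v x * 1)"
    using tendsto_add[OF tendsto_diff[OF l4 l3] l2] tendsto_minus[OF l1] unfolding eq
    by (rule LIMSEQ_unique)
  then have "c * v 0 + (LBINT x:{0<..}. g x * vderiv v x) = - (LBINT x:{0<..}. g' x * v x)" by simp
  then show ?thesis by algebra
qed

text \<open>Two integrations by parts leave d_j v0 - u0 v_j'(0) on each edge. Continuity at the
  vertex takes u0 and v0 out of the sum over the edges, and the two derivative conditions turn the
  remainder into \<alpha> u0 v0 - u0 \<alpha> v0 = 0.\<close>

lemma star_H_symmetric:
  assumes H: "star_H N \<alpha> u w"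
    and v: "\<And>j. j \<in> {1..N} \<Longrightarrow> smooth (v j) \<and> in_L2 (v j) \<and> in_L2 (vderiv (v j)) \<and> in_L2 (vderiv (vderiv (v j)))"
    and v0: "\<And>j. j \<in> {1..N} \<Longrightarrow> v j 0 = v0" and v1: "(\<Sum>j=1..N. vderiv (v j) 0) = of_real \<alpha> * v0"
  shows "pairing N w v = pairing N u (\<lambda>j x. - vderiv (vderiv (v j)) x)"
proof -
  from H obtain u0 d where tr: "\<forall>j\<in>{1..N}. trace_at_0 (u j) u0"
    and d: "\<forall>j\<in>{1..N}. \<exists>u'. weak_deriv (u j) u' \<and> trace_at_0 u' (d j)"
    and sum_d: "(\<Sum>j=1..N. d j) = of_real \<alpha> * u0"
    and H2: "\<forall>j\<in>{1..N}. \<exists>u'. weak_deriv (u j) u' \<and> weak_deriv u' (\<lambda>x. - w j x)"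
    by (auto simp: star_H_def star_domain_def)
  have "(LBINT x:{0<..}. w j x * v j x) + (LBINT x:{0<..}. u j x * vderiv (vderiv (v j)) x) =
      d j * v0 - u0 * vderiv (v j) 0" if j: "j \<in> {1..N}" for j
  proof -
    obtain u' where u': "weak_deriv (u j) u'" "weak_deriv u' (\<lambda>x. - w j x)" using H2 j by blast
    obtain u'' where "weak_deriv (u j) u''" "trace_at_0 u'' (d j)" using d j by blast
    \<comment> \<open>The trace is known for \<open>u''\<close> and the second weak derivative for
      \<open>u'\<close>; both are weak derivatives of \<open>u j\<close>.\<close>
    then have tr': "trace_at_0 u' (d j)"
      using trace_at_0_cong_AE weak_deriv_unique u'(1) by blast
    have "(LBINT x:{0<..}. - w j x * v j x) + (LBINT x:{0<..}. u' x * vderiv (v j) x) = - (d j * v j 0)"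
      using weak_by_parts[OF u'(2) tr'] v[OF j] by blast
    moreover have "(LBINT x:{0<..}. u' x * vderiv (v j) x) + (LBINT x:{0<..}. u j x * vderiv (vderiv (v j)) x) =
        - (u0 * vderiv (v j) 0)"
      using weak_by_parts[OF u'(1)] tr j v[OF j] by blast
    moreover have "(LBINT x:{0<..}. - w j x * v j x) = - (LBINT x:{0<..}. w j x * v j x)"
      using set_integral_mult_right[of lborel "{0<..}" "-1" "\<lambda>x. w j x * v j x"] by simp
    ultimately show ?thesis unfolding v0[OF j] by algebra
  qed
  then have "pairing N w v + pairing N u (\<lambda>j. vderiv (vderiv (v j))) = (\<Sum>j=1..N. d j * v0 - u0 * vderiv (v j) 0)"
    by (simp add: pairing_def sum.distrib[symmetric])
  also have "\<dots> = (\<Sum>j=1..N. d j) * v0 - u0 * (\<Sum>j=1..N. vderiv (v j) 0)"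
    by (simp add: sum_subtractf sum_distrib_left sum_distrib_right)
  also have "\<dots> = 0" unfolding sum_d v1 by simp
  finally show ?thesis by (simp add: eq_neg_iff_add_eq_0)
qed

section \<open>Schwartz functions\<close>

definition schwartz :: "(real \<Rightarrow> complex) \<Rightarrow> bool" where
  "schwartz h \<longleftrightarrow> smooth h \<and> (\<forall>n m. \<exists>C. \<forall>z. \<bar>z\<bar> ^ m * cmod ((vderiv ^^ n) h z) \<le> C)"

lemma schwartz_smooth: "schwartz h \<Longrightarrow> smooth h"
  by (simp add: schwartz_def)

lemma schwartzE:
  assumes "schwartz h" obtains C where "\<And>z. \<bar>z\<bar> ^ m * cmod ((vderiv ^^ n) h z) \<le> C"
  using assms unfolding schwartz_def by blast

lemma schwartz_vderiv [intro]: "schwartz h \<Longrightarrow> schwartz (vderiv h)"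
  unfolding schwartz_def by (metis funpow_Suc_right o_apply smooth_vderiv)

lemma schwartz_add [intro]:
  assumes g: "schwartz g" and h: "schwartz h" shows "schwartz (\<lambda>z. g z + h z)"
  unfolding schwartz_def
proof (intro conjI allI)
  show "smooth (\<lambda>z. g z + h z)" by (intro smooth_add schwartz_smooth g h)
  fix n m
  obtain A where A: "\<And>z. \<bar>z\<bar> ^ m * cmod ((vderiv ^^ n) g z) \<le> A" by (rule schwartzE[OF g, of "m" "n"]) blast
  obtain B where B: "\<And>z. \<bar>z\<bar> ^ m * cmod ((vderiv ^^ n) h z) \<le> B" by (rule schwartzE[OF h, of "m" "n"]) blast
  have "\<bar>z\<bar> ^ m * cmod ((vderiv ^^ n) g z + (vderiv ^^ n) h z) \<le> A + B" for z
  proof -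
    have "\<bar>z\<bar> ^ m * cmod ((vderiv ^^ n) g z + (vderiv ^^ n) h z) \<le>
        \<bar>z\<bar> ^ m * (cmod ((vderiv ^^ n) g z) + cmod ((vderiv ^^ n) h z))"
      by (intro mult_left_mono norm_triangle_ineq) auto
    then show ?thesis using A[of z] B[of z] unfolding distrib_left by linarith
  qed
  then show "\<exists>C. \<forall>z. \<bar>z\<bar> ^ m * cmod ((vderiv ^^ n) (\<lambda>z. g z + h z) z) \<le> C"
    unfolding vderiv_n_add[OF schwartz_smooth[OF g] schwartz_smooth[OF h]] by blast
qed

lemma schwartz_cmult [intro]:
  assumes h: "schwartz h" shows "schwartz (\<lambda>z. c * h z)"
  unfolding schwartz_def
proof (intro conjI allI)
  show "smooth (\<lambda>z. c * h z)" by (intro smooth_mult smooth_const schwartz_smooth h)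
  fix n m
  obtain B where B: "\<And>z. \<bar>z\<bar> ^ m * cmod ((vderiv ^^ n) h z) \<le> B" by (rule schwartzE[OF h, of "m" "n"]) blast
  have "\<bar>z\<bar> ^ m * cmod (c * (vderiv ^^ n) h z) \<le> cmod c * B" for z
    using mult_left_mono[OF B[of z], of "cmod c"] by (simp add: norm_mult mult_ac)
  then show "\<exists>C. \<forall>z. \<bar>z\<bar> ^ m * cmod ((vderiv ^^ n) (\<lambda>z. c * h z) z) \<le> C"
    unfolding vderiv_n_cmult[OF schwartz_smooth[OF h]] by blast
qed

lemma schwartz_diff [intro]: "schwartz g \<Longrightarrow> schwartz h \<Longrightarrow> schwartz (\<lambda>z. g z - h z)"
  using schwartz_add[OF _ schwartz_cmult[of h "-1"]] by simp

lemma schwartz_reflect: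
  assumes h: "schwartz h" shows "schwartz (\<lambda>z. h (- z))"
  unfolding schwartz_def
proof (intro conjI allI)
  show "smooth (\<lambda>z. h (- z))" by (intro smooth_reflect schwartz_smooth h)
  fix n m
  obtain B where B: "\<And>z. \<bar>z\<bar> ^ m * cmod ((vderiv ^^ n) h z) \<le> B" by (rule schwartzE[OF h, of "m" "n"]) blast
  have "\<bar>z\<bar> ^ m * cmod ((-1) ^ n * (vderiv ^^ n) h (- z)) \<le> B" for z
    using B[of "- z"] by (simp add: norm_mult norm_power)
  then show "\<exists>C. \<forall>z. \<bar>z\<bar> ^ m * cmod ((vderiv ^^ n) (\<lambda>z. h (- z)) z) \<le> C"
    unfolding vderiv_n_reflect[OF schwartz_smooth[OF h]] by blast
qed

lemma schwartz_zero [simp, intro]: "schwartz (\<lambda>_. 0)"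
  using vderiv_sequence[of "\<lambda>_ _. 0"] by (auto simp: schwartz_def)

lemma schwartz_sum [intro]: "(\<And>i. i \<in> I \<Longrightarrow> schwartz (h i)) \<Longrightarrow> schwartz (\<lambda>z. \<Sum>i\<in>I. h i z)"
  by (induction I rule: infinite_finite_induct) auto

lemma test_fun_schwartz:
  assumes "test_fun f" shows "schwartz f"
  unfolding schwartz_def
proof (intro conjI allI)
  show sm: "smooth f" using assms test_fun_smooth by blast
  obtain a b where ab: "0 < a" "a \<le> b" "\<And>x. x \<notin> {a..b} \<Longrightarrow> f x = 0" using test_fun_supportE[OF assms] by blast
  fix n m
  have "continuous_on {a..b} (\<lambda>z. \<bar>z\<bar> ^ m * cmod ((vderiv ^^ n) f z))"
    by (intro continuous_intros smooth_continuous smooth_vderiv_n sm)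
  then have "compact ((\<lambda>z. \<bar>z\<bar> ^ m * cmod ((vderiv ^^ n) f z)) ` {a..b})"
    by (intro compact_continuous_image) auto
  then obtain B where B: "\<And>z. z \<in> {a..b} \<Longrightarrow> norm (\<bar>z\<bar> ^ m * cmod ((vderiv ^^ n) f z)) \<le> B"
    by (meson bounded_iff compact_imp_bounded image_eqI)
  have "\<bar>z\<bar> ^ m * cmod ((vderiv ^^ n) f z) \<le> max B 0" for z
    using B[of z] vderiv_n_zero_outside[of a b f z n, OF ab(3)] by (cases "z \<in> {a..b}") fastforce+
  then show "\<exists>C. \<forall>z. \<bar>z\<bar> ^ m * cmod ((vderiv ^^ n) f z) \<le> C" by blast
qed

lemma schwartz_times_id [intro]:
  assumes h: "schwartz h" shows "schwartz (\<lambda>z. of_real z * h z)"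
proof -
  have sm: "smooth h" using h by (rule schwartz_smooth)
  define H where "H n z = of_real z * (vderiv ^^ n) h z + of_nat n * (vderiv ^^ (n - 1)) h z" for n z
  have id: "(complex_of_real has_vector_derivative 1) (at x)" for x
    using has_vector_derivative_of_real[of "\<lambda>x. x" 1] by (simp add: has_real_derivative_iff_has_vector_derivative)
  have H: "(H n has_vector_derivative H (Suc n) x) (at x)" for n x
  proof -
    have "(H n has_vector_derivative (of_real x * (vderiv ^^ Suc n) h x + 1 * (vderiv ^^ n) h x)
       + of_nat n * (vderiv ^^ Suc (n - 1)) h x) (at x)"
      unfolding H_def
      by (intro has_vector_derivative_add has_vector_derivative_mult has_vector_derivative_mult_right
          smooth_has_vderiv sm id)
    moreover have "(of_real x * (vderiv ^^ Suc n) h x + 1 * (vderiv ^^ n) h x)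
       + of_nat n * (vderiv ^^ Suc (n - 1)) h x = H (Suc n) x"
      unfolding H_def by (cases n) (simp_all add: algebra_simps)
    ultimately show ?thesis by (simp only:)
  qed
  have H0: "H 0 = (\<lambda>z. of_real z * h z)" by (simp add: H_def fun_eq_iff)
  show ?thesis unfolding schwartz_def
  proof (intro conjI allI)
    show "smooth (\<lambda>z. of_real z * h z)" using smooth_sequenceI[of H, OF H] by (simp add: H0)
    fix n m
    obtain A where A: "\<And>z. \<bar>z\<bar> ^ Suc m * cmod ((vderiv ^^ n) h z) \<le> A" by (rule schwartzE[OF h, of "Suc m" "n"]) blast
    obtain B where B: "\<And>z. \<bar>z\<bar> ^ m * cmod ((vderiv ^^ (n - 1)) h z) \<le> B" by (rule schwartzE[OF h, of "m" "n - 1"]) blast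
    have "\<bar>z\<bar> ^ m * cmod (H n z) \<le> A + n * B" for z
    proof -
      have "\<bar>z\<bar> ^ m * cmod (H n z) \<le> \<bar>z\<bar> ^ m * (\<bar>z\<bar> * cmod ((vderiv ^^ n) h z) + n * cmod ((vderiv ^^ (n - 1)) h z))"
        unfolding H_def by (intro mult_left_mono order_trans[OF norm_triangle_ineq]) (auto simp: norm_mult)
      also have "\<dots> = \<bar>z\<bar> ^ Suc m * cmod ((vderiv ^^ n) h z) + n * (\<bar>z\<bar> ^ m * cmod ((vderiv ^^ (n - 1)) h z))"
        by (simp add: algebra_simps)
      also have "\<dots> \<le> A + n * B" by (intro add_mono A mult_left_mono B) auto
      finally show ?thesis .
    qed
    then show "\<exists>C. \<forall>z. \<bar>z\<bar> ^ m * cmod ((vderiv ^^ n) (\<lambda>z. of_real z * h z) z) \<le> C"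
      unfolding vderiv_sequence[of H, OF H, unfolded H0] by blast
  qed
qed

text \<open>Two powers of 1 + z^2: one compensates a kernel of quadratic growth in a convolution,
  the other leaves an integrable function.\<close>

lemma schwartz_bound:
  assumes h: "schwartz h" obtains C where "C \<ge> 0" "\<And>z. cmod (h z) \<le> C / (1 + z\<^sup>2)\<^sup>2"
proof -
  obtain A where A: "\<And>z. \<bar>z\<bar> ^ 0 * cmod ((vderiv ^^ 0) h z) \<le> A" by (rule schwartzE[OF h, of "0" "0"]) blast
  obtain B where B: "\<And>z. \<bar>z\<bar> ^ 2 * cmod ((vderiv ^^ 0) h z) \<le> B" by (rule schwartzE[OF h, of "2" "0"]) blast
  obtain C where C: "\<And>z. \<bar>z\<bar> ^ 4 * cmod ((vderiv ^^ 0) h z) \<le> C" by (rule schwartzE[OF h, of "4" "0"]) blast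
  have main: "(1 + z\<^sup>2)\<^sup>2 * cmod (h z) \<le> A + 2 * B + C" for z
  proof -
    have "(1 + z\<^sup>2)\<^sup>2 * cmod (h z) = cmod (h z) + 2 * (\<bar>z\<bar> ^ 2 * cmod (h z)) + \<bar>z\<bar> ^ 4 * cmod (h z)"
      by (simp add: power2_sum algebra_simps power_even_abs_numeral)
    then show ?thesis using A[of z] B[of z] C[of z] by simp
  qed
  have "A + 2 * B + C \<ge> 0" using order_trans[OF _ main[of 0]] by simp
  then show ?thesis
  proof (intro that[of "A + 2 * B + C"])
    fix z :: real
    have "0 < (1 + z\<^sup>2)\<^sup>2" by (intro zero_less_power add_pos_nonneg) auto
    then show "cmod (h z) \<le> (A + 2 * B + C) / (1 + z\<^sup>2)\<^sup>2"
      using main[of z] by (simp add: pos_le_divide_eq mult.commute)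
  qed
qed

lemma schwartz_bound_Lorentz:
  assumes h: "schwartz h" obtains C where "C \<ge> 0" "\<And>z. cmod (h z) \<le> C / (1 + z\<^sup>2)"
proof -
  obtain C where C: "C \<ge> 0" "\<And>z. cmod (h z) \<le> C / (1 + z\<^sup>2)\<^sup>2" by (rule schwartz_bound[OF h]) blast
  have "C / (1 + z\<^sup>2)\<^sup>2 \<le> C / (1 + z\<^sup>2)" for z :: real
    using C(1) by (intro divide_left_mono self_le_power) (auto intro!: mult_pos_pos zero_less_power add_pos_nonneg)
  then show ?thesis using that[of C] C order_trans by blast
qed

lemma schwartz_bounded:
  assumes h: "schwartz h" obtains C where "\<And>z. cmod (h z) \<le> C"
  using schwartzE[OF h, of 0 0] by auto

lemma schwartz_borel: "schwartz h \<Longrightarrow> h \<in> borel_measurable borel"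
  using schwartz_smooth smooth_borel by blast

lemma schwartz_integrable: assumes h: "schwartz h" shows "integrable lborel h"
proof -
  obtain C where C: "C \<ge> 0" "\<And>z. cmod (h z) \<le> C / (1 + z\<^sup>2)" by (rule schwartz_bound_Lorentz[OF h]) blast
  show ?thesis
  proof (rule Bochner_Integration.integrable_bound)
    show "integrable lborel (\<lambda>z. C * (1 / (1 + z\<^sup>2)))"
      by (intro integrable_mult_right integrable_Lorentz)
    show "AE x in lborel. cmod (h x) \<le> norm (C * (1 / (1 + x\<^sup>2)))"
      using C by simp
  qed (use schwartz_borel[OF h] in simp)
qed

lemma schwartz_tendsto_0:
  assumes h: "schwartz h" shows "(h \<longlongrightarrow> 0) at_top" "(h \<longlongrightarrow> 0) at_bot"
proof -
  obtain C where C: "\<And>z. cmod (h z) \<le> C / (1 + z\<^sup>2)" by (rule schwartz_bound_Lorentz[OF h]) blast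
  have lim: "((\<lambda>z::real. C / (1 + z\<^sup>2)) \<longlongrightarrow> 0) at_top" by real_asymp
  show "(h \<longlongrightarrow> 0) at_top"
    by (rule Lim_null_comparison[OF _ lim]) (use C in auto)
  have lim: "((\<lambda>z::real. C / (1 + z\<^sup>2)) \<longlongrightarrow> 0) at_bot" by real_asymp
  show "(h \<longlongrightarrow> 0) at_bot"
    by (rule Lim_null_comparison[OF _ lim]) (use C in auto)
qed

subsection \<open>The exponential tail operator\<close>

text \<open>The convolution of f with exp(-\<kappa> y) on y \<ge> 0, that is, the solution of E' = f
  - \<kappa> E that vanishes to the left of the support of f.\<close>

definition exp_tail :: "real \<Rightarrow> (real \<Rightarrow> complex) \<Rightarrow> real \<Rightarrow> complex" where
  "exp_tail \<kappa> f y = of_real (exp (- \<kappa> * y)) * (LBINT r:{..y}. of_real (exp (\<kappa> * r)) * f r)"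

lemma test_fun_nonpos: "test_fun f \<Longrightarrow> x \<le> 0 \<Longrightarrow> f x = 0"
  using test_fun_supportE by (metis atLeastAtMost_iff less_le_trans not_less)

context
  fixes \<kappa> :: real and f :: "real \<Rightarrow> complex"
  assumes \<kappa>: "\<kappa> > 0" and f: "test_fun f"
begin

lemma exp_weighted_test_fun: "continuous_on UNIV (\<lambda>r. of_real (exp (\<kappa> * r)) * f r)"
    "integrable lborel (\<lambda>r. of_real (exp (\<kappa> * r)) * f r)"
proof -
  show c: "continuous_on UNIV (\<lambda>r. of_real (exp (\<kappa> * r)) * f r)"
    using smooth_continuous[OF test_fun_smooth[OF f], of UNIV] by (intro continuous_intros)
  obtain a b where ab: "0 < a" "a \<le> b" "\<And>x. x \<notin> {a..b} \<Longrightarrow> f x = 0" using test_fun_supportE[OF f] by blast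
  have "set_integrable lborel {a..b} (\<lambda>r. of_real (exp (\<kappa> * r)) * f r)"
    by (rule borel_integrable_atLeastAtMost'[OF continuous_on_subset[OF c]]) simp
  then show "integrable lborel (\<lambda>r. of_real (exp (\<kappa> * r)) * f r)"
    unfolding set_integrable_def
    by (rule Bochner_Integration.integrable_cong[OF refl, THEN iffD1, rotated])
       (use ab in \<open>force simp: indicator_def\<close>)
qed

lemma exp_tail_nonpos: assumes "y \<le> 0" shows "exp_tail \<kappa> f y = 0"
proof -
  have "indicator {..y} r *\<^sub>R (of_real (exp (\<kappa> * r)) * f r) = 0" for r
    using test_fun_nonpos[OF f, of r] assms by (auto simp: indicator_def)
  then show ?thesis unfolding exp_tail_def set_lebesgue_integral_def by (simp only:) simp
qed

lemma exp_tail_deriv: "(exp_tail \<kappa> f has_vector_derivative f y - of_real \<kappa> * exp_tail \<kappa> f y) (at y)"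
proof -
  define g where "g r = of_real (exp (\<kappa> * r)) * f r" for r
  define G where "G y = (LBINT r:{..y}. g r)" for y
  have c: "continuous_on UNIV g" and i: "integrable lborel g"
    using exp_weighted_test_fun unfolding g_def by auto
  have int: "set_integrable lborel S g" if "S \<in> sets lborel" for S
    unfolding set_integrable_def using i that by (intro integrable_mult_indicator)
  have G: "(G has_vector_derivative g y) (at y)"
  proof -
    have split: "G x = G (y - 1) + integral {y - 1..x} g" if "x \<in> {y - 1..y + 1}" for x
    proof -
      have "G x = (LBINT s:{..y - 1} \<union> {y - 1<..x}. g s)"
        unfolding G_def using that by (intro arg_cong[where f = "\<lambda>A. set_lebesgue_integral lborel A g"]) auto
      also have "\<dots> = G (y - 1) + (LBINT s:{y - 1<..x}. g s)"
        unfolding G_def by (rule set_integral_Un) (auto intro: int)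
      also have "(LBINT s:{y - 1<..x}. g s) = integral {y - 1<..x} g"
        by (rule set_borel_integral_eq_integral(2)[OF int]) simp
      also have "\<dots> = integral {y - 1..x} g"
        by (rule integral_spike_set) (auto intro: negligible_subset[of "{y - 1}"])
      finally show ?thesis .
    qed
    have "((\<lambda>x. integral {y - 1..x} g) has_vector_derivative g y) (at y within {y - 1..y + 1})"
      by (rule integral_has_vector_derivative) (auto intro: continuous_on_subset[OF c])
    then have "((\<lambda>x. integral {y - 1..x} g) has_vector_derivative g y) (at y)"
      by (simp add: at_within_Icc_at)
    then have "((\<lambda>x. G (y - 1) + integral {y - 1..x} g) has_vector_derivative g y) (at y)"
      by (auto intro!: derivative_eq_intros)
    then show ?thesis
      by (rule has_vector_derivative_transform_within_open[of _ _ _ "{y - 1<..<y + 1}"])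
         (auto intro!: split[symmetric])
  qed
  have e: "((\<lambda>y. complex_of_real (exp (- \<kappa> * y))) has_vector_derivative of_real (- \<kappa> * exp (- \<kappa> * y))) (at y)"
    by (rule has_vector_derivative_of_real)
       (auto intro!: derivative_eq_intros simp: has_real_derivative_iff_has_vector_derivative[symmetric])
  have eq: "exp_tail \<kappa> f = (\<lambda>y. complex_of_real (exp (- \<kappa> * y)) * G y)"
    by (simp add: exp_tail_def G_def g_def fun_eq_iff)
  have "(exp_tail \<kappa> f has_vector_derivative complex_of_real (exp (- \<kappa> * y)) * g y
      + of_real (- \<kappa> * exp (- \<kappa> * y)) * G y) (at y)"
    unfolding eq by (rule has_vector_derivative_mult[OF e G])
  moreover have "complex_of_real (exp (- \<kappa> * y)) * g y = f y"
    unfolding g_def by (simp add: mult.assoc[symmetric] of_real_mult[symmetric] exp_add[symmetric] del: of_real_mult)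
  ultimately show ?thesis by (simp add: eq mult.assoc)
qed

lemma exp_tail_schwartz: "schwartz (exp_tail \<kappa> f)"
proof -
  let ?E = "exp_tail \<kappa> f"
  have sm: "smooth ?E"
    unfolding smooth_iff_times_diff
  proof
    fix n show "times_diff n ?E"
    proof (induction n)
      case (Suc n)
      have const: "times_diff n (\<lambda>_. - of_real \<kappa>)" using smooth_const smooth_iff_times_diff by blast
      have "times_diff n f" using test_fun_smooth[OF f] smooth_iff_times_diff by blast
      from times_diff_add[OF this times_diff_mult[OF const Suc]]
      have "times_diff n (\<lambda>y. f y - of_real \<kappa> * ?E y)" by simp
      with exp_tail_deriv show ?case by (auto intro!: exI[of _ "\<lambda>y. f y - of_real \<kappa> * ?E y"])
    qed simp
  qed
  have vd: "vderiv ?E = (\<lambda>y. f y - of_real \<kappa> * ?E y)" using exp_tail_deriv by (rule vderiv_eq)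
  \<comment> \<open>By E' = f - \<kappa> E the sums of Schwartz functions and multiples of E are
    stable under differentiation, so only the decay of E itself has to be estimated.\<close>
  have form: "\<exists>g c. schwartz g \<and> (vderiv ^^ n) ?E = (\<lambda>y. g y + c * ?E y)" for n
  proof (induction n)
    case 0
    show ?case by (intro exI[of _ "\<lambda>_. 0"] exI[of _ 1]) auto
  next
    case (Suc n)
    then obtain g c where g: "schwartz g" "(vderiv ^^ n) ?E = (\<lambda>y. g y + c * ?E y)" by blast
    have sg: "smooth g" using g schwartz_smooth by blast
    have "(vderiv ^^ Suc n) ?E = (\<lambda>y. vderiv g y + c * (f y - of_real \<kappa> * ?E y))"
      using vderiv_add[OF sg smooth_mult[OF smooth_const sm]] vderiv_cmult[OF sm] by (simp add: g vd)
    also have "\<dots> = (\<lambda>y. (vderiv g y + c * f y) + (- c * of_real \<kappa>) * ?E y)"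
      by (simp add: algebra_simps)
    finally show ?case using g test_fun_schwartz[OF f]
      by (intro exI[of _ "\<lambda>y. vderiv g y + c * f y"] exI[of _ "- c * of_real \<kappa>"]) auto
  qed
  define M where "M = (LBINT r. cmod (of_real (exp (\<kappa> * r)) * f r))"
  have M: "cmod (?E y) \<le> exp (- \<kappa> * y) * M" for y
  proof -
    have i: "integrable lborel (\<lambda>r. cmod (of_real (exp (\<kappa> * r)) * f r))"
      using exp_weighted_test_fun(2) by (rule integrable_norm)
    have i2: "set_integrable lborel {..y} (\<lambda>r. of_real (exp (\<kappa> * r)) * f r)"
      unfolding set_integrable_def using exp_weighted_test_fun(2) by (intro integrable_mult_indicator) auto
    have "cmod (LBINT r:{..y}. of_real (exp (\<kappa> * r)) * f r) \<le> (LBINT r:{..y}. cmod (of_real (exp (\<kappa> * r)) * f r))"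
      using set_integral_norm_bound[OF i2] .
    also have "\<dots> \<le> M" unfolding M_def set_lebesgue_integral_def
      using i by (intro integral_mono integrable_mult_indicator) (auto simp: indicator_def)
    finally show ?thesis unfolding exp_tail_def norm_mult by (simp add: mult_left_mono)
  qed
  have M0: "M \<ge> 0" unfolding M_def by (rule Bochner_Integration.integral_nonneg) simp
  have decay: "\<bar>y\<bar> ^ m * cmod (?E y) \<le> (real (Suc m) / \<kappa>) ^ m * M" for m y
  proof (cases "y \<le> 0")
    case True
    then show ?thesis using exp_tail_nonpos M0 \<kappa> by simp
  next
    case False
    \<comment> \<open>The bound (1 + u/n)^n \<le> exp u with u = \<kappa> y is used for n = m + 1
      rather than n = m, as m may be 0.\<close>
    have "(\<kappa> * y / real (Suc m)) ^ m \<le> (1 + \<kappa> * y / real (Suc m)) ^ m"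
      using False \<kappa> by (intro power_mono) auto
    also have "\<dots> \<le> (1 + \<kappa> * y / real (Suc m)) ^ Suc m"
      using False \<kappa> by (intro power_increasing) auto
    also have "\<dots> \<le> exp (\<kappa> * y)"
    proof (rule exp_ge_one_plus_x_over_n_power_n)
      have "0 \<le> \<kappa> * y" using False \<kappa> by simp
      then show "- real (Suc m) \<le> \<kappa> * y" by linarith
    qed simp
    finally have "y ^ m \<le> (real (Suc m) / \<kappa>) ^ m * exp (\<kappa> * y)"
      using \<kappa> by (simp add: power_divide power_mult_distrib field_simps del: of_nat_Suc)
    then have "y ^ m * exp (- \<kappa> * y) \<le> (real (Suc m) / \<kappa>) ^ m"
      by (simp add: exp_minus field_simps del: of_nat_Suc)
    then have "y ^ m * exp (- \<kappa> * y) * M \<le> (real (Suc m) / \<kappa>) ^ m * M" using M0 by (rule mult_right_mono)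
    moreover have "\<bar>y\<bar> ^ m * cmod (?E y) \<le> y ^ m * (exp (- \<kappa> * y) * M)"
      using False by (intro mult_mono M) auto
    ultimately show ?thesis by (simp add: mult.assoc del: of_nat_Suc)
  qed
  show ?thesis unfolding schwartz_def
  proof (intro conjI allI sm)
    fix n m
    obtain g c where g: "schwartz g" "(vderiv ^^ n) ?E = (\<lambda>y. g y + c * ?E y)" using form by blast
    obtain A where A: "\<And>z. \<bar>z\<bar> ^ m * cmod ((vderiv ^^ 0) g z) \<le> A" by (rule schwartzE[OF g(1), of "m" "0"]) blast
    have "\<bar>z\<bar> ^ m * cmod ((vderiv ^^ n) ?E z) \<le> A + cmod c * ((real (Suc m) / \<kappa>) ^ m * M)" for z
    proof -
      have "\<bar>z\<bar> ^ m * cmod (g z + c * ?E z) \<le> \<bar>z\<bar> ^ m * (cmod (g z) + cmod c * cmod (?E z))"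
        by (intro mult_left_mono order_trans[OF norm_triangle_ineq]) (auto simp: norm_mult)
      also have "\<dots> = \<bar>z\<bar> ^ m * cmod (g z) + cmod c * (\<bar>z\<bar> ^ m * cmod (?E z))" by (simp add: algebra_simps)
      also have "\<dots> \<le> A + cmod c * ((real (Suc m) / \<kappa>) ^ m * M)"
        using A[of z] by (intro add_mono mult_left_mono decay) auto
      finally show ?thesis by (simp add: g)
    qed
    then show "\<exists>C. \<forall>z. \<bar>z\<bar> ^ m * cmod ((vderiv ^^ n) ?E z) \<le> C" by blast
  qed
qed

end

section \<open>Pointwise criteria for the notions on \<open>L\<^sup>2\<close>\<close>

text \<open>The pointwise limit inherits the bound C/(1+x), so the squared difference is dominated
  by (2C/(1+x))^2.\<close>

lemma L2_tendsto_dominated: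
  assumes F: "sequential F" "F \<noteq> bot"
    and v: "\<And>j. j \<in> {1..N} \<Longrightarrow> v j \<in> borel_measurable borel"
    and w: "\<forall>\<^sub>F t in F. \<forall>j\<in>{1..N}. w t j \<in> borel_measurable borel \<and> (\<forall>x>0. cmod (w t j x) \<le> C / (1 + x))"
    and lim: "\<And>j x. j \<in> {1..N} \<Longrightarrow> x > 0 \<Longrightarrow> ((\<lambda>t. w t j x) \<longlongrightarrow> v j x) F"
  shows "L2_tendsto N w v F"
  unfolding L2_tendsto_def
proof (intro conjI)
  have v_bd: "cmod (v j x) \<le> C / (1 + x)" if "j \<in> {1..N}" "x > 0" for j x
  proof (rule tendsto_upperbound[OF tendsto_norm[OF lim[OF that]] _ F(2)])
    show "\<forall>\<^sub>F t in F. norm (w t j x) \<le> C / (1 + x)" using w by eventually_elim (use that in auto)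
  qed
  show "in_L2N N v" unfolding in_L2N_def using v v_bd by (auto intro!: in_L2_weightI[of _ C])
  show "\<forall>\<^sub>F t in F. in_L2N N (w t)"
    using w by eventually_elim (auto simp: in_L2N_def intro!: in_L2_weightI[of _ C])
  have "((\<lambda>t. LBINT x. indicator {0<..} x *\<^sub>R (cmod (w t j x - v j x))\<^sup>2) \<longlongrightarrow> (LBINT x::real. 0)) F" if j: "j \<in> {1..N}" for j
  proof (rule integral_dominated_convergence_filter[OF F(1), where f = "\<lambda>_. 0"])
    show "integrable lborel (\<lambda>x. indicator {0<..} x *\<^sub>R ((2 * C) / (1 + x))\<^sup>2)"
      by (rule half_line_weight_integrable)
    show "\<forall>\<^sub>F t in F. (\<lambda>x. indicator {0<..} x *\<^sub>R (cmod (w t j x - v j x))\<^sup>2) \<in> borel_measurable lborel"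
      using w
    proof eventually_elim
      case (elim t)
      then have [measurable]: "w t j \<in> borel_measurable borel" "v j \<in> borel_measurable borel" using j v by auto
      show ?case by measurable
    qed
    show "AE x in lborel. ((\<lambda>t. indicator {0<..} x *\<^sub>R (cmod (w t j x - v j x))\<^sup>2) \<longlongrightarrow> 0) F"
    proof (rule AE_I2)
      fix x :: real
      show "((\<lambda>t. indicator {0<..} x *\<^sub>R (cmod (w t j x - v j x))\<^sup>2) \<longlongrightarrow> 0) F"
      proof (cases "x > 0")
        case True
        from tendsto_power[OF tendsto_norm[OF LIM_zero[OF lim[OF j True]]], of 2] True show ?thesis by simp
      qed simp
    qed
    show "\<forall>\<^sub>F t in F. AE x in lborel. norm (indicator {0<..} x *\<^sub>R (cmod (w t j x - v j x))\<^sup>2)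
        \<le> indicator {0<..} x *\<^sub>R ((2 * C) / (1 + x))\<^sup>2"
      using w
    proof eventually_elim
      case (elim t)
      have "(cmod (w t j x - v j x))\<^sup>2 \<le> ((2 * C) / (1 + x))\<^sup>2" if "x > 0" for x
      proof (rule power_mono)
        have "cmod (w t j x - v j x) \<le> C / (1 + x) + C / (1 + x)"
          using elim j that v_bd[OF j that] by (intro order_trans[OF norm_triangle_ineq4] add_mono) auto
        then show "cmod (w t j x - v j x) \<le> (2 * C) / (1 + x)" by simp
      qed simp
      then show ?case by (auto simp: indicator_def)
    qed
  qed simp
  then have "((\<lambda>t. \<Sum>j=1..N. LBINT x:{0<..}. (cmod (w t j x - v j x))\<^sup>2) \<longlongrightarrow> (\<Sum>j=1..N. 0)) F"
    unfolding set_lebesgue_integral_def by (intro tendsto_sum) simp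
  from tendsto_real_sqrt[OF this]
  show "((\<lambda>t. L2_norm N (\<lambda>j x. w t j x - v j x)) \<longlongrightarrow> 0) F" by (simp add: L2_norm_def)
qed

text \<open>Uniformity near t is the point: by the mean value inequality such a bound on the time
  derivative dominates the difference quotients at t.\<close>

definition locally_weighted :: "(real \<Rightarrow> real \<Rightarrow> complex) \<Rightarrow> bool" where
  "locally_weighted w \<longleftrightarrow>
     (\<forall>t>0. \<exists>\<delta>>0. \<exists>C. \<forall>s x. \<bar>s - t\<bar> < \<delta> \<longrightarrow> x > 0 \<longrightarrow> cmod (w s x) \<le> C / (1 + x))"

lemma locally_weighted_cmult: "locally_weighted w \<Longrightarrow> locally_weighted (\<lambda>t x. c * w t x)"
  unfolding locally_weighted_def
proof (intro allI impI)
  fix t :: real assume w: "\<forall>t>0. \<exists>\<delta>>0. \<exists>C. \<forall>s x. \<bar>s - t\<bar> < \<delta> \<longrightarrow> x > 0 \<longrightarrow> cmod (w s x) \<le> C / (1 + x)" and "t > 0"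
  then obtain \<delta> C where "\<delta> > 0" and C: "\<And>s x. \<bar>s - t\<bar> < \<delta> \<Longrightarrow> x > 0 \<Longrightarrow> cmod (w s x) \<le> C / (1 + x)" by blast
  have "cmod (c * w s x) \<le> (cmod c * C) / (1 + x)" if "\<bar>s - t\<bar> < \<delta>" "x > 0" for s x
    using mult_left_mono[OF C[OF that], of "cmod c"] by (simp add: norm_mult)
  with \<open>\<delta> > 0\<close> show "\<exists>\<delta>>0. \<exists>C. \<forall>s x. \<bar>s - t\<bar> < \<delta> \<longrightarrow> x > 0 \<longrightarrow> cmod (c * w s x) \<le> C / (1 + x)" by blast
qed

lemma locally_weighted_in_L2:
  "locally_weighted w \<Longrightarrow> t > 0 \<Longrightarrow> w t \<in> borel_measurable borel \<Longrightarrow> in_L2 (w t)"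
  unfolding locally_weighted_def by (metis abs_zero diff_self in_L2_weightI)

lemma locally_weighted_uniform:
  assumes "\<And>j. j \<in> {1..N::nat} \<Longrightarrow> locally_weighted (w j)" "t > 0"
  shows "\<exists>\<delta>>0. \<exists>C. \<forall>j\<in>{1..N}. \<forall>s x. \<bar>s - t\<bar> < \<delta> \<longrightarrow> x > 0 \<longrightarrow> cmod (w j s x) \<le> C / (1 + x)"
proof -
  have "\<exists>\<delta>>0. \<exists>C. \<forall>j\<in>{1..n}. \<forall>s x. \<bar>s - t\<bar> < \<delta> \<longrightarrow> x > 0 \<longrightarrow> cmod (w j s x) \<le> C / (1 + x)" if "n \<le> N" for n
    using that
  proof (induction n)
    case 0
    show ?case by (auto intro: exI[of _ 1])
  next
    case (Suc n)
    then obtain d1 C1 where 1: "d1 > 0" "\<forall>j\<in>{1..n}. \<forall>s x. \<bar>s - t\<bar> < d1 \<longrightarrow> x > 0 \<longrightarrow> cmod (w j s x) \<le> C1 / (1 + x)"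
      by auto
    obtain d2 C2 where 2: "d2 > 0" "\<forall>s x. \<bar>s - t\<bar> < d2 \<longrightarrow> x > 0 \<longrightarrow> cmod (w (Suc n) s x) \<le> C2 / (1 + x)"
      using assms(1)[of "Suc n"] Suc.prems assms(2) by (auto simp: locally_weighted_def)
    have "cmod (w j s x) \<le> max C1 C2 / (1 + x)"
      if "j \<in> {1..Suc n}" "\<bar>s - t\<bar> < min d1 d2" "x > 0" for j s x
    proof -
      have "cmod (w j s x) \<le> C1 / (1 + x) \<or> cmod (w j s x) \<le> C2 / (1 + x)"
        using that 1(2) 2(2) by (cases "j = Suc n") auto
      moreover have "C1 / (1 + x) \<le> max C1 C2 / (1 + x)" "C2 / (1 + x) \<le> max C1 C2 / (1 + x)"
        using that(3) by (auto intro!: divide_right_mono)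
      ultimately show ?thesis by linarith
    qed
    then show ?case using 1(1) 2(1) by (intro exI[of _ "min d1 d2"] conjI exI[of _ "max C1 C2"]) auto
  qed
  then show ?thesis by blast
qed

lemma vector_derivative_bound:
  fixes f :: "real \<Rightarrow> 'a::real_normed_vector"
  assumes d: "\<And>r. r \<in> closed_segment t s \<Longrightarrow> (f has_vector_derivative f' r) (at r)"
    and B: "\<And>r. r \<in> closed_segment t s \<Longrightarrow> norm (f' r) \<le> B"
  shows "norm (f s - f t) \<le> \<bar>s - t\<bar> * B"
proof -
  have "norm (f s - f t) \<le> B * norm (s - t)"
  proof (rule differentiable_bound[OF convex_closed_segment])
    fix r assume r: "r \<in> closed_segment t s"
    show "(f has_derivative (\<lambda>h. h *\<^sub>R f' r)) (at r within closed_segment t s)"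
      using d[OF r] unfolding has_vector_derivative_def by (rule has_derivative_at_withinI)
    show "onorm (\<lambda>h. h *\<^sub>R f' r) \<le> B"
      by (rule onorm_le) (use B[OF r] in \<open>simp add: mult.commute[of B] mult_left_mono\<close>)
  qed auto
  then show ?thesis by (simp add: mult.commute)
qed

lemma L2_has_derivI:
  assumes t: "t > 0"
    and d: "\<And>j s x. j \<in> {1..N} \<Longrightarrow> s > 0 \<Longrightarrow> x > 0 \<Longrightarrow> ((\<lambda>s. u s j x) has_vector_derivative u' s j x) (at s)"
    and m: "\<And>j s. j \<in> {1..N} \<Longrightarrow> s > 0 \<Longrightarrow> u s j \<in> borel_measurable borel"
    and m': "\<And>j s. j \<in> {1..N} \<Longrightarrow> s > 0 \<Longrightarrow> u' s j \<in> borel_measurable borel"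
    and b: "\<And>j. j \<in> {1..N} \<Longrightarrow> locally_weighted (\<lambda>s x. u s j x)"
    and b': "\<And>j. j \<in> {1..N} \<Longrightarrow> locally_weighted (\<lambda>s x. u' s j x)"
  shows "L2_has_deriv N u (u' t) t"
  unfolding L2_has_deriv_def
proof
  show "in_L2N N (u t)" unfolding in_L2N_def
    using locally_weighted_in_L2[OF b t] m t by auto
  obtain \<delta> C where \<delta>: "\<delta> > 0"
    and C: "\<And>j s x. j \<in> {1..N} \<Longrightarrow> \<bar>s - t\<bar> < \<delta> \<Longrightarrow> x > 0 \<Longrightarrow> cmod (u' s j x) \<le> C / (1 + x)"
    using locally_weighted_uniform[of N "\<lambda>j s x. u' s j x", OF b' t] by blast
  show "L2_tendsto N (\<lambda>s j x. (u s j x - u t j x) / of_real (s - t)) (u' t) (at t)"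
  proof (rule L2_tendsto_dominated[OF sequential_at])
    show "at t \<noteq> bot" by simp
    show "u' t j \<in> borel_measurable borel" if "j \<in> {1..N}" for j using m' t that by blast
    show "((\<lambda>s. (u s j x - u t j x) / of_real (s - t)) \<longlongrightarrow> u' t j x) (at t)" if "j \<in> {1..N}" "x > 0" for j x
      using d[OF that(1) t that(2)] unfolding has_vector_derivative_iff_tendsto
      by (simp add: scaleR_conv_of_real divide_inverse mult.commute)
    have "\<forall>\<^sub>F s in at t. \<bar>s - t\<bar> < min \<delta> t \<and> s \<noteq> t"
      using \<delta> t by (auto simp: eventually_at dist_real_def intro!: exI[of _ "min \<delta> t"])
    then show "\<forall>\<^sub>F s in at t. \<forall>j\<in>{1..N}. (\<lambda>x. (u s j x - u t j x) / of_real (s - t)) \<in> borel_measurable borel \<and>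
        (\<forall>x>0. cmod ((u s j x - u t j x) / of_real (s - t)) \<le> C / (1 + x))"
    proof eventually_elim
      case (elim s)
      then have s: "s > 0" by auto
      show ?case
      proof (intro ballI conjI allI impI)
        fix j assume j: "j \<in> {1..N}"
        have [measurable]: "u s j \<in> borel_measurable borel" "u t j \<in> borel_measurable borel"
          using m[OF j] s t by auto
        show "(\<lambda>x. (u s j x - u t j x) / of_real (s - t)) \<in> borel_measurable borel" by measurable
        fix x :: real assume x: "x > 0"
        have "cmod (u s j x - u t j x) \<le> \<bar>s - t\<bar> * (C / (1 + x))"
        proof (rule vector_derivative_bound)
          fix r assume "r \<in> closed_segment t s"
          then have r: "r > 0" "\<bar>r - t\<bar> < \<delta>"
            using elim s t by (auto simp: closed_segment_eq_real_ivl split: if_splits)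
          show "((\<lambda>s. u s j x) has_vector_derivative u' r j x) (at r)" using d[OF j r(1) x] .
          show "cmod (u' r j x) \<le> C / (1 + x)" using C[OF j r(2) x] .
        qed
        then show "cmod ((u s j x - u t j x) / of_real (s - t)) \<le> C / (1 + x)"
          using elim by (simp add: norm_divide divide_le_eq mult.commute flip: of_real_diff)
      qed
    qed
  qed
qed

lemma in_L2_weak_derivI:
  assumes g: "in_L2 g" and g': "in_L2 g'" and d: "\<And>x. (g has_vector_derivative g' x) (at x)"
    and cont: "continuous_on UNIV g'"
  shows "weak_deriv g g'"
  unfolding weak_deriv_def
proof (intro conjI allI impI g g')
  fix \<phi> assume \<phi>: "test_fun \<phi>"
  obtain a b where ab: "0 < a" "a \<le> b" "\<And>x. x \<notin> {a..b} \<Longrightarrow> \<phi> x = 0" using test_fun_supportE[OF \<phi>] by blast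
  have sm: "smooth \<phi>" using \<phi> test_fun_smooth by blast
  have cg: "continuous_on UNIV g" using d by (meson continuous_at_imp_continuous_on has_vector_derivative_continuous)
  \<comment> \<open>The interval from a/2 to b + 1 contains the support of \<open>\<phi>\<close> in
    its interior, so the boundary terms vanish.\<close>
  define c where "c = b + 1"
  have c: "\<phi> c = 0" "\<phi> (a / 2) = 0" using ab by (auto simp: c_def)
  have "((\<lambda>x. g x * \<phi> x) has_vector_derivative g x * vderiv \<phi> x + g' x * \<phi> x) (at x)" for x
    by (intro has_vector_derivative_mult d smooth_vderiv_at sm)
  then have "((\<lambda>x. g x * vderiv \<phi> x + g' x * \<phi> x) has_integral g c * \<phi> c - g (a / 2) * \<phi> (a / 2)) {a / 2..c}"
    using ab by (intro fundamental_theorem_of_calculus) (simp_all add: c_def has_vector_derivative_at_within)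
  then have 0: "integral {a / 2..c} (\<lambda>x. g x * vderiv \<phi> x + g' x * \<phi> x) = 0" using c by (simp add: integral_unique)
  have i: "set_integrable lborel {a / 2..c} (\<lambda>x. g x * vderiv \<phi> x + g' x * \<phi> x)"
    by (intro borel_integrable_atLeastAtMost' continuous_intros continuous_on_subset[OF cg]
        continuous_on_subset[OF cont] smooth_continuous smooth_vderiv sm) auto
  have L: "in_L2 \<phi>" "in_L2 (vderiv \<phi>)" using \<phi> test_fun_in_L2 test_fun_vderiv by blast+
  have "(LBINT x:{0<..}. g x * vderiv \<phi> x) + (LBINT x:{0<..}. g' x * \<phi> x) =
      (LBINT x:{0<..}. g x * vderiv \<phi> x + g' x * \<phi> x)"
    by (rule set_integral_add(2)[symmetric]) (intro in_L2_mult_integrable g g' L)+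
  also have "\<dots> = (LBINT x:{a / 2..c}. g x * vderiv \<phi> x + g' x * \<phi> x)"
    unfolding set_lebesgue_integral_def
  proof (rule Bochner_Integration.integral_cong[OF refl])
    fix x
    have "x \<notin> {a / 2..c} \<Longrightarrow> x \<notin> {a..b}" using ab by (auto simp: c_def)
    then show "indicator {0<..} x *\<^sub>R (g x * vderiv \<phi> x + g' x * \<phi> x) =
        indicator {a / 2..c} x *\<^sub>R (g x * vderiv \<phi> x + g' x * \<phi> x)"
      using ab(1) ab(3)[of x] vderiv_zero_outside[of a b \<phi> x, OF ab(3)] by (auto simp: indicator_def)
  qed
  also have "\<dots> = 0" using set_borel_integral_eq_integral(2)[OF i] 0 by simp
  finally show "(LBINT x:{0<..}. g x * vderiv \<phi> x) = - (LBINT x:{0<..}. g' x * \<phi> x)"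
    by (simp add: eq_neg_iff_add_eq_0)
qed

lemma trace_at_0_continuous: "continuous_on UNIV g \<Longrightarrow> trace_at_0 g (g 0)"
  by (auto simp: trace_at_0_def intro!: exI[of _ g] continuous_on_subset[of UNIV])

section \<open>From evolutions on the line to evolutions on the star graph\<close>

text \<open>The constant may differ from edge to edge; the sum of the absolute values serves all
  edges.\<close>

lemma L2_tendsto_uniform:
  assumes F: "sequential F" "F \<noteq> bot" "\<forall>\<^sub>F t in F. t \<in> A"
    and v: "\<And>j. j \<in> {1..N} \<Longrightarrow> v j \<in> borel_measurable borel"
    and m: "\<And>j t. j \<in> {1..N} \<Longrightarrow> t \<in> A \<Longrightarrow> w t j \<in> borel_measurable borel"
    and b: "\<And>j. j \<in> {1..N} \<Longrightarrow> \<exists>C. \<forall>t\<in>A. \<forall>x>0. cmod (w t j x) \<le> C / (1 + x)"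
    and lim: "\<And>j x. j \<in> {1..N} \<Longrightarrow> x > 0 \<Longrightarrow> ((\<lambda>t. w t j x) \<longlongrightarrow> v j x) F"
  shows "L2_tendsto N w v F"
proof -
  have "\<forall>j\<in>{1..N}. \<exists>C. \<forall>t\<in>A. \<forall>x>0. cmod (w t j x) \<le> C / (1 + x)" using b by blast
  from bchoice[OF this] obtain C where C: "\<forall>j\<in>{1..N}. \<forall>t\<in>A. \<forall>x>0. cmod (w t j x) \<le> C j / (1 + x)" by blast
  have bd: "cmod (w t j x) \<le> (\<Sum>j=1..N. \<bar>C j\<bar>) / (1 + x)" if "j \<in> {1..N}" "t \<in> A" "x > 0" for t j x
  proof -
    have "cmod (w t j x) \<le> C j / (1 + x)" using C that by blast
    also have "C j \<le> (\<Sum>j=1..N. \<bar>C j\<bar>)"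
      using member_le_sum[of j "{1..N}" "\<lambda>j. \<bar>C j\<bar>"] that(1) by auto
    finally show ?thesis using that(3) by (simp add: divide_right_mono)
  qed
  show ?thesis
  proof (rule L2_tendsto_dominated[OF F(1,2) v _ lim])
    show "\<forall>\<^sub>F t in F. \<forall>j\<in>{1..N}. w t j \<in> borel_measurable borel \<and>
        (\<forall>x>0. cmod (w t j x) \<le> (\<Sum>j=1..N. \<bar>C j\<bar>) / (1 + x))"
      using F(3) by eventually_elim (use bd m in blast)
  qed
qed

text \<open>What the passage from the line to the graph requires of the four problems in common.
  Only \<open>ev_odd\<close> refers to the vertex. Bounds are asked for on x > 0, since the negative
  axis carries auxiliary data only; \<open>ev_bound\<close> is uniform down to t = 0, as the initial
  condition demands, whereas \<open>evt_bound\<close> is local in t > 0.\<close>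

locale line_evolution =
  fixes ev evt :: "(real \<Rightarrow> complex) \<Rightarrow> real \<Rightarrow> real \<Rightarrow> complex"
  assumes ev_add: "\<lbrakk>schwartz g; schwartz h; t > 0\<rbrakk> \<Longrightarrow> ev (\<lambda>z. g z + h z) t x = ev g t x + ev h t x"
    and ev_cmult: "\<lbrakk>schwartz h; t > 0\<rbrakk> \<Longrightarrow> ev (\<lambda>z. c * h z) t x = c * ev h t x"
    and ev_vderiv: "\<lbrakk>schwartz h; t > 0\<rbrakk> \<Longrightarrow> (ev h t has_vector_derivative ev (vderiv h) t x) (at x)"
    and ev_odd: "\<lbrakk>schwartz h; t > 0; \<And>z. h (- z) = - h z\<rbrakk> \<Longrightarrow> ev h t 0 = 0"
    and ev_bound: "schwartz h \<Longrightarrow> \<exists>C. \<forall>t\<in>{0<..T}. \<forall>x>0. cmod (ev h t x) \<le> C / (1 + x)"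
    and ev_initial: "\<lbrakk>schwartz h; x > 0\<rbrakk> \<Longrightarrow> ((\<lambda>t. ev h t x) \<longlongrightarrow> h x) (at_right 0)"
    and ev_deriv: "\<lbrakk>schwartz h; t > 0\<rbrakk> \<Longrightarrow> ((\<lambda>s. ev h s x) has_vector_derivative evt h t x) (at t)"
    and evt_bound: "schwartz h \<Longrightarrow> locally_weighted (evt h)"
    and evt_borel: "\<lbrakk>schwartz h; t > 0\<rbrakk> \<Longrightarrow> evt h t \<in> borel_measurable borel"
begin

lemma ev_zero: "t > 0 \<Longrightarrow> ev (\<lambda>_. 0) t x = 0"
  using ev_cmult[of "\<lambda>_. 0" t 0 x] by simp

lemma ev_sum:
  assumes "t > 0" "\<And>i. i \<in> I \<Longrightarrow> schwartz (h i)"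
  shows "ev (\<lambda>z. \<Sum>i\<in>I. h i z) t x = (\<Sum>i\<in>I. ev (h i) t x)"
  using assms(2)
proof (induction I rule: infinite_finite_induct)
  case (insert i I)
  then show ?case using ev_add[of "h i" "\<lambda>z. \<Sum>i\<in>I. h i z" t x] assms(1) schwartz_sum[of I h] by simp
qed (use ev_zero assms(1) in auto)

lemma ev_diff: "\<lbrakk>schwartz g; schwartz h; t > 0\<rbrakk> \<Longrightarrow> ev (\<lambda>z. g z - h z) t x = ev g t x - ev h t x"
  using ev_add[of g "\<lambda>z. (-1) * h z" t x] ev_cmult[of h t "-1" x] schwartz_cmult[of h "-1"] by simp

lemma schwartz_vderiv_n: "schwartz h \<Longrightarrow> schwartz ((vderiv ^^ n) h)"
  by (induction n) auto

lemma ev_vderiv_n: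
  assumes "schwartz h" "t > 0"
  shows "(vderiv ^^ n) (ev h t) = ev ((vderiv ^^ n) h) t"
  using vderiv_sequence[of "\<lambda>n. ev ((vderiv ^^ n) h) t" n] ev_vderiv[OF schwartz_vderiv_n[OF assms(1)] assms(2)]
  by simp

lemma ev_smooth:
  assumes "schwartz h" "t > 0" shows "smooth (ev h t)"
  using smooth_sequenceI[of "\<lambda>n. ev ((vderiv ^^ n) h) t"] ev_vderiv[OF schwartz_vderiv_n[OF assms(1)] assms(2)]
  by simp

lemma ev_continuous: "schwartz h \<Longrightarrow> t > 0 \<Longrightarrow> continuous_on UNIV (ev h t)"
  using ev_smooth smooth_continuous by blast

lemma ev_borel: "schwartz h \<Longrightarrow> t > 0 \<Longrightarrow> ev h t \<in> borel_measurable borel"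
  using ev_smooth smooth_borel by blast

lemma ev_locally_weighted: assumes "schwartz h" shows "locally_weighted (ev h)"
  unfolding locally_weighted_def
proof (intro allI impI)
  fix t :: real assume t: "t > 0"
  obtain C where C: "\<forall>s\<in>{0<..2 * t}. \<forall>x>0. cmod (ev h s x) \<le> C / (1 + x)" using ev_bound[OF assms] by blast
  show "\<exists>\<delta>>0. \<exists>C. \<forall>s x. \<bar>s - t\<bar> < \<delta> \<longrightarrow> x > 0 \<longrightarrow> cmod (ev h s x) \<le> C / (1 + x)"
    by (intro exI[of _ t] exI[of _ C] conjI t) (use C in \<open>auto simp: abs_less_iff\<close>)
qed

lemma ev_in_L2: "schwartz h \<Longrightarrow> t > 0 \<Longrightarrow> in_L2 (ev h t)"
  using locally_weighted_in_L2 ev_locally_weighted ev_borel by blast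

lemma ev_weak_deriv: "schwartz h \<Longrightarrow> t > 0 \<Longrightarrow> weak_deriv (ev h t) (ev (vderiv h) t)"
  by (intro in_L2_weak_derivI ev_in_L2 ev_vderiv ev_continuous schwartz_vderiv)

end

text \<open>
  The extension of the initial data to the whole line for which the evolution on the line restricts
  to the evolution on the graph: the part of the data that is common to all edges satisfies a Robin
  condition at the vertex with parameter \<open>\<alpha> / N\<close>, the rest a Dirichlet condition.
\<close>

definition star_ext :: "nat \<Rightarrow> real \<Rightarrow> (nat \<Rightarrow> real \<Rightarrow> complex) \<Rightarrow> nat \<Rightarrow> real \<Rightarrow> complex" where
  "star_ext N \<alpha> f j z = (f j z - f j (- z)) +
     of_real (2 / N) * (\<Sum>l=1..N. f l (- z) - of_real (\<alpha> / N) * exp_tail (\<alpha> / N) (f l) (- z))"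

locale star_evolution = line_evolution +
  fixes N :: nat and \<alpha> :: real
  assumes N: "N \<ge> 1" and \<alpha>: "\<alpha> > 0"
begin

abbreviation "test_data f \<equiv> \<forall>l\<in>{1..N}. test_fun (f l)"
abbreviation "ext \<equiv> star_ext N \<alpha>"
definition sol :: "(nat \<Rightarrow> real \<Rightarrow> complex) \<Rightarrow> real \<Rightarrow> nat \<Rightarrow> real \<Rightarrow> complex" where
  "sol f t j x = ev (ext f j) t x"
definition solt :: "(nat \<Rightarrow> real \<Rightarrow> complex) \<Rightarrow> real \<Rightarrow> nat \<Rightarrow> real \<Rightarrow> complex" where
  "solt f t j x = evt (ext f j) t x"
definition solxx :: "(nat \<Rightarrow> real \<Rightarrow> complex) \<Rightarrow> real \<Rightarrow> nat \<Rightarrow> real \<Rightarrow> complex" where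
  "solxx f t j x = ev (vderiv (vderiv (ext f j))) t x"

lemma \<kappa>: "\<alpha> / N > 0" using N \<alpha> by simp

context
  fixes f assumes f: "test_data f"
begin

lemma schwartz_data: "j \<in> {1..N} \<Longrightarrow> schwartz (f j)"
  using f test_fun_schwartz by blast

lemma schwartz_tail: "j \<in> {1..N} \<Longrightarrow> schwartz (exp_tail (\<alpha> / N) (f j))"
  using f exp_tail_schwartz[OF \<kappa>] by blast

lemma ext_schwartz: assumes j: "j \<in> {1..N}" shows "schwartz (ext f j)"
  unfolding star_ext_def[abs_def]
  by (intro schwartz_add schwartz_diff schwartz_cmult schwartz_sum schwartz_reflect schwartz_data schwartz_tail j)

lemma ext_pos: "j \<in> {1..N} \<Longrightarrow> x > 0 \<Longrightarrow> ext f j x = f j x"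
  using f test_fun_nonpos[of "f _" "- x"] exp_tail_nonpos[OF \<kappa>, of "f _" "- x"] by (simp add: star_ext_def)

text \<open>On each edge the extension is an odd function plus a part common to all edges, and odd
  data evolve to 0 at the vertex.\<close>

lemma ext_at_0:
  assumes t: "t > 0" and j: "j \<in> {1..N}"
  shows "sol f t j 0 = sol f t 1 0"
proof -
  define c where "c z = of_real (2 / N) * (\<Sum>l=1..N. f l (- z) - of_real (\<alpha> / N) * exp_tail (\<alpha> / N) (f l) (- z))" for z
  have c: "schwartz c" unfolding c_def
    by (intro schwartz_diff schwartz_cmult schwartz_sum schwartz_reflect schwartz_data schwartz_tail)
  have "sol f t i 0 = ev c t 0" if i: "i \<in> {1..N}" for i
  proof -
    have o: "schwartz (\<lambda>z. f i z - f i (- z))" by (intro schwartz_diff schwartz_reflect schwartz_data i)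
    have "ext f i = (\<lambda>z. (f i z - f i (- z)) + c z)" by (simp add: star_ext_def c_def fun_eq_iff)
    then show ?thesis using ev_add[OF o c t] ev_odd[OF o t] by (simp add: sol_def)
  qed
  from this[OF j] this[of 1] N show ?thesis by simp
qed

text \<open>The sum over the edges of h' - (\<alpha>/N) h, with h the extensions, is odd, so its
  evolution vanishes at 0. As all edges have the same value at the vertex, N copies of \<alpha>/N
  add up to \<alpha>.\<close>

lemma vertex_condition:
  assumes t: "t > 0"
  shows "(\<Sum>j=1..N. ev (vderiv (ext f j)) t 0) = of_real \<alpha> * sol f t 1 0"
proof -
  define \<kappa>' where "\<kappa>' = complex_of_real (\<alpha> / N)"
  define E where "E l = exp_tail (\<alpha> / N) (f l)" for l
  have smf: "smooth (f l)" and smE: "smooth (E l)" if "l \<in> {1..N}" for l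
    using schwartz_smooth[OF schwartz_data[OF that]] schwartz_smooth[OF schwartz_tail[OF that]] by (auto simp: E_def)
  have dE: "vderiv (E l) z = f l z - \<kappa>' * E l z" if "l \<in> {1..N}" for l z
    using exp_tail_deriv[OF \<kappa>, of "f l" z] f that
    by (simp add: E_def \<kappa>'_def vderiv_def vector_derivative_at)
  define S where "S z = (\<Sum>j=1..N. ext f j z)" for z
  \<comment> \<open>The common part occurs N times with the factor 2/N; the resulting 2 f(-z) turns
    the odd reflection of the data into an even one.\<close>
  have S_eq: "S z = (\<Sum>l=1..N. f l z + f l (- z) - 2 * \<kappa>' * E l (- z))" for z
  proof -
    have "S z = (\<Sum>j=1..N. f j z - f j (- z)) + of_nat N * (of_real (2 / N) * (\<Sum>l=1..N. f l (- z) - \<kappa>' * E l (- z)))"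
      by (simp add: S_def star_ext_def sum.distrib \<kappa>'_def E_def)
    also have "of_nat N * (of_real (2 / N) * (\<Sum>l=1..N. f l (- z) - \<kappa>' * E l (- z))) = 2 * (\<Sum>l=1..N. f l (- z) - \<kappa>' * E l (- z))"
      using N by simp
    finally show ?thesis by (simp add: sum_distrib_left sum.distrib[symmetric] algebra_simps)
  qed
  have sch: "schwartz (\<lambda>z. vderiv (ext f j) z - \<kappa>' * ext f j z)" if "j \<in> {1..N}" for j
    by (intro schwartz_diff schwartz_cmult schwartz_vderiv ext_schwartz that)
  define W where "W z = (\<Sum>j=1..N. vderiv (ext f j) z - \<kappa>' * ext f j z)" for z
  have W_sch: "schwartz W" unfolding W_def by (intro schwartz_sum sch)
  have dS: "(\<Sum>j=1..N. vderiv (ext f j) z) = (\<Sum>l=1..N. vderiv (f l) z - vderiv (f l) (- z) + 2 * \<kappa>' * (f l (- z) - \<kappa>' * E l (- z)))" for z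
  proof -
    have "(S has_vector_derivative (\<Sum>j=1..N. vderiv (ext f j) z)) (at z)"
      unfolding S_def[abs_def]
      by (intro has_vector_derivative_sum smooth_vderiv_at schwartz_smooth ext_schwartz)
    moreover have "(S has_vector_derivative (\<Sum>l=1..N. vderiv (f l) z - vderiv (f l) (- z) + 2 * \<kappa>' * (f l (- z) - \<kappa>' * E l (- z)))) (at z)"
      unfolding S_eq[abs_def]
    proof (intro has_vector_derivative_sum)
      fix l assume l: "l \<in> {1..N}"
      have d: "((\<lambda>z. h (- z)) has_vector_derivative - vderiv h (- z)) (at z)" if "smooth h" for h
        using smooth_vderiv_at[OF smooth_reflect[OF that]] by (simp add: vderiv_reflect[OF that])
      have "((\<lambda>z. f l z + f l (- z) - 2 * \<kappa>' * E l (- z)) has_vector_derivative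
         vderiv (f l) z + - vderiv (f l) (- z) - 2 * \<kappa>' * (- vderiv (E l) (- z))) (at z)"
        using smf[OF l] smE[OF l]
        by (intro has_vector_derivative_add has_vector_derivative_diff has_vector_derivative_mult_right d smooth_vderiv_at)
      moreover have "vderiv (f l) z + - vderiv (f l) (- z) - 2 * \<kappa>' * (- vderiv (E l) (- z)) =
          vderiv (f l) z - vderiv (f l) (- z) + 2 * \<kappa>' * (f l (- z) - \<kappa>' * E l (- z))"
        by (simp add: dE[OF l] algebra_simps)
      ultimately show "((\<lambda>z. f l z + f l (- z) - 2 * \<kappa>' * E l (- z)) has_vector_derivative
         vderiv (f l) z - vderiv (f l) (- z) + 2 * \<kappa>' * (f l (- z) - \<kappa>' * E l (- z))) (at z)"
        by (simp only:)
    qed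
    ultimately show ?thesis by (rule vector_derivative_unique_at)
  qed
  \<comment> \<open>The tails cancel here because \<open>vderiv (E l)\<close> is f - \<kappa>' E;
    the remaining terms are visibly odd.\<close>
  have W_eq: "W z = (\<Sum>l=1..N. (vderiv (f l) z - vderiv (f l) (- z)) - \<kappa>' * (f l z - f l (- z)))" for z
  proof -
    have "W z = (\<Sum>j=1..N. vderiv (ext f j) z) - \<kappa>' * S z"
      by (simp add: W_def S_def sum_subtractf sum_distrib_left)
    then show ?thesis unfolding dS S_eq
      by (simp add: sum_distrib_left sum_subtractf[symmetric] algebra_simps)
  qed
  have "ev W t 0 = 0"
    by (rule ev_odd[OF W_sch t]) (simp add: W_eq sum_negf[symmetric] algebra_simps)
  moreover have "ev W t 0 = (\<Sum>j=1..N. ev (vderiv (ext f j)) t 0 - \<kappa>' * sol f t j 0)"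
    unfolding W_def[abs_def]
    by (subst ev_sum[OF t sch]) (auto intro!: sum.cong simp: sol_def ev_diff[OF _ _ t] ev_cmult[OF _ t] ext_schwartz schwartz_vderiv schwartz_cmult)
  moreover have "(\<Sum>j=1..N. \<kappa>' * sol f t j 0) = of_real \<alpha> * sol f t 1 0"
  proof -
    have "(\<Sum>j=1..N. \<kappa>' * sol f t j 0) = (\<Sum>j=1..N. \<kappa>' * sol f t 1 0)"
      by (intro sum.cong arg_cong[where f = "\<lambda>u. \<kappa>' * u"] ext_at_0 t) auto
    then show ?thesis using N by (simp add: \<kappa>'_def)
  qed
  ultimately show ?thesis by (simp add: sum_subtractf)
qed

lemma sol_smooth: "t > 0 \<Longrightarrow> j \<in> {1..N} \<Longrightarrow> smooth (sol f t j)"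
  unfolding sol_def[abs_def] by (intro ev_smooth ext_schwartz)

lemma sol_vderiv: "t > 0 \<Longrightarrow> j \<in> {1..N} \<Longrightarrow> vderiv (sol f t j) = ev (vderiv (ext f j)) t"
  "t > 0 \<Longrightarrow> j \<in> {1..N} \<Longrightarrow> vderiv (vderiv (sol f t j)) = solxx f t j"
  using ev_vderiv_n[OF ext_schwartz, of j t 1] ev_vderiv_n[OF ext_schwartz, of j t 2]
  by (simp_all add: sol_def[abs_def] solxx_def[abs_def] numeral_2_eq_2)

lemma sol_in_L2N: "t > 0 \<Longrightarrow> in_L2N N (sol f t)"
  unfolding in_L2N_def sol_def[abs_def] using ev_in_L2 ext_schwartz by blast

lemma solxx_in_L2N: "t > 0 \<Longrightarrow> in_L2N N (solxx f t)"
  unfolding in_L2N_def solxx_def[abs_def] using ev_in_L2 ext_schwartz schwartz_vderiv by blast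

lemma star_H_sol:
  assumes t: "t > 0" shows "star_H N \<alpha> (sol f t) (\<lambda>j x. - solxx f t j x)"
proof -
  have w: "weak_deriv (sol f t j) (ev (vderiv (ext f j)) t)" "weak_deriv (ev (vderiv (ext f j)) t) (solxx f t j)"
    if "j \<in> {1..N}" for j
    unfolding sol_def[abs_def] solxx_def[abs_def] by (intro ev_weak_deriv schwartz_vderiv ext_schwartz that t)+
  have tr: "trace_at_0 (sol f t j) (sol f t 1 0)" "trace_at_0 (ev (vderiv (ext f j)) t) (ev (vderiv (ext f j)) t 0)"
    if "j \<in> {1..N}" for j
  proof -
    have "trace_at_0 (sol f t j) (sol f t j 0)"
      by (intro trace_at_0_continuous smooth_continuous sol_smooth t that)
    then show "trace_at_0 (sol f t j) (sol f t 1 0)" by (simp add: ext_at_0[OF t that])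
    show "trace_at_0 (ev (vderiv (ext f j)) t) (ev (vderiv (ext f j)) t 0)"
      by (intro trace_at_0_continuous ev_continuous schwartz_vderiv ext_schwartz t that)
  qed
  have "star_domain N \<alpha> (sol f t)" unfolding star_domain_def
  proof (intro conjI)
    show "\<forall>j\<in>{1..N}. sobolev_H2 (sol f t j)" using w unfolding sobolev_H2_def by blast
    show "\<exists>u0 d. (\<forall>j\<in>{1..N}. trace_at_0 (sol f t j) u0) \<and>
        (\<forall>j\<in>{1..N}. \<exists>u'. weak_deriv (sol f t j) u' \<and> trace_at_0 u' (d j)) \<and> (\<Sum>j=1..N. d j) = of_real \<alpha> * u0"
      using w tr vertex_condition[OF t]
      by (intro exI[of _ "sol f t 1 0"] exI[of _ "\<lambda>j. ev (vderiv (ext f j)) t 0"]) blast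
  qed
  then show ?thesis using w unfolding star_H_def minus_minus by blast
qed

text \<open>Symmetry of H in the form used by all duality arguments: the operator passes to the
  explicit solution, where it is minus the evolution of the second derivative of the extended
  data.\<close>

lemma star_H_pairing_sol:
  assumes "star_H N \<alpha> u w" and t: "t > 0"
  shows "pairing N w (sol f t) = - pairing N u (solxx f t)"
proof -
  have "pairing N w (sol f t) = pairing N u (\<lambda>j x. - vderiv (vderiv (sol f t j)) x)"
  proof (rule star_H_symmetric[OF assms(1)])
    show "smooth (sol f t j) \<and> in_L2 (sol f t j) \<and> in_L2 (vderiv (sol f t j)) \<and> in_L2 (vderiv (vderiv (sol f t j)))"
      if j: "j \<in> {1..N}" for j
      unfolding sol_vderiv(2)[OF t j] unfolding sol_vderiv(1)[OF t j]
      using sol_smooth[OF t j] sol_in_L2N[OF t] solxx_in_L2N[OF t] j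
        ev_in_L2[OF schwartz_vderiv[OF ext_schwartz[OF j]] t] unfolding in_L2N_def by blast
    show "sol f t j 0 = sol f t 1 0" if "j \<in> {1..N}" for j using ext_at_0[OF t that] .
    show "(\<Sum>j=1..N. vderiv (sol f t j) 0) = of_real \<alpha> * sol f t 1 0"
      unfolding vertex_condition[OF t, symmetric] by (intro sum.cong) (auto simp: sol_vderiv[OF t])
  qed
  also have "\<dots> = - pairing N u (\<lambda>j. vderiv (vderiv (sol f t j)))" by simp
  also have "pairing N u (\<lambda>j. vderiv (vderiv (sol f t j))) = pairing N u (solxx f t)"
    unfolding pairing_def by (intro sum.cong) (auto simp only: sol_vderiv(2)[OF t])
  finally show ?thesis .
qed

lemma L2_has_deriv_sol: "t > 0 \<Longrightarrow> L2_has_deriv N (sol f) (solt f t) t"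
  unfolding sol_def[abs_def] solt_def[abs_def]
  by (rule L2_has_derivI[where u' = "\<lambda>t j x. evt (ext f j) t x"])
     (assumption | rule ev_deriv ev_borel evt_borel ev_locally_weighted evt_bound ext_schwartz)+

lemma sol_initial: "L2_tendsto N (sol f) f (at_right 0)"
proof -
  have "\<forall>\<^sub>F t in at_right (0::real). t \<in> {0<..1}"
    by (auto simp: eventually_at_right_field intro!: exI[of _ 1])
  then show ?thesis
  proof (rule L2_tendsto_uniform[OF sequential_at trivial_limit_at_right_real])
    show "((\<lambda>t. sol f t j x) \<longlongrightarrow> f j x) (at_right 0)" if "j \<in> {1..N}" "x > 0" for j x
      using ev_initial[OF ext_schwartz[OF that(1)] that(2)] ext_pos[OF that] by (simp add: sol_def)
    show "sol f t j \<in> borel_measurable borel" if "j \<in> {1..N}" "t \<in> {0<..1}" for t j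
      using ev_borel[OF ext_schwartz[OF that(1)]] that(2) by (simp add: sol_def[abs_def])
    show "\<exists>C. \<forall>t\<in>{0<..1}. \<forall>x>0. cmod (sol f t j x) \<le> C / (1 + x)" if "j \<in> {1..N}" for j
      using ev_bound[OF ext_schwartz[OF that]] by (simp add: sol_def)
  qed (intro schwartz_borel schwartz_data)
qed

end

lemma test_data_in_L2N: "test_data f \<Longrightarrow> in_L2N N f"
  by (auto simp: in_L2N_def test_fun_in_L2)

section \<open>Time reversal of the explicit solution\<close>

lemma sol_reversed_deriv:
  assumes "test_data g" "s < t"
  shows "L2_has_deriv N (\<lambda>s. sol g (t - s)) (\<lambda>j x. - solt g (t - s) j x) s"
  using L2_has_deriv_affine[of N "sol g" "solt g (t - s)" t "-1" s] L2_has_deriv_sol[OF assms(1), of "t - s"] assms(2)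
  by simp

lemma sol_reversed_final:
  assumes "test_data g" shows "L2_tendsto N (\<lambda>s. sol g (t - s)) g (at_left t)"
proof (rule L2_tendsto_compose[OF sol_initial[OF assms]])
  show "filterlim (\<lambda>s. t - s) (at_right 0) (at_left t)"
    by (auto simp: filterlim_at eventually_at_filter intro!: tendsto_eq_intros)
qed

lemma sol_reversed_start:
  assumes "test_data g" "t > 0" shows "L2_tendsto N (\<lambda>s. sol g (t - s)) (sol g t) (at_right 0)"
  using L2_has_deriv_continuous[OF sol_reversed_deriv[OF assms(1), of 0 t]] assms(2)
  by (auto intro: L2_tendsto_mono at_le)

text \<open>The right-hand side of the duality relation does not contain u, so u and the explicit
  solution have the same pairing with every test datum; data supported on a single edge isolate the
  component j.\<close>

lemma AE_eq_sol:
  assumes f: "test_data f" and t: "t > 0" and ut: "in_L2N N u"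
    and dual: "\<And>g. test_data g \<Longrightarrow> pairing N u g = pairing N f (sol g t)"
    and dual': "\<And>g. test_data g \<Longrightarrow> pairing N (sol f t) g = pairing N f (sol g t)"
    and j: "j \<in> {1..N}"
  shows "AE x in lborel. 0 < x \<longrightarrow> u j x = sol f t j x"
proof (rule in_L2_AE_eqI)
  show "in_L2 (u j)" "in_L2 (sol f t j)" using ut sol_in_L2N[OF f t] j by (auto simp: in_L2N_def)
  fix \<psi> assume \<psi>: "test_fun \<psi>"
  define g where "g i = (if i = j then \<psi> else (\<lambda>_. 0))" for i
  have g: "test_data g" using \<psi> by (simp add: g_def)
  have single: "pairing N w g = (LBINT x:{0<..}. w j x * \<psi> x)" for w
  proof -
    have "pairing N w g = (\<Sum>i=1..N. if i = j then LBINT x:{0<..}. w j x * \<psi> x else 0)"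
      unfolding pairing_def by (intro sum.cong) (auto simp: g_def set_lebesgue_integral_def)
    then show ?thesis using j by simp
  qed
  show "(LBINT x:{0<..}. u j x * \<psi> x) = (LBINT x:{0<..}. sol f t j x * \<psi> x)"
    using dual[OF g] dual'[OF g] unfolding single by simp
qed

end

text \<open>Stated with one-sided limits because solutions attain their initial data only in the
  limit of time 0.\<close>

lemma constant_limits:
  fixes \<phi> :: "real \<Rightarrow> complex"
  assumes ab: "a < b" and d: "\<And>s. a < s \<Longrightarrow> s < b \<Longrightarrow> (\<phi> has_vector_derivative 0) (at s)"
    and A: "(\<phi> \<longlongrightarrow> A) (at_right a)" and B: "(\<phi> \<longlongrightarrow> B) (at_left b)"
  shows "A = B"
proof -
  have "\<exists>c. \<forall>s\<in>{a<..<b}. \<phi> s = c"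
    by (rule has_derivative_zero_constant)
       (use d in \<open>auto simp: has_vector_derivative_def intro: has_derivative_at_withinI\<close>)
  then obtain c where c: "\<And>s. a < s \<Longrightarrow> s < b \<Longrightarrow> \<phi> s = c" by auto
  have "(\<phi> \<longlongrightarrow> c) (at_right a)"
    by (rule tendsto_eventually) (use ab c in \<open>auto simp: eventually_at_right_field\<close>)
  then have "A = c" using A by (intro tendsto_unique[of "at_right a"]) auto
  moreover have "(\<phi> \<longlongrightarrow> c) (at_left b)"
    by (rule tendsto_eventually) (use ab c in \<open>auto simp: eventually_at_left_field\<close>)
  then have "B = c" using B by (intro tendsto_unique[of "at_left b"]) auto
  ultimately show ?thesis by simp
qed

section \<open>Uniqueness for the heat and quantum problems\<close>

locale first_order_evolution = star_evolution +
  fixes c :: complex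
  assumes c: "c \<noteq> 0" and evt_eq: "\<lbrakk>schwartz h; t > 0\<rbrakk> \<Longrightarrow> evt h t x = c * ev (vderiv (vderiv h)) t x"
begin

text \<open>The equation is u_t = c u_xx, that is, H u = -(1/c) u_t. For c = 1 this is the heat
  problem; for c = \<i> the factor is again \<i>, which gives the quantum problem.\<close>

definition solution :: "(nat \<Rightarrow> real \<Rightarrow> complex) \<Rightarrow> (real \<Rightarrow> nat \<Rightarrow> real \<Rightarrow> complex) \<Rightarrow> bool" where
  "solution f u \<longleftrightarrow>
     (\<exists>ut. \<forall>t>0. L2_has_deriv N u (ut t) t \<and> star_H N \<alpha> (u t) (\<lambda>j x. - (1 / c) * ut t j x)) \<and>
     L2_tendsto N u f (at_right 0)"

lemma solt_eq: "test_data f \<Longrightarrow> t > 0 \<Longrightarrow> j \<in> {1..N} \<Longrightarrow> solt f t j x = c * solxx f t j x"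
  by (simp add: solt_def solxx_def evt_eq ext_schwartz)

lemma star_H_cong:
  assumes "star_H N \<alpha> u w" "\<And>j x. j \<in> {1..N} \<Longrightarrow> w j x = w' j x" shows "star_H N \<alpha> u w'"
proof -
  have "(\<lambda>x. - w j x) = (\<lambda>x. - w' j x)" if "j \<in> {1..N}" for j using assms(2)[OF that] by auto
  then show ?thesis using assms(1) unfolding star_H_def by auto
qed

lemma solution_sol: assumes f: "test_data f" shows "solution f (sol f)"
proof -
  have "star_H N \<alpha> (sol f t) (\<lambda>j x. - (1 / c) * solt f t j x)" if t: "t > 0" for t
    by (rule star_H_cong[OF star_H_sol[OF f t]]) (use solt_eq[OF f t] c in simp)
  then show ?thesis unfolding solution_def using L2_has_deriv_sol[OF f] sol_initial[OF f] by blast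
qed

lemma solution_dual:
  assumes S: "solution f u" and g: "test_data g" and t: "t > 0"
  shows "pairing N (u t) g = pairing N f (sol g t)"
proof -
  obtain ut where u: "\<And>t. t > 0 \<Longrightarrow> L2_has_deriv N u (ut t) t"
    and H: "\<And>t. t > 0 \<Longrightarrow> star_H N \<alpha> (u t) (\<lambda>j x. - (1 / c) * ut t j x)"
    and init: "L2_tendsto N u f (at_right 0)" using S by (auto simp: solution_def)
  define \<phi> where "\<phi> s = pairing N (u s) (sol g (t - s))" for s
  have "pairing N f (sol g t) = pairing N (u t) g"
  proof (rule constant_limits[of 0 t \<phi>, OF t])
    fix s assume s: "0 < s" "s < t"
    have "pairing N (\<lambda>j x. - (1 / c) * ut s j x) (sol g (t - s)) = - pairing N (u s) (solxx g (t - s))"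
      using star_H_pairing_sol[OF g H[OF s(1)], of "t - s"] s by simp
    \<comment> \<open>Symmetry of H has moved the operator to the explicit solution; this term and
      the one in 2 enter the derivative of \<open>\<phi>\<close> with opposite signs.\<close>
    then have 1: "pairing N (ut s) (sol g (t - s)) = c * pairing N (u s) (solxx g (t - s))"
      using c by (simp only: pairing_cmult_left) (simp add: field_simps)
    have "pairing N (u s) (solt g (t - s)) = pairing N (u s) (\<lambda>j x. c * solxx g (t - s) j x)"
      unfolding pairing_def using s by (intro sum.cong) (auto simp: solt_eq[OF g])
    then have 2: "pairing N (u s) (solt g (t - s)) = c * pairing N (u s) (solxx g (t - s))" by simp
    show "(\<phi> has_vector_derivative 0) (at s)"
      using pairing_has_deriv[OF u[OF s(1)] sol_reversed_deriv[OF g s(2)]] by (simp add: \<phi>_def[abs_def] 1 2)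
  next
    show "(\<phi> \<longlongrightarrow> pairing N f (sol g t)) (at_right 0)"
      unfolding \<phi>_def by (intro pairing_tendsto init sol_reversed_start g t)
    show "(\<phi> \<longlongrightarrow> pairing N (u t) g) (at_left t)"
      unfolding \<phi>_def
      by (intro pairing_tendsto sol_reversed_final g L2_tendsto_mono[OF L2_has_deriv_continuous[OF u[OF t]]] at_le) simp
  qed
  then show ?thesis by simp
qed

lemma solution_unique:
  assumes "solution f u" "test_data f" "t > 0" "j \<in> {1..N}"
  shows "AE x in lborel. 0 < x \<longrightarrow> u t j x = sol f t j x"
proof (rule AE_eq_sol)
  show "in_L2N N (u t)" using assms(1,3) by (auto simp: solution_def L2_has_deriv_def)
qed (use assms solution_dual solution_sol in auto)

end

text \<open>The equation is u_tt = \<sigma> u_xx = -\<sigma> H u: the wave problem for \<sigma> = 1,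
  the elliptic cylinder problem for \<sigma> = -1.\<close>

locale second_order_evolution = star_evolution +
  fixes \<sigma> :: complex
  assumes \<sigma>: "\<sigma> = 1 \<or> \<sigma> = -1"
    and evt_deriv: "\<lbrakk>schwartz h; t > 0\<rbrakk> \<Longrightarrow>
      ((\<lambda>s. evt h s x) has_vector_derivative \<sigma> * ev (vderiv (vderiv h)) t x) (at t)"
begin

lemma L2_has_deriv_solt:
  assumes f: "test_data f" and t: "t > 0"
  shows "L2_has_deriv N (solt f) (\<lambda>j x. \<sigma> * solxx f t j x) t"
  unfolding solt_def[abs_def] solxx_def[abs_def]
  by (rule L2_has_derivI[where u' = "\<lambda>t j x. \<sigma> * ev (vderiv (vderiv (ext f j))) t x", OF t])
     (assumption | rule evt_deriv evt_borel evt_bound ext_schwartz f locally_weighted_cmult ev_locally_weighted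
       schwartz_vderiv borel_measurable_times borel_measurable_const ev_borel)+

lemma solt_reversed_deriv:
  assumes "test_data g" "s < t"
  shows "L2_has_deriv N (\<lambda>s. solt g (t - s)) (\<lambda>j x. - (\<sigma> * solxx g (t - s) j x)) s"
  using L2_has_deriv_affine[of N "solt g" "\<lambda>j x. \<sigma> * solxx g (t - s) j x" t "-1" s]
    L2_has_deriv_solt[OF assms(1), of "t - s"] assms(2) by simp

end

section \<open>Uniqueness for the wave problem\<close>

locale wave_evolution = second_order_evolution _ _ _ _ 1 +
  assumes evt_initial_bound: "schwartz h \<Longrightarrow> \<exists>C. \<forall>t\<in>{0<..1}. \<forall>x>0. cmod (evt h t x) \<le> C / (1 + x)"
    and evt_initial: "\<lbrakk>schwartz h; x > 0\<rbrakk> \<Longrightarrow> ((\<lambda>t. evt h t x) \<longlongrightarrow> 0) (at_right 0)"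
begin

lemma solt_initial: assumes f: "test_data f" shows "L2_tendsto N (solt f) (\<lambda>_ _. 0) (at_right 0)"
proof -
  have "\<forall>\<^sub>F t in at_right (0::real). t \<in> {0<..1}"
    by (auto simp: eventually_at_right_field intro!: exI[of _ 1])
  then show ?thesis
  proof (rule L2_tendsto_uniform[OF sequential_at trivial_limit_at_right_real])
    show "((\<lambda>t. solt f t j x) \<longlongrightarrow> 0) (at_right 0)" if "j \<in> {1..N}" "x > 0" for j x
      using evt_initial[OF ext_schwartz[OF f that(1)] that(2)] by (simp add: solt_def)
    show "solt f t j \<in> borel_measurable borel" if "j \<in> {1..N}" "t \<in> {0<..1}" for t j
      using evt_borel[OF ext_schwartz[OF f that(1)]] that(2) by (simp add: solt_def[abs_def])
    show "\<exists>C. \<forall>t\<in>{0<..1}. \<forall>x>0. cmod (solt f t j x) \<le> C / (1 + x)" if "j \<in> {1..N}" for j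
      using evt_initial_bound[OF ext_schwartz[OF f that]] by (simp add: solt_def)
  qed simp
qed

lemma solution_sol: assumes f: "test_data f" shows "wave_solution N \<alpha> f (sol f)"
  unfolding wave_solution_def
proof (rule exI[of _ "solt f"], rule exI[of _ "solxx f"], intro conjI allI impI)
  fix t :: real assume t: "t > 0"
  show "L2_has_deriv N (sol f) (solt f t) t" using L2_has_deriv_sol[OF f t] .
  show "L2_has_deriv N (solt f) (solxx f t) t" using L2_has_deriv_solt[OF f t] by simp
  show "star_H N \<alpha> (sol f t) (\<lambda>j x. - solxx f t j x)" using star_H_sol[OF f t] .
qed (use sol_initial[OF f] solt_initial[OF f] in auto)

text \<open>With v the explicit solution for g, the expression <u_t(s), v(t-s)> + <u(s), v_t(t-s)>
  is constant in s. Both initial velocities vanish, so its end values say that <u(t), g> and <f,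
  v(t)> have the same derivative in t; they also have the same limit at 0.\<close>

lemma solution_dual:
  assumes S: "wave_solution N \<alpha> f u" and g: "test_data g" and t: "t > 0"
  shows "pairing N (u t) g = pairing N f (sol g t)"
proof -
  obtain ut utt where u: "\<And>t. t > 0 \<Longrightarrow> L2_has_deriv N u (ut t) t"
    and u': "\<And>t. t > 0 \<Longrightarrow> L2_has_deriv N ut (utt t) t"
    and H: "\<And>t. t > 0 \<Longrightarrow> star_H N \<alpha> (u t) (\<lambda>j x. - utt t j x)"
    and init: "L2_tendsto N u f (at_right 0)" and init': "L2_tendsto N ut (\<lambda>_ _. 0) (at_right 0)"
    using S by (auto simp: wave_solution_def)
  have fL: "in_L2N N f" using init by (simp add: L2_tendsto_def)
  have vel: "pairing N (ut t) g = pairing N f (solt g t)" if t: "t > 0" for t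
  proof -
    define \<psi> where "\<psi> s = pairing N (ut s) (sol g (t - s)) + pairing N (u s) (solt g (t - s))" for s
    have "pairing N (\<lambda>_ _. 0) (sol g t) + pairing N f (solt g t) = pairing N (ut t) g + pairing N (u t) (\<lambda>_ _. 0)"
    proof (rule constant_limits[of 0 t \<psi>, OF t])
      fix s assume s: "0 < s" "s < t"
      have "pairing N (utt s) (sol g (t - s)) = pairing N (u s) (solxx g (t - s))"
        using star_H_pairing_sol[OF g H[OF s(1)], of "t - s"] s by simp
      then show "(\<psi> has_vector_derivative 0) (at s)"
        using has_vector_derivative_add[OF pairing_has_deriv[OF u'[OF s(1)] sol_reversed_deriv[OF g s(2)]]
            pairing_has_deriv[OF u[OF s(1)] solt_reversed_deriv[OF g s(2)]]]
        by (simp add: \<psi>_def[abs_def])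
    next
      have "L2_tendsto N (\<lambda>s. solt g (t - s)) (solt g t) (at_right 0)"
        using L2_has_deriv_continuous[OF solt_reversed_deriv[OF g, of 0 t]] t
        by (auto intro: L2_tendsto_mono at_le)
      then show "(\<psi> \<longlongrightarrow> pairing N (\<lambda>_ _. 0) (sol g t) + pairing N f (solt g t)) (at_right 0)"
        unfolding \<psi>_def by (intro tendsto_add pairing_tendsto init init' sol_reversed_start g t)
      have "filterlim (\<lambda>s. t - s) (at_right 0) (at_left t)"
        by (auto simp: filterlim_at eventually_at_filter intro!: tendsto_eq_intros)
      then have "L2_tendsto N (\<lambda>s. solt g (t - s)) (\<lambda>_ _. 0) (at_left t)"
        by (rule L2_tendsto_compose[OF solt_initial[OF g]])
      then show "(\<psi> \<longlongrightarrow> pairing N (ut t) g + pairing N (u t) (\<lambda>_ _. 0)) (at_left t)"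
        unfolding \<psi>_def
        by (intro tendsto_add pairing_tendsto sol_reversed_final g
            L2_tendsto_mono[OF L2_has_deriv_continuous[OF u[OF t]]]
            L2_tendsto_mono[OF L2_has_deriv_continuous[OF u'[OF t]]] at_le) simp_all
    qed
    then show ?thesis by simp
  qed
  define \<phi> where "\<phi> s = pairing N (u s) g - pairing N f (sol g s)" for s
  have const: "L2_has_deriv N (\<lambda>_. w) (\<lambda>_ _. 0) s" if "in_L2N N w" for w s
    using that by (auto simp: L2_has_deriv_def L2_tendsto_def in_L2N_def in_L2_def set_borel_measurable_def
        set_integrable_def L2_norm_def)
  have d: "(\<phi> has_vector_derivative 0) (at s)" if s: "s > 0" for s
    using has_vector_derivative_diff[OF pairing_has_deriv[OF u[OF s] const[OF test_data_in_L2N[OF g]]]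
        pairing_has_deriv[OF const[OF fL] L2_has_deriv_sol[OF g s]]] vel[OF s]
    by (simp add: \<phi>_def[abs_def])
  have "pairing N f g - pairing N f g = \<phi> t"
  proof (rule constant_limits[of 0 t \<phi>, OF t d])
    show "(\<phi> \<longlongrightarrow> pairing N f g - pairing N f g) (at_right 0)"
      unfolding \<phi>_def
      by (intro tendsto_diff pairing_tendsto init L2_tendsto_const sol_initial g fL test_data_in_L2N)
    show "(\<phi> \<longlongrightarrow> \<phi> t) (at_left t)"
      using has_vector_derivative_continuous[OF d[OF t]] by (simp add: continuous_within filterlim_at_split)
  qed
  then show ?thesis by (simp add: \<phi>_def)
qed

lemma solution_unique:
  assumes "wave_solution N \<alpha> f u" "test_data f" "t > 0" "j \<in> {1..N}"
  shows "AE x in lborel. 0 < x \<longrightarrow> u t j x = sol f t j x"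
proof (rule AE_eq_sol)
  show "in_L2N N (u t)" using assms(1,3) by (auto simp: wave_solution_def L2_has_deriv_def)
qed (use assms solution_dual solution_sol in auto)

end

section \<open>Uniqueness for the cylinder problem\<close>

locale cylinder_evolution = second_order_evolution _ _ _ _ "-1" +
  assumes ev_final_bound: "schwartz h \<Longrightarrow> \<exists>C. \<forall>t\<ge>1. \<forall>x>0. cmod (ev h t x) \<le> C / (1 + x)"
    and ev_final: "\<lbrakk>schwartz h; x > 0\<rbrakk> \<Longrightarrow> ((\<lambda>t. ev h t x) \<longlongrightarrow> 0) at_top"
    and evt_final_bound: "schwartz h \<Longrightarrow> \<exists>C. \<forall>t\<ge>1. \<forall>x>0. cmod (evt h t x) \<le> C / (1 + x)"
begin

lemma sol_final: assumes f: "test_data f" shows "L2_tendsto N (sol f) (\<lambda>_ _. 0) at_top"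
proof -
  have "\<forall>\<^sub>F t in at_top. t \<in> {1::real..}" by (simp add: eventually_ge_at_top)
  then show ?thesis
  proof (rule L2_tendsto_uniform[OF sequential_at_top trivial_limit_at_top_linorder])
    show "((\<lambda>t. sol f t j x) \<longlongrightarrow> 0) at_top" if "j \<in> {1..N}" "x > 0" for j x
      using ev_final[OF ext_schwartz[OF f that(1)] that(2)] by (simp add: sol_def)
    show "sol f t j \<in> borel_measurable borel" if "j \<in> {1..N}" "t \<in> {1..}" for t j
      using ev_borel[OF ext_schwartz[OF f that(1)]] that(2) by (simp add: sol_def[abs_def])
    show "\<exists>C. \<forall>t\<in>{1..}. \<forall>x>0. cmod (sol f t j x) \<le> C / (1 + x)" if "j \<in> {1..N}" for j
      using ev_final_bound[OF ext_schwartz[OF f that]] by (simp add: sol_def Ball_def)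
  qed simp
qed

lemma solution_sol: assumes f: "test_data f" shows "cylinder_solution N \<alpha> f (sol f)"
proof -
  have main: "L2_has_deriv N (sol f) (solt f t) t \<and> L2_has_deriv N (solt f) (\<lambda>j x. - solxx f t j x) t \<and>
      star_H N \<alpha> (sol f t) (\<lambda>j x. - solxx f t j x)" if t: "t > 0" for t
    using L2_has_deriv_sol[OF f t] L2_has_deriv_solt[OF f t] star_H_sol[OF f t] by simp
  have "\<exists>ut utt. \<forall>t>0. L2_has_deriv N (sol f) (ut t) t \<and> L2_has_deriv N ut (utt t) t \<and> star_H N \<alpha> (sol f t) (utt t)"
    by (rule exI[of _ "solt f"], rule exI[of _ "\<lambda>t j x. - solxx f t j x"]) (use main in simp)
  then show ?thesis unfolding cylinder_solution_def using sol_initial[OF f] sol_final[OF f] by blast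
qed

text \<open>This is paired with a solution u that tends to 0 in norm, so a bound for large times
  makes that pairing tend to 0.\<close>

lemma solt_norm_bounded:
  assumes g: "test_data g" shows "\<exists>K. \<forall>t\<ge>1. L2_norm N (solt g t) \<le> K"
proof -
  have "\<exists>K. \<forall>t\<ge>1. (LBINT x:{0<..}. (cmod (solt g t j x))\<^sup>2) \<le> K" if j: "j \<in> {1..N}" for j
  proof -
    obtain C where C: "\<And>t x. t \<ge> 1 \<Longrightarrow> x > 0 \<Longrightarrow> cmod (solt g t j x) \<le> C / (1 + x)"
      using evt_final_bound[OF ext_schwartz[OF g j]] unfolding solt_def by blast
    have "(LBINT x:{0<..}. (cmod (solt g t j x))\<^sup>2) \<le> (LBINT x. indicator {0<..} x *\<^sub>R (C / (1 + x))\<^sup>2)"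
      if t: "t \<ge> 1" for t
      unfolding set_lebesgue_integral_def
    proof (rule integral_mono)
      have "solt g t j \<in> borel_measurable borel"
        using evt_borel[OF ext_schwartz[OF g j], of t] t by (simp add: solt_def[abs_def])
      from in_L2_weightI[OF this C[OF t]]
      show "integrable lborel (\<lambda>x. indicator {0<..} x *\<^sub>R (cmod (solt g t j x))\<^sup>2)" by (rule in_L2_square)
      show "indicator {0<..} x *\<^sub>R (cmod (solt g t j x))\<^sup>2 \<le> indicator {0<..} x *\<^sub>R (C / (1 + x))\<^sup>2" for x
        using C[OF t, of x] by (auto simp: indicator_def intro!: power_mono)
    qed (rule half_line_weight_integrable)
    then show ?thesis by blast
  qed
  then have "\<forall>j\<in>{1..N}. \<exists>K. \<forall>t\<ge>1. (LBINT x:{0<..}. (cmod (solt g t j x))\<^sup>2) \<le> K" by blast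
  from bchoice[OF this] obtain K where
    K: "\<forall>j\<in>{1..N}. \<forall>t\<ge>1. (LBINT x:{0<..}. (cmod (solt g t j x))\<^sup>2) \<le> K j" by blast
  then have "\<forall>t\<ge>1. L2_norm N (solt g t) \<le> sqrt (\<Sum>j=1..N. K j)"
    unfolding L2_norm_def by (intro allI impI real_sqrt_le_mono sum_mono) blast
  then show ?thesis by blast
qed

text \<open>
  In the quadrant \<open>s, r > 0\<close> the pairing of \<open>u(s)\<close> with the explicit solution at time \<open>r\<close> satisfies
  the one-dimensional wave equation. The decay of \<open>u\<close> at infinity eliminates one of the two
  travelling waves, so that it depends on \<open>s + r\<close> only.
\<close>

lemma solution_dual:
  assumes S: "cylinder_solution N \<alpha> f u" and g: "test_data g" and t: "t > 0"
  shows "pairing N (u t) g = pairing N f (sol g t)"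
proof -
  obtain ut utt where u: "\<And>t. t > 0 \<Longrightarrow> L2_has_deriv N u (ut t) t"
    and u': "\<And>t. t > 0 \<Longrightarrow> L2_has_deriv N ut (utt t) t"
    and H: "\<And>t. t > 0 \<Longrightarrow> star_H N \<alpha> (u t) (utt t)"
    and init: "L2_tendsto N u f (at_right 0)" and final: "L2_tendsto N u (\<lambda>_ _. 0) at_top"
    using S by (auto simp: cylinder_solution_def)
  have shift: "L2_has_deriv N (\<lambda>s. sol g (s - T)) (solt g (s - T)) s"
    "L2_has_deriv N (\<lambda>s. solt g (s - T)) (\<lambda>j x. - solxx g (s - T) j x) s" if "s > T" for s T
    using L2_has_deriv_affine[of N "sol g" "solt g (s - T)" "- T" 1 s] L2_has_deriv_sol[OF g, of "s - T"]
      L2_has_deriv_affine[of N "solt g" "\<lambda>j x. - solxx g (s - T) j x" "- T" 1 s] L2_has_deriv_solt[OF g, of "s - T"] that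
    by simp_all
  have transport: "pairing N (ut s) (sol g r) = pairing N (u s) (solt g r)" if s: "s > 0" and r: "r > 0" for s r
  proof -
    \<comment> \<open>The point (s, r) lies on the characteristic s - r = T, parametrised by
      \<sigma>; T0 is where it enters the quadrant of positive times. With b the pairing as a
      function of the two times, \<open>c\<close> is b_s - b_r.\<close>
    define T where "T = s - r"
    define T0 where "T0 = max T 0"
    define c where "c \<sigma> = pairing N (ut \<sigma>) (sol g (\<sigma> - T)) - pairing N (u \<sigma>) (solt g (\<sigma> - T))" for \<sigma>
    define b where "b \<sigma> = pairing N (u \<sigma>) (sol g (\<sigma> - T))" for \<sigma>
    define q where "q \<sigma> = pairing N (u \<sigma>) (solt g (\<sigma> - T))" for \<sigma>
    have dc: "(c has_vector_derivative 0) (at \<sigma>)" if "\<sigma> > T0" for \<sigma>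
    proof -
      have \<sigma>: "\<sigma> > 0" "\<sigma> > T" using that by (auto simp: T0_def)
      have "pairing N (utt \<sigma>) (sol g (\<sigma> - T)) = - pairing N (u \<sigma>) (solxx g (\<sigma> - T))"
        using star_H_pairing_sol[OF g H[OF \<sigma>(1)], of "\<sigma> - T"] \<sigma> by simp
      then show ?thesis
        using has_vector_derivative_diff[OF pairing_has_deriv[OF u'[OF \<sigma>(1)] shift(1)[OF \<sigma>(2)]]
            pairing_has_deriv[OF u[OF \<sigma>(1)] shift(2)[OF \<sigma>(2)]]]
        by (simp add: c_def[abs_def])
    qed
    \<comment> \<open>Along the characteristic b changes at the rate b_s + b_r, which is c + 2 q
      since q is b_r.\<close>
    have db: "(b has_vector_derivative (c \<sigma> + 2 * q \<sigma>)) (at \<sigma>)" if "\<sigma> > T0" for \<sigma>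
    proof -
      have \<sigma>: "\<sigma> > 0" "\<sigma> > T" using that by (auto simp: T0_def)
      show ?thesis using pairing_has_deriv[OF u[OF \<sigma>(1)] shift(1)[OF \<sigma>(2)]]
        by (simp add: b_def[abs_def] c_def q_def add.commute)
    qed
    have "\<exists>k. \<forall>\<sigma>\<in>{T0<..}. c \<sigma> = k"
      by (rule has_derivative_zero_constant)
         (use dc in \<open>auto simp: has_vector_derivative_def intro: has_derivative_at_withinI\<close>)
    then obtain k where k: "\<And>\<sigma>. \<sigma> > T0 \<Longrightarrow> c \<sigma> = k" by auto
    have shift_top: "filterlim (\<lambda>\<sigma>::real. \<sigma> - T) at_top at_top"
      using filterlim_tendsto_add_at_top[OF tendsto_const[of "- T"] filterlim_ident] by simp
    have b_lim: "(b \<longlongrightarrow> 0) at_top"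
      using pairing_tendsto[OF final L2_tendsto_compose[OF sol_final[OF g] shift_top]]
      by (simp add: b_def[abs_def])
    have q_lim: "(q \<longlongrightarrow> 0) at_top"
    proof -
      obtain K where K: "\<And>t. t \<ge> 1 \<Longrightarrow> L2_norm N (solt g t) \<le> K" using solt_norm_bounded[OF g] by blast
      have "\<forall>\<^sub>F \<sigma> in at_top. norm (q \<sigma>) \<le> N * (L2_norm N (u \<sigma>) * K)"
        using eventually_ge_at_top[of "T0 + 1"]
      proof eventually_elim
        case (elim \<sigma>)
        then have \<sigma>: "\<sigma> > 0" "\<sigma> > T" "\<sigma> - T \<ge> 1" by (auto simp: T0_def)
        have "norm (q \<sigma>) \<le> N * (L2_norm N (u \<sigma>) * L2_norm N (solt g (\<sigma> - T)))"
          unfolding q_def using u[OF \<sigma>(1)] shift(2)[OF \<sigma>(2)] by (intro pairing_bound) (auto simp: L2_has_deriv_def)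
        also have "\<dots> \<le> N * (L2_norm N (u \<sigma>) * K)"
          by (intro mult_left_mono K \<sigma>) (auto simp: L2_norm_nonneg)
        finally show ?case .
      qed
      moreover have "((\<lambda>\<sigma>. N * (L2_norm N (u \<sigma>) * K)) \<longlongrightarrow> real N * (0 * K)) at_top"
        using final by (intro tendsto_intros) (simp add: L2_tendsto_def)
      ultimately show ?thesis using Lim_null_comparison by fastforce
    qed
    \<comment> \<open>Far out, b and q are smaller than |k|/4. Over an interval of length 1 the
      increment of b would have to equal k up to an error of |k|/2, although it is smaller than
      |k|/2.\<close>
    have "k = 0"
    proof (rule ccontr)
      assume "k \<noteq> 0"
      then have e: "cmod k / 4 > 0" by simp
      have "\<forall>\<^sub>F \<sigma> in at_top. cmod (q \<sigma>) < cmod k / 4" "\<forall>\<^sub>F \<sigma> in at_top. cmod (b \<sigma>) < cmod k / 4"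
        using tendstoD[OF q_lim e] tendstoD[OF b_lim e] by simp_all
      from eventually_conj[OF this] obtain R where R: "\<And>\<sigma>. \<sigma> \<ge> R \<Longrightarrow> cmod (q \<sigma>) < cmod k / 4 \<and> cmod (b \<sigma>) < cmod k / 4"
        by (auto simp: eventually_at_top_linorder)
      define \<sigma> where "\<sigma> = max R (T0 + 1)"
      have "cmod ((b (\<sigma> + 1) - of_real (\<sigma> + 1) * k) - (b \<sigma> - of_real \<sigma> * k)) \<le> \<bar>\<sigma> + 1 - \<sigma>\<bar> * (2 * (cmod k / 4))"
      proof (rule vector_derivative_bound[where f' = "\<lambda>\<tau>. 2 * q \<tau>"])
        fix \<tau> assume "\<tau> \<in> closed_segment \<sigma> (\<sigma> + 1)"
        then have \<tau>: "\<tau> \<ge> R" "\<tau> > T0" by (auto simp: closed_segment_eq_real_ivl \<sigma>_def)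
        have "((\<lambda>\<tau>. of_real \<tau> * k) has_vector_derivative k) (at \<tau>)"
          using has_vector_derivative_scaleR[of "\<lambda>x. x" 1 \<tau> UNIV "\<lambda>_. k" 0] by (simp add: scaleR_conv_of_real)
        from has_vector_derivative_diff[OF db[OF \<tau>(2)] this]
        show "((\<lambda>\<tau>. b \<tau> - of_real \<tau> * k) has_vector_derivative 2 * q \<tau>) (at \<tau>)" by (simp add: k[OF \<tau>(2)])
        show "cmod (2 * q \<tau>) \<le> 2 * (cmod k / 4)" using R[OF \<tau>(1)] by (simp add: norm_mult)
      qed
      moreover define d where "d = (b (\<sigma> + 1) - of_real (\<sigma> + 1) * k) - (b \<sigma> - of_real \<sigma> * k)"
      moreover have "k = b (\<sigma> + 1) - b \<sigma> - d"
        by (simp add: d_def algebra_simps)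
      then have "cmod k \<le> cmod (b (\<sigma> + 1)) + cmod (b \<sigma>) + cmod d"
        using norm_triangle_ineq4[of "b (\<sigma> + 1) - b \<sigma>" d] norm_triangle_ineq4[of "b (\<sigma> + 1)" "b \<sigma>"] by simp
      moreover have "cmod (b (\<sigma> + 1)) < cmod k / 4" "cmod (b \<sigma>) < cmod k / 4"
        using R[of \<sigma>] R[of "\<sigma> + 1"] by (auto simp: \<sigma>_def)
      ultimately show False by simp
    qed
    moreover have "s > T0" using s r by (auto simp: T0_def T_def)
    ultimately show ?thesis using k[of s] by (simp add: c_def T_def)
  qed
  define \<phi> where "\<phi> s = pairing N (u s) (sol g (t - s))" for s
  have "pairing N f (sol g t) = pairing N (u t) g"
  proof (rule constant_limits[of 0 t \<phi>, OF t])
    fix s assume s: "0 < s" "s < t"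
    show "(\<phi> has_vector_derivative 0) (at s)"
      using pairing_has_deriv[OF u[OF s(1)] sol_reversed_deriv[OF g s(2)]] transport[of s "t - s"] s
      by (simp add: \<phi>_def[abs_def])
  next
    show "(\<phi> \<longlongrightarrow> pairing N f (sol g t)) (at_right 0)"
      unfolding \<phi>_def by (intro pairing_tendsto init sol_reversed_start g t)
    show "(\<phi> \<longlongrightarrow> pairing N (u t) g) (at_left t)"
      unfolding \<phi>_def
      by (intro pairing_tendsto sol_reversed_final g L2_tendsto_mono[OF L2_has_deriv_continuous[OF u[OF t]]] at_le) simp
  qed
  then show ?thesis by simp
qed

lemma solution_unique:
  assumes "cylinder_solution N \<alpha> f u" "test_data f" "t > 0" "j \<in> {1..N}"
  shows "AE x in lborel. 0 < x \<longrightarrow> u t j x = sol f t j x"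
proof (rule AE_eq_sol)
  show "in_L2N N (u t)" using assms(1,3) by (auto simp: cylinder_solution_def L2_has_deriv_def)
qed (use assms solution_dual solution_sol in auto)

end

section \<open>Convolution with kernels of at most quadratic growth\<close>

definition conv :: "(real \<Rightarrow> complex) \<Rightarrow> (real \<Rightarrow> complex) \<Rightarrow> real \<Rightarrow> complex" where
  "conv A h x = (LBINT z. A z * h (x - z))"

text \<open>The time derivative of the Schroedinger kernel grows like z^2, its exponential factor
  having modulus one; convolutions with it converge by the decay of the Schwartz function
  alone.\<close>

definition quadratic_growth :: "(real \<Rightarrow> complex) \<Rightarrow> bool" where
  "quadratic_growth A \<longleftrightarrow> A \<in> borel_measurable borel \<and> (\<exists>M. \<forall>z. cmod (A z) \<le> M * (1 + z\<^sup>2))"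

lemma quadratic_growthI:
  "A \<in> borel_measurable borel \<Longrightarrow> (\<And>z. cmod (A z) \<le> M * (1 + z\<^sup>2)) \<Longrightarrow> quadratic_growth A"
  by (auto simp: quadratic_growth_def)

lemma quadratic_growth_bounded:
  assumes "A \<in> borel_measurable borel" "\<And>z. cmod (A z) \<le> M" shows "quadratic_growth A"
proof (rule quadratic_growthI[OF assms(1)])
  fix z :: real
  have "M \<ge> 0" using order_trans[OF norm_ge_zero assms(2)] .
  have "cmod (A z) \<le> M * 1" using assms(2) by simp
  also have "\<dots> \<le> M * (1 + z\<^sup>2)" using \<open>M \<ge> 0\<close> by (intro mult_left_mono) auto
  finally show "cmod (A z) \<le> M * (1 + z\<^sup>2)" .
qed

text \<open>Peetre's inequality; the difference of the two sides is a sum of squares.\<close>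

lemma one_plus_square_shift: "1 + z\<^sup>2 \<le> 2 * (1 + x\<^sup>2) * (1 + (x - z)\<^sup>2)" for x z :: real
proof -
  have "2 * (1 + x\<^sup>2) * (1 + (x - z)\<^sup>2) - (1 + z\<^sup>2) = 1 + (2 * x - z)\<^sup>2 + 2 * x\<^sup>2 * (x - z)\<^sup>2"
    by (simp add: power2_eq_square algebra_simps)
  moreover have "\<dots> \<ge> 0" by simp
  ultimately show ?thesis by linarith
qed

text \<open>The majorant depends on x only through the bound X, which is the uniformity required for
  differentiating under the integral in x.\<close>

lemma conv_integrand_bound:
  assumes A: "\<And>z. cmod (A z) \<le> M * (1 + z\<^sup>2)" and h: "\<And>y. cmod (h y) \<le> C / (1 + y\<^sup>2)\<^sup>2"
    and x: "\<bar>x\<bar> \<le> X"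
  shows "cmod (A z * h (x - z)) \<le> 4 * M * C * (1 + X\<^sup>2)\<^sup>2 * (1 / (1 + z\<^sup>2))"
proof -
  have pos: "0 < 1 + z\<^sup>2" for z :: real by (intro add_pos_nonneg) auto
  have M: "M \<ge> 0" using order_trans[OF norm_ge_zero A[of 0]] by simp
  have C: "C \<ge> 0" using order_trans[OF norm_ge_zero h[of 0]] by simp
  have "x\<^sup>2 \<le> X\<^sup>2" using x by (intro power2_le_iff_abs_le[THEN iffD2]) auto
  then have xX: "(1 + x\<^sup>2)\<^sup>2 \<le> (1 + X\<^sup>2)\<^sup>2" by (intro power_mono) auto
  have "(1 + z\<^sup>2)\<^sup>2 \<le> (2 * (1 + x\<^sup>2) * (1 + (x - z)\<^sup>2))\<^sup>2"
    using one_plus_square_shift[of z x] pos[of z] by (intro power_mono) auto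
  also have "\<dots> = 4 * (1 + x\<^sup>2)\<^sup>2 * (1 + (x - z)\<^sup>2)\<^sup>2" unfolding power_mult_distrib by simp
  finally have key: "(1 + z\<^sup>2)\<^sup>2 \<le> 4 * (1 + x\<^sup>2)\<^sup>2 * (1 + (x - z)\<^sup>2)\<^sup>2" .
  have "1 / (1 + (x - z)\<^sup>2)\<^sup>2 \<le> 4 * (1 + x\<^sup>2)\<^sup>2 / (1 + z\<^sup>2)\<^sup>2"
    using key pos[of z] pos[of "x - z"] by (simp add: divide_simps mult.commute)
  then have "C / (1 + (x - z)\<^sup>2)\<^sup>2 \<le> C * (4 * (1 + x\<^sup>2)\<^sup>2 / (1 + z\<^sup>2)\<^sup>2)"
    using mult_left_mono[OF _ C] by fastforce
  with h[of "x - z"] have h': "cmod (h (x - z)) \<le> C * (4 * (1 + x\<^sup>2)\<^sup>2 / (1 + z\<^sup>2)\<^sup>2)" by linarith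
  have "cmod (A z * h (x - z)) \<le> (M * (1 + z\<^sup>2)) * (C * (4 * (1 + x\<^sup>2)\<^sup>2 / (1 + z\<^sup>2)\<^sup>2))"
    unfolding norm_mult using M pos[of z] by (intro mult_mono A h') auto
  also have "\<dots> = 4 * M * C * (1 + x\<^sup>2)\<^sup>2 * (1 / (1 + z\<^sup>2))"
    using pos[of z] by (simp add: power2_eq_square[of "1 + z\<^sup>2"])
  also have "\<dots> \<le> 4 * M * C * (1 + X\<^sup>2)\<^sup>2 * (1 / (1 + z\<^sup>2))"
    using M C pos[of z] xX by (intro mult_right_mono mult_left_mono) auto
  finally show ?thesis .
qed

lemma conv_measurable:
  assumes "A \<in> borel_measurable borel" "schwartz h"
  shows "(\<lambda>z. A z * h (x - z)) \<in> borel_measurable lborel"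
proof -
  have [measurable]: "A \<in> borel_measurable borel" "h \<in> borel_measurable borel"
    using assms schwartz_borel by auto
  show ?thesis by measurable
qed

lemma conv_integrable:
  assumes A: "quadratic_growth A" and h: "schwartz h"
  shows "integrable lborel (\<lambda>z. A z * h (x - z))"
proof -
  obtain M where M: "\<And>z. cmod (A z) \<le> M * (1 + z\<^sup>2)" using A by (auto simp: quadratic_growth_def)
  obtain C where C: "\<And>y. cmod (h y) \<le> C / (1 + y\<^sup>2)\<^sup>2" by (rule schwartz_bound[OF h]) blast
  show ?thesis
  proof (rule Bochner_Integration.integrable_bound)
    show "integrable lborel (\<lambda>z. 4 * M * C * (1 + \<bar>x\<bar>\<^sup>2)\<^sup>2 * (1 / (1 + z\<^sup>2)))"
      by (intro integrable_mult_right integrable_Lorentz)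
    show "AE z in lborel. norm (A z * h (x - z)) \<le> norm (4 * M * C * (1 + \<bar>x\<bar>\<^sup>2)\<^sup>2 * (1 / (1 + z\<^sup>2)))"
      unfolding real_norm_def by (intro AE_I2 order_trans[OF conv_integrand_bound[OF M C order_refl] abs_ge_self])
  qed (rule conv_measurable; use A h in \<open>simp add: quadratic_growth_def\<close>)
qed

lemma conv_reflected: "conv A h x = (LBINT z. A (x - z) * h z)"
  unfolding conv_def by (subst lborel_integral_real_affine[where c = "-1" and t = x]) auto

section \<open>Derivatives of convolutions in space and in a parameter\<close>

lemma differentiation_under_integral:
  fixes f g :: "real \<Rightarrow> 'a \<Rightarrow> 'b::{banach, second_countable_topology}"
  assumes \<delta>: "\<delta> > 0"
    and d: "\<And>s z. \<bar>s - t\<bar> < \<delta> \<Longrightarrow> z \<in> space M \<Longrightarrow> ((\<lambda>s. f s z) has_vector_derivative g s z) (at s)"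
    and b: "\<And>s z. \<bar>s - t\<bar> < \<delta> \<Longrightarrow> z \<in> space M \<Longrightarrow> norm (g s z) \<le> w z"
    and f: "\<And>s. \<bar>s - t\<bar> < \<delta> \<Longrightarrow> integrable M (f s)" and w: "integrable M w"
    and g: "g t \<in> borel_measurable M"
  shows "((\<lambda>s. \<integral>z. f s z \<partial>M) has_vector_derivative (\<integral>z. g t z \<partial>M)) (at t)"
  unfolding has_vector_derivative_iff_tendsto
proof (rule Lim_transform_eventually)
  have near: "\<forall>\<^sub>F s in at t. \<bar>s - t\<bar> < \<delta> \<and> s \<noteq> t"
    using \<delta> by (auto simp: eventually_at dist_real_def)
  show "((\<lambda>s. \<integral>z. (f s z - f t z) /\<^sub>R (s - t) \<partial>M) \<longlongrightarrow> (\<integral>z. g t z \<partial>M)) (at t)"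
  proof (rule integral_dominated_convergence_filter[OF sequential_at g _ w])
    show "\<forall>\<^sub>F s in at t. (\<lambda>z. (f s z - f t z) /\<^sub>R (s - t)) \<in> borel_measurable M"
      using near
    proof eventually_elim
      case (elim s)
      have "f s \<in> borel_measurable M" "f t \<in> borel_measurable M"
        using f[of s] f[of t] elim \<delta> by auto
      then show ?case by measurable
    qed
    show "AE z in M. ((\<lambda>s. (f s z - f t z) /\<^sub>R (s - t)) \<longlongrightarrow> g t z) (at t)"
      using d[of t] \<delta> by (intro AE_I2) (auto simp: has_vector_derivative_iff_tendsto)
    show "\<forall>\<^sub>F s in at t. AE z in M. norm ((f s z - f t z) /\<^sub>R (s - t)) \<le> w z"
      using near
    proof eventually_elim
      case (elim s)
      show ?case
      proof (rule AE_I2)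
        fix z assume z: "z \<in> space M"
        have "norm (f s z - f t z) \<le> \<bar>s - t\<bar> * w z"
        proof (rule vector_derivative_bound)
          fix r assume "r \<in> closed_segment t s"
          then have r: "\<bar>r - t\<bar> < \<delta>" using elim by (auto simp: closed_segment_eq_real_ivl split: if_splits)
          show "((\<lambda>s. f s z) has_vector_derivative g r z) (at r)" using d[OF r z] .
          show "norm (g r z) \<le> w z" using b[OF r z] .
        qed
        then have "inverse \<bar>s - t\<bar> * norm (f s z - f t z) \<le> inverse \<bar>s - t\<bar> * (\<bar>s - t\<bar> * w z)"
          by (rule mult_left_mono) simp
        also have "\<dots> = w z" using elim by (simp add: mult.assoc[symmetric])
        finally show "norm ((f s z - f t z) /\<^sub>R (s - t)) \<le> w z" by simp
      qed
    qed
  qed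
  show "\<forall>\<^sub>F s in at t. (\<integral>z. (f s z - f t z) /\<^sub>R (s - t) \<partial>M) = ((\<integral>z. f s z \<partial>M) - (\<integral>z. f t z \<partial>M)) /\<^sub>R (s - t)"
    using near
  proof eventually_elim
    case (elim s)
    then show ?case using f[of s] f[of t] \<delta> by simp
  qed
qed

lemma conv_vderiv:
  assumes A: "quadratic_growth A" and h: "schwartz h"
  shows "(conv A h has_vector_derivative conv A (vderiv h) x) (at x)"
proof -
  obtain M where M: "\<And>z. cmod (A z) \<le> M * (1 + z\<^sup>2)" using A by (auto simp: quadratic_growth_def)
  obtain C where C: "\<And>y. cmod (vderiv h y) \<le> C / (1 + y\<^sup>2)\<^sup>2" by (rule schwartz_bound[OF schwartz_vderiv[OF h]]) blast
  show ?thesis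
    unfolding conv_def[abs_def]
  proof (rule differentiation_under_integral[where \<delta> = 1 and w = "\<lambda>z. 4 * M * C * (1 + (\<bar>x\<bar> + 1)\<^sup>2)\<^sup>2 * (1 / (1 + z\<^sup>2))"])
    fix s z :: real assume s: "\<bar>s - x\<bar> < 1"
    have "((h \<circ> (\<lambda>s. s - z)) has_vector_derivative 1 *\<^sub>R vderiv h (s - z)) (at s)"
      by (rule vector_diff_chain_at) (auto intro!: derivative_eq_intros smooth_vderiv_at[OF schwartz_smooth[OF h]]
            simp: has_real_derivative_iff_has_vector_derivative[symmetric])
    then show "((\<lambda>s. A z * h (s - z)) has_vector_derivative A z * vderiv h (s - z)) (at s)"
      by (intro has_vector_derivative_mult_right) (simp add: o_def)
    show "cmod (A z * vderiv h (s - z)) \<le> 4 * M * C * (1 + (\<bar>x\<bar> + 1)\<^sup>2)\<^sup>2 * (1 / (1 + z\<^sup>2))"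
      by (rule conv_integrand_bound[OF M C]) (use s in auto)
  next
    show "integrable lborel (\<lambda>z. 4 * M * C * (1 + (\<bar>x\<bar> + 1)\<^sup>2)\<^sup>2 * (1 / (1 + z\<^sup>2)))"
      by (intro integrable_mult_right integrable_Lorentz)
    show "integrable lborel (\<lambda>z. A z * h (s - z))" for s by (rule conv_integrable[OF A h])
    show "(\<lambda>z. A z * vderiv h (x - z)) \<in> borel_measurable lborel"
      using A h by (intro conv_measurable schwartz_vderiv) (simp_all add: quadratic_growth_def)
  qed simp
qed

lemma conv_continuous: "quadratic_growth A \<Longrightarrow> schwartz h \<Longrightarrow> continuous_on UNIV (conv A h)"
  by (meson continuous_at_imp_continuous_on conv_vderiv has_vector_derivative_continuous)

lemma conv_deriv_parameter:
  assumes \<delta>: "\<delta> > 0" and A: "\<And>s. \<bar>s - t\<bar> < \<delta> \<Longrightarrow> quadratic_growth (A s)" and h: "schwartz h"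
    and d: "\<And>s z. \<bar>s - t\<bar> < \<delta> \<Longrightarrow> ((\<lambda>s. A s z) has_vector_derivative B s z) (at s)"
    and b: "\<And>s z. \<bar>s - t\<bar> < \<delta> \<Longrightarrow> cmod (B s z) \<le> M * (1 + z\<^sup>2)"
    and B: "B t \<in> borel_measurable borel"
  shows "((\<lambda>s. conv (A s) h x) has_vector_derivative conv (B t) h x) (at t)"
proof -
  obtain C where C: "\<And>y. cmod (h y) \<le> C / (1 + y\<^sup>2)\<^sup>2" by (rule schwartz_bound[OF h]) blast
  show ?thesis unfolding conv_def
  proof (rule differentiation_under_integral[OF \<delta>, where w = "\<lambda>z. 4 * M * C * (1 + \<bar>x\<bar>\<^sup>2)\<^sup>2 * (1 / (1 + z\<^sup>2))"])
    fix s z assume s: "\<bar>s - t\<bar> < \<delta>"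
    show "((\<lambda>s. A s z * h (x - z)) has_vector_derivative B s z * h (x - z)) (at s)"
      by (rule has_vector_derivative_mult_left[OF d[OF s]])
    show "cmod (B s z * h (x - z)) \<le> 4 * M * C * (1 + \<bar>x\<bar>\<^sup>2)\<^sup>2 * (1 / (1 + z\<^sup>2))"
      by (rule conv_integrand_bound[OF b[OF s] C]) auto
  next
    show "integrable lborel (\<lambda>z. A s z * h (x - z))" if "\<bar>s - t\<bar> < \<delta>" for s
      by (rule conv_integrable[OF A[OF that] h])
    show "integrable lborel (\<lambda>z. 4 * M * C * (1 + \<bar>x\<bar>\<^sup>2)\<^sup>2 * (1 / (1 + z\<^sup>2)))"
      by (intro integrable_mult_right integrable_Lorentz)
  qed (use conv_measurable[OF B h] in simp)
qed

section \<open>Integration by parts on the line\<close>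

lemma integral_half_line_FTC:
  fixes F f :: "real \<Rightarrow> complex"
  assumes d: "\<And>x. (F has_vector_derivative f x) (at x)" and c: "continuous_on UNIV f"
    and i: "integrable lborel f" and lim: "(F \<longlongrightarrow> 0) at_top"
  shows "(LBINT x:{0<..}. f x) = - F 0"
proof -
  have "(LBINT x=ereal 0..\<infinity>. f x) = 0 - F 0"
  proof (rule interval_integral_FTC_integrable)
    show "set_integrable lborel (einterval (ereal 0) \<infinity>) f"
      unfolding set_integrable_def using i by (intro integrable_mult_indicator) auto
    show "isCont f x" for x using c by (simp add: continuous_on_eq_continuous_at)
    have "isCont F 0" using d by (rule has_vector_derivative_continuous)
    then have "(F \<longlongrightarrow> F 0) (at_right 0)" by (simp add: isCont_def filterlim_at_split)
    then show "((F \<circ> real_of_ereal) \<longlongrightarrow> F 0) (at_right (ereal 0))"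
      by (simp add: at_right_ereal filterlim_filtermap o_def ereal_tendsto_simps)
    show "((F \<circ> real_of_ereal) \<longlongrightarrow> 0) (at_left \<infinity>)"
      using lim by (simp add: at_left_PInf filterlim_filtermap o_def ereal_tendsto_simps)
  qed (use d in auto)
  moreover have "einterval (ereal 0) \<infinity> = {0<..}" by (auto simp: einterval_def)
  ultimately show ?thesis by (simp add: interval_lebesgue_integral_def)
qed

lemma integral_line_split:
  fixes f :: "real \<Rightarrow> complex"
  assumes "integrable lborel f"
  shows "(LBINT x. f x) = (LBINT x:{0<..}. f x) + (LBINT x:{0<..}. f (- x))"
proof -
  have s: "set_integrable lborel S f" if "S \<in> sets lborel" for S
    unfolding set_integrable_def using assms that by (intro integrable_mult_indicator)
  have "(LBINT x. f x) = (LBINT x:{..0} \<union> {0<..}. f x)"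
    unfolding set_lebesgue_integral_def by (intro Bochner_Integration.integral_cong) (auto simp: indicator_def)
  also have "\<dots> = (LBINT x:{..0}. f x) + (LBINT x:{0<..}. f x)"
    by (rule set_integral_Un) (auto intro: s)
  also have "(LBINT x:{..0}. f x) = (LBINT x. indicator {..0} (- x) *\<^sub>R f (- x))"
    unfolding set_lebesgue_integral_def
    by (subst lborel_integral_real_affine[where c = "-1" and t = 0]) auto
  also have "\<dots> = (LBINT x:{0<..}. f (- x))"
    unfolding set_lebesgue_integral_def
  proof (rule integral_cong_AE)
    have [measurable]: "f \<in> borel_measurable borel" using borel_measurable_integrable[OF assms] by simp
    show "(\<lambda>x. indicator {..0} (- x) *\<^sub>R f (- x)) \<in> borel_measurable lborel"
      "(\<lambda>x. indicator {0<..} x *\<^sub>R f (- x)) \<in> borel_measurable lborel" by measurable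
    show "AE x in lborel. indicator {..0} (- x) *\<^sub>R f (- x) = indicator {0<..} x *\<^sub>R f (- x)"
      using AE_lborel_singleton[of "0::real"] by eventually_elim (auto simp: indicator_def)
  qed
  finally show ?thesis by simp
qed

lemma tendsto_at_top_mirror_iff: "(f \<longlongrightarrow> l) at_bot \<longleftrightarrow> ((\<lambda>x::real. f (- x)) \<longlongrightarrow> l) at_top"
  by (simp add: at_bot_mirror filterlim_filtermap)

lemma integral_derivative_line:
  fixes F f :: "real \<Rightarrow> complex"
  assumes d: "\<And>x. (F has_vector_derivative f x) (at x)" and c: "continuous_on UNIV f"
    and i: "integrable lborel f" and lim: "(F \<longlongrightarrow> 0) at_top" "(F \<longlongrightarrow> 0) at_bot"
  shows "(LBINT x. f x) = 0"
proof -
  have "(LBINT x:{0<..}. - f (- x)) = - F (- 0)"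
  proof (rule integral_half_line_FTC)
    show "((\<lambda>x. F (- x)) has_vector_derivative - f (- x)) (at x)" for x
    proof -
      have "((F \<circ> uminus) has_vector_derivative (- 1) *\<^sub>R f (- x)) (at x)"
        by (rule vector_diff_chain_at) (auto intro!: derivative_eq_intros d
            simp: has_real_derivative_iff_has_vector_derivative[symmetric])
      then show ?thesis by (simp add: o_def)
    qed
    show "continuous_on UNIV (\<lambda>x. - f (- x))"
      by (intro continuous_intros continuous_on_compose2[OF c]) auto
    show "integrable lborel (\<lambda>x. - f (- x))"
      using lborel_integrable_real_affine[OF i, of "-1" 0] by simp
    show "((\<lambda>x. F (- x)) \<longlongrightarrow> 0) at_top" using lim(2) by (simp add: tendsto_at_top_mirror_iff)
  qed
  moreover have "(LBINT x:{0<..}. - f (- x)) = - (LBINT x:{0<..}. f (- x))"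
    unfolding set_lebesgue_integral_def by simp
  ultimately show ?thesis
    using integral_half_line_FTC[OF d c i lim(1)] integral_line_split[OF i] by simp
qed

text \<open>The product A(z) h(x - z) is O(1/(1 + z^2)), so no boundary terms arise. This is how
  derivatives pass from a kernel to the data, and how a kernel is replaced by its primitive.\<close>

lemma conv_by_parts:
  assumes d: "\<And>z. (A has_vector_derivative B z) (at z)" and Bc: "continuous_on UNIV B"
    and A: "quadratic_growth A" and B: "quadratic_growth B" and h: "schwartz h"
  shows "conv B h x = conv A (vderiv h) x"
proof -
  have Ac: "continuous_on UNIV A" using d by (meson continuous_at_imp_continuous_on has_vector_derivative_continuous)
  have hc: "continuous_on UNIV (\<lambda>z. h (x - z))" "continuous_on UNIV (\<lambda>z. vderiv h (x - z))"
    using schwartz_smooth[OF h] by (auto intro!: continuous_on_compose2[OF smooth_continuous[of _ UNIV]] continuous_intros)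
  have i1: "integrable lborel (\<lambda>z. B z * h (x - z))" and i2: "integrable lborel (\<lambda>z. A z * vderiv h (x - z))"
    using conv_integrable A B h by blast+
  obtain M where M: "\<And>z. cmod (A z) \<le> M * (1 + z\<^sup>2)" using A by (auto simp: quadratic_growth_def)
  obtain C where C: "\<And>y. cmod (h y) \<le> C / (1 + y\<^sup>2)\<^sup>2" by (rule schwartz_bound[OF h]) blast
  define K where "K = 4 * M * C * (1 + \<bar>x\<bar>\<^sup>2)\<^sup>2"
  have K: "cmod (A z * h (x - z)) \<le> K * (1 / (1 + z\<^sup>2))" for z
    unfolding K_def by (rule conv_integrand_bound[OF M C]) auto
  have "(LBINT z. B z * h (x - z) - A z * vderiv h (x - z)) = 0"
  proof (rule integral_derivative_line[where F = "\<lambda>z. A z * h (x - z)"])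
    show "((\<lambda>z. A z * h (x - z)) has_vector_derivative B z * h (x - z) - A z * vderiv h (x - z)) (at z)" for z
    proof -
      have "((h \<circ> (\<lambda>s. x - s)) has_vector_derivative (- 1) *\<^sub>R vderiv h (x - z)) (at z)"
        by (rule vector_diff_chain_at) (auto intro!: derivative_eq_intros smooth_vderiv_at[OF schwartz_smooth[OF h]]
              simp: has_real_derivative_iff_has_vector_derivative[symmetric])
      from has_vector_derivative_mult[OF d[of z] this[unfolded o_def]] show ?thesis by (simp add: algebra_simps)
    qed
    show "continuous_on UNIV (\<lambda>z. B z * h (x - z) - A z * vderiv h (x - z))"
      by (intro continuous_intros Ac Bc hc)
    show "integrable lborel (\<lambda>z. B z * h (x - z) - A z * vderiv h (x - z))"
      by (intro Bochner_Integration.integrable_diff i1 i2)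
    have "((\<lambda>z::real. K * (1 / (1 + z\<^sup>2))) \<longlongrightarrow> 0) at_top" by real_asymp
    then show "((\<lambda>z. A z * h (x - z)) \<longlongrightarrow> 0) at_top"
      by (rule Lim_null_comparison[rotated]) (use K in auto)
    have "((\<lambda>z::real. K * (1 / (1 + z\<^sup>2))) \<longlongrightarrow> 0) at_bot" by real_asymp
    then show "((\<lambda>z. A z * h (x - z)) \<longlongrightarrow> 0) at_bot"
      by (rule Lim_null_comparison[rotated]) (use K in auto)
  qed
  then show ?thesis using Bochner_Integration.integral_diff[OF i1 i2] by (simp add: conv_def)
qed

lemma conv_norm_bound:
  assumes A: "A \<in> borel_measurable borel" and b: "\<And>z. cmod (A z) \<le> B" and h: "schwartz h"
  shows "cmod (conv A h x) \<le> B * (LBINT z. cmod (h z))"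
proof -
  have i: "integrable lborel (\<lambda>z. A z * h (x - z))"
    by (rule conv_integrable[OF quadratic_growth_bounded[OF A b] h])
  have ih: "integrable lborel (\<lambda>z. cmod (h (x - z)))"
    using lborel_integrable_real_affine[OF schwartz_integrable[OF h], of "-1" x] by (intro integrable_norm) simp
  have "cmod (conv A h x) \<le> (LBINT z. cmod (A z * h (x - z)))"
    unfolding conv_def by (rule integral_norm_bound)
  also have "\<dots> \<le> (LBINT z. B * cmod (h (x - z)))"
    using i ih b by (intro integral_mono integrable_norm) (auto simp: norm_mult intro!: mult_right_mono)
  also have "\<dots> = B * (LBINT z. cmod (h (x - z)))" by simp
  also have "(LBINT z. cmod (h (x - z))) = (LBINT z. cmod (h z))"
    by (subst (2) lborel_integral_real_affine[where c = "-1" and t = x]) auto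
  finally show ?thesis .
qed

text \<open>From x = z + (x - z). Decay of a convolution in x is thereby reduced to bounds involving
  the kernel z A(z) and the Schwartz function z h(z).\<close>

lemma conv_times_id:
  assumes A: "quadratic_growth A" and zA: "quadratic_growth (\<lambda>z. of_real z * A z)" and h: "schwartz h"
  shows "of_real x * conv A h x = conv (\<lambda>z. of_real z * A z) h x + conv A (\<lambda>z. of_real z * h z) x"
proof -
  have "conv (\<lambda>z. of_real z * A z) h x + conv A (\<lambda>z. of_real z * h z) x =
    (LBINT z. of_real z * A z * h (x - z) + A z * (of_real (x - z) * h (x - z)))"
    unfolding conv_def
    by (rule Bochner_Integration.integral_add[symmetric])
       (use conv_integrable[OF zA h, of x] conv_integrable[OF A schwartz_times_id[OF h], of x] in auto)
  also have "\<dots> = (LBINT z. of_real x * (A z * h (x - z)))"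
    by (rule Bochner_Integration.integral_cong) (auto simp: algebra_simps)
  finally show ?thesis unfolding conv_def by simp
qed

section \<open>Evolutions given by a kernel on the line\<close>

text \<open>
  \<open>G\<close> is the kernel, \<open>\<Gamma>\<close> a primitive of \<open>G\<close> in the space variable that is bounded uniformly in
  time, and \<open>R\<close> the time derivative of \<open>G\<close>. Boundedness of \<open>\<Gamma>\<close> replaces integrability of \<open>G\<close>, which
  fails for the Schroedinger kernel.
\<close>

locale line_kernel =
  fixes G \<Gamma> R :: "real \<Rightarrow> real \<Rightarrow> complex" and B :: real
  assumes \<Gamma>_deriv: "t > 0 \<Longrightarrow> (\<Gamma> t has_vector_derivative G t z) (at z)"
    and \<Gamma>_bound: "t > 0 \<Longrightarrow> cmod (\<Gamma> t z) \<le> B"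
    and \<Gamma>_limit: "z \<noteq> 0 \<Longrightarrow> ((\<lambda>t. \<Gamma> t z) \<longlongrightarrow> of_real (sgn z) / 2) (at_right 0)"
    and G_cont: "t > 0 \<Longrightarrow> continuous_on UNIV (G t)"
    and G_bounded: "t > 0 \<Longrightarrow> \<exists>M. \<forall>z. cmod (G t z) \<le> M"
    and G_even: "t > 0 \<Longrightarrow> G t (- z) = G t z"
    and G_weight: "schwartz h \<Longrightarrow> \<exists>C. \<forall>t\<in>{0<..T}. \<forall>x. cmod (conv (\<lambda>z. of_real z * G t z) h x) \<le> C"
    and G_deriv: "t > 0 \<Longrightarrow> ((\<lambda>s. G s z) has_vector_derivative R t z) (at t)"
    and R_cont: "t > 0 \<Longrightarrow> continuous_on UNIV (R t)"
    and R_bound: "t > 0 \<Longrightarrow> \<exists>\<delta>>0. \<exists>M. \<forall>s z. \<bar>s - t\<bar> < \<delta> \<longrightarrow> cmod (R s z) \<le> M * (1 + z\<^sup>2)"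
begin

definition ev :: "(real \<Rightarrow> complex) \<Rightarrow> real \<Rightarrow> real \<Rightarrow> complex" where "ev h t x = conv (G t) h x"
definition evt :: "(real \<Rightarrow> complex) \<Rightarrow> real \<Rightarrow> real \<Rightarrow> complex" where "evt h t x = conv (R t) h x"

lemma G_borel: "t > 0 \<Longrightarrow> G t \<in> borel_measurable borel"
  using G_cont borel_measurable_continuous_onI by blast

lemma G_growth: assumes "t > 0" shows "quadratic_growth (G t)"
proof -
  obtain M where "\<And>z. cmod (G t z) \<le> M" using G_bounded[OF assms] by blast
  then show ?thesis by (intro quadratic_growth_bounded G_borel assms)
qed

lemma \<Gamma>_borel: "t > 0 \<Longrightarrow> \<Gamma> t \<in> borel_measurable borel"
  by (meson \<Gamma>_deriv borel_measurable_continuous_onI continuous_at_imp_continuous_on has_vector_derivative_continuous)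

lemma zG_growth: assumes "t > 0" shows "quadratic_growth (\<lambda>z. of_real z * G t z)"
proof -
  obtain M where M: "\<And>z. cmod (G t z) \<le> M" using G_bounded[OF assms] by blast
  have M0: "M \<ge> 0" using order_trans[OF norm_ge_zero M] .
  have [measurable]: "G t \<in> borel_measurable borel" by (rule G_borel[OF assms])
  show ?thesis
  proof (rule quadratic_growthI)
    fix z :: real
    have "\<bar>z\<bar> \<le> 1 + z\<^sup>2" using zero_le_power2[of "\<bar>z\<bar> - 1"] unfolding power2_diff by simp
    have "cmod (of_real z * G t z) = cmod (G t z) * \<bar>z\<bar>" by (simp add: norm_mult)
    also have "\<dots> \<le> M * (1 + z\<^sup>2)" using M0 \<open>\<bar>z\<bar> \<le> 1 + z\<^sup>2\<close> by (intro mult_mono M) auto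
    finally show "cmod (of_real z * G t z) \<le> M * (1 + z\<^sup>2)" .
  qed measurable
qed

lemma R_borel: "t > 0 \<Longrightarrow> R t \<in> borel_measurable borel"
  using R_cont borel_measurable_continuous_onI by blast

lemma R_growth: assumes "t > 0" shows "quadratic_growth (R t)"
proof -
  obtain \<delta> M where "\<delta> > 0" "\<forall>s z. \<bar>s - t\<bar> < \<delta> \<longrightarrow> cmod (R s z) \<le> M * (1 + z\<^sup>2)" using R_bound[OF assms] by blast
  then have "cmod (R t z) \<le> M * (1 + z\<^sup>2)" for z by auto
  then show ?thesis by (intro quadratic_growthI R_borel assms)
qed

lemma ev_primitive: "schwartz h \<Longrightarrow> t > 0 \<Longrightarrow> ev h t x = conv (\<Gamma> t) (vderiv h) x"
  unfolding ev_def
  by (rule conv_by_parts[OF \<Gamma>_deriv G_cont quadratic_growth_bounded[OF \<Gamma>_borel \<Gamma>_bound] G_growth])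

lemma ev_uniform_bound: "schwartz h \<Longrightarrow> t > 0 \<Longrightarrow> cmod (ev h t x) \<le> B * (LBINT z. cmod (vderiv h z))"
  by (simp add: ev_primitive conv_norm_bound \<Gamma>_borel \<Gamma>_bound schwartz_vderiv)

text \<open>The bounds for the evolution and for x times the evolution are added;
  \<open>conv_times_id\<close> splits the latter into the first moment of the kernel, controlled by
  \<open>G_weight\<close>, and the evolution of z h(z).\<close>

lemma ev_weighted_bound:
  assumes h: "schwartz h"
  shows "\<exists>C. \<forall>t\<in>{0<..T}. \<forall>x>0. cmod (ev h t x) \<le> C / (1 + x)"
proof -
  obtain C where "\<forall>t\<in>{0<..T}. \<forall>x. cmod (conv (\<lambda>z. of_real z * G t z) h x) \<le> C"
    using G_weight[OF h, of T] by blast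
  then have C: "\<And>t x. 0 < t \<Longrightarrow> t \<le> T \<Longrightarrow> cmod (conv (\<lambda>z. of_real z * G t z) h x) \<le> C" by auto
  let ?h = "\<lambda>z. of_real z * h z"
  have "cmod (ev h t x) \<le> (B * (LBINT z. cmod (vderiv h z)) + (C + B * (LBINT z. cmod (vderiv ?h z)))) / (1 + x)"
    if t: "0 < t" "t \<le> T" and x: "x > 0" for t x
  proof -
    have "x * cmod (ev h t x) = cmod (of_real x * ev h t x)" using x by (simp add: norm_mult)
    also have "of_real x * ev h t x = conv (\<lambda>z. of_real z * G t z) h x + ev ?h t x"
      unfolding ev_def by (rule conv_times_id[OF G_growth zG_growth h]) (use t in auto)
    also have "cmod \<dots> \<le> C + B * (LBINT z. cmod (vderiv ?h z))"
      by (intro order_trans[OF norm_triangle_ineq] add_mono C t ev_uniform_bound schwartz_times_id h)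
    finally have "(1 + x) * cmod (ev h t x) \<le> B * (LBINT z. cmod (vderiv h z)) + (C + B * (LBINT z. cmod (vderiv ?h z)))"
      using ev_uniform_bound[OF h t(1), of x] by (simp add: distrib_right)
    then show ?thesis using x by (simp add: pos_le_divide_eq mult.commute)
  qed
  then show ?thesis by (auto simp: Ball_def)
qed

text \<open>In the form of a convolution of \<Gamma> with h' the limit is a matter of dominated
  convergence: \<open>\<Gamma> t\<close> is uniformly bounded and tends to half the sign function, a
  primitive of the delta function.\<close>

lemma ev_limit:
  assumes h: "schwartz h" shows "((\<lambda>t. ev h t x) \<longlongrightarrow> h x) (at_right 0)"
proof -
  have sm: "smooth h" using h by (rule schwartz_smooth)
  have h': "schwartz (vderiv h)" using h by blast
  have [measurable]: "vderiv h \<in> borel_measurable borel" by (rule schwartz_borel[OF h'])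
  have ih: "integrable lborel (\<lambda>z. vderiv h (x - z))"
    using lborel_integrable_real_affine[OF schwartz_integrable[OF h'], of "-1" x] by simp
  have pos: "\<forall>\<^sub>F t in at_right (0::real). t > 0" by (simp add: eventually_at_right_less)
  have "((\<lambda>t. LBINT z. \<Gamma> t z * vderiv h (x - z)) \<longlongrightarrow> (LBINT z. of_real (sgn z) / 2 * vderiv h (x - z))) (at_right 0)"
  proof (rule integral_dominated_convergence_filter[OF sequential_at])
    show "integrable lborel (\<lambda>z. B * cmod (vderiv h (x - z)))" using ih by auto
    show "\<forall>\<^sub>F t in at_right 0. (\<lambda>z. \<Gamma> t z * vderiv h (x - z)) \<in> borel_measurable lborel"
      using pos by eventually_elim (rule conv_measurable[OF \<Gamma>_borel h'])
    show "AE z in lborel. ((\<lambda>t. \<Gamma> t z * vderiv h (x - z)) \<longlongrightarrow> of_real (sgn z) / 2 * vderiv h (x - z)) (at_right 0)"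
      using AE_lborel_singleton[of "0::real"]
      by eventually_elim (intro tendsto_mult tendsto_const \<Gamma>_limit)
    show "\<forall>\<^sub>F t in at_right 0. AE z in lborel. norm (\<Gamma> t z * vderiv h (x - z)) \<le> B * cmod (vderiv h (x - z))"
      using pos by eventually_elim (auto simp: norm_mult intro!: mult_right_mono \<Gamma>_bound)
  qed measurable
  also have "(LBINT z. of_real (sgn z) / 2 * vderiv h (x - z)) = h x"
  proof -
    have d: "((\<lambda>z. - h (x - z)) has_vector_derivative vderiv h (x - z)) (at z)"
      "((\<lambda>z. h (x + z)) has_vector_derivative vderiv h (x + z)) (at z)" for z
    proof -
      have "((h \<circ> (\<lambda>s. x - s)) has_vector_derivative (- 1) *\<^sub>R vderiv h (x - z)) (at z)"
        "((h \<circ> (\<lambda>s. x + s)) has_vector_derivative 1 *\<^sub>R vderiv h (x + z)) (at z)"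
        by (rule vector_diff_chain_at; auto intro!: derivative_eq_intros smooth_vderiv_at[OF sm]
              simp: has_real_derivative_iff_has_vector_derivative[symmetric])+
      then show "((\<lambda>z. - h (x - z)) has_vector_derivative vderiv h (x - z)) (at z)"
        "((\<lambda>z. h (x + z)) has_vector_derivative vderiv h (x + z)) (at z)"
        using has_vector_derivative_minus by (fastforce simp: o_def)+
    qed
    have c: "continuous_on UNIV (\<lambda>z. vderiv h (x - z))" "continuous_on UNIV (\<lambda>z. vderiv h (x + z))"
      by (auto intro!: continuous_on_compose2[OF smooth_continuous[OF smooth_vderiv[OF sm], of UNIV]] continuous_intros)
    have i2: "integrable lborel (\<lambda>z. vderiv h (x + z))"
      using lborel_integrable_real_affine[OF schwartz_integrable[OF h'], of 1 x] by simp
    have sh: "filterlim (\<lambda>z. x + z) at_top at_top" "filterlim (\<lambda>z. x - z) at_bot at_top"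
      by real_asymp+
    have "(LBINT z:{0<..}. vderiv h (x - z)) = - (- h (x - 0))"
      by (rule integral_half_line_FTC[OF d(1) c(1) ih])
         (use tendsto_minus[OF filterlim_compose[OF schwartz_tendsto_0(2)[OF h] sh(2)]] in simp)
    moreover have "(LBINT z:{0<..}. vderiv h (x + z)) = - h (x + 0)"
      by (rule integral_half_line_FTC[OF d(2) c(2) i2])
         (use filterlim_compose[OF schwartz_tendsto_0(1)[OF h] sh(1)] in simp)
    moreover have "integrable lborel (\<lambda>z. complex_of_real (sgn z) / 2 * vderiv h (x - z))"
      by (rule Bochner_Integration.integrable_bound[OF ih]) (auto simp: norm_mult sgn_if)
    note integral_line_split[OF this]
    moreover have "(LBINT z:{0<..}. complex_of_real (sgn z) / 2 * vderiv h (x - z)) = (LBINT z:{0<..}. (1 / 2) * vderiv h (x - z))"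
      "(LBINT z:{0<..}. complex_of_real (sgn (- z)) / 2 * vderiv h (x - (- z))) = (LBINT z:{0<..}. (- 1 / 2) * vderiv h (x + z))"
      by (rule set_lebesgue_integral_cong; simp)+
    ultimately show ?thesis unfolding set_integral_mult_right by simp
  qed
  finally show ?thesis
    by (rule Lim_transform_eventually) (use pos in eventually_elim, simp add: ev_primitive[OF h] conv_def)
qed

lemma ev_deriv:
  assumes h: "schwartz h" and t: "t > 0"
  shows "((\<lambda>s. ev h s x) has_vector_derivative evt h t x) (at t)"
proof -
  obtain \<delta> M where \<delta>: "\<delta> > 0" "\<And>s z. \<bar>s - t\<bar> < \<delta> \<Longrightarrow> cmod (R s z) \<le> M * (1 + z\<^sup>2)" using R_bound[OF t] by blast
  show ?thesis unfolding ev_def evt_def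
    by (rule conv_deriv_parameter[where \<delta> = "min \<delta> t" and M = M])
       (use \<delta> t in \<open>auto intro!: G_growth h G_deriv R_borel\<close>)
qed

lemma line_evolution:
  assumes evt: "\<And>h. schwartz h \<Longrightarrow> locally_weighted (evt h)"
  shows "line_evolution ev evt"
proof
  fix g h :: "real \<Rightarrow> complex" and t x :: real and T :: real and c :: complex
  assume h: "schwartz h"
  show "\<exists>C. \<forall>t\<in>{0<..T}. \<forall>x>0. cmod (ev h t x) \<le> C / (1 + x)" using ev_weighted_bound[OF h] .
  show "locally_weighted (evt h)" using evt[OF h] .
  show "((\<lambda>t. ev h t x) \<longlongrightarrow> h x) (at_right 0)" using ev_limit[OF h] .
  assume t: "t > 0"
  show "ev (\<lambda>z. g z + h z) t x = ev g t x + ev h t x" if "schwartz g"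
    unfolding ev_def conv_def distrib_left
    by (rule Bochner_Integration.integral_add) (intro conv_integrable G_growth t h that)+
  show "ev (\<lambda>z. c * h z) t x = c * ev h t x"
    unfolding ev_def conv_def by (simp add: mult.left_commute[of _ c])
  show "(ev h t has_vector_derivative ev (vderiv h) t x) (at x)"
    unfolding ev_def[abs_def] by (intro conv_vderiv G_growth t h)
  show "((\<lambda>s. ev h s x) has_vector_derivative evt h t x) (at t)" using ev_deriv[OF h t] .
  show "evt h t \<in> borel_measurable borel"
    unfolding evt_def[abs_def] by (intro borel_measurable_continuous_onI conv_continuous R_growth t h)
  assume odd: "\<And>z. h (- z) = - h z"
  \<comment> \<open>Reflecting the integration variable changes the sign, because the kernel is even
    and h is odd.\<close>
  have "ev h t 0 = (LBINT z. G t (- z) * h z)"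
    unfolding ev_def conv_reflected by simp
  also have "\<dots> = (LBINT z. G t z * h (- z))"
    by (subst lborel_integral_real_affine[where c = "-1" and t = 0]) auto
  also have "\<dots> = - (LBINT z. G t (- z) * h z)" by (simp add: odd G_even[OF t])
  finally show "ev h t 0 = 0"
    unfolding ev_def conv_reflected by simp
qed

end

section \<open>The Gaussian and Fresnel integrals\<close>

text \<open>The error function without the factor 2 / sqrt pi, as an entire function: the heat
  problem evaluates it on the real axis, the quantum problem on the line through 0 in the direction
  -pi/4.\<close>

definition gauss_prim :: "complex \<Rightarrow> complex" where
  "gauss_prim = (SOME P. P 0 = 0 \<and> (\<forall>z. (P has_field_derivative exp (- z\<^sup>2)) (at z)))"

lemma gauss_prim_0: "gauss_prim 0 = 0"
  and gauss_prim_deriv: "(gauss_prim has_field_derivative exp (- z\<^sup>2)) (at z)"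
proof -
  have hol: "(\<lambda>z::complex. exp (- z\<^sup>2)) holomorphic_on UNIV" by (intro holomorphic_intros)
  obtain g where g: "\<And>z. z \<in> UNIV \<Longrightarrow> (g has_field_derivative exp (- z\<^sup>2)) (at z within UNIV :: complex filter)"
    using holomorphic_convex_primitive'[OF convex_UNIV open_UNIV hol] by blast
  have "((\<lambda>z. g z - g 0) has_field_derivative exp (- z\<^sup>2)) (at z)" for z :: complex
    using g[of z] by (auto intro!: derivative_eq_intros)
  then have "\<exists>P :: complex \<Rightarrow> complex. P 0 = 0 \<and> (\<forall>z. (P has_field_derivative exp (- z\<^sup>2)) (at z))"
    by (intro exI[of _ "\<lambda>z. g z - g 0"]) auto
  from someI_ex[OF this]
  show "gauss_prim 0 = 0" "(gauss_prim has_field_derivative exp (- z\<^sup>2)) (at z)"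
    unfolding gauss_prim_def by auto
qed

lemma gauss_prim_minus: "gauss_prim (- z) = - gauss_prim z"
proof -
  have "\<exists>c. \<forall>z\<in>UNIV. gauss_prim z + gauss_prim (- z) = c"
  proof (rule has_field_derivative_zero_constant)
    fix z
    have "((\<lambda>z. gauss_prim z + gauss_prim (- z)) has_field_derivative
        exp (- z\<^sup>2) + exp (- (- z)\<^sup>2) * (- 1)) (at z)"
      by (intro DERIV_add gauss_prim_deriv DERIV_chain2[OF gauss_prim_deriv]) (auto intro!: derivative_eq_intros)
    then show "((\<lambda>z. gauss_prim z + gauss_prim (- z)) has_field_derivative 0) (at z)" by simp
  qed simp
  then obtain c where c: "\<And>z. gauss_prim z + gauss_prim (- z) = c" by auto
  from c[of 0] c[of z] show ?thesis by (simp add: gauss_prim_0 add_eq_0_iff)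
qed

lemma gauss_prim_real_limit: "((\<lambda>x. gauss_prim (of_real x)) \<longlongrightarrow> of_real (sqrt pi / 2)) at_top"
proof -
  define f where "f x = complex_of_real (indicator {0..} x *\<^sub>R exp (- x\<^sup>2))" for x :: real
  have i: "integrable lborel (\<lambda>x::real. indicator {0..} x *\<^sub>R exp (- x\<^sup>2))"
    "(LBINT x::real. indicator {0..} x *\<^sub>R exp (- x\<^sup>2)) = sqrt pi / 2"
    using gaussian_moment_0 unfolding has_bochner_integral_iff by blast+
  have int: "integrable lborel f" "(LBINT x. f x) = of_real (sqrt pi / 2)"
    unfolding f_def integral_complex_of_real i(2) using i(1) by (simp_all only: integrable_of_real)
  have "((\<lambda>y. LBINT x. indicator {..y} x *\<^sub>R f x) \<longlongrightarrow> of_real (sqrt pi / 2)) at_top"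
    using tendsto_integral_at_top[of lborel f] int by simp
  moreover have "\<forall>\<^sub>F y in at_top. (LBINT x. indicator {..y} x *\<^sub>R f x) = gauss_prim (of_real y)"
    using eventually_ge_at_top[of 0]
  proof eventually_elim
    case (elim y)
    have "(LBINT x. indicator {..y} x *\<^sub>R f x) = (LBINT x. indicator {0..y} x *\<^sub>R exp (- (complex_of_real x)\<^sup>2))"
      by (rule Bochner_Integration.integral_cong)
         (auto simp: f_def indicator_def exp_of_real[symmetric] simp del: exp_of_real)
    also have "\<dots> = gauss_prim (of_real y) - gauss_prim (of_real 0)"
      by (rule integral_FTC_atLeastAtMost[OF elim])
         (auto intro!: has_vector_derivative_real_field gauss_prim_deriv has_field_derivative_at_within continuous_intros)
    finally show ?case by (simp add: gauss_prim_0)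
  qed
  ultimately show ?thesis by (rule Lim_transform_eventually)
qed

text \<open>Rotation of the path of integration from the positive real axis by the angle \<open>-\<pi>/4\<close>.\<close>

lemma gauss_prim_rotate:
  assumes r: "r > 0" shows "cmod (gauss_prim (of_real r - \<i> * of_real r) - gauss_prim (of_real r)) \<le> 1 / r"
proof -
  define p where "p y = gauss_prim (of_real r - \<i> * of_real y)" for y
  \<comment> \<open>A primitive of exp(-r(r - y)), which dominates |exp(-(r - iy)^2)| = exp(-(r^2 -
    y^2)) for 0 \<le> y \<le> r because y^2 \<le> r y. Its total increase is at most 1/r.\<close>
  define q where "q y = exp (- r * (r - y)) / r" for y
  have dp: "(p has_vector_derivative exp (- (of_real r - \<i> * of_real y)\<^sup>2) * (- \<i>)) (at y)" for y
    unfolding p_def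
    by (rule has_vector_derivative_real_field[where f = "\<lambda>w. gauss_prim (of_real r - \<i> * w)"],
        rule DERIV_chain2[OF gauss_prim_deriv]) (auto intro!: derivative_eq_intros)
  have dq: "(q has_vector_derivative exp (- r * (r - y))) (at y)" for y
    unfolding q_def has_real_derivative_iff_has_vector_derivative[symmetric]
    using r by (auto intro!: derivative_eq_intros)
  have "cmod (p r - p 0) \<le> q r - q 0"
  proof (rule differentiable_bound_general[OF r])
    show "continuous_on {0..r} p" "continuous_on {0..r} q"
      using dp dq by (meson continuous_at_imp_continuous_on has_vector_derivative_continuous)+
    fix y assume y: "0 < y" "y < r"
    have "Re ((of_real r - \<i> * of_real y)\<^sup>2) = r\<^sup>2 - y\<^sup>2" by (simp add: power2_eq_square)
    then have "cmod (exp (- (of_real r - \<i> * of_real y)\<^sup>2) * (- \<i>)) = exp (- (r\<^sup>2 - y\<^sup>2))"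
      by (simp add: norm_mult)
    also have "\<dots> \<le> exp (- r * (r - y))"
    proof -
      have "y * y \<le> r * y" using y by (intro mult_right_mono) auto
      then show ?thesis by (simp add: power2_eq_square algebra_simps)
    qed
    finally show "cmod (exp (- (of_real r - \<i> * of_real y)\<^sup>2) * (- \<i>)) \<le> exp (- r * (r - y))" .
  qed (rule dp dq)+
  also have "\<dots> \<le> 1 / r" using r by (simp add: q_def)
  finally show ?thesis by (simp add: p_def)
qed

lemma of_real_has_vector_derivative:
  "(f has_real_derivative d) (at x) \<Longrightarrow> ((\<lambda>x. complex_of_real (f x)) has_vector_derivative of_real d) (at x)"
  by (rule has_vector_derivative_of_real) (simp add: has_real_derivative_iff_has_vector_derivative)

section \<open>The heat and Schroedinger kernels\<close>

text \<open>The heat problem corresponds to \<open>c = 1\<close>, the quantum problem to \<open>c = \<i>\<close>.\<close>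

locale gaussian_kernel =
  fixes c :: complex
  assumes c: "c = 1 \<or> c = \<i>"
begin

definition q where "q = csqrt c"
definition G :: "real \<Rightarrow> real \<Rightarrow> complex" where
  "G t z = exp (- (of_real z)\<^sup>2 / (4 * c * of_real t)) / csqrt (4 * of_real pi * c * of_real t)"
text \<open>The profile of the primitive of the kernel, which depends on z and t only through z /
  sqrt t; bounds for it are therefore uniform in time.\<close>

definition \<Gamma>1 :: "real \<Rightarrow> complex" where "\<Gamma>1 w = gauss_prim (of_real w / (2 * q)) / of_real (sqrt pi)"
definition \<Gamma> :: "real \<Rightarrow> real \<Rightarrow> complex" where "\<Gamma> t z = \<Gamma>1 (z / sqrt t)"
definition Gz :: "real \<Rightarrow> real \<Rightarrow> complex" where "Gz t z = - of_real z / (2 * c * of_real t) * G t z"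
text \<open>At once the time derivative of G and c times its second space derivative, which is the
  equation u_t = c u_xx for the kernel.\<close>

definition R :: "real \<Rightarrow> real \<Rightarrow> complex" where
  "R t z = ((of_real z)\<^sup>2 / (4 * c * (of_real t)\<^sup>2) - 1 / (2 * of_real t)) * G t z"

lemma q: "q\<^sup>2 = c" "cmod q = 1" "Re q > 0" "c \<noteq> 0" "q \<noteq> 0" "cmod c = 1"
proof -
  show q2: "q\<^sup>2 = c" by (simp add: q_def)
  show c0: "c \<noteq> 0" "cmod c = 1" using c by auto
  show "q \<noteq> 0" using q2 c0 by auto
  have "(cmod q)\<^sup>2 = 1" using q2 c0 by (simp flip: norm_power)
  then show "cmod q = 1" by (simp add: power2_eq_1_iff) (smt (verit) norm_ge_zero)
  show "Re q > 0"
  proof -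
    have "Re q \<ge> 0" unfolding q_def by (rule Re_csqrt)
    moreover have "Re q \<noteq> 0"
    proof
      assume "Re q = 0"
      then have "Re (q\<^sup>2) \<le> 0 \<and> Im (q\<^sup>2) = 0" by (simp add: power2_eq_square)
      then show False using q2 c by auto
    qed
    ultimately show ?thesis by simp
  qed
qed

text \<open>The root on the right has positive real part, which identifies it as the principal
  one.\<close>

lemma csqrt_eq: "t > 0 \<Longrightarrow> csqrt (4 * of_real pi * c * of_real t) = of_real (2 * sqrt (pi * t)) * q"
proof (rule csqrt_unique)
  assume t: "t > 0"
  have "(of_real (2 * sqrt (pi * t)) * q)\<^sup>2 = of_real ((2 * sqrt (pi * t))\<^sup>2) * q\<^sup>2" by (simp add: power_mult_distrib)
  also have "(2 * sqrt (pi * t))\<^sup>2 = 4 * (pi * t)" using t by (simp add: power_mult_distrib)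
  finally show "(of_real (2 * sqrt (pi * t)) * q)\<^sup>2 = 4 * of_real pi * c * of_real t" by (simp add: q(1))
  show "0 < Re (of_real (2 * sqrt (pi * t)) * q) \<or> Re (of_real (2 * sqrt (pi * t)) * q) = 0 \<and> 0 \<le> Im (of_real (2 * sqrt (pi * t)) * q)"
    using t q(3) by simp
qed

text \<open>Equality holds for c = \<i>: the Schroedinger kernel has constant modulus in z, so the
  bound on G drawn from this carries no decay.\<close>

lemma exponent_Re_nonpos: "t > 0 \<Longrightarrow> Re (- (of_real z)\<^sup>2 / (4 * c * of_real t)) \<le> 0"
  using c by (auto simp: Re_divide power2_eq_square zero_le_mult_iff)

lemma G_bound: assumes t: "t > 0" shows "cmod (G t z) \<le> 1 / (2 * sqrt (pi * t))"
proof -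
  have "cmod (G t z) = exp (Re (- (of_real z)\<^sup>2 / (4 * c * of_real t))) / (2 * sqrt (pi * t))"
    using t by (simp add: G_def csqrt_eq norm_divide norm_mult q)
  also have "\<dots> \<le> 1 / (2 * sqrt (pi * t))"
    using exponent_Re_nonpos[OF t, of z] t by (intro divide_right_mono) auto
  finally show ?thesis .
qed

lemma G_cont: "continuous_on UNIV (G t)"
  unfolding G_def[abs_def] divide_inverse by (intro continuous_intros)

lemma Gz_deriv: assumes t: "t > 0" shows "(G t has_vector_derivative Gz t z) (at z)"
proof -
  define D where "D = csqrt (4 * of_real pi * c * of_real t)"
  have "((\<lambda>w. exp (- w\<^sup>2 / (4 * c * of_real t)) / D) has_field_derivative
     - of_real z / (2 * c * of_real t) * (exp (- (of_real z)\<^sup>2 / (4 * c * of_real t)) / D)) (at (of_real z))"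
    using t q(4) by (auto intro!: derivative_eq_intros simp: D_def csqrt_eq q field_simps)
  from has_vector_derivative_real_field[OF this] show ?thesis unfolding G_def[abs_def] Gz_def G_def D_def .
qed

lemma Gzz_deriv: assumes t: "t > 0" shows "(Gz t has_vector_derivative R t z / c) (at z)"
proof -
  have "((\<lambda>z. - of_real z / (2 * c * of_real t)) has_vector_derivative (- 1 / (2 * c * of_real t))) (at z)"
    by (rule has_vector_derivative_real_field[where f = "\<lambda>z. - z / (2 * c * of_real t)"])
       (use t q(4) in \<open>auto intro!: derivative_eq_intros\<close>)
  from has_vector_derivative_mult[OF this Gz_deriv[OF t]]
  have "(Gz t has_vector_derivative - of_real z / (2 * c * of_real t) * Gz t z + - 1 / (2 * c * of_real t) * G t z) (at z)"
    unfolding Gz_def[abs_def] .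
  moreover have "- of_real z / (2 * c * of_real t) * Gz t z + - 1 / (2 * c * of_real t) * G t z = R t z / c"
    using t q(4) by (simp add: Gz_def R_def field_simps power2_eq_square)
  ultimately show ?thesis by (simp only:)
qed

lemma R_deriv: assumes t: "t > 0" shows "((\<lambda>s. G s z) has_vector_derivative R t z) (at t)"
proof -
  define e where "e w = exp (- (of_real z)\<^sup>2 / (4 * c * w))" for w :: complex
  have e: "((\<lambda>s. e (of_real s)) has_vector_derivative (of_real z)\<^sup>2 / (4 * c * (of_real t)\<^sup>2) * e (of_real t)) (at t)"
    unfolding e_def
    by (rule has_vector_derivative_real_field[where f = "\<lambda>w. exp (- (of_real z)\<^sup>2 / (4 * c * w))"])
       (use t q(4) in \<open>auto intro!: derivative_eq_intros simp: power2_eq_square field_simps\<close>)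
  have s: "((\<lambda>s. complex_of_real (1 / (2 * sqrt (pi * s)))) has_vector_derivative
      of_real (- 1 / (2 * t) * (1 / (2 * sqrt (pi * t))))) (at t)"
    by (rule of_real_has_vector_derivative)
       (use t in \<open>auto intro!: derivative_eq_intros simp: field_simps real_sqrt_mult\<close>)
  have "((\<lambda>s. e (of_real s) * of_real (1 / (2 * sqrt (pi * s))) * (1 / q)) has_vector_derivative
      (e (of_real t) * of_real (- 1 / (2 * t) * (1 / (2 * sqrt (pi * t)))) +
       ((of_real z)\<^sup>2 / (4 * c * (of_real t)\<^sup>2) * e (of_real t)) * of_real (1 / (2 * sqrt (pi * t)))) * (1 / q)) (at t)"
    by (intro has_vector_derivative_mult_left has_vector_derivative_mult e s)
  moreover have G: "G s z = e (of_real s) * of_real (1 / (2 * sqrt (pi * s))) * (1 / q)" if "s > 0" for s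
    using that by (simp add: G_def e_def csqrt_eq)
  moreover have "(e (of_real t) * of_real (- 1 / (2 * t) * (1 / (2 * sqrt (pi * t)))) +
       ((of_real z)\<^sup>2 / (4 * c * (of_real t)\<^sup>2) * e (of_real t)) * of_real (1 / (2 * sqrt (pi * t)))) * (1 / q) = R t z"
    unfolding R_def G[OF t] by (simp add: algebra_simps)
  ultimately show ?thesis
    by (intro has_vector_derivative_transform_within_open[of _ _ t "{0<..}" "\<lambda>s. G s z"]) (use t in auto)
qed

lemma R_growth_local:
  assumes t: "t > 0" and s: "\<bar>s - t\<bar> < t / 2"
  shows "cmod (R s z) \<le> (1 / t\<^sup>2 + 1 / t) * (1 / (2 * sqrt (pi * (t / 2)))) * (1 + z\<^sup>2)"
proof -
  have s2: "s \<ge> t / 2" "s > 0" using s t unfolding abs_less_iff by linarith+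
  have ss: "t\<^sup>2 \<le> 4 * s\<^sup>2" using power_mono[of t "2 * s" 2] s2 t by (simp add: power_mult_distrib)
  have "cmod ((of_real z)\<^sup>2 / (4 * c * (of_real s)\<^sup>2) - 1 / (2 * of_real s)) \<le> z\<^sup>2 / (4 * s\<^sup>2) + 1 / (2 * s)"
    using s2 q(6) by (intro order_trans[OF norm_triangle_ineq4] add_mono) (auto simp: norm_divide norm_mult norm_power)
  also have "\<dots> \<le> z\<^sup>2 / t\<^sup>2 + 1 / t"
    using s2 t ss by (intro add_mono divide_left_mono mult_pos_pos) auto
  also have "\<dots> \<le> (1 / t\<^sup>2 + 1 / t) * (1 + z\<^sup>2)"
  proof -
    have "(1 / t\<^sup>2 + 1 / t) * (1 + z\<^sup>2) - (z\<^sup>2 / t\<^sup>2 + 1 / t) = 1 / t\<^sup>2 + z\<^sup>2 / t"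
      by (simp add: algebra_simps add_divide_distrib)
    moreover have "1 / t\<^sup>2 + z\<^sup>2 / t \<ge> 0" using t by simp
    ultimately show ?thesis by linarith
  qed
  finally have 1: "cmod ((of_real z)\<^sup>2 / (4 * c * (of_real s)\<^sup>2) - 1 / (2 * of_real s)) \<le> (1 / t\<^sup>2 + 1 / t) * (1 + z\<^sup>2)" .
  have 2: "cmod (G s z) \<le> 1 / (2 * sqrt (pi * (t / 2)))"
    using s2 t by (intro order_trans[OF G_bound] divide_left_mono mult_left_mono real_sqrt_le_mono mult_pos_pos) auto
  have "cmod (R s z) \<le> ((1 / t\<^sup>2 + 1 / t) * (1 + z\<^sup>2)) * (1 / (2 * sqrt (pi * (t / 2))))"
    unfolding R_def norm_mult using t by (intro mult_mono 1 2) (auto intro!: mult_nonneg_nonneg add_nonneg_nonneg)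
  then show ?thesis by (simp add: mult_ac)
qed

lemma \<Gamma>1_deriv: "(\<Gamma>1 has_vector_derivative exp (- (of_real w / (2 * q))\<^sup>2) * (1 / (2 * q)) / of_real (sqrt pi)) (at w)"
  unfolding \<Gamma>1_def[abs_def]
  by (rule has_vector_derivative_real_field[where f = "\<lambda>w. gauss_prim (w / (2 * q)) / of_real (sqrt pi)"],
      rule DERIV_cdivide, rule DERIV_chain2[OF gauss_prim_deriv]) (use q(5) in \<open>auto intro!: derivative_eq_intros\<close>)

lemma \<Gamma>1_minus: "\<Gamma>1 (- w) = - \<Gamma>1 w"
  using gauss_prim_minus[of "of_real w / (2 * q)"] by (simp add: \<Gamma>1_def)

lemma \<Gamma>1_limit: "(\<Gamma>1 \<longlongrightarrow> 1 / 2) at_top"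
proof -
  have "((\<lambda>w. gauss_prim (of_real w / (2 * q))) \<longlongrightarrow> of_real (sqrt pi / 2)) at_top"
    using c
  proof
    assume c: "c = 1"
    have "filterlim (\<lambda>w::real. w / 2) at_top at_top" by real_asymp
    moreover have "q = 1" unfolding q_def using c by simp
    ultimately show ?thesis using filterlim_compose[OF gauss_prim_real_limit] by fastforce
  next
    assume c: "c = \<i>"
    define a where "a = 2 * sqrt 2"
    have a: "a > 0" by (simp add: a_def)
    \<comment> \<open>Dividing by 2q scales by a positive factor and turns the positive axis by
      -pi/4, onto the ray that \<open>gauss_prim_rotate\<close> compares with the real axis.\<close>
    have "csqrt \<i> = (1 + \<i>) / of_real (sqrt 2)"
      by (rule csqrt_unique) (auto simp: power2_eq_square complex_eq_iff field_simps)
    then have "q = (1 + \<i>) / of_real (sqrt 2)" unfolding q_def using c by simp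
    then have "of_real w / (2 * q) = of_real (w / a) - \<i> * of_real (w / a)" for w
      by (simp add: a_def complex_eq_iff Re_divide Im_divide power2_eq_square field_simps)
    moreover have sc: "filterlim (\<lambda>w::real. w / a) at_top at_top"
      using a by real_asymp
    moreover have "((\<lambda>w. gauss_prim (of_real (w / a) - \<i> * of_real (w / a)) - gauss_prim (of_real (w / a))) \<longlongrightarrow> 0) at_top"
    proof (rule Lim_null_comparison)
      show "\<forall>\<^sub>F w in at_top. cmod (gauss_prim (of_real (w / a) - \<i> * of_real (w / a)) - gauss_prim (of_real (w / a))) \<le> 1 / (w / a)"
        using eventually_gt_at_top[of 0] by eventually_elim (rule gauss_prim_rotate, use a in simp)
      show "((\<lambda>w. 1 / (w / a)) \<longlongrightarrow> 0) at_top" using a by real_asymp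
    qed
    ultimately show ?thesis
      using tendsto_add[OF _ filterlim_compose[OF gauss_prim_real_limit sc]] by fastforce
  qed
  then have "((\<lambda>w. gauss_prim (of_real w / (2 * q)) / of_real (sqrt pi)) \<longlongrightarrow> of_real (sqrt pi / 2) / of_real (sqrt pi)) at_top"
    by (intro tendsto_divide tendsto_const) auto
  then show ?thesis unfolding \<Gamma>1_def[abs_def] by simp
qed

text \<open>Oddness reduces the claim to w \<ge> 0, where the limit covers large w and compactness
  the rest.\<close>

lemma \<Gamma>1_bounded: "\<exists>B. \<forall>w. cmod (\<Gamma>1 w) \<le> B"
proof -
  have "\<forall>\<^sub>F w in at_top. dist (\<Gamma>1 w) (1 / 2) < 1" using tendstoD[OF \<Gamma>1_limit] by simp
  then obtain W where W: "\<And>w. w \<ge> W \<Longrightarrow> dist (\<Gamma>1 w) (1 / 2) < 1" by (auto simp: eventually_at_top_linorder)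
  have "compact (\<Gamma>1 ` {0..W})"
    using \<Gamma>1_deriv by (intro compact_continuous_image continuous_at_imp_continuous_on ballI has_vector_derivative_continuous) auto
  then obtain B where B: "\<And>w. w \<in> {0..W} \<Longrightarrow> cmod (\<Gamma>1 w) \<le> B"
    by (meson bounded_iff compact_imp_bounded image_eqI)
  have pos: "cmod (\<Gamma>1 w) \<le> max B 2" if "w \<ge> 0" for w
  proof (cases "w \<le> W")
    case False
    then have "dist (\<Gamma>1 w) (1 / 2) < 1" by (intro W) simp
    moreover have "cmod (\<Gamma>1 w) \<le> dist (\<Gamma>1 w) (1 / 2) + cmod (1 / 2)"
      unfolding dist_norm using norm_triangle_ineq[of "\<Gamma>1 w - 1 / 2" "1 / 2"] by simp
    ultimately show ?thesis by simp
  qed (use B that in fastforce)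
  have "cmod (\<Gamma>1 w) \<le> max B 2" for w
    using pos[of w] pos[of "- w"] \<Gamma>1_minus[of w] by (cases "w \<ge> 0") auto
  then show ?thesis by blast
qed

definition B where "B = (SOME B. \<forall>w. cmod (\<Gamma>1 w) \<le> B)"

lemma B: "cmod (\<Gamma>1 w) \<le> B"
  using someI_ex[OF \<Gamma>1_bounded] unfolding B_def by blast

lemma \<Gamma>_deriv: assumes t: "t > 0" shows "(\<Gamma> t has_vector_derivative G t z) (at z)"
proof -
  have "((\<Gamma>1 \<circ> (\<lambda>z. z / sqrt t)) has_vector_derivative (1 / sqrt t) *\<^sub>R
      (exp (- (of_real (z / sqrt t) / (2 * q))\<^sup>2) * (1 / (2 * q)) / of_real (sqrt pi))) (at z)"
    by (rule vector_diff_chain_at[OF _ \<Gamma>1_deriv],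
        unfold has_real_derivative_iff_has_vector_derivative[symmetric], rule DERIV_cdivide[OF DERIV_ident])
  moreover have "(1 / sqrt t) *\<^sub>R (exp (- (of_real (z / sqrt t) / (2 * q))\<^sup>2) * (1 / (2 * q)) / of_real (sqrt pi)) = G t z"
  proof -
    have "(of_real (z / sqrt t) / (2 * q))\<^sup>2 = of_real ((z / sqrt t)\<^sup>2) / (4 * q\<^sup>2)"
      by (simp add: power_divide power_mult_distrib)
    also have "(z / sqrt t)\<^sup>2 = z\<^sup>2 / t" using t by (simp add: power_divide)
    finally have "(of_real (z / sqrt t) / (2 * q))\<^sup>2 = (of_real z)\<^sup>2 / (4 * c * of_real t)" by (simp add: q(1))
    then show ?thesis using t by (simp add: G_def csqrt_eq scaleR_conv_of_real real_sqrt_mult)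
  qed
  ultimately show ?thesis by (simp add: \<Gamma>_def[abs_def] o_def)
qed

lemma \<Gamma>_limit: assumes "z \<noteq> 0" shows "((\<lambda>t. \<Gamma> t z) \<longlongrightarrow> of_real (sgn z) / 2) (at_right 0)"
proof -
  have pos: "((\<lambda>t. \<Gamma> t z) \<longlongrightarrow> 1 / 2) (at_right 0)" if z: "z > 0" for z
  proof -
    have "filterlim (\<lambda>t. z / sqrt t) at_top (at_right 0)" using z by real_asymp
    from filterlim_compose[OF \<Gamma>1_limit this] show ?thesis by (simp add: \<Gamma>_def)
  qed
  show ?thesis
  proof (cases "z > 0")
    case True
    then show ?thesis using pos by simp
  next
    case False
    with assms have "- z > 0" by simp
    have "\<Gamma> t (- z) = - \<Gamma> t z" for t by (simp add: \<Gamma>_def \<Gamma>1_minus)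
    with tendsto_minus[OF pos[OF \<open>- z > 0\<close>]] False assms show ?thesis by simp
  qed
qed

lemma G_growth: "t > 0 \<Longrightarrow> quadratic_growth (G t)"
  by (rule quadratic_growth_bounded[OF borel_measurable_continuous_onI[OF G_cont] G_bound])

lemma zG_growth: assumes t: "t > 0" shows "quadratic_growth (\<lambda>z. of_real z * G t z)"
proof (rule quadratic_growthI)
  have [measurable]: "G t \<in> borel_measurable borel" by (rule borel_measurable_continuous_onI[OF G_cont])
  show "(\<lambda>z. of_real z * G t z) \<in> borel_measurable borel" by measurable
  fix z :: real
  have "\<bar>z\<bar> \<le> 1 + z\<^sup>2" using zero_le_power2[of "\<bar>z\<bar> - 1"] unfolding power2_diff by simp
  have "cmod (of_real z * G t z) = cmod (G t z) * \<bar>z\<bar>" by (simp add: norm_mult)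
  also have "\<dots> \<le> 1 / (2 * sqrt (pi * t)) * (1 + z\<^sup>2)"
    using t \<open>\<bar>z\<bar> \<le> 1 + z\<^sup>2\<close> by (intro mult_mono G_bound) auto
  finally show "cmod (of_real z * G t z) \<le> 1 / (2 * sqrt (pi * t)) * (1 + z\<^sup>2)" .
qed

lemma Gz_eq: "Gz t = (\<lambda>z. (- 1 / (2 * c * of_real t)) * (of_real z * G t z))"
  by (simp add: Gz_def fun_eq_iff)

lemma quadratic_growth_cmult:
  assumes "quadratic_growth A" shows "quadratic_growth (\<lambda>z. k * A z)"
proof -
  obtain M where M: "\<And>z. cmod (A z) \<le> M * (1 + z\<^sup>2)" and [measurable]: "A \<in> borel_measurable borel"
    using assms by (auto simp: quadratic_growth_def)
  have "cmod (k * A z) \<le> cmod k * M * (1 + z\<^sup>2)" for z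
    using mult_left_mono[OF M[of z], of "cmod k"] by (simp add: norm_mult mult.assoc)
  then show ?thesis by (intro quadratic_growthI) auto
qed

lemma Gz_growth: "t > 0 \<Longrightarrow> quadratic_growth (Gz t)"
  unfolding Gz_eq by (intro quadratic_growth_cmult zG_growth)

lemma Gz_cont: "continuous_on UNIV (Gz t)"
  unfolding Gz_eq by (intro continuous_intros G_cont)

lemma R_cont: "continuous_on UNIV (R t)"
  unfolding R_def[abs_def] divide_inverse by (intro continuous_intros G_cont)

lemma R_growth: assumes t: "t > 0" shows "quadratic_growth (R t)"
  by (rule quadratic_growthI[OF borel_measurable_continuous_onI[OF R_cont] R_growth_local[OF t, of t]]) (use t in simp)

lemma conv_cmult: "conv (\<lambda>z. k * A z) h x = k * conv A h x"
  by (simp add: conv_def mult.assoc)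

text \<open>The kernel z G is -2ct times the space derivative of G, so two integrations by parts
  replace it by the bounded \<Gamma> acting on h''. The factor t is bounded by T, which makes the
  estimate uniform down to t = 0.\<close>

lemma G_weight:
  assumes h: "schwartz h" shows "\<exists>C. \<forall>t\<in>{0<..T}. \<forall>x. cmod (conv (\<lambda>z. of_real z * G t z) h x) \<le> C"
proof -
  define L where "L = (LBINT z. cmod (vderiv (vderiv h) z))"
  have B0: "B \<ge> 0" using order_trans[OF norm_ge_zero B[of 0]] .
  have L0: "L \<ge> 0" unfolding L_def by (rule Bochner_Integration.integral_nonneg) simp
  have "cmod (conv (\<lambda>z. of_real z * G t z) h x) \<le> 2 * T * (B * L)" if t: "0 < t" "t \<le> T" for t x
  proof -
    have "(\<lambda>z. of_real z * G t z) = (\<lambda>z. (- 2 * c * of_real t) * Gz t z)"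
      using t q(4) by (simp add: Gz_eq fun_eq_iff)
    then have "conv (\<lambda>z. of_real z * G t z) h x = (- 2 * c * of_real t) * conv (Gz t) h x"
      by (simp only: conv_cmult)
    also have "conv (Gz t) h x = conv (G t) (vderiv h) x"
      by (rule conv_by_parts[OF Gz_deriv[OF t(1)] Gz_cont G_growth[OF t(1)] Gz_growth[OF t(1)] h])
    also have "\<dots> = conv (\<Gamma> t) (vderiv (vderiv h)) x"
    proof (rule conv_by_parts[OF \<Gamma>_deriv[OF t(1)] G_cont _ G_growth[OF t(1)] schwartz_vderiv[OF h]])
      have "\<Gamma> t \<in> borel_measurable borel"
        using \<Gamma>_deriv[OF t(1)] by (meson borel_measurable_continuous_onI continuous_at_imp_continuous_on has_vector_derivative_continuous)
      then show "quadratic_growth (\<Gamma> t)" by (rule quadratic_growth_bounded[where M = B]) (simp add: \<Gamma>_def B)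
    qed
    finally have "cmod (conv (\<lambda>z. of_real z * G t z) h x) = 2 * t * cmod (conv (\<Gamma> t) (vderiv (vderiv h)) x)"
      using t q(6) by (simp add: norm_mult)
    also have "\<dots> \<le> 2 * T * (B * L)"
    proof (intro mult_mono)
      show "cmod (conv (\<Gamma> t) (vderiv (vderiv h)) x) \<le> B * L" unfolding L_def
        using \<Gamma>_deriv[OF t(1)] h
        by (intro conv_norm_bound schwartz_vderiv)
           (auto simp: \<Gamma>_def B intro!: borel_measurable_continuous_onI continuous_at_imp_continuous_on dest: has_vector_derivative_continuous)
    qed (use t in auto)
    finally show ?thesis .
  qed
  then show ?thesis by (intro exI[of _ "2 * T * (B * L)"]) auto
qed

sublocale line_kernel G \<Gamma> R B
proof
  fix t z :: real assume t: "t > 0"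
  show "(\<Gamma> t has_vector_derivative G t z) (at z)" by (rule \<Gamma>_deriv[OF t])
  show "cmod (\<Gamma> t z) \<le> B" by (simp add: \<Gamma>_def B)
  show "\<exists>M. \<forall>z. cmod (G t z) \<le> M" using G_bound[OF t] by blast
  show "((\<lambda>s. G s z) has_vector_derivative R t z) (at t)" by (rule R_deriv[OF t])
  show "\<exists>\<delta>>0. \<exists>M. \<forall>s z. \<bar>s - t\<bar> < \<delta> \<longrightarrow> cmod (R s z) \<le> M * (1 + z\<^sup>2)"
    using R_growth_local[OF t] t
    by (intro exI[of _ "t / 2"] exI[of _ "(1 / t\<^sup>2 + 1 / t) * (1 / (2 * sqrt (pi * (t / 2))))"] conjI allI impI) auto
  show "G t (- z) = G t z" by (simp add: G_def)
qed (auto intro: \<Gamma>_limit G_cont G_weight R_cont)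

lemma evt_eq: assumes h: "schwartz h" and t: "t > 0" shows "evt h t x = c * ev (vderiv (vderiv h)) t x"
proof -
  have "R t = (\<lambda>z. c * (R t z / c))" using q(4) by simp
  then have "evt h t x = c * conv (\<lambda>z. R t z / c) h x" unfolding evt_def using conv_cmult[of c "\<lambda>z. R t z / c"] by simp
  also have "conv (\<lambda>z. R t z / c) h x = conv (Gz t) (vderiv h) x"
    using quadratic_growth_cmult[OF R_growth[OF t], where k = "1 / c"] continuous_on_mult_left[OF R_cont[OF t], where c = "1 / c"]
    by (intro conv_by_parts[OF Gzz_deriv[OF t] _ Gz_growth[OF t] _ h]) simp_all
  also have "\<dots> = ev (vderiv (vderiv h)) t x" unfolding ev_def
    by (rule conv_by_parts[OF Gz_deriv[OF t] Gz_cont G_growth[OF t] Gz_growth[OF t] schwartz_vderiv[OF h]])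
  finally show ?thesis .
qed

lemma evt_locally_weighted: assumes h: "schwartz h" shows "locally_weighted (evt h)"
  unfolding locally_weighted_def
proof (intro allI impI)
  fix t :: real assume t: "t > 0"
  have h2: "schwartz (vderiv (vderiv h))" using h by blast
  obtain C where C: "\<forall>s\<in>{0<..2 * t}. \<forall>x>0. cmod (ev (vderiv (vderiv h)) s x) \<le> C / (1 + x)"
    using ev_weighted_bound[OF h2] by blast
  show "\<exists>\<delta>>0. \<exists>C. \<forall>s x. \<bar>s - t\<bar> < \<delta> \<longrightarrow> x > 0 \<longrightarrow> cmod (evt h s x) \<le> C / (1 + x)"
    by (intro exI[of _ t] exI[of _ C] conjI t)
       (use C q(6) in \<open>auto simp: abs_less_iff evt_eq[OF h] norm_mult\<close>)
qed

lemma first_order_evolution: assumes "N \<ge> 1" "\<alpha> > 0" shows "first_order_evolution ev evt N \<alpha> c"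
  using line_evolution[OF evt_locally_weighted] assms q(4) evt_eq
  by (simp add: first_order_evolution_def star_evolution_def star_evolution_axioms_def first_order_evolution_axioms_def)

end

section \<open>The Poisson kernel\<close>

context
begin

definition cyl_G :: "real \<Rightarrow> real \<Rightarrow> complex" where "cyl_G t z = of_real ((t / pi) / (t\<^sup>2 + z\<^sup>2))"
definition cyl_\<Gamma> :: "real \<Rightarrow> real \<Rightarrow> complex" where "cyl_\<Gamma> t z = of_real (arctan (z / t) / pi)"
text \<open>The conjugate Poisson kernel. With \<open>cyl_G\<close> it satisfies the Cauchy-Riemann
  equations: its space derivative is minus the time derivative of \<open>cyl_G\<close>, and its time
  derivative is the space derivative \<open>cyl_Gz\<close>.\<close>

definition cyl_Q :: "real \<Rightarrow> real \<Rightarrow> complex" where "cyl_Q t z = of_real ((z / pi) / (t\<^sup>2 + z\<^sup>2))"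
definition cyl_R :: "real \<Rightarrow> real \<Rightarrow> complex" where "cyl_R t z = of_real ((z\<^sup>2 - t\<^sup>2) / (pi * (t\<^sup>2 + z\<^sup>2)\<^sup>2))"
definition cyl_Gz :: "real \<Rightarrow> real \<Rightarrow> complex" where "cyl_Gz t z = of_real (- (2 * t * z) / (pi * (t\<^sup>2 + z\<^sup>2)\<^sup>2))"

end

lemma sum_squares_pos: "t > 0 \<Longrightarrow> (t::real)\<^sup>2 + z\<^sup>2 > 0"
  by (simp add: add_pos_nonneg)

lemma cyl_derivs:
  assumes t: "t > 0"
  shows "(cyl_\<Gamma> t has_vector_derivative cyl_G t z) (at z)"
    and "(cyl_G t has_vector_derivative cyl_Gz t z) (at z)"
    and "(cyl_Q t has_vector_derivative - cyl_R t z) (at z)"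
    and "((\<lambda>s. cyl_G s z) has_vector_derivative cyl_R t z) (at t)"
    and "((\<lambda>s. cyl_Q s z) has_vector_derivative cyl_Gz t z) (at t)"
proof -
  define D where "D = t\<^sup>2 + z\<^sup>2"
  have D: "D \<noteq> 0" using sum_squares_pos[OF t, of z] unfolding D_def by linarith
  \<comment> \<open>This relation makes the sums below polynomial identities in
    \<open>inverse D\<close>, within reach of \<open>algebra\<close>.\<close>
  have i: "inverse D * (t\<^sup>2 + z\<^sup>2) = 1" using D by (simp add: D_def[symmetric])
  have inv_z: "((\<lambda>z. inverse (t\<^sup>2 + z\<^sup>2)) has_real_derivative - (2 * z) * (inverse D)\<^sup>2) (at z)"
    using D by (auto intro!: derivative_eq_intros simp: D_def power2_eq_square)
  have inv_t: "((\<lambda>s. inverse (s\<^sup>2 + z\<^sup>2)) has_real_derivative - (2 * t) * (inverse D)\<^sup>2) (at t)"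
    using D by (auto intro!: derivative_eq_intros simp: D_def power2_eq_square)
  have "((\<lambda>z. arctan (z / t) / pi) has_real_derivative inverse (1 + (z / t)\<^sup>2) * (1 / t) / pi) (at z)"
    by (intro DERIV_cdivide DERIV_chain2[OF DERIV_arctan] DERIV_ident)
  moreover have "inverse (1 + (z / t)\<^sup>2) = t\<^sup>2 / (t\<^sup>2 + z\<^sup>2)"
  proof -
    have "1 + (z / t)\<^sup>2 = (t\<^sup>2 + z\<^sup>2) / t\<^sup>2" using t by (simp add: power_divide add_divide_distrib)
    then show ?thesis by (simp only: inverse_divide)
  qed
  ultimately have "((\<lambda>z. arctan (z / t) / pi) has_real_derivative (t / pi) / (t\<^sup>2 + z\<^sup>2)) (at z)"
    using t by (simp add: power2_eq_square mult.commute)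
  then show "(cyl_\<Gamma> t has_vector_derivative cyl_G t z) (at z)"
    unfolding cyl_\<Gamma>_def[abs_def] cyl_G_def by (rule of_real_has_vector_derivative)
  have "((\<lambda>z. (t / pi) * inverse (t\<^sup>2 + z\<^sup>2)) has_real_derivative (t / pi) * (- (2 * z) * (inverse D)\<^sup>2)) (at z)"
    by (rule DERIV_cmult[OF inv_z])
  also have "(t / pi) * (- (2 * z) * (inverse D)\<^sup>2) = - (2 * t * z) / (pi * D\<^sup>2)"
    by (simp add: divide_inverse power_inverse mult_ac)
  finally show "(cyl_G t has_vector_derivative cyl_Gz t z) (at z)"
    unfolding cyl_G_def[abs_def] cyl_Gz_def D_def
    by (intro of_real_has_vector_derivative) (simp add: divide_inverse)
  have "((\<lambda>z. (z / pi) * inverse (t\<^sup>2 + z\<^sup>2)) has_real_derivative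
      (1 / pi) * inverse (t\<^sup>2 + z\<^sup>2) + (- (2 * z) * (inverse D)\<^sup>2) * (z / pi)) (at z)"
    by (rule DERIV_mult'[OF _ inv_z, THEN DERIV_cong]) (auto intro!: derivative_eq_intros)
  also have "(1 / pi) * inverse (t\<^sup>2 + z\<^sup>2) + (- (2 * z) * (inverse D)\<^sup>2) * (z / pi) =
      (1 / pi) * (inverse D + (- (2 * z) * (inverse D)\<^sup>2) * z)" by (simp add: D_def algebra_simps)
  also have "inverse D + (- (2 * z) * (inverse D)\<^sup>2) * z = - ((z\<^sup>2 - t\<^sup>2) * (inverse D)\<^sup>2)" using i by algebra
  also have "(1 / pi) * - ((z\<^sup>2 - t\<^sup>2) * (inverse D)\<^sup>2) = - ((z\<^sup>2 - t\<^sup>2) / (pi * D\<^sup>2))"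
    by (simp add: divide_inverse power_inverse mult_ac)
  finally show "(cyl_Q t has_vector_derivative - cyl_R t z) (at z)"
    unfolding cyl_Q_def[abs_def] cyl_R_def of_real_minus[symmetric] D_def
    by (intro of_real_has_vector_derivative) (simp add: divide_inverse)
  have "((\<lambda>s. (s / pi) * inverse (s\<^sup>2 + z\<^sup>2)) has_real_derivative
      (1 / pi) * inverse (t\<^sup>2 + z\<^sup>2) + (- (2 * t) * (inverse D)\<^sup>2) * (t / pi)) (at t)"
    by (rule DERIV_mult'[OF _ inv_t, THEN DERIV_cong]) (auto intro!: derivative_eq_intros)
  also have "(1 / pi) * inverse (t\<^sup>2 + z\<^sup>2) + (- (2 * t) * (inverse D)\<^sup>2) * (t / pi) =
      (1 / pi) * (inverse D + (- (2 * t) * (inverse D)\<^sup>2) * t)" by (simp add: D_def algebra_simps)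
  also have "inverse D + (- (2 * t) * (inverse D)\<^sup>2) * t = (z\<^sup>2 - t\<^sup>2) * (inverse D)\<^sup>2" using i by algebra
  also have "(1 / pi) * ((z\<^sup>2 - t\<^sup>2) * (inverse D)\<^sup>2) = (z\<^sup>2 - t\<^sup>2) / (pi * D\<^sup>2)"
    by (simp add: divide_inverse power_inverse mult_ac)
  finally show "((\<lambda>s. cyl_G s z) has_vector_derivative cyl_R t z) (at t)"
    unfolding cyl_G_def cyl_R_def D_def
    by (intro of_real_has_vector_derivative) (simp add: divide_inverse)
  have "((\<lambda>s. (z / pi) * inverse (s\<^sup>2 + z\<^sup>2)) has_real_derivative (z / pi) * (- (2 * t) * (inverse D)\<^sup>2)) (at t)"
    by (rule DERIV_cmult[OF inv_t])
  also have "(z / pi) * (- (2 * t) * (inverse D)\<^sup>2) = - (2 * t * z) / (pi * D\<^sup>2)"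
    by (simp add: divide_inverse power_inverse mult_ac)
  finally show "((\<lambda>s. cyl_Q s z) has_vector_derivative cyl_Gz t z) (at t)"
    unfolding cyl_Q_def cyl_Gz_def D_def
    by (intro of_real_has_vector_derivative) (simp add: divide_inverse)
qed

lemma cyl_cont: "t > 0 \<Longrightarrow> continuous_on UNIV (cyl_G t)" "t > 0 \<Longrightarrow> continuous_on UNIV (cyl_Q t)"
  "t > 0 \<Longrightarrow> continuous_on UNIV (cyl_\<Gamma> t)" "t > 0 \<Longrightarrow> continuous_on UNIV (cyl_R t)"
  "t > 0 \<Longrightarrow> continuous_on UNIV (cyl_Gz t)"
  unfolding cyl_G_def[abs_def] cyl_Q_def[abs_def] cyl_\<Gamma>_def[abs_def] cyl_R_def[abs_def] cyl_Gz_def[abs_def]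
  using sum_squares_pos[of t, THEN less_imp_neq]
  by (intro continuous_on_of_real continuous_intros ballI; force)+

lemma cyl_bounds:
  assumes t: "t > 0"
  shows "cmod (cyl_G t z) \<le> 1 / (pi * t)" "cmod (cyl_Q t z) \<le> 1 / (2 * pi * t)"
    and "cmod (of_real z * cyl_G t z) \<le> 1 / (2 * pi)" "cmod (of_real z * cyl_Q t z) \<le> 1 / pi"
    and "cmod (cyl_\<Gamma> t z) \<le> 1 / 2" "cmod (cyl_R t z) \<le> 1 / (pi * t\<^sup>2)" "cmod (cyl_Gz t z) \<le> 1 / (pi * t\<^sup>2)"
proof -
  note p = sum_squares_pos[OF t, of z]
  have am: "2 * (t * \<bar>z\<bar>) \<le> t\<^sup>2 + z\<^sup>2"
    using zero_le_power2[of "t - \<bar>z\<bar>"] unfolding power2_diff by simp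
  have tt: "t\<^sup>2 \<le> t\<^sup>2 + z\<^sup>2" "z\<^sup>2 \<le> t\<^sup>2 + z\<^sup>2" by auto
  have frac: "(a / pi) / (t\<^sup>2 + z\<^sup>2) \<le> 1 / (pi * b)" if "a * b \<le> t\<^sup>2 + z\<^sup>2" "b > 0" for a b
    using that p by (simp add: divide_simps mult.commute)
  have "cmod (cyl_G t z) = (t / pi) / (t\<^sup>2 + z\<^sup>2)" using t p unfolding cyl_G_def norm_of_real by simp
  also have "\<dots> \<le> 1 / (pi * t)" by (rule frac) (use t in \<open>auto simp: power2_eq_square\<close>)
  finally show "cmod (cyl_G t z) \<le> 1 / (pi * t)" .
  have Q: "cmod (cyl_Q t z) = (\<bar>z\<bar> / pi) / (t\<^sup>2 + z\<^sup>2)" using p unfolding cyl_Q_def norm_of_real by (simp add: abs_divide)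
  also have "\<dots> \<le> 1 / (pi * (2 * t))" by (rule frac) (use t am in \<open>auto simp: mult_ac\<close>)
  finally show "cmod (cyl_Q t z) \<le> 1 / (2 * pi * t)" by (simp add: mult_ac)
  have "cmod (of_real z * cyl_G t z) = ((\<bar>z\<bar> * t) / pi) / (t\<^sup>2 + z\<^sup>2)"
    using t p unfolding cyl_G_def of_real_mult[symmetric] norm_of_real by (simp add: abs_mult abs_divide)
  also have "\<dots> \<le> 1 / (pi * 2)" by (rule frac) (use am in \<open>auto simp: mult_ac\<close>)
  finally show "cmod (of_real z * cyl_G t z) \<le> 1 / (2 * pi)" by (simp add: mult_ac)
  have "cmod (of_real z * cyl_Q t z) = (z\<^sup>2 / pi) / (t\<^sup>2 + z\<^sup>2)"
    using p unfolding cyl_Q_def of_real_mult[symmetric] norm_of_real by (simp add: abs_mult abs_divide power2_eq_square)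
  also have "\<dots> \<le> 1 / (pi * 1)" by (rule frac) auto
  finally show "cmod (of_real z * cyl_Q t z) \<le> 1 / pi" by simp
  show "cmod (cyl_\<Gamma> t z) \<le> 1 / 2"
    unfolding cyl_\<Gamma>_def norm_of_real
    using arctan_bounded[of "z / t"] by (auto simp: abs_le_iff divide_simps)
  have frac2: "a / (pi * (t\<^sup>2 + z\<^sup>2)\<^sup>2) \<le> 1 / (pi * t\<^sup>2)" if "0 \<le> a" "a \<le> t\<^sup>2 + z\<^sup>2" for a
  proof -
    have "a / (pi * (t\<^sup>2 + z\<^sup>2)\<^sup>2) \<le> (t\<^sup>2 + z\<^sup>2) / (pi * (t\<^sup>2 + z\<^sup>2)\<^sup>2)"
      using that by (intro divide_right_mono) auto
    also have "\<dots> = 1 / (pi * (t\<^sup>2 + z\<^sup>2))" using p by (simp add: power2_eq_square)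
    also have "\<dots> \<le> 1 / (pi * t\<^sup>2)" using t p by (intro divide_left_mono mult_left_mono mult_pos_pos) auto
    finally show ?thesis .
  qed
  have "cmod (cyl_R t z) = \<bar>z\<^sup>2 - t\<^sup>2\<bar> / (pi * (t\<^sup>2 + z\<^sup>2)\<^sup>2)"
    unfolding cyl_R_def norm_of_real by (simp add: abs_divide abs_mult)
  also have "\<dots> \<le> 1 / (pi * t\<^sup>2)" by (rule frac2) (auto simp: abs_le_iff)
  finally show "cmod (cyl_R t z) \<le> 1 / (pi * t\<^sup>2)" .
  have "cmod (cyl_Gz t z) = (2 * t * \<bar>z\<bar>) / (pi * (t\<^sup>2 + z\<^sup>2)\<^sup>2)"
    unfolding cyl_Gz_def norm_of_real using t by (simp add: abs_divide abs_mult)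
  also have "\<dots> \<le> 1 / (pi * t\<^sup>2)" by (rule frac2) (use t am in auto)
  finally show "cmod (cyl_Gz t z) \<le> 1 / (pi * t\<^sup>2)" .
qed

lemma cyl_growth: assumes "t > 0"
  shows "quadratic_growth (cyl_G t)" "quadratic_growth (cyl_Q t)" "quadratic_growth (cyl_Gz t)" "quadratic_growth (cyl_R t)"
    "quadratic_growth (\<lambda>z. of_real z * cyl_G t z)" "quadratic_growth (\<lambda>z. of_real z * cyl_Q t z)"
  using cyl_bounds[OF assms]
  by (auto intro!: quadratic_growth_bounded borel_measurable_continuous_onI continuous_intros cyl_cont assms)

lemma cyl_square_lower: "t > 0 \<Longrightarrow> \<bar>s - t\<bar> < t / 2 \<Longrightarrow> 1 / (pi * s\<^sup>2) \<le> 4 / (pi * t\<^sup>2)"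
proof -
  assume t: "t > 0" and s: "\<bar>s - t\<bar> < t / 2"
  then have s2: "s \<ge> t / 2" unfolding abs_less_iff by linarith
  then have "t\<^sup>2 \<le> 4 * s\<^sup>2" using power_mono[of t "2 * s" 2] t by (simp add: power_mult_distrib)
  then show ?thesis using t s2 by (simp add: divide_simps)
qed

interpretation cyl: line_kernel cyl_G cyl_\<Gamma> cyl_R "1 / 2"
proof
  fix t z T :: real and h :: "real \<Rightarrow> complex"
  show "((\<lambda>t. cyl_\<Gamma> t z) \<longlongrightarrow> of_real (sgn z) / 2) (at_right 0)" if z: "z \<noteq> 0"
  proof -
    have "((\<lambda>t. arctan (z / t) / pi) \<longlongrightarrow> sgn z / 2) (at_right 0)"
    proof (cases "z > 0")
      case True
      then have "filterlim (\<lambda>t. z / t) at_top (at_right 0)" by real_asymp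
      from tendsto_divide[OF filterlim_compose[OF tendsto_arctan_at_top this] tendsto_const[of pi]] True
      show ?thesis by simp
    next
      case False
      then have "z < 0" using z by simp
      then have "filterlim (\<lambda>t. z / t) at_bot (at_right 0)" by real_asymp
      from tendsto_divide[OF filterlim_compose[OF tendsto_arctan_at_bot this] tendsto_const[of pi]] \<open>z < 0\<close>
      show ?thesis by simp
    qed
    from tendsto_of_real[OF this, where 'a = complex] show ?thesis by (simp add: cyl_\<Gamma>_def)
  qed
  show "\<exists>C. \<forall>t\<in>{0<..T}. \<forall>x. cmod (conv (\<lambda>z. of_real z * cyl_G t z) h x) \<le> C" if "schwartz h"
    using that cyl_bounds(3)
    by (intro exI[of _ "1 / (2 * pi) * (LBINT z. cmod (h z))"] ballI allI conv_norm_bound)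
       (auto intro!: borel_measurable_continuous_onI continuous_intros cyl_cont)
  assume t: "t > 0"
  show "\<exists>M. \<forall>z. cmod (cyl_G t z) \<le> M" using cyl_bounds(1)[OF t] by blast
  show "cmod (cyl_\<Gamma> t z) \<le> 1 / 2" using cyl_bounds(5)[OF t] .
  show "\<exists>\<delta>>0. \<exists>M. \<forall>s z. \<bar>s - t\<bar> < \<delta> \<longrightarrow> cmod (cyl_R s z) \<le> M * (1 + z\<^sup>2)"
  proof (rule exI[of _ "t / 2"], rule conjI, use t in simp, rule exI[of _ "4 / (pi * t\<^sup>2)"], intro allI impI)
    fix s z assume s: "\<bar>s - t\<bar> < t / 2"
    then have "s > 0" using t unfolding abs_less_iff by linarith
    then have "cmod (cyl_R s z) \<le> 4 / (pi * t\<^sup>2) * 1"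
      using cyl_bounds(6)[of s z] cyl_square_lower[OF t s] by simp
    also have "\<dots> \<le> 4 / (pi * t\<^sup>2) * (1 + z\<^sup>2)" using t by (intro mult_left_mono) auto
    finally show "cmod (cyl_R s z) \<le> 4 / (pi * t\<^sup>2) * (1 + z\<^sup>2)" .
  qed
  show "cyl_G t (- z) = cyl_G t z" by (simp add: cyl_G_def)
qed (auto intro: cyl_derivs cyl_cont)

text \<open>Integration by parts with the first Cauchy-Riemann equation. In this form a second time
  derivative can be taken by the other equation, which produces a space derivative of the Poisson
  kernel.\<close>

lemma cyl_evt_eq: "schwartz h \<Longrightarrow> t > 0 \<Longrightarrow> cyl.evt h t x = - conv (cyl_Q t) (vderiv h) x"
proof -
  assume h: "schwartz h" and t: "t > 0"
  have "conv (\<lambda>z. - cyl_R t z) h x = conv (cyl_Q t) (vderiv h) x"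
    using cyl_growth(4)[OF t] cyl_cont(4)[OF t]
    by (intro conv_by_parts[OF cyl_derivs(3)[OF t] _ cyl_growth(2)[OF t] _ h])
       (auto intro!: continuous_intros simp: quadratic_growth_def)
  moreover have "cyl.evt h t x = - conv (\<lambda>z. - cyl_R t z) h x" by (simp add: conv_def cyl.evt_def)
  ultimately show ?thesis by simp
qed

text \<open>Used on two ranges: with \<tau> = t/2 as the bound near a given time t, with \<tau> = 1
  as the bound for large times.\<close>

lemma cyl_evt_weighted:
  assumes h: "schwartz h" and \<tau>: "\<tau> > 0"
  shows "\<exists>C. \<forall>t\<ge>\<tau>. \<forall>x>0. cmod (cyl.evt h t x) \<le> C / (1 + x)"
proof -
  define k where "k = vderiv h"
  have k: "schwartz k" using h by (auto simp: k_def)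
  define K where "K = 1 / (2 * pi * \<tau>) * (LBINT z. cmod (k z)) + (1 / pi * (LBINT z. cmod (k z)) +
    1 / (2 * pi * \<tau>) * (LBINT z. cmod (of_real z * k z)))"
  have "cmod (cyl.evt h t x) \<le> K / (1 + x)" if t: "t \<ge> \<tau>" and x: "x > 0" for t x
  proof -
    have t0: "t > 0" using t \<tau> by simp
    have m: "cyl_Q t \<in> borel_measurable borel" "(\<lambda>z. of_real z * cyl_Q t z) \<in> borel_measurable borel"
      by (auto intro!: borel_measurable_continuous_onI continuous_intros cyl_cont t0)
    have b: "cmod (cyl_Q t z) \<le> 1 / (2 * pi * \<tau>)" for z
      using t \<tau> by (intro order_trans[OF cyl_bounds(2)[OF t0]] divide_left_mono mult_left_mono mult_pos_pos) auto
    have e: "cmod (cyl.evt h t x) = cmod (conv (cyl_Q t) k x)" by (simp add: cyl_evt_eq[OF h t0] k_def)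
    have "x * cmod (conv (cyl_Q t) k x) = cmod (of_real x * conv (cyl_Q t) k x)" using x by (simp add: norm_mult)
    also have "of_real x * conv (cyl_Q t) k x = conv (\<lambda>z. of_real z * cyl_Q t z) k x + conv (cyl_Q t) (\<lambda>z. of_real z * k z) x"
      by (rule conv_times_id[OF cyl_growth(2)[OF t0] cyl_growth(6)[OF t0] k])
    also have "cmod \<dots> \<le> 1 / pi * (LBINT z. cmod (k z)) + 1 / (2 * pi * \<tau>) * (LBINT z. cmod (of_real z * k z))"
      by (intro order_trans[OF norm_triangle_ineq] add_mono conv_norm_bound m b k schwartz_times_id cyl_bounds(4) t0)
    finally have "(1 + x) * cmod (conv (cyl_Q t) k x) \<le> K"
      using conv_norm_bound[OF m(1) b k, of x] by (simp add: distrib_right K_def)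
    then show ?thesis using x by (simp add: e pos_le_divide_eq mult.commute)
  qed
  then show ?thesis by blast
qed

lemma cyl_evt_locally_weighted: assumes h: "schwartz h" shows "locally_weighted (cyl.evt h)"
  unfolding locally_weighted_def
proof (intro allI impI)
  fix t :: real assume t: "t > 0"
  obtain C where C: "\<forall>s\<ge>t / 2. \<forall>x>0. cmod (cyl.evt h s x) \<le> C / (1 + x)"
    using cyl_evt_weighted[OF h, of "t / 2"] t by auto
  have "s \<ge> t / 2" if "\<bar>s - t\<bar> < t / 2" for s using that unfolding abs_less_iff by linarith
  then show "\<exists>\<delta>>0. \<exists>C. \<forall>s x. \<bar>s - t\<bar> < \<delta> \<longrightarrow> x > 0 \<longrightarrow> cmod (cyl.evt h s x) \<le> C / (1 + x)"
    using C t by (intro exI[of _ "t / 2"] exI[of _ C]) auto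
qed

lemma cyl_evt_deriv:
  assumes h: "schwartz h" and t: "t > 0"
  shows "((\<lambda>s. cyl.evt h s x) has_vector_derivative - 1 * cyl.ev (vderiv (vderiv h)) t x) (at t)"
proof -
  have h': "schwartz (vderiv h)" using h by blast
  have "((\<lambda>s. conv (cyl_Q s) (vderiv h) x) has_vector_derivative conv (cyl_Gz t) (vderiv h) x) (at t)"
  proof (rule conv_deriv_parameter[where \<delta> = "t / 2" and M = "4 / (pi * t\<^sup>2)"])
    fix s z assume s: "\<bar>s - t\<bar> < t / 2"
    then have s0: "s > 0" using t unfolding abs_less_iff by linarith
    show "quadratic_growth (cyl_Q s)" using cyl_growth(2)[OF s0] .
    show "((\<lambda>s. cyl_Q s z) has_vector_derivative cyl_Gz s z) (at s)" using cyl_derivs(5)[OF s0] .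
    have "cmod (cyl_Gz s z) \<le> 4 / (pi * t\<^sup>2) * 1"
      using cyl_bounds(7)[OF s0, of z] cyl_square_lower[OF t s] by simp
    also have "\<dots> \<le> 4 / (pi * t\<^sup>2) * (1 + z\<^sup>2)" using t by (intro mult_left_mono) auto
    finally show "cmod (cyl_Gz s z) \<le> 4 / (pi * t\<^sup>2) * (1 + z\<^sup>2)" .
  qed (use t h' cyl_cont in \<open>auto intro: borel_measurable_continuous_onI\<close>)
  also have "conv (cyl_Gz t) (vderiv h) x = cyl.ev (vderiv (vderiv h)) t x"
    unfolding cyl.ev_def
    by (rule conv_by_parts[OF cyl_derivs(2)[OF t] cyl_cont(5)[OF t] cyl_growth(1)[OF t] cyl_growth(3)[OF t] h'])
  finally have "((\<lambda>s. - conv (cyl_Q s) (vderiv h) x) has_vector_derivative - 1 * cyl.ev (vderiv (vderiv h)) t x) (at t)"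
    using has_vector_derivative_minus by fastforce
  then show ?thesis
    by (rule has_vector_derivative_transform_within_open[of _ _ _ "{0<..}"]) (use t in \<open>auto simp: cyl_evt_eq[OF h]\<close>)
qed

text \<open>The maximum 1/(pi t) of the Poisson kernel gives the limit; the weight in x comes from
  the first moment z G, which is bounded by 1/(2 pi) at all times.\<close>

lemma cyl_ev_final:
  assumes h: "schwartz h"
  shows "\<exists>C. \<forall>t\<ge>1. \<forall>x>0. cmod (cyl.ev h t x) \<le> C / (1 + x)" "((\<lambda>t. cyl.ev h t x) \<longlongrightarrow> 0) at_top"
proof -
  have m: "cyl_G t \<in> borel_measurable borel" "(\<lambda>z. of_real z * cyl_G t z) \<in> borel_measurable borel" if "t > 0" for t
    by (auto intro!: borel_measurable_continuous_onI continuous_intros cyl_cont that)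
  define K where "K = 1 / pi * (LBINT z. cmod (h z)) + (1 / (2 * pi) * (LBINT z. cmod (h z)) +
    1 / pi * (LBINT z. cmod (of_real z * h z)))"
  have "cmod (cyl.ev h t x) \<le> K / (1 + x)" if t: "t \<ge> 1" and x: "x > 0" for t x
  proof -
    have t0: "t > 0" using t by simp
    have b: "cmod (cyl_G t z) \<le> 1 / pi" for z
      using t by (intro order_trans[OF cyl_bounds(1)[OF t0]] divide_left_mono) auto
    have "x * cmod (cyl.ev h t x) = cmod (of_real x * conv (cyl_G t) h x)" using x by (simp add: norm_mult cyl.ev_def)
    also have "of_real x * conv (cyl_G t) h x = conv (\<lambda>z. of_real z * cyl_G t z) h x + conv (cyl_G t) (\<lambda>z. of_real z * h z) x"
      by (rule conv_times_id[OF cyl_growth(1)[OF t0] cyl_growth(5)[OF t0] h])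
    also have "cmod \<dots> \<le> 1 / (2 * pi) * (LBINT z. cmod (h z)) + 1 / pi * (LBINT z. cmod (of_real z * h z))"
      by (intro order_trans[OF norm_triangle_ineq] add_mono conv_norm_bound m b h schwartz_times_id cyl_bounds(3) t0)
    finally have "(1 + x) * cmod (cyl.ev h t x) \<le> K"
      using conv_norm_bound[OF m(1)[OF t0] b h, of x] by (simp add: distrib_right K_def cyl.ev_def)
    then show ?thesis using x by (simp add: pos_le_divide_eq mult.commute)
  qed
  then show "\<exists>C. \<forall>t\<ge>1. \<forall>x>0. cmod (cyl.ev h t x) \<le> C / (1 + x)" by blast
  show "((\<lambda>t. cyl.ev h t x) \<longlongrightarrow> 0) at_top"
  proof (rule Lim_null_comparison)
    show "\<forall>\<^sub>F t in at_top. cmod (cyl.ev h t x) \<le> 1 / (pi * t) * (LBINT z. cmod (h z))"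
      using eventually_gt_at_top[of 0]
      by eventually_elim (unfold cyl.ev_def, intro conv_norm_bound m cyl_bounds h)
    have "((\<lambda>t. 1 / (pi * t)) \<longlongrightarrow> 0) at_top" by real_asymp
    then show "((\<lambda>t. 1 / (pi * t) * (LBINT z. cmod (h z))) \<longlongrightarrow> 0) at_top" by (rule tendsto_mult_left_zero)
  qed
qed

lemma cyl_evolution: assumes "N \<ge> 1" "\<alpha> > 0" shows "cylinder_evolution cyl.ev cyl.evt N \<alpha>"
  using cyl.line_evolution[OF cyl_evt_locally_weighted] assms cyl_evt_deriv cyl_ev_final cyl_evt_weighted[of _ 1]
  by (simp add: cylinder_evolution_def cylinder_evolution_axioms_def second_order_evolution_def
      second_order_evolution_axioms_def star_evolution_def star_evolution_axioms_def)

section \<open>The wave evolution\<close>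

text \<open>D'Alembert's formula for vanishing initial velocity.\<close>

definition wave_ev :: "(real \<Rightarrow> complex) \<Rightarrow> real \<Rightarrow> real \<Rightarrow> complex" where
  "wave_ev h t x = (h (x - t) + h (x + t)) / 2"
definition wave_evt :: "(real \<Rightarrow> complex) \<Rightarrow> real \<Rightarrow> real \<Rightarrow> complex" where
  "wave_evt h t x = (vderiv h (x + t) - vderiv h (x - t)) / 2"

lemma shifted_weight:
  assumes h: "schwartz h"
  shows "\<exists>C. \<forall>t\<in>{0<..T}. \<forall>x>0. cmod (h (x - t)) \<le> C / (1 + x) \<and> cmod (h (x + t)) \<le> C / (1 + x)"
proof -
  obtain C where C: "C \<ge> 0" "\<And>z. cmod (h z) \<le> C / (1 + z\<^sup>2)" by (rule schwartz_bound_Lorentz[OF h]) blast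
  have "cmod (h y) \<le> C * (2 + \<bar>T\<bar>) / (1 + x)" if x: "x > 0" and y: "\<bar>x - y\<bar> \<le> \<bar>T\<bar>" for x y
  proof -
    have "\<bar>y\<bar> \<le> 1 + y\<^sup>2" using zero_le_power2[of "\<bar>y\<bar> - 1"] unfolding power2_diff by simp
    then have "1 + x \<le> 1 + (1 + y\<^sup>2) + \<bar>T\<bar>" using y by linarith
    also have "\<dots> \<le> (2 + \<bar>T\<bar>) * (1 + y\<^sup>2)" by (simp add: algebra_simps)
    finally have "C * (1 + x) \<le> C * ((2 + \<bar>T\<bar>) * (1 + y\<^sup>2))" using C(1) by (rule mult_left_mono)
    moreover have "0 < 1 + y\<^sup>2" by (intro add_pos_nonneg) auto
    ultimately have "C / (1 + y\<^sup>2) \<le> C * (2 + \<bar>T\<bar>) / (1 + x)"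
      using x by (simp add: divide_simps mult_ac)
    then show ?thesis using C(2)[of y] by linarith
  qed
  then show ?thesis by (intro exI[of _ "C * (2 + \<bar>T\<bar>)"]) auto
qed

lemma shifted_derivs:
  assumes "smooth h"
  shows "((\<lambda>t. h (x - t)) has_vector_derivative - vderiv h (x - t)) (at t)"
    "((\<lambda>t. h (x + t)) has_vector_derivative vderiv h (x + t)) (at t)"
    "((\<lambda>x. h (x - t)) has_vector_derivative vderiv h (x - t)) (at x)"
    "((\<lambda>x. h (x + t)) has_vector_derivative vderiv h (x + t)) (at x)"
proof -
  have c: "((\<lambda>s. h (a * s + b)) has_vector_derivative of_real a * vderiv h (a * s + b)) (at s)" for a b s
    using smooth_vderiv_at[OF smooth_affine[OF assms, of a b], of s] vderiv_n_affine[OF assms, of 1 a b] by simp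
  show "((\<lambda>t. h (x - t)) has_vector_derivative - vderiv h (x - t)) (at t)"
    "((\<lambda>t. h (x + t)) has_vector_derivative vderiv h (x + t)) (at t)"
    "((\<lambda>x. h (x - t)) has_vector_derivative vderiv h (x - t)) (at x)"
    "((\<lambda>x. h (x + t)) has_vector_derivative vderiv h (x + t)) (at x)"
    using c[of "-1" x t] c[of 1 x t] c[of 1 "-t" x] c[of 1 t x] by (simp_all add: add.commute)
qed

lemma wave_bound:
  assumes h: "schwartz h"
  shows "\<exists>C. \<forall>t\<in>{0<..T}. \<forall>x>0. cmod (wave_ev h t x) \<le> C / (1 + x)"
    "\<exists>C. \<forall>t\<in>{0<..T}. \<forall>x>0. cmod (wave_evt h t x) \<le> C / (1 + x)"
proof -
  have avg: "cmod ((a + b) / 2) \<le> c" "cmod ((b - a) / 2) \<le> c" if "cmod a \<le> c" "cmod b \<le> c" for a b c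
    using that norm_triangle_ineq[of a b] norm_triangle_ineq4[of b a] by (auto simp: norm_divide)
  obtain C where "\<forall>t\<in>{0<..T}. \<forall>x>0. cmod (h (x - t)) \<le> C / (1 + x) \<and> cmod (h (x + t)) \<le> C / (1 + x)"
    using shifted_weight[OF h] by blast
  then show "\<exists>C. \<forall>t\<in>{0<..T}. \<forall>x>0. cmod (wave_ev h t x) \<le> C / (1 + x)"
    unfolding wave_ev_def by (intro exI[of _ C] ballI allI impI avg) auto
  obtain C where "\<forall>t\<in>{0<..T}. \<forall>x>0. cmod (vderiv h (x - t)) \<le> C / (1 + x) \<and> cmod (vderiv h (x + t)) \<le> C / (1 + x)"
    using shifted_weight[OF schwartz_vderiv[OF h]] by blast
  then show "\<exists>C. \<forall>t\<in>{0<..T}. \<forall>x>0. cmod (wave_evt h t x) \<le> C / (1 + x)"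
    unfolding wave_evt_def by (intro exI[of _ C] ballI allI impI avg) auto
qed

lemma wave_line_evolution: "line_evolution wave_ev wave_evt"
proof
  fix g h :: "real \<Rightarrow> complex" and t x T :: real and c :: complex
  assume h: "schwartz h"
  have sm: "smooth h" "smooth (vderiv h)" using schwartz_smooth[OF h] by auto
  show "\<exists>C. \<forall>t\<in>{0<..T}. \<forall>x>0. cmod (wave_ev h t x) \<le> C / (1 + x)" using wave_bound(1)[OF h] .
  show "locally_weighted (wave_evt h)" unfolding locally_weighted_def
  proof (intro allI impI)
    fix t :: real assume t: "t > 0"
    obtain C where C: "\<forall>s\<in>{0<..2 * t}. \<forall>x>0. cmod (wave_evt h s x) \<le> C / (1 + x)" using wave_bound(2)[OF h] by blast
    show "\<exists>\<delta>>0. \<exists>C. \<forall>s x. \<bar>s - t\<bar> < \<delta> \<longrightarrow> x > 0 \<longrightarrow> cmod (wave_evt h s x) \<le> C / (1 + x)"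
      by (intro exI[of _ t] exI[of _ C] conjI t) (use C in \<open>auto simp: abs_less_iff\<close>)
  qed
  show "((\<lambda>t. wave_ev h t x) \<longlongrightarrow> h x) (at_right 0)"
  proof -
    have "((\<lambda>t. h (x - t)) \<longlongrightarrow> h (x - 0)) (at_right 0)" "((\<lambda>t. h (x + t)) \<longlongrightarrow> h (x + 0)) (at_right 0)"
      by (intro isCont_tendsto_compose[OF smooth_isCont[OF sm(1)]] tendsto_intros)+
    from tendsto_divide[OF tendsto_add[OF this] tendsto_const[of 2]] show ?thesis by (simp add: wave_ev_def)
  qed
  show "(wave_ev h t has_vector_derivative wave_ev (vderiv h) t x) (at x)"
    unfolding wave_ev_def[abs_def] by (intro has_vector_derivative_divide has_vector_derivative_add shifted_derivs sm)
  show "((\<lambda>s. wave_ev h s x) has_vector_derivative wave_evt h t x) (at t)"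
    unfolding wave_ev_def wave_evt_def
    using has_vector_derivative_divide[OF has_vector_derivative_add[OF shifted_derivs(1,2)[OF sm(1)]], of x x 2 t] by simp
  show "wave_evt h t \<in> borel_measurable borel"
    unfolding wave_evt_def[abs_def]
    by (intro borel_measurable_continuous_onI continuous_intros continuous_on_compose2[OF smooth_continuous[OF sm(2), of UNIV]]) auto
  show "wave_ev (\<lambda>z. g z + h z) t x = wave_ev g t x + wave_ev h t x" by (simp add: wave_ev_def field_simps)
  show "wave_ev (\<lambda>z. c * h z) t x = c * wave_ev h t x" by (simp add: wave_ev_def field_simps)
  assume "\<And>z. h (- z) = - h z"
  from this[of t] show "wave_ev h t 0 = 0" by (simp add: wave_ev_def)
qed

lemma wave_evolution: assumes "N \<ge> 1" "\<alpha> > 0" shows "wave_evolution wave_ev wave_evt N \<alpha>"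
proof -
  have "((\<lambda>s. wave_evt h s x) has_vector_derivative 1 * wave_ev (vderiv (vderiv h)) t x) (at t)" if h: "schwartz h" for h t x
    unfolding wave_ev_def wave_evt_def
    using has_vector_derivative_divide[OF has_vector_derivative_diff[OF shifted_derivs(2,1)], of "vderiv h" "vderiv h" x x 2 t]
      schwartz_smooth[OF h] by (simp add: add.commute)
  moreover have "((\<lambda>t. wave_evt h t x) \<longlongrightarrow> 0) (at_right 0)" if h: "schwartz h" for h x
  proof -
    have sm: "smooth (vderiv h)" using schwartz_smooth[OF h] by auto
    have "((\<lambda>t. vderiv h (x - t)) \<longlongrightarrow> vderiv h (x - 0)) (at_right 0)" "((\<lambda>t. vderiv h (x + t)) \<longlongrightarrow> vderiv h (x + 0)) (at_right 0)"
      by (intro isCont_tendsto_compose[OF smooth_isCont[OF sm]] tendsto_intros)+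
    from tendsto_divide[OF tendsto_diff[OF this(2,1)] tendsto_const[of 2]] show ?thesis by (simp add: wave_evt_def)
  qed
  ultimately show ?thesis
    using wave_line_evolution assms wave_bound(2)[of _ 1]
    by (simp add: wave_evolution_def wave_evolution_axioms_def second_order_evolution_def
        second_order_evolution_axioms_def star_evolution_def star_evolution_axioms_def)
qed

section \<open>The kernel of the explicit solution\<close>

text \<open>Comparison with the integrable function 1/(1 + u^2), by way of 1 + u + u^2/2 \<le> exp
  u.\<close>

lemma exp_half_line_integrable:
  assumes \<kappa>: "\<kappa> > 0"
  shows "integrable lborel (\<lambda>s::real. indicator {x..} s *\<^sub>R exp (- (\<kappa> * (s - x))))"
proof (rule Bochner_Integration.integrable_bound)
  show "integrable lborel (\<lambda>s. 2 * (1 / (1 + (- \<kappa> * x + \<kappa> * s)\<^sup>2)))"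
    using \<kappa> by (intro integrable_mult_right lborel_integrable_real_affine[OF integrable_Lorentz]) simp
  have "exp (- u) \<le> 2 * (1 / (1 + u\<^sup>2))" if "u \<ge> 0" for u :: real
  proof -
    have "1 + u + u\<^sup>2 / 2 \<le> exp u" using that by (rule exp_lower_Taylor_quadratic)
    then have "1 + u\<^sup>2 \<le> 2 * exp u" using that by simp
    moreover have "0 < 1 + u\<^sup>2" by (intro add_pos_nonneg) auto
    ultimately show ?thesis by (simp add: exp_minus field_simps)
  qed
  moreover have "- \<kappa> * x + \<kappa> * s = \<kappa> * (s - x)" for s by (simp add: algebra_simps)
  ultimately show "AE s in lborel. norm (indicator {x..} s *\<^sub>R exp (- (\<kappa> * (s - x)))) \<le>
      norm (2 * (1 / (1 + (- \<kappa> * x + \<kappa> * s)\<^sup>2)))"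
    using \<kappa> by (intro AE_I2) (auto simp: indicator_def abs_of_nonneg)
qed auto

lemma exp_weighted_integrable:
  assumes \<kappa>: "\<kappa> > 0" and g [measurable]: "g \<in> borel_measurable borel" and M: "\<And>s. cmod (g s) \<le> M"
  shows "set_integrable lborel {x..} (\<lambda>s. of_real (exp (- (\<kappa> * (s - x)))) * g s)"
    and "cmod (LBINT s:{x..}. of_real (exp (- (\<kappa> * (s - x)))) * g s) \<le>
      M * (LBINT s:{0..}. exp (- (\<kappa> * s)))"
proof -
  have i: "integrable lborel (\<lambda>s. M * (indicator {x..} s *\<^sub>R exp (- (\<kappa> * (s - x)))))"
    by (intro integrable_mult_right exp_half_line_integrable \<kappa>)
  have b: "norm (indicator {x..} s *\<^sub>R (of_real (exp (- (\<kappa> * (s - x)))) * g s)) \<le>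
      M * (indicator {x..} s *\<^sub>R exp (- (\<kappa> * (s - x))))" for s
    using M[of s] by (auto simp: indicator_def norm_mult mult.commute intro!: mult_left_mono)
  show si: "set_integrable lborel {x..} (\<lambda>s. of_real (exp (- (\<kappa> * (s - x)))) * g s)"
    unfolding set_integrable_def
  proof (rule Bochner_Integration.integrable_bound[OF i])
    show "AE s in lborel. norm (indicator {x..} s *\<^sub>R (of_real (exp (- (\<kappa> * (s - x)))) * g s)) \<le>
      norm (M * (indicator {x..} s *\<^sub>R exp (- (\<kappa> * (s - x)))))"
      unfolding real_norm_def by (intro AE_I2 order_trans[OF b abs_ge_self])
  qed measurable
  have "cmod (LBINT s:{x..}. of_real (exp (- (\<kappa> * (s - x)))) * g s) \<le>
      (LBINT s. norm (indicator {x..} s *\<^sub>R (of_real (exp (- (\<kappa> * (s - x)))) * g s)))"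
    unfolding set_lebesgue_integral_def by (rule integral_norm_bound)
  also have "\<dots> \<le> (LBINT s. M * (indicator {x..} s *\<^sub>R exp (- (\<kappa> * (s - x)))))"
    using si unfolding set_integrable_def by (intro integral_mono integrable_norm i b)
  also have "\<dots> = M * (LBINT s. indicator {x..} s *\<^sub>R exp (- (\<kappa> * (s - x))))" by simp
  also have "(LBINT s. indicator {x..} s *\<^sub>R exp (- (\<kappa> * (s - x)))) = (LBINT s:{0..}. exp (- (\<kappa> * s)))"
    unfolding set_lebesgue_integral_def
    by (subst lborel_integral_real_affine[where c = 1 and t = x])
       (auto intro!: Bochner_Integration.integral_cong simp: indicator_def)
  finally show "cmod (LBINT s:{x..}. of_real (exp (- (\<kappa> * (s - x)))) * g s) \<le>
      M * (LBINT s:{0..}. exp (- (\<kappa> * s)))" .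
qed

lemma test_fun_times_integrable:
  assumes f: "test_fun f" and [measurable]: "g \<in> borel_measurable borel" and M: "\<And>y. cmod (g y) \<le> M"
  shows "integrable lborel (\<lambda>y. g y * f y)"
proof (rule Bochner_Integration.integrable_bound)
  have i: "integrable lborel f" using schwartz_integrable[OF test_fun_schwartz[OF f]] .
  have [measurable]: "f \<in> borel_measurable borel" using borel_measurable_integrable[OF i] by simp
  show "(\<lambda>y. g y * f y) \<in> borel_measurable lborel" by measurable
  show "integrable lborel (\<lambda>y. M * cmod (f y))" using i by auto
  show "AE y in lborel. norm (g y * f y) \<le> norm (M * cmod (f y))"
    using M by (intro AE_I2) (auto simp: norm_mult abs_mult intro!: mult_right_mono order_trans[OF M abs_ge_self])
qed

lemma test_fun_half_line:
  assumes "test_fun f"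
  shows "(LBINT y:{0<..}. g y * f y) = (LBINT y. g y * f y)"
  unfolding set_lebesgue_integral_def
proof (rule Bochner_Integration.integral_cong[OF refl])
  show "indicator {0<..} y *\<^sub>R (g y * f y) = g y * f y" for y
    using test_fun_nonpos[OF assms, of y] by (cases "y > 0") auto
qed

text \<open>The origin of the exponential integral in the formula. Writing out
  \<open>exp_tail\<close> gives a double integral over r \<le> w; Fubini and the substitution w = r
  - x + s turn it into a kernel acting on f.\<close>

lemma conv_exp_tail_reflected:
  assumes \<kappa>: "\<kappa> > 0" and f: "test_fun f" and [measurable]: "g \<in> borel_measurable borel" and M: "\<And>z. cmod (g z) \<le> M"
  shows "(LBINT z. g (x - z) * exp_tail \<kappa> f (- z)) =
    (LBINT y. (LBINT s:{x..}. of_real (exp (- (\<kappa> * (s - x)))) * g (s + y)) * f y)"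
proof -
  have i: "integrable lborel f" using schwartz_integrable[OF test_fun_schwartz[OF f]] .
  have [measurable]: "f \<in> borel_measurable borel" using borel_measurable_integrable[OF i] by simp
  have M0: "M \<ge> 0" using order_trans[OF norm_ge_zero M] .
  define F where "F r w = indicator {0..} (w - r) *\<^sub>R (of_real (exp (- (\<kappa> * (w - r)))) * g (x + w) * f r)" for r w
  have F_meas [measurable]: "case_prod F \<in> borel_measurable (lborel \<Otimes>\<^sub>M lborel)"
    unfolding F_def by measurable
  have F_bound: "norm (F r w) \<le> (M * cmod (f r)) * (indicator {r..} w *\<^sub>R exp (- (\<kappa> * (w - r))))" for r w
  proof -
    have "exp (- (\<kappa> * (w - r))) * cmod (g (x + w)) * cmod (f r) \<le> exp (- (\<kappa> * (w - r))) * M * cmod (f r)"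
      by (intro mult_right_mono mult_left_mono M) auto
    then show ?thesis by (auto simp: F_def indicator_def norm_mult mult_ac)
  qed
  have Fi: "integrable lborel (F r)" for r
  proof (rule Bochner_Integration.integrable_bound)
    show "integrable lborel (\<lambda>w. (M * cmod (f r)) * (indicator {r..} w *\<^sub>R exp (- (\<kappa> * (w - r)))))"
      by (intro integrable_mult_right exp_half_line_integrable \<kappa>)
    show "AE w in lborel. norm (F r w) \<le> norm ((M * cmod (f r)) * (indicator {r..} w *\<^sub>R exp (- (\<kappa> * (w - r)))))"
      unfolding real_norm_def by (intro AE_I2 order_trans[OF F_bound abs_ge_self])
  qed (unfold F_def, measurable)
  define I where "I = (LBINT s:{0..}. exp (- (\<kappa> * s)))"
  have inner: "(LBINT w. indicator {r..} w *\<^sub>R exp (- (\<kappa> * (w - r)))) = I" for r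
    unfolding I_def set_lebesgue_integral_def
    by (subst lborel_integral_real_affine[where c = 1 and t = r])
       (auto intro!: Bochner_Integration.integral_cong simp: indicator_def)
  have prod: "integrable (lborel \<Otimes>\<^sub>M lborel) (case_prod F)"
  proof (rule lborel_pair.Fubini_integrable[OF F_meas])
    show "AE r in lborel. integrable lborel (\<lambda>w. case_prod F (r, w))" using Fi by simp
    show "integrable lborel (\<lambda>r. LBINT w. norm (case_prod F (r, w)))"
    proof (rule Bochner_Integration.integrable_bound)
      show "integrable lborel (\<lambda>r. (M * cmod (f r)) * I)" using i by auto
      show "(\<lambda>r. LBINT w. norm (case_prod F (r, w))) \<in> borel_measurable lborel" by measurable
      show "AE r in lborel. norm (LBINT w. norm (case_prod F (r, w))) \<le> norm ((M * cmod (f r)) * I)"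
      proof (rule AE_I2)
        fix r
        have "(LBINT w. norm (F r w)) \<le> (LBINT w. (M * cmod (f r)) * (indicator {r..} w *\<^sub>R exp (- (\<kappa> * (w - r)))))"
          by (intro integral_mono integrable_norm Fi integrable_mult_right exp_half_line_integrable \<kappa> F_bound)
        also have "\<dots> = (M * cmod (f r)) * I" by (simp only: integral_mult_right_zero inner)
        finally show "norm (LBINT w. norm (case_prod F (r, w))) \<le> norm ((M * cmod (f r)) * I)" by simp
      qed
    qed
  qed
  have "(LBINT z. g (x - z) * exp_tail \<kappa> f (- z)) = (LBINT w. g (x + w) * exp_tail \<kappa> f w)"
    by (subst lborel_integral_real_affine[where c = "-1" and t = 0]) auto
  also have "\<dots> = (LBINT w. LBINT r. F r w)"
  proof (rule Bochner_Integration.integral_cong[OF refl])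
    fix w
    have "g (x + w) * exp_tail \<kappa> f w =
        (g (x + w) * of_real (exp (- \<kappa> * w))) * (LBINT r. indicator {..w} r *\<^sub>R (of_real (exp (\<kappa> * r)) * f r))"
      by (simp add: exp_tail_def set_lebesgue_integral_def)
    also have "\<dots> = (LBINT r. (g (x + w) * of_real (exp (- \<kappa> * w))) * (indicator {..w} r *\<^sub>R (of_real (exp (\<kappa> * r)) * f r)))"
      by (rule integral_mult_right_zero[symmetric])
    also have "\<dots> = (LBINT r. F r w)"
    proof (rule Bochner_Integration.integral_cong[OF refl])
      fix r
      have "- (\<kappa> * (w - r)) = - \<kappa> * w + \<kappa> * r" by (simp add: algebra_simps)
      then have "complex_of_real (exp (- (\<kappa> * (w - r)))) = of_real (exp (- \<kappa> * w)) * of_real (exp (\<kappa> * r))"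
        by (simp only: exp_add of_real_mult)
      then show "(g (x + w) * of_real (exp (- \<kappa> * w))) * (indicator {..w} r *\<^sub>R (of_real (exp (\<kappa> * r)) * f r)) = F r w"
        by (auto simp: F_def indicator_def mult_ac)
    qed
    finally show "g (x + w) * exp_tail \<kappa> f w = (LBINT r. F r w)" .
  qed
  also have "\<dots> = (LBINT r. LBINT w. F r w)"
    using lborel_pair.Fubini_integral[OF prod] .
  also have "\<dots> = (LBINT y. (LBINT s:{x..}. of_real (exp (- (\<kappa> * (s - x)))) * g (s + y)) * f y)"
  proof (rule Bochner_Integration.integral_cong[OF refl])
    fix r
    have "(LBINT w. F r w) = (LBINT s. F r (r - x + s))"
      by (subst lborel_integral_real_affine[where c = 1 and t = "r - x"]) auto
    also have "\<dots> = (LBINT s. (indicator {x..} s *\<^sub>R (of_real (exp (- (\<kappa> * (s - x)))) * g (s + r))) * f r)"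
      by (rule Bochner_Integration.integral_cong[OF refl]) (auto simp: F_def indicator_def add.commute)
    finally show "(LBINT w. F r w) = (LBINT s:{x..}. of_real (exp (- (\<kappa> * (s - x)))) * g (s + r)) * f r"
      unfolding set_lebesgue_integral_def by (simp only: integral_mult_left_zero)
  qed
  finally show ?thesis .
qed

lemma exp_weighted_eq:
  "(LBINT s:{x..}. complex_of_real (exp (- \<alpha> * (s - x) / real N)) * g s) =
   (LBINT s:{x..}. of_real (exp (- (\<alpha> / real N * (s - x)))) * g s)"
proof -
  have "- \<alpha> * (s - x) / real N = - (\<alpha> / real N * (s - x))" for s by simp
  then show ?thesis by (simp only:)
qed

text \<open>The terms of the formula arise from the data, their reflection and the reflected tail;
  the coefficient 2 \<alpha> / N^2 is 2/N times \<alpha>/N. The kernel is frozen at one time, hence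
  the constant function \<open>\<lambda>_. g\<close>.\<close>

lemma conv_star_ext:
  fixes g :: "real \<Rightarrow> complex"
  assumes N: "N \<ge> 1" and \<alpha>: "\<alpha> > 0" and f: "\<forall>l\<in>{1..N}. test_fun (f l)" and j: "j \<in> {1..N}"
    and c: "continuous_on UNIV g" and M: "\<And>z. cmod (g z) \<le> M" and even: "\<And>z. g (- z) = g z"
  shows "conv g (star_ext N \<alpha> f j) x =
    (\<Sum>l=1..N. LBINT y:{0<..}. star_formula N \<alpha> (\<lambda>_. g) j l t x y * f l y)"
proof -
  define \<kappa> where "\<kappa> = \<alpha> / real N"
  have \<kappa>: "\<kappa> > 0" using N \<alpha> by (simp add: \<kappa>_def)
  have [measurable]: "g \<in> borel_measurable borel" using c by (rule borel_measurable_continuous_onI)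
  have qg: "quadratic_growth g" by (rule quadratic_growth_bounded[OF _ M]) measurable
  define J where "J y = (LBINT s:{x..}. of_real (exp (- (\<kappa> * (s - x)))) * g (s + y))" for y
  define a b e where "a l = (LBINT y. g (x - y) * f l y)" and "b l = (LBINT y. g (x + y) * f l y)"
    and "e l = (LBINT y. J y * f l y)" for l
  have J_meas [measurable]: "J \<in> borel_measurable borel"
    unfolding J_def set_lebesgue_integral_def measurable_lborel1[symmetric] by measurable
  have J_bound: "cmod (J y) \<le> M * (LBINT s:{0..}. exp (- (\<kappa> * s)))" for y
    unfolding J_def by (rule exp_weighted_integrable(2)[OF \<kappa> _ M]) measurable
  have i: "integrable lborel (\<lambda>y. g (x - y) * f l y)" "integrable lborel (\<lambda>y. g (x + y) * f l y)"
    "integrable lborel (\<lambda>y. J y * f l y)" if "l \<in> {1..N}" for l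
    using f that by (auto intro!: test_fun_times_integrable M J_bound)
  have sch: "schwartz (f l)" "schwartz (exp_tail \<kappa> (f l))" if "l \<in> {1..N}" for l
    using f that test_fun_schwartz exp_tail_schwartz[OF \<kappa>] by auto
  have cv: "conv g (f l) x = a l" "conv g (\<lambda>z. f l (- z)) x = b l" "conv g (\<lambda>z. exp_tail \<kappa> (f l) (- z)) x = e l"
    if l: "l \<in> {1..N}" for l
  proof -
    show "conv g (f l) x = a l" by (simp add: conv_reflected a_def)
    show "conv g (\<lambda>z. f l (- z)) x = b l"
      unfolding conv_reflected b_def by (subst lborel_integral_real_affine[where c = "-1" and t = 0]) auto
    show "conv g (\<lambda>z. exp_tail \<kappa> (f l) (- z)) x = e l"
      unfolding conv_reflected e_def J_def using f l by (intro conv_exp_tail_reflected[OF \<kappa> _ _ M]) auto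
  qed
  have conv_lin: "conv g (\<lambda>z. u z - v z) x = conv g u x - conv g v x" "conv g (\<lambda>z. u z + v z) x = conv g u x + conv g v x"
    "conv g (\<lambda>z. k * u z) x = k * conv g u x" if "schwartz u" "schwartz v" for u v k
    unfolding conv_def using conv_integrable[OF qg that(1), of x] conv_integrable[OF qg that(2), of x]
    by (auto simp: right_diff_distrib distrib_left mult.left_commute[of _ k])
  have conv_sum: "conv g (\<lambda>z. \<Sum>l\<in>I. u l z) x = (\<Sum>l\<in>I. conv g (u l) x)" if "\<And>l. l \<in> I \<Longrightarrow> schwartz (u l)" for u :: "nat \<Rightarrow> _" and I
    unfolding conv_def sum_distrib_left using conv_integrable[OF qg that] by (intro Bochner_Integration.integral_sum) auto
  have conv_eq: "conv g (star_ext N \<alpha> f j) x = a j - b j + of_real (2 / N) * (\<Sum>l=1..N. b l - of_real \<kappa> * e l)"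
  proof -
    have s1: "schwartz (\<lambda>z. f j (- z))" using sch(1)[OF j] by (rule schwartz_reflect)
    have s2: "schwartz (\<lambda>z. f l (- z) - of_real \<kappa> * exp_tail \<kappa> (f l) (- z))" if "l \<in> {1..N}" for l
      by (intro schwartz_diff schwartz_cmult schwartz_reflect sch that)
    have s3: "schwartz (\<lambda>z. \<Sum>l=1..N. f l (- z) - of_real \<kappa> * exp_tail \<kappa> (f l) (- z))"
      by (intro schwartz_sum s2)
    have "conv g (\<lambda>z. \<Sum>l=1..N. f l (- z) - of_real \<kappa> * exp_tail \<kappa> (f l) (- z)) x = (\<Sum>l=1..N. b l - of_real \<kappa> * e l)"
    proof (subst conv_sum[OF s2], simp, intro sum.cong refl)
      fix l assume l: "l \<in> {1..N}"
      show "conv g (\<lambda>z. f l (- z) - of_real \<kappa> * exp_tail \<kappa> (f l) (- z)) x = b l - of_real \<kappa> * e l"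
        using conv_lin(1)[OF schwartz_reflect[OF sch(1)[OF l]] schwartz_cmult[OF schwartz_reflect[OF sch(2)[OF l]]]]
          conv_lin(3)[OF schwartz_reflect[OF sch(2)[OF l]] schwartz_zero] cv[OF l] by simp
    qed
    then show ?thesis
      unfolding star_ext_def[abs_def] \<kappa>_def[symmetric]
        conv_lin(2)[OF schwartz_diff[OF sch(1)[OF j] s1] schwartz_cmult[OF s3, of "of_real (2 / N)"]]
        conv_lin(1)[OF sch(1)[OF j] s1] conv_lin(3)[OF s3 schwartz_zero] cv[OF j] by (simp only:)
  qed
  have formula: "(LBINT y:{0<..}. star_formula N \<alpha> (\<lambda>_. g) j l t x y * f l y) =
      of_bool (j = l) * a l + (2 / of_nat N - of_bool (j = l)) * b l - of_real (2 * \<alpha> / (real N)\<^sup>2) * e l"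
    if l: "l \<in> {1..N}" for l
  proof -
    have tf: "test_fun (f l)" using f l by blast
    have "g \<bar>x - y\<bar> = g (x - y)" for y using even[of "x - y"] by (simp add: abs_if)
    then have "star_formula N \<alpha> (\<lambda>_. g) j l t x y * f l y =
       of_bool (j = l) * (g (x - y) * f l y) + (2 / of_nat N - of_bool (j = l)) * (g (x + y) * f l y)
       - of_real (2 * \<alpha> / (real N)\<^sup>2) * (J y * f l y)" for y
      unfolding star_formula_def exp_weighted_eq J_def \<kappa>_def by (simp add: algebra_simps)
    then show ?thesis
      unfolding test_fun_half_line[OF tf] a_def b_def e_def using i[OF l] by simp
  qed
  have "(\<Sum>l=1..N. LBINT y:{0<..}. star_formula N \<alpha> (\<lambda>_. g) j l t x y * f l y) =
      (\<Sum>l=1..N. of_bool (j = l) * a l + (2 / of_nat N - of_bool (j = l)) * b l - of_real (2 * \<alpha> / (real N)\<^sup>2) * e l)"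
    by (intro sum.cong refl formula)
  also have "\<dots> = (\<Sum>l=1..N. of_bool (j = l) * (a l - b l)) + (\<Sum>l=1..N. of_real (2 / N) * (b l - of_real \<kappa> * e l))"
    unfolding sum.distrib[symmetric]
    by (intro sum.cong) (auto simp: \<kappa>_def power2_eq_square algebra_simps)
  also have "(\<Sum>l=1..N. of_bool (j = l) * (a l - b l)) = a j - b j"
  proof -
    have "(\<Sum>l=1..N. of_bool (j = l) * (a l - b l)) = (\<Sum>l=1..N. if j = l then a l - b l else 0)"
      by (intro sum.cong) auto
    then show ?thesis using j by (simp only: sum.delta' finite_atLeastAtMost if_True)
  qed
  finally show ?thesis unfolding conv_eq sum_distrib_left by (rule sym)
qed

lemma star_formula_continuous:
  assumes N: "N \<ge> 1" and \<alpha>: "\<alpha> > 0" and c: "continuous_on UNIV g" and M: "\<And>z. cmod (g z) \<le> M"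
  shows "continuous_on S (\<lambda>(x, y). star_formula N \<alpha> (\<lambda>_. g) j l t x y)"
proof -
  define \<kappa> where "\<kappa> = \<alpha> / real N"
  have \<kappa>: "\<kappa> > 0" using N \<alpha> by (simp add: \<kappa>_def)
  have [measurable]: "g \<in> borel_measurable borel" using c by (rule borel_measurable_continuous_onI)
  \<comment> \<open>Shifting s by x shows that the exponential integral depends on x and y through x
    + y only.\<close>
  define J where "J p = (LBINT s:{0..}. of_real (exp (- (\<kappa> * s))) * g (s + p))" for p
  have J: "(LBINT s:{x..}. of_real (exp (- (\<kappa> * (s - x)))) * g (s + y)) = J (x + y)" for x y
    unfolding J_def set_lebesgue_integral_def
    by (subst lborel_integral_real_affine[where c = 1 and t = x])
       (auto intro!: Bochner_Integration.integral_cong simp: indicator_def add_ac)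
  have "isCont J p" for p
    unfolding isCont_def J_def set_lebesgue_integral_def
  proof (rule integral_dominated_convergence_filter[OF sequential_at])
    show "integrable lborel (\<lambda>s. M * (indicator {0..} s *\<^sub>R exp (- (\<kappa> * (s - 0)))))"
      by (intro integrable_mult_right exp_half_line_integrable \<kappa>)
    show "AE s in lborel. ((\<lambda>q. indicator {0..} s *\<^sub>R (of_real (exp (- (\<kappa> * s))) * g (s + q))) \<longlongrightarrow>
        indicator {0..} s *\<^sub>R (of_real (exp (- (\<kappa> * s))) * g (s + p))) (at p)"
      using c by (intro AE_I2 tendsto_intros isCont_tendsto_compose[of _ g]) (simp add: continuous_on_eq_continuous_at)
    show "\<forall>\<^sub>F q in at p. AE s in lborel. norm (indicator {0..} s *\<^sub>R (of_real (exp (- (\<kappa> * s))) * g (s + q))) \<le>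
        M * (indicator {0..} s *\<^sub>R exp (- (\<kappa> * (s - 0))))"
      using M by (intro always_eventually allI AE_I2) (auto simp: indicator_def norm_mult mult.commute intro!: mult_left_mono)
  qed (auto intro!: always_eventually)
  then have Jc: "continuous_on UNIV J" by (simp add: continuous_on_eq_continuous_at)
  have "continuous_on S (\<lambda>p. of_bool (j = l) * g \<bar>fst p - snd p\<bar> + (2 / of_nat N - of_bool (j = l)) * g (fst p + snd p)
     - of_real (2 * \<alpha> / (real N)\<^sup>2) * J (fst p + snd p))"
    by (intro continuous_intros continuous_on_compose2[OF c] continuous_on_compose2[OF Jc]) auto
  then show ?thesis
    unfolding star_formula_def exp_weighted_eq \<kappa>_def[symmetric] J by (simp add: case_prod_unfold)
qed

section \<open>Uniqueness of continuous kernels\<close>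

text \<open>A nonzero value would persist on a nonempty open set, which is not negligible.\<close>

lemma continuous_AE_zero:
  fixes g :: "real \<Rightarrow> complex"
  assumes c: "continuous_on {0<..} g" and z: "AE x in lborel. 0 < x \<longrightarrow> g x = 0" and x: "x > 0"
  shows "g x = 0"
proof (rule ccontr)
  assume nz: "g x \<noteq> 0"
  define U where "U = {0<..} \<inter> g -` (- {0})"
  have U: "open U" unfolding U_def by (rule continuous_open_preimage[OF c]) auto
  have "AE x in lborel. x \<notin> U" using z by eventually_elim (auto simp: U_def)
  then have "U \<in> null_sets lborel" using U by (subst AE_iff_null_sets) auto
  then have "negligible U" using negligible_iff_null_sets null_sets_completionI by blast
  moreover have "x \<in> U" using nz x by (simp add: U_def)
  ultimately show False using open_not_negligible[OF U] by blast
qed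

lemma test_fun_integral_set:
  assumes f: "test_fun f" "\<And>y. y \<notin> {a..b} \<Longrightarrow> f y = 0" "0 < a" and g: "continuous_on {0<..} g"
  shows "set_integrable lborel {0<..} (\<lambda>y. g y * f y)" "(LBINT y:{0<..}. g y * f y) = integral {a..b} (\<lambda>y. g y * f y)"
proof -
  have c: "continuous_on {a..b} (\<lambda>y. g y * f y)"
    using f(3) by (intro continuous_intros continuous_on_subset[OF g] smooth_continuous test_fun_smooth f(1)) auto
  note i = borel_integrable_atLeastAtMost'[OF c]
  have eq: "indicator {0<..} y *\<^sub>R (g y * f y) = indicator {a..b} y *\<^sub>R (g y * f y)" for y
    using f(2)[of y] f(3) by (auto simp: indicator_def)
  show "set_integrable lborel {0<..} (\<lambda>y. g y * f y)" using i unfolding set_integrable_def eq .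
  show "(LBINT y:{0<..}. g y * f y) = integral {a..b} (\<lambda>y. g y * f y)"
    unfolding set_borel_integral_eq_integral(2)[OF i, symmetric] by (simp add: set_lebesgue_integral_def eq)
qed

text \<open>The exceptional null set of x depends on f. Continuity of the integral in x removes it,
  after which f may vary for fixed x.\<close>

lemma continuous_kernel_zero:
  fixes D :: "real \<Rightarrow> real \<Rightarrow> complex"
  assumes c: "continuous_on ({0<..} \<times> {0<..}) (\<lambda>(x, y). D x y)"
    and zero: "\<And>f. test_fun f \<Longrightarrow> AE x in lborel. 0 < x \<longrightarrow> (LBINT y:{0<..}. D x y * f y) = 0"
    and x: "x > 0" and y: "y > 0"
  shows "D x y = 0"
proof -
  have cy: "continuous_on {0<..} (D x)" if "x > 0" for x
  proof -
    have "continuous_on {0<..} (\<lambda>y. (x, y))" by (intro continuous_intros)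
    from continuous_on_compose2[OF c this] that show ?thesis by auto
  qed
  have all: "(LBINT y:{0<..}. D x y * f y) = 0" if f: "test_fun f" and x: "x > 0" for f x
  proof -
    obtain a b where ab: "0 < a" "a \<le> b" "\<And>x. x \<notin> {a..b} \<Longrightarrow> f x = 0" using test_fun_supportE[OF f] by blast
    have eq: "(LBINT y:{0<..}. D x y * f y) = integral (cbox a b) (\<lambda>y. D x y * f y)" if "x > 0" for x
      using test_fun_integral_set(2)[OF f ab(3,1) cy[OF that]] by simp
    have cont: "continuous_on {0<..} (\<lambda>x. integral (cbox a b) (\<lambda>y. D x y * f y))"
    proof (rule integral_continuous_on_param)
      have "continuous_on ({0<..} \<times> cbox a b) (\<lambda>p. D (fst p) (snd p) * f (snd p))"
        using ab by (intro continuous_intros continuous_on_compose2[OF smooth_continuous[OF test_fun_smooth[OF f], of UNIV]]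
          continuous_on_subset[OF c[unfolded case_prod_unfold]]) auto
      then show "continuous_on ({0<..} \<times> cbox a b) (\<lambda>(x, y). D x y * f y)" by (simp add: case_prod_unfold)
    qed
    have "integral (cbox a b) (\<lambda>y. D x y * f y) = 0"
      by (rule continuous_AE_zero[OF cont _ x]) (use zero[OF f] in eventually_elim, simp add: eq)
    then show ?thesis using eq[OF x] by simp
  qed
  have "AE y in lborel. 0 < y \<longrightarrow> D x y = 0"
  proof (rule test_fun_AE_zero)
    show "set_integrable lborel {a..b} (D x)" if "0 < a" for a b
      using that by (intro borel_integrable_atLeastAtMost' continuous_on_subset[OF cy[OF x]]) auto
  qed (rule all[OF _ x])
  from continuous_AE_zero[OF cy[OF x] this y] show ?thesis .
qed

text \<open>The problem S enters only through existence and a representation of its solutions, so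
  that the heat, quantum and cylinder problems share the argument.\<close>

lemma green_function_iff:
  assumes ex: "\<And>f. \<forall>l\<in>{1..N}. test_fun (f l) \<Longrightarrow> \<exists>u. S f u"
    and rep: "\<And>f u t j. \<lbrakk>\<forall>l\<in>{1..N}. test_fun (f l); S f u; t > 0; j \<in> {1..N}\<rbrakk> \<Longrightarrow>
      AE x in lborel. 0 < x \<longrightarrow> u t j x = (\<Sum>l=1..N. LBINT y:{0<..}. K0 j l t x y * f l y)"
    and K0: "\<And>j l t. t > 0 \<Longrightarrow> continuous_on ({0<..} \<times> {0<..}) (\<lambda>(x, y). K0 j l t x y)"
  shows "green_function N S K \<longleftrightarrow>
    (\<forall>j\<in>{1..N}. \<forall>l\<in>{1..N}. \<forall>t>0. \<forall>x>0. \<forall>y>0. K j l t x y = K0 j l t x y)"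
proof
  assume eq: "\<forall>j\<in>{1..N}. \<forall>l\<in>{1..N}. \<forall>t>0. \<forall>x>0. \<forall>y>0. K j l t x y = K0 j l t x y"
  show "green_function N S K" unfolding green_function_def
  proof (intro conjI ballI allI impI)
    fix j l and t :: real assume jl: "j \<in> {1..N}" "l \<in> {1..N}" and t: "t > 0"
    show "continuous_on ({0<..} \<times> {0<..}) (\<lambda>(x, y). K j l t x y)"
      by (rule continuous_on_eq[OF K0[OF t, of j l]]) (use eq jl t in auto)
  next
    fix f assume f: "\<forall>l\<in>{1..N}. test_fun (f l)"
    show "\<exists>u. S f u" using ex[OF f] .
    fix u and t :: real and j assume u: "S f u" and t: "t > 0" and j: "j \<in> {1..N}"
    show "AE x in lborel. 0 < x \<longrightarrow> u t j x = (\<Sum>l=1..N. LBINT y:{0<..}. K j l t x y * f l y)"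
      using rep[OF f u t j]
    proof eventually_elim
      case (elim x)
      show ?case
      proof
        assume x: "0 < x"
        have "(LBINT y:{0<..}. K0 j l t x y * f l y) = (LBINT y:{0<..}. K j l t x y * f l y)" if "l \<in> {1..N}" for l
          using eq j that t x by (intro set_lebesgue_integral_cong) auto
        then have "(\<Sum>l=1..N. LBINT y:{0<..}. K0 j l t x y * f l y) = (\<Sum>l=1..N. LBINT y:{0<..}. K j l t x y * f l y)"
          by (intro sum.cong refl)
        then show "u t j x = (\<Sum>l=1..N. LBINT y:{0<..}. K j l t x y * f l y)"
          using elim x by simp
      qed
    qed
  qed
next
  assume G: "green_function N S K"
  show "\<forall>j\<in>{1..N}. \<forall>l\<in>{1..N}. \<forall>t>0. \<forall>x>0. \<forall>y>0. K j l t x y = K0 j l t x y"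
  proof (intro ballI allI impI)
    fix j l and t x y :: real assume j: "j \<in> {1..N}" and l: "l \<in> {1..N}" and t: "t > 0" and x: "x > 0" and y: "y > 0"
    have K: "continuous_on ({0<..} \<times> {0<..}) (\<lambda>(x, y). K j l t x y)"
      using G j l t by (auto simp: green_function_def)
    have cy: "continuous_on {0<..} (K j l t x)" "continuous_on {0<..} (K0 j l t x)" if "x > 0" for x
    proof -
      have p: "continuous_on {0<..} (\<lambda>y. (x, y))" by (intro continuous_intros)
      from continuous_on_compose2[OF K p] continuous_on_compose2[OF K0[OF t, of j l] p] that
      show "continuous_on {0<..} (K j l t x)" "continuous_on {0<..} (K0 j l t x)" by auto
    qed
    have "K j l t x y - K0 j l t x y = 0"
    proof (rule continuous_kernel_zero[OF _ _ x y])
      show "continuous_on ({0<..} \<times> {0<..}) (\<lambda>(x, y). K j l t x y - K0 j l t x y)"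
        using continuous_on_diff[OF K K0[OF t, of j l]] by (simp add: case_prod_unfold)
      fix \<psi> assume \<psi>: "test_fun \<psi>"
      define f where "f i = (if i = l then \<psi> else (\<lambda>_. 0))" for i
      have f: "\<forall>l\<in>{1..N}. test_fun (f l)" using \<psi> by (simp add: f_def)
      have single: "(\<Sum>i=1..N. LBINT y:{0<..}. A i y * f i y) = (LBINT y:{0<..}. A l y * \<psi> y)" for A :: "nat \<Rightarrow> real \<Rightarrow> complex"
      proof -
        have "(\<Sum>i=1..N. LBINT y:{0<..}. A i y * f i y) = (\<Sum>i=1..N. if i = l then LBINT y:{0<..}. A l y * \<psi> y else 0)"
          by (intro sum.cong) (auto simp: f_def set_lebesgue_integral_def)
        then show ?thesis using l by simp
      qed
      obtain a b where ab: "0 < a" "a \<le> b" "\<And>x. x \<notin> {a..b} \<Longrightarrow> \<psi> x = 0" using test_fun_supportE[OF \<psi>] by blast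
      obtain u where u: "S f u" using ex[OF f] by blast
      have "AE x in lborel. 0 < x \<longrightarrow> u t j x = (\<Sum>l=1..N. LBINT y:{0<..}. K j l t x y * f l y)"
        using G f u t j by (auto simp: green_function_def)
      with rep[OF f u t j]
      show "AE x in lborel. 0 < x \<longrightarrow> (LBINT y:{0<..}. (K j l t x y - K0 j l t x y) * \<psi> y) = 0"
      proof eventually_elim
        case (elim x)
        show ?case
        proof
          assume x: "0 < x"
          then have "(LBINT y:{0<..}. K j l t x y * \<psi> y) = (LBINT y:{0<..}. K0 j l t x y * \<psi> y)"
            using elim unfolding single by simp
          then show "(LBINT y:{0<..}. (K j l t x y - K0 j l t x y) * \<psi> y) = 0"
            using set_integral_diff(2)[OF test_fun_integral_set(1)[OF \<psi> ab(3,1) cy(1)[OF x]]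
                test_fun_integral_set(1)[OF \<psi> ab(3,1) cy(2)[OF x]]] by (simp add: left_diff_distrib)
        qed
      qed
    qed
    then show "K j l t x y = K0 j l t x y" by simp
  qed
qed

lemma (in line_kernel) green_function_star:
  assumes N: "N \<ge> 1" and \<alpha>: "\<alpha> > 0" and L: "line_evolution ev evt"
    and ex: "\<And>f. \<forall>l\<in>{1..N}. test_fun (f l) \<Longrightarrow> \<exists>u. S f u"
    and rep: "\<And>f u t j. \<lbrakk>\<forall>l\<in>{1..N}. test_fun (f l); S f u; t > 0; j \<in> {1..N}\<rbrakk> \<Longrightarrow>
      AE x in lborel. 0 < x \<longrightarrow> u t j x = ev (star_ext N \<alpha> f j) t x"
    and G': "\<And>t z :: real. t > 0 \<Longrightarrow> G' t z = G t z"
  shows "green_function N S K \<longleftrightarrow>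
    (\<forall>j\<in>{1..N}. \<forall>l\<in>{1..N}. \<forall>t>0. \<forall>x>0. \<forall>y>0. K j l t x y = star_formula N \<alpha> G' j l t x y)"
proof (rule green_function_iff[OF ex])
  \<comment> \<open>Only the values of the kernel at the time t enter the formula, so it may be
    frozen there.\<close>
  have sf: "star_formula N \<alpha> G' j l t = star_formula N \<alpha> (\<lambda>_. G t) j l t" if "t > 0" for j l and t :: real
    using G'[OF that] by (simp add: star_formula_def fun_eq_iff)
  show "continuous_on ({0<..} \<times> {0<..}) (\<lambda>(x, y). star_formula N \<alpha> G' j l t x y)" if t: "t > 0" for j l and t :: real
  proof -
    obtain M where "\<And>z. cmod (G t z) \<le> M" using G_bounded[OF t] by blast
    then show ?thesis unfolding sf[OF t] by (rule star_formula_continuous[OF N \<alpha> G_cont[OF t]])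
  qed
  fix f u j and t :: real assume f: "\<forall>l\<in>{1..N}. test_fun (f l)" and u: "S f u" and t: "t > 0" and j: "j \<in> {1..N}"
  obtain M where M: "\<And>z. cmod (G t z) \<le> M" using G_bounded[OF t] by blast
  show "AE x in lborel. 0 < x \<longrightarrow> u t j x = (\<Sum>l=1..N. LBINT y:{0<..}. star_formula N \<alpha> G' j l t x y * f l y)"
    using rep[OF f u t j] unfolding sf[OF t] ev_def
    by (simp add: conv_star_ext[OF N \<alpha> f j G_cont[OF t] M G_even[OF t], where t = t])
qed

section \<open>The heat, quantum and cylinder Green functions\<close>

lemma heat_green_function:
  assumes N: "N \<ge> 1" and \<alpha>: "\<alpha> > 0"
  shows "green_function N (heat_solution N \<alpha>) K \<longleftrightarrow>
    (\<forall>j\<in>{1..N}. \<forall>l\<in>{1..N}. \<forall>t>0. \<forall>x>0. \<forall>y>0. K j l t x y = star_formula N \<alpha> heat_line j l t x y)"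
proof -
  interpret gaussian_kernel 1 by unfold_locales simp
  interpret E: first_order_evolution ev evt N \<alpha> 1 by (rule first_order_evolution[OF N \<alpha>])
  have S: "heat_solution N \<alpha> = E.solution"
    by (simp add: heat_solution_def E.solution_def fun_eq_iff)
  show ?thesis unfolding S
  proof (rule green_function_star[OF N \<alpha> E.line_evolution_axioms])
    show "heat_line t z = G t z" if t: "t > 0" for t z
    proof -
      have "csqrt (4 * of_real pi * 1 * of_real t) = of_real (sqrt (4 * pi * t))"
        using t of_real_sqrt[of "4 * pi * t"] by simp
      moreover have "heat_line t z = of_real (exp (- z\<^sup>2 / (4 * t)) / sqrt (4 * pi * t))"
        using t powr_minus_divide[of "4 * pi * t" "1 / 2"] by (simp add: heat_line_def powr_half_sqrt)
      moreover have "complex_of_real (exp (- z\<^sup>2 / (4 * t))) = exp (- (of_real z)\<^sup>2 / (4 * 1 * of_real t))"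
        unfolding exp_of_real[symmetric] by simp
      ultimately show ?thesis unfolding G_def by (simp only: of_real_divide)
    qed
    fix f assume f: "\<forall>l\<in>{1..N}. test_fun (f l)"
    show "\<exists>u. E.solution f u" using E.solution_sol[OF f] by blast
    show "AE x in lborel. 0 < x \<longrightarrow> u t j x = ev (star_ext N \<alpha> f j) t x"
      if "E.solution f u" "t > 0" "j \<in> {1..N}" for u t j
      using E.solution_unique[OF that(1) f that(2,3)] by (simp add: E.sol_def)
  qed
qed

lemma quantum_green_function:
  assumes N: "N \<ge> 1" and \<alpha>: "\<alpha> > 0"
  shows "green_function N (quantum_solution N \<alpha>) K \<longleftrightarrow>
    (\<forall>j\<in>{1..N}. \<forall>l\<in>{1..N}. \<forall>t>0. \<forall>x>0. \<forall>y>0. K j l t x y = star_formula N \<alpha> quantum_line j l t x y)"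
proof -
  interpret gaussian_kernel \<i> by unfold_locales simp
  interpret E: first_order_evolution ev evt N \<alpha> \<i> by (rule first_order_evolution[OF N \<alpha>])
  have S: "quantum_solution N \<alpha> = E.solution"
    by (simp add: quantum_solution_def E.solution_def fun_eq_iff)
  show ?thesis unfolding S
  proof (rule green_function_star[OF N \<alpha> E.line_evolution_axioms])
    show "quantum_line t z = G t z" if t: "t > 0" for t z
      by (simp add: quantum_line_def G_def)
    fix f assume f: "\<forall>l\<in>{1..N}. test_fun (f l)"
    show "\<exists>u. E.solution f u" using E.solution_sol[OF f] by blast
    show "AE x in lborel. 0 < x \<longrightarrow> u t j x = ev (star_ext N \<alpha> f j) t x"
      if "E.solution f u" "t > 0" "j \<in> {1..N}" for u t j
      using E.solution_unique[OF that(1) f that(2,3)] by (simp add: E.sol_def)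
  qed
qed

lemma cylinder_green_function:
  assumes N: "N \<ge> 1" and \<alpha>: "\<alpha> > 0"
  shows "green_function N (cylinder_solution N \<alpha>) K \<longleftrightarrow>
    (\<forall>j\<in>{1..N}. \<forall>l\<in>{1..N}. \<forall>t>0. \<forall>x>0. \<forall>y>0. K j l t x y = star_formula N \<alpha> cylinder_line j l t x y)"
proof -
  interpret E: cylinder_evolution cyl.ev cyl.evt N \<alpha> by (rule cyl_evolution[OF N \<alpha>])
  show ?thesis
  proof (rule cyl.green_function_star[OF N \<alpha> E.line_evolution_axioms])
    show "cylinder_line t z = cyl_G t z" for t z
      by (simp add: cylinder_line_def cyl_G_def)
    fix f assume f: "\<forall>l\<in>{1..N}. test_fun (f l)"
    show "\<exists>u. cylinder_solution N \<alpha> f u" using E.solution_sol[OF f] by blast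
    show "AE x in lborel. 0 < x \<longrightarrow> u t j x = cyl.ev (star_ext N \<alpha> f j) t x"
      if "cylinder_solution N \<alpha> f u" "t > 0" "j \<in> {1..N}" for u t j
      using E.solution_unique[OF that(1) f that(2,3)] by (simp add: E.sol_def)
  qed
qed

section \<open>Test functions of two variables\<close>

lemma pderiv1_eq: "pderiv1 \<Phi> = (\<lambda>x y. vderiv (\<lambda>x'. \<Phi> x' y) x)"
  and pderiv2_eq: "pderiv2 \<Phi> = (\<lambda>x. vderiv (\<Phi> x))"
  by (intro ext, simp add: pderiv1_def vderiv_def, intro ext, simp add: pderiv2_def vderiv_def)

lemma pderivs_eq: "pderivs m n \<Phi> x y = (vderiv ^^ m) (\<lambda>x'. (vderiv ^^ n) (\<Phi> x') y) x"
proof -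
  have p1: "(pderiv1 ^^ m) \<Theta> = (\<lambda>x y. (vderiv ^^ m) (\<lambda>x'. \<Theta> x' y) x)" for \<Theta>
  proof (induction m)
    case (Suc m)
    then show ?case by (simp add: pderiv1_eq)
  qed simp
  have p2: "(pderiv2 ^^ n) \<Phi> = (\<lambda>x. (vderiv ^^ n) (\<Phi> x))"
  proof (induction n)
    case (Suc n)
    then show ?case by (simp add: pderiv2_eq)
  qed simp
  show ?thesis unfolding pderivs_def p1 p2 ..
qed

lemma pderivs_0 [simp]: "pderivs 0 0 \<Phi> = \<Phi>"
  by (simp add: pderivs_def)

text \<open>The two-variable counterpart of \<open>smooth_sequenceI\<close>: a doubly indexed family
  in which each partial derivative raises its own index by one. That the derivatives commute is
  built into the indexing.\<close>

lemma
  assumes d1: "\<And>m n x y. ((\<lambda>x'. F m n x' y) has_vector_derivative F (Suc m) n x y) (at x)"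
    and d2: "\<And>m n x y. ((\<lambda>y'. F m n x y') has_vector_derivative F m (Suc n) x y) (at y)"
  shows pderivs_unique: "pderivs m n (F 0 0) = F m n"
    and smooth2I: "(\<And>m n. continuous_on UNIV (\<lambda>(x, y). F m n x y)) \<Longrightarrow> smooth2 (F 0 0)"
proof -
  have p1: "pderiv1 (F m n) = F (Suc m) n" for m n
    using d1 by (simp add: pderiv1_def fun_eq_iff vector_derivative_at)
  have p2: "pderiv2 (F 0 n) = F 0 (Suc n)" for n
    using d2 by (simp add: pderiv2_def fun_eq_iff vector_derivative_at)
  have "(pderiv2 ^^ n) (F 0 0) = F 0 n" for n by (induction n) (simp_all add: p2)
  moreover have "(pderiv1 ^^ m) (F 0 n) = F m n" for m n by (induction m) (simp_all add: p1)
  ultimately have eq: "pderivs m n (F 0 0) = F m n" for m n by (simp add: pderivs_def)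
  then show "pderivs m n (F 0 0) = F m n" .
  show "smooth2 (F 0 0)" if "\<And>m n. continuous_on UNIV (\<lambda>(x, y). F m n x y)"
    unfolding smooth2_def eq using that d1 d2 by blast
qed

lemma smooth2D:
  assumes "smooth2 \<Phi>"
  shows "continuous_on UNIV (\<lambda>(x, y). pderivs m n \<Phi> x y)"
    and "((\<lambda>x'. pderivs m n \<Phi> x' y) has_vector_derivative pderivs (Suc m) n \<Phi> x y) (at x)"
    and "((\<lambda>y'. pderivs m n \<Phi> x y') has_vector_derivative pderivs m (Suc n) \<Phi> x y) (at y)"
  using assms unfolding smooth2_def by blast+

lemma
  assumes \<Phi>: "smooth2 \<Phi>" and \<Psi>: "smooth2 \<Psi>"
  shows pderivs_add: "pderivs m n (\<lambda>x y. \<Phi> x y + \<Psi> x y) = (\<lambda>x y. pderivs m n \<Phi> x y + pderivs m n \<Psi> x y)"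
    and smooth2_add: "smooth2 (\<lambda>x y. \<Phi> x y + \<Psi> x y)"
proof -
  define F where "F m n x y = pderivs m n \<Phi> x y + pderivs m n \<Psi> x y" for m n x y
  have d1: "((\<lambda>x'. F m n x' y) has_vector_derivative F (Suc m) n x y) (at x)"
    and d2: "((\<lambda>y'. F m n x y') has_vector_derivative F m (Suc n) x y) (at y)" for m n x y
    unfolding F_def by (rule has_vector_derivative_add smooth2D \<Phi> \<Psi>)+
  have c: "continuous_on UNIV (\<lambda>(x, y). F m n x y)" for m n
    using continuous_on_add[OF smooth2D(1)[OF \<Phi>] smooth2D(1)[OF \<Psi>]] by (simp add: F_def case_prod_unfold)
  have F0: "F 0 0 = (\<lambda>x y. \<Phi> x y + \<Psi> x y)" by (simp add: F_def fun_eq_iff)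
  show "pderivs m n (\<lambda>x y. \<Phi> x y + \<Psi> x y) = (\<lambda>x y. pderivs m n \<Phi> x y + pderivs m n \<Psi> x y)"
    using pderivs_unique[of F, OF d1 d2, of m n] unfolding F0 by (simp add: F_def fun_eq_iff)
  show "smooth2 (\<lambda>x y. \<Phi> x y + \<Psi> x y)"
    using smooth2I[of F, OF d1 d2 c] unfolding F0 .
qed

lemma
  assumes f: "smooth f" and g: "smooth g"
  shows pderivs_tensor: "pderivs m n (\<lambda>x y. f x * g y) = (\<lambda>x y. (vderiv ^^ m) f x * (vderiv ^^ n) g y)"
    and smooth2_tensor: "smooth2 (\<lambda>x y. f x * g y)"
proof -
  define F where "F m n x y = (vderiv ^^ m) f x * (vderiv ^^ n) g y" for m n x y
  have d1: "((\<lambda>x'. F m n x' y) has_vector_derivative F (Suc m) n x y) (at x)"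
    and d2: "((\<lambda>y'. F m n x y') has_vector_derivative F m (Suc n) x y) (at y)" for m n x y
    unfolding F_def by (rule has_vector_derivative_mult_left has_vector_derivative_mult_right smooth_has_vderiv f g)+
  have c: "continuous_on UNIV (\<lambda>(x, y). F m n x y)" for m n
    unfolding F_def case_prod_unfold
    by (intro continuous_intros continuous_on_compose2[OF smooth_continuous[of _ UNIV]] smooth_vderiv_n f g) auto
  have F0: "F 0 0 = (\<lambda>x y. f x * g y)" by (simp add: F_def fun_eq_iff)
  show "pderivs m n (\<lambda>x y. f x * g y) = (\<lambda>x y. (vderiv ^^ m) f x * (vderiv ^^ n) g y)"
    using pderivs_unique[of F, OF d1 d2, of m n] unfolding F0 by (simp add: F_def fun_eq_iff)
  show "smooth2 (\<lambda>x y. f x * g y)"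
    using smooth2I[of F, OF d1 d2 c] unfolding F0 .
qed

lemma
  assumes \<Phi>: "smooth2 \<Phi>"
  shows pderivs_cmult: "pderivs m n (\<lambda>x y. c * \<Phi> x y) = (\<lambda>x y. c * pderivs m n \<Phi> x y)"
    and smooth2_cmult: "smooth2 (\<lambda>x y. c * \<Phi> x y)"
proof -
  define F where "F m n x y = c * pderivs m n \<Phi> x y" for m n x y
  have d1: "((\<lambda>x'. F m n x' y) has_vector_derivative F (Suc m) n x y) (at x)"
    and d2: "((\<lambda>y'. F m n x y') has_vector_derivative F m (Suc n) x y) (at y)" for m n x y
    unfolding F_def by (rule has_vector_derivative_mult_right smooth2D \<Phi>)+
  have c: "continuous_on UNIV (\<lambda>(x, y). F m n x y)" for m n
    using continuous_on_mult[OF continuous_on_const[of _ c] smooth2D(1)[OF \<Phi>]] by (simp add: F_def case_prod_unfold)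
  have F0: "F 0 0 = (\<lambda>x y. c * \<Phi> x y)" by (simp add: F_def fun_eq_iff)
  show "pderivs m n (\<lambda>x y. c * \<Phi> x y) = (\<lambda>x y. c * pderivs m n \<Phi> x y)"
    using pderivs_unique[of F, OF d1 d2, of m n] unfolding F0 by (simp add: F_def fun_eq_iff)
  show "smooth2 (\<lambda>x y. c * \<Phi> x y)"
    using smooth2I[of F, OF d1 d2 c] unfolding F0 .
qed

lemma pderivs_sum:
  assumes "\<And>i. i < (k::nat) \<Longrightarrow> smooth2 (\<Phi> i)"
  shows "pderivs m n (\<lambda>x y. \<Sum>i<k. \<Phi> i x y) = (\<lambda>x y. \<Sum>i<k. pderivs m n (\<Phi> i) x y)"
proof -
  have zero: "smooth2 (\<lambda>x y. 0)" using smooth2_tensor[OF smooth_const[of 0] smooth_const[of 0]] by simp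
  have pzero: "pderivs m n (\<lambda>x y. 0) = (\<lambda>x y. 0)" using pderivs_cmult[OF zero, of m n 0] by simp
  have "pderivs m n (\<lambda>x y. \<Sum>i<k. \<Phi> i x y) = (\<lambda>x y. \<Sum>i<k. pderivs m n (\<Phi> i) x y) \<and> smooth2 (\<lambda>x y. \<Sum>i<k. \<Phi> i x y)"
    using assms
  proof (induction k)
    case 0
    then show ?case using zero pzero by simp
  next
    case (Suc k)
    have IH: "pderivs m n (\<lambda>x y. \<Sum>i<k. \<Phi> i x y) = (\<lambda>x y. \<Sum>i<k. pderivs m n (\<Phi> i) x y)"
      "smooth2 (\<lambda>x y. \<Sum>i<k. \<Phi> i x y)" using Suc by auto
    have s: "smooth2 (\<Phi> k)" using Suc.prems by simp
    show ?case using pderivs_add[OF IH(2) s, of m n] smooth2_add[OF IH(2) s] IH(1) by simp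
  qed
  then show ?thesis by blast
qed

lemma supported_in_mono: "supported_in a b \<Phi> \<Longrightarrow> a' \<le> a \<Longrightarrow> b \<le> b' \<Longrightarrow> supported_in a' b' \<Phi>"
  unfolding supported_in_def by (metis atLeastAtMost_iff mem_Sigma_iff order_trans)

lemma test_fun2_smooth2: "test_fun2 \<Phi> \<Longrightarrow> smooth2 \<Phi>"
  by (simp add: test_fun2_def)

lemma test_fun2I: "smooth2 \<Phi> \<Longrightarrow> 0 < a \<Longrightarrow> supported_in a b \<Phi> \<Longrightarrow> test_fun2 \<Phi>"
  by (auto simp: test_fun2_def)

lemma test_fun2_supportE:
  assumes "test_fun2 \<Phi>" obtains a b where "0 < a" "a \<le> b" "supported_in a b \<Phi>"
proof -
  obtain a b where "0 < a" "supported_in a b \<Phi>" using assms by (auto simp: test_fun2_def)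
  then show ?thesis by (intro that[of a "max a b"]) (auto intro: supported_in_mono)
qed

lemma test_fun2_add:
  assumes \<Phi>: "test_fun2 \<Phi>" and \<Psi>: "test_fun2 \<Psi>" shows "test_fun2 (\<lambda>x y. \<Phi> x y + \<Psi> x y)"
proof -
  obtain a b where ab: "0 < a" "supported_in a b \<Phi>" using test_fun2_supportE[OF \<Phi>] by blast
  obtain c d where cd: "0 < c" "supported_in c d \<Psi>" using test_fun2_supportE[OF \<Psi>] by blast
  have "supported_in (min a c) (max b d) \<Phi>" "supported_in (min a c) (max b d) \<Psi>"
    by (rule supported_in_mono[OF ab(2)] supported_in_mono[OF cd(2)]; simp)+
  then have "supported_in (min a c) (max b d) (\<lambda>x y. \<Phi> x y + \<Psi> x y)"
    unfolding supported_in_def by (metis add_0_left)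
  from test_fun2I[OF smooth2_add[OF test_fun2_smooth2[OF \<Phi>] test_fun2_smooth2[OF \<Psi>]] _ this]
  show ?thesis using ab cd by simp
qed

lemma test_fun2_cmult: "test_fun2 \<Phi> \<Longrightarrow> test_fun2 (\<lambda>x y. c * \<Phi> x y)"
  using smooth2_cmult[of \<Phi> c] by (force simp: test_fun2_def supported_in_def)

lemma test_fun2_tensor:
  assumes f: "test_fun f" and g: "test_fun g" shows "test_fun2 (\<lambda>x y. f x * g y)"
proof -
  obtain a b where ab: "0 < a" "\<And>x. x \<notin> {a..b} \<Longrightarrow> f x = 0" using test_fun_supportE[OF f] by blast
  obtain c d where cd: "0 < c" "\<And>x. x \<notin> {c..d} \<Longrightarrow> g x = 0" using test_fun_supportE[OF g] by blast
  show ?thesis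
  proof (rule test_fun2I[OF smooth2_tensor])
    show "supported_in (min a c) (max b d) (\<lambda>x y. f x * g y)"
      using ab(2) cd(2) by (force simp: supported_in_def)
  qed (use f g ab cd test_fun_smooth in auto)
qed

lemma test_fun2_sum:
  assumes "\<And>i. i < (k::nat) \<Longrightarrow> test_fun2 (\<Phi> i)" shows "test_fun2 (\<lambda>x y. \<Sum>i<k. \<Phi> i x y)"
  using assms
proof (induction k)
  case 0
  then show ?case using test_fun2_tensor[OF test_fun_zero test_fun_zero] by simp
next
  case (Suc k)
  then show ?case using test_fun2_add[of "\<lambda>x y. \<Sum>i<k. \<Phi> i x y" "\<Phi> k"] by simp
qed

lemma pderivs_zero_outside:
  assumes "supported_in a b \<Phi>" shows "supported_in a b (pderivs m n \<Phi>)"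
  unfolding supported_in_def
proof (intro allI impI)
  fix x y assume xy: "(x, y) \<notin> {a..b} \<times> {a..b}"
  show "pderivs m n \<Phi> x y = 0"
  proof (cases "y \<in> {a..b}")
    case False
    have "(vderiv ^^ n) (\<Phi> x') y = 0" for x'
      by (rule vderiv_n_zero_outside[OF _ False]) (use assms in \<open>auto simp: supported_in_def\<close>)
    \<comment> \<open>The interval {1..0} is empty, so every point lies outside and the derivatives
      of the zero function vanish everywhere.\<close>
    moreover have "(vderiv ^^ m) (\<lambda>x'. 0) x = 0" for m
      by (rule vderiv_n_zero_outside[of 1 0]) auto
    ultimately show ?thesis unfolding pderivs_eq by simp
  next
    case True
    then have x: "x \<notin> {a..b}" using xy by simp
    have "(vderiv ^^ n) (\<Phi> x') y = 0" if "x' \<notin> {a..b}" for x'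
    proof -
      have "\<Phi> x' = (\<lambda>_. 0)" using assms that by (auto simp: supported_in_def)
      then show ?thesis using vderiv_n_zero_outside[of 1 0 "\<lambda>_. 0" y n] by simp
    qed
    then show ?thesis unfolding pderivs_eq by (rule vderiv_n_zero_outside[OF _ x])
  qed
qed

lemma pderivs_bounded:
  assumes \<Phi>: "test_fun2 \<Phi>" obtains B where "\<And>x y. cmod (pderivs m n \<Phi> x y) \<le> B"
proof -
  obtain a b where ab: "0 < a" "a \<le> b" "supported_in a b \<Phi>" using test_fun2_supportE[OF \<Phi>] .
  have "compact ((\<lambda>(x, y). pderivs m n \<Phi> x y) ` ({a..b} \<times> {a..b}))"
    by (intro compact_continuous_image compact_Times continuous_on_subset[OF smooth2D(1)[OF test_fun2_smooth2[OF \<Phi>]]]) auto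
  then obtain B where B: "\<And>w. w \<in> (\<lambda>(x, y). pderivs m n \<Phi> x y) ` ({a..b} \<times> {a..b}) \<Longrightarrow> norm w \<le> B"
    using compact_imp_bounded bounded_iff by metis
  have "cmod (pderivs m n \<Phi> x y) \<le> max B 0" for x y
  proof (cases "(x, y) \<in> {a..b} \<times> {a..b}")
    case True
    then have "cmod (pderivs m n \<Phi> x y) \<le> B" by (intro B) force
    then show ?thesis by simp
  next
    case False
    then have "pderivs m n \<Phi> x y = 0" using pderivs_zero_outside[OF ab(3), of m n] unfolding supported_in_def by blast
    then show ?thesis by simp
  qed
  then show ?thesis using that by blast
qed

lemma
  assumes \<Phi>: "test_fun2 \<Phi>"
  shows test_fun2_section1: "test_fun (\<lambda>x. pderivs 0 n \<Phi> x y)"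
    and test_fun2_section1_deriv: "(vderiv ^^ m) (\<lambda>x. pderivs 0 n \<Phi> x y) = (\<lambda>x. pderivs m n \<Phi> x y)"
    and test_fun2_section2: "test_fun (\<Phi> x)"
    and test_fun2_section2_deriv: "(vderiv ^^ n) (\<Phi> x) = pderivs 0 n \<Phi> x"
proof -
  note D = smooth2D[OF test_fun2_smooth2[OF \<Phi>]]
  obtain a b where ab: "0 < a" "a \<le> b" "supported_in a b \<Phi>" using test_fun2_supportE[OF \<Phi>] .
  have eq1: "(vderiv ^^ m) (\<lambda>x. pderivs 0 n \<Phi> x y) = (\<lambda>x. pderivs m n \<Phi> x y)" for m n y
    by (simp add: pderivs_eq fun_eq_iff)
  have eq2: "(vderiv ^^ n) (\<Phi> x) = pderivs 0 n \<Phi> x" for n x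
    by (simp add: pderivs_eq fun_eq_iff)
  show "(vderiv ^^ m) (\<lambda>x. pderivs 0 n \<Phi> x y) = (\<lambda>x. pderivs m n \<Phi> x y)" "(vderiv ^^ n) (\<Phi> x) = pderivs 0 n \<Phi> x"
    by (fact eq1 eq2)+
  have "pderivs 0 n \<Phi> x y = 0" if "x \<notin> {a..b} \<or> y \<notin> {a..b}" for n x y
    using pderivs_zero_outside[OF ab(3), of 0 n] that by (auto simp: supported_in_def)
  note out = this this[of _ _ 0, simplified]
  show "test_fun (\<lambda>x. pderivs 0 n \<Phi> x y)"
    by (rule test_funI[OF _ ab(1), of _ b])
       (auto simp: smooth_def eq1 out differentiableI_vector[OF D(2)])
  show "test_fun (\<Phi> x)"
    by (rule test_funI[OF _ ab(1), of _ b])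
       (auto simp: smooth_def eq2 out differentiableI_vector[OF D(3)])
qed

section \<open>Tensor products determine a distribution\<close>

text \<open>Left end points are used; each subinterval contributes an error of at most L
  \<Delta>^2.\<close>

lemma riemann_sum_error:
  fixes g g' :: "real \<Rightarrow> complex"
  assumes d: "\<And>x. (g has_vector_derivative g' x) (at x)" and L: "\<And>x. cmod (g' x) \<le> L" and \<Delta>: "\<Delta> \<ge> 0"
  shows "cmod ((\<Sum>i<n. of_real \<Delta> * g (a + real i * \<Delta>)) - integral {a..a + real n * \<Delta>} g) \<le> real n * (L * \<Delta> * \<Delta>)"
proof (induction n)
  case (Suc n)
  define p where "p = a + real n * \<Delta>"
  have c: "continuous_on S g" for S
    using d by (meson continuous_at_imp_continuous_on has_vector_derivative_continuous)
  have p: "a \<le> p" "a + real (Suc n) * \<Delta> = p + \<Delta>" using \<Delta> by (auto simp: p_def algebra_simps)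
  have "integral {a..p + \<Delta>} g = integral {a..p} g + integral {p..p + \<Delta>} g"
    using p \<Delta> by (intro Henstock_Kurzweil_Integration.integral_combine[symmetric] integrable_continuous_real c) auto
  moreover have "integral {p..p + \<Delta>} (\<lambda>x. g p - g x) = of_real \<Delta> * g p - integral {p..p + \<Delta>} g"
    using \<Delta> by (subst integral_diff) (auto intro!: integrable_continuous_real c simp: scaleR_conv_of_real)
  moreover have "cmod (integral {p..p + \<Delta>} (\<lambda>x. g p - g x)) \<le> (L * \<Delta>) * (p + \<Delta> - p)"
  proof (rule integral_bound)
    fix x assume x: "x \<in> {p..p + \<Delta>}"
    have "cmod (g p - g x) \<le> \<bar>p - x\<bar> * L" by (rule vector_derivative_bound[OF d L])
    also have "\<dots> \<le> \<Delta> * L" using x order_trans[OF norm_ge_zero L] by (intro mult_right_mono) auto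
    finally show "cmod (g p - g x) \<le> L * \<Delta>" by (simp add: mult.commute)
  qed (use \<Delta> in \<open>auto intro!: continuous_intros c\<close>)
  ultimately have "cmod (of_real \<Delta> * g p - (integral {a..p + \<Delta>} g - integral {a..p} g)) \<le> L * \<Delta> * \<Delta>" by simp
  then have "cmod (((\<Sum>i<n. of_real \<Delta> * g (a + real i * \<Delta>)) - integral {a..p} g)
      + (of_real \<Delta> * g p - (integral {a..p + \<Delta>} g - integral {a..p} g))) \<le> real n * (L * \<Delta> * \<Delta>) + L * \<Delta> * \<Delta>"
    using Suc.IH unfolding p_def[symmetric] by (intro norm_triangle_mono)
  moreover have "((\<Sum>i<n. of_real \<Delta> * g (a + real i * \<Delta>)) - integral {a..p} g)
      + (of_real \<Delta> * g p - (integral {a..p + \<Delta>} g - integral {a..p} g))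
      = (\<Sum>i<Suc n. of_real \<Delta> * g (a + real i * \<Delta>)) - integral {a..a + real (Suc n) * \<Delta>} g"
    unfolding p(2) by (simp add: p_def)
  moreover have "real n * (L * \<Delta> * \<Delta>) + L * \<Delta> * \<Delta> = real (Suc n) * (L * \<Delta> * \<Delta>)" by (simp add: algebra_simps)
  ultimately show ?case by (simp only:)
qed simp

text \<open>Two errors add up. The Riemann sum approximates the convolution of the m-th derivative
  of \<open>\<sigma>\<close> with h, at the cost of a derivative of order m + 1. Integration by
  parts moves the m derivatives to h, and convolving with \<open>\<sigma>\<close>, which has mass
  one on an interval of length \<delta>, changes the m-th derivative of h by at most M
  \<delta>.\<close>

lemma mollified_sum_error:
  fixes h \<sigma> :: "real \<Rightarrow> complex"
  assumes \<sigma>: "smooth \<sigma>" "\<And>z. z \<notin> {0..\<delta>} \<Longrightarrow> \<sigma> z = 0" "integrable lborel \<sigma>" "(LBINT z. \<sigma> z) = 1" "(LBINT z. cmod (\<sigma> z)) = 1"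
    and A: "\<And>i z. i \<le> Suc m \<Longrightarrow> cmod ((vderiv ^^ i) \<sigma> z) \<le> A"
    and h: "smooth h" "\<And>z. z \<notin> {a..b} \<Longrightarrow> h z = 0" "0 < a" "a \<le> b"
    and M: "\<And>i z. i \<le> Suc m \<Longrightarrow> cmod ((vderiv ^^ i) h z) \<le> M" and n: "n > 0" and \<Delta>_def: "\<Delta> = (b - a) / real n"
  shows "cmod ((\<Sum>i<n. of_real \<Delta> * ((vderiv ^^ m) \<sigma> (x - (a + real i * \<Delta>)) * h (a + real i * \<Delta>))) - (vderiv ^^ m) h x) \<le>
    (b - a) * (2 * A * M) * \<Delta> + M * \<delta>"
proof -
  have tf: "test_fun ((vderiv ^^ i) h)" for i
    using vderiv_n_zero_outside[of a b h, OF h(2)] h by (intro test_funI[of _ a b] smooth_vderiv_n) auto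
  have sch: "schwartz ((vderiv ^^ i) h)" for i by (rule test_fun_schwartz[OF tf])
  have \<Delta>: "\<Delta> \<ge> 0" "real n * \<Delta> = b - a" using h(4) n by (auto simp: \<Delta>_def)
  have A0: "A \<ge> 0" using A[of 0 0] norm_ge_zero order_trans by blast
  have M0: "M \<ge> 0" using M[of 0 0] norm_ge_zero order_trans by blast
  have \<delta>0: "\<delta> \<ge> 0"
  proof (rule ccontr)
    assume "\<not> \<delta> \<ge> 0"
    then have "\<sigma> z = 0" for z using \<sigma>(2)[of z] by auto
    then show False using \<sigma>(4) by simp
  qed
  have sd: "((vderiv ^^ i) \<sigma> has_vector_derivative (vderiv ^^ Suc i) \<sigma> z) (at z)" for i z
    by (rule smooth_has_vderiv[OF \<sigma>(1)])
  have quad: "quadratic_growth ((vderiv ^^ i) \<sigma>)" if "i \<le> Suc m" for i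
    by (rule quadratic_growth_bounded[OF smooth_borel A[OF that]]) (use \<sigma>(1) in blast)
  have parts: "conv ((vderiv ^^ i) \<sigma>) h x = conv \<sigma> ((vderiv ^^ i) h) x" if "i \<le> m" for i
  proof -
    have "conv ((vderiv ^^ i) \<sigma>) ((vderiv ^^ j) h) x = conv \<sigma> ((vderiv ^^ (i + j)) h) x" for j
      using that
    proof (induction i arbitrary: j)
      case (Suc i)
      have "conv ((vderiv ^^ Suc i) \<sigma>) ((vderiv ^^ j) h) x = conv ((vderiv ^^ i) \<sigma>) (vderiv ((vderiv ^^ j) h)) x"
        by (rule conv_by_parts[OF sd _ quad quad sch]) (use Suc.prems \<sigma>(1) in \<open>auto intro: smooth_continuous\<close>)
      then show ?case using Suc.IH[of "Suc j"] Suc.prems by simp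
    qed simp
    from this[of 0] show ?thesis by simp
  qed
  define g where "g p = (vderiv ^^ m) \<sigma> (x - p) * h p" for p
  define g' where "g' p = (vderiv ^^ m) \<sigma> (x - p) * vderiv h p - (vderiv ^^ Suc m) \<sigma> (x - p) * h p" for p
  have gd: "(g has_vector_derivative g' p) (at p)" for p
  proof -
    have "((\<lambda>p. (vderiv ^^ m) \<sigma> (x - p)) has_vector_derivative - (vderiv ^^ Suc m) \<sigma> (x - p)) (at p)"
    proof -
      have "((\<lambda>p. x - p) has_vector_derivative -1) (at p)" by (auto intro!: derivative_eq_intros)
      from vector_diff_chain_at[OF this sd, of m] show ?thesis by (simp add: o_def)
    qed
    from has_vector_derivative_mult[OF this smooth_vderiv_at[OF h(1)]] show ?thesis by (simp add: g_def[abs_def] g'_def)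
  qed
  have gb: "cmod (g' p) \<le> 2 * A * M" for p
  proof -
    have "cmod (g' p) \<le> cmod ((vderiv ^^ m) \<sigma> (x - p)) * cmod (vderiv h p) + cmod ((vderiv ^^ Suc m) \<sigma> (x - p)) * cmod (h p)"
      unfolding g'_def norm_mult[symmetric] by (rule norm_triangle_ineq4)
    also have "\<dots> \<le> A * M + A * M"
      using A[of m] A[of "Suc m"] M[of 1] M[of 0] A0 by (intro add_mono mult_mono) auto
    finally show ?thesis by simp
  qed
  have c: "continuous_on S g" for S using gd by (meson continuous_at_imp_continuous_on has_vector_derivative_continuous)
  have "conv ((vderiv ^^ m) \<sigma>) h x = (LBINT y:{0<..}. (vderiv ^^ m) \<sigma> (x - y) * h y)"
    unfolding conv_reflected using test_fun_half_line[OF tf[of 0]] by simp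
  also have "\<dots> = integral {a..b} g"
  proof -
    have "continuous_on {0<..} (\<lambda>y. (vderiv ^^ m) \<sigma> (x - y))"
      by (intro continuous_on_compose2[OF smooth_continuous[of _ UNIV]] smooth_vderiv_n \<sigma>(1) continuous_intros) auto
    from test_fun_integral_set(2)[OF tf[of 0] _ h(3) this] h(2) show ?thesis by (simp add: g_def[abs_def])
  qed
  finally have int: "conv ((vderiv ^^ m) \<sigma>) h x = integral {a..b} g" .
  define H where "H = (vderiv ^^ m) h"
  have Hd: "(H has_vector_derivative (vderiv ^^ Suc m) h z) (at z)" for z
    unfolding H_def by (rule smooth_has_vderiv[OF h(1)])
  have i1: "integrable lborel (\<lambda>z. \<sigma> z * H (x - z))"
    unfolding H_def using conv_integrable[OF quad[of 0] sch] by simp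
  have "conv \<sigma> H x - H x = (LBINT z. \<sigma> z * (H (x - z) - H x))"
    unfolding conv_def right_diff_distrib using i1 \<sigma>(3,4) by simp
  also have "cmod \<dots> \<le> (LBINT z. cmod (\<sigma> z * (H (x - z) - H x)))" by (rule integral_norm_bound)
  also have "\<dots> \<le> (LBINT z. (M * \<delta>) * cmod (\<sigma> z))"
  proof (rule integral_mono)
    have "integrable lborel (\<lambda>z. \<sigma> z * (H (x - z) - H x))"
      unfolding right_diff_distrib using i1 \<sigma>(3) by auto
    then show "integrable lborel (\<lambda>z. cmod (\<sigma> z * (H (x - z) - H x)))" by (rule integrable_norm)
    show "integrable lborel (\<lambda>z. (M * \<delta>) * cmod (\<sigma> z))" using \<sigma>(3) by auto
    fix z
    show "cmod (\<sigma> z * (H (x - z) - H x)) \<le> (M * \<delta>) * cmod (\<sigma> z)"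
    proof (cases "z \<in> {0..\<delta>}")
      case True
      have "cmod (H (x - z) - H x) \<le> \<bar>(x - z) - x\<bar> * M"
        by (rule vector_derivative_bound[OF Hd M]) simp
      also have "\<dots> \<le> \<delta> * M" using True M0 by (intro mult_right_mono) auto
      finally have "cmod (H (x - z) - H x) * cmod (\<sigma> z) \<le> (\<delta> * M) * cmod (\<sigma> z)" by (rule mult_right_mono) simp
      then show ?thesis by (simp add: norm_mult mult_ac)
    next
      case False
      then show ?thesis using \<sigma>(2) by simp
    qed
  qed
  also have "\<dots> = M * \<delta>" using \<sigma>(5) by simp
  finally have e2: "cmod (integral {a..b} g - (vderiv ^^ m) h x) \<le> M * \<delta>"
    unfolding int[symmetric] parts[OF order_refl] H_def .
  have e1: "cmod ((\<Sum>i<n. of_real \<Delta> * g (a + real i * \<Delta>)) - integral {a..b} g) \<le> (b - a) * (2 * A * M) * \<Delta>"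
  proof -
    have "a + real n * \<Delta> = b" using \<Delta>(2) by simp
    moreover have "real n * (2 * A * M * \<Delta> * \<Delta>) = (b - a) * (2 * A * M) * \<Delta>"
      unfolding \<Delta>(2)[symmetric] by (simp add: mult_ac)
    ultimately show ?thesis
      using riemann_sum_error[OF gd gb \<Delta>(1), where n = n and a = a] by (simp only:)
  qed
  have "cmod (((\<Sum>i<n. of_real \<Delta> * g (a + real i * \<Delta>)) - integral {a..b} g) + (integral {a..b} g - (vderiv ^^ m) h x))
      \<le> (b - a) * (2 * A * M) * \<Delta> + M * \<delta>"
    using e1 e2 by (intro norm_triangle_mono)
  then show ?thesis by (simp add: g_def)
qed

lemma distribution2_sum:
  assumes S: "distribution2 S" and t: "\<And>i. i < (k::nat) \<Longrightarrow> test_fun2 (\<Phi> i)"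
  shows "S (\<lambda>x y. \<Sum>i<k. \<Phi> i x y) = (\<Sum>i<k. S (\<Phi> i))"
  using t
proof (induction k)
  case 0
  have "test_fun2 (\<lambda>x y. 0)" using test_fun2_tensor[OF test_fun_zero test_fun_zero] by simp
  then have "S (\<lambda>x y. 0 * 0) = 0 * S (\<lambda>x y. 0)" using S unfolding distribution2_def by blast
  then show ?case by simp
next
  case (Suc k)
  have t: "test_fun2 (\<lambda>x y. \<Sum>i<k. \<Phi> i x y)" "test_fun2 (\<Phi> k)" using Suc.prems by (auto intro: test_fun2_sum)
  then have "S (\<lambda>x y. (\<Sum>i<k. \<Phi> i x y) + \<Phi> k x y) = S (\<lambda>x y. \<Sum>i<k. \<Phi> i x y) + S (\<Phi> k)"
    using S unfolding distribution2_def by blast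
  then show ?case using Suc by simp
qed

text \<open>Derivatives in x fall on the mollifier and those in y on the sections of
  \<open>\<Phi>\<close>, so each mixed derivative is covered by the one-variable estimate
  \<open>mollified_sum_error\<close>, uniformly in y.\<close>

lemma distribution2_tensor_density:
  assumes S: "distribution2 S" and zero: "\<And>\<phi> f. test_fun \<phi> \<Longrightarrow> test_fun f \<Longrightarrow> S (\<lambda>x y. \<phi> x * f y) = 0"
    and \<Phi>: "test_fun2 \<Phi>"
  shows "S \<Phi> = 0"
proof -
  have add: "S (\<lambda>x y. \<Phi> x y + \<Psi> x y) = S \<Phi> + S \<Psi>" if "test_fun2 \<Phi>" "test_fun2 \<Psi>" for \<Phi> \<Psi>
    using S that unfolding distribution2_def by blast
  have cmult: "S (\<lambda>x y. c * \<Phi> x y) = c * S \<Phi>" if "test_fun2 \<Phi>" for c \<Phi>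
    using S that unfolding distribution2_def by blast
  obtain a b where ab: "0 < a" "a \<le> b" "supported_in a b \<Phi>" using test_fun2_supportE[OF \<Phi>] .
  obtain \<rho> :: "real \<Rightarrow> complex" where \<rho>: "smooth \<rho>" "\<And>x. x \<notin> {0..1} \<Longrightarrow> \<rho> x = 0"
    "\<And>x. \<rho> x = of_real (cmod (\<rho> x))" "integrable lborel \<rho>" "(LBINT x. \<rho> x) = 1" by (rule ex_smooth_mollifier) blast
  have \<rho>1: "(LBINT z. cmod (\<rho> z)) = 1"
  proof -
    have "complex_of_real (LBINT z. cmod (\<rho> z)) = (LBINT z. of_real (cmod (\<rho> z)))" 
      using integrable_norm[OF \<rho>(4)] by (simp only: integral_of_real)
    also have "\<dots> = (LBINT z. \<rho> z)" by (rule Bochner_Integration.integral_cong[OF refl]) (rule \<rho>(3)[symmetric])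
    finally show ?thesis using \<rho>(5) by (metis of_real_eq_1_iff)
  qed
  define \<kappa> where "\<kappa> k = real (Suc k)" for k
  have \<kappa>: "\<kappa> k \<ge> 1" for k by (simp add: \<kappa>_def)
  \<comment> \<open>The summand 0 brings the argument into the affine form of
    \<open>vderiv_n_affine\<close>.\<close>
  define \<sigma> where "\<sigma> k z = of_real (\<kappa> k) * \<rho> (\<kappa> k * z + 0)" for k z
  have \<sigma>_deriv: "(vderiv ^^ i) (\<sigma> k) = (\<lambda>z. of_real (\<kappa> k) * (of_real (\<kappa> k) ^ i * (vderiv ^^ i) \<rho> (\<kappa> k * z + 0)))" for i k
    unfolding \<sigma>_def[abs_def] vderiv_n_cmult[OF smooth_affine[OF \<rho>(1)]] vderiv_n_affine[OF \<rho>(1)] ..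
  have \<sigma>_smooth: "smooth (\<sigma> k)" for k unfolding \<sigma>_def[abs_def] by (intro smooth_mult smooth_const smooth_affine \<rho>(1))
  have \<sigma>_out: "\<sigma> k z = 0" if "z \<notin> {0..1 / \<kappa> k}" for k z
  proof -
    have "\<kappa> k * z \<notin> {0..1}" using that \<kappa>[of k] by (auto simp: field_simps zero_le_mult_iff)
    then show ?thesis using \<rho>(2) by (simp add: \<sigma>_def)
  qed
  have \<sigma>_int: "integrable lborel (\<sigma> k)" "(LBINT z. \<sigma> k z) = 1" "(LBINT z. cmod (\<sigma> k z)) = 1" for k
  proof -
    have k: "\<kappa> k \<noteq> 0" "\<kappa> k > 0" using \<kappa>[of k] by auto
    show "integrable lborel (\<sigma> k)"
      using lborel_integrable_real_affine[OF \<rho>(4) k(1), of 0] unfolding \<sigma>_def[abs_def] by (auto simp: add.commute)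
    have "(LBINT z. \<rho> (0 + \<kappa> k * z)) = 1 / of_real (\<kappa> k)"
      using lborel_integral_real_affine[OF k(1), of \<rho> 0] \<rho>(5) k by (simp add: scaleR_conv_of_real field_simps)
    then show "(LBINT z. \<sigma> k z) = 1" using k by (simp add: \<sigma>_def)
    have "(LBINT z. cmod (\<rho> (0 + \<kappa> k * z))) = 1 / \<kappa> k"
      using lborel_integral_real_affine[OF k(1), of "\<lambda>z. cmod (\<rho> z)" 0] \<rho>1 k by (simp add: field_simps)
    then show "(LBINT z. cmod (\<sigma> k z)) = 1" using k by (simp add: \<sigma>_def norm_mult)
  qed
  have "\<exists>A. \<forall>z. cmod ((vderiv ^^ i) \<rho> z) \<le> A" for i
  proof -
    have "compact ((vderiv ^^ i) \<rho> ` {0..1})"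
      by (intro compact_continuous_image smooth_continuous smooth_vderiv_n \<rho>(1)) auto
    then obtain A where A: "\<And>w. w \<in> (vderiv ^^ i) \<rho> ` {0..1} \<Longrightarrow> norm w \<le> A" using compact_imp_bounded bounded_iff by metis
    have "cmod ((vderiv ^^ i) \<rho> z) \<le> max A 0" for z
    proof (cases "z \<in> {0..1}")
      case True then show ?thesis using A[OF imageI[OF True]] by simp
    next
      case False
      have "(vderiv ^^ i) \<rho> z = 0" by (rule vderiv_n_zero_outside[OF \<rho>(2) False]) 
      then show ?thesis by simp
    qed
    then show ?thesis by blast
  qed
  then obtain A where A: "\<And>i z. cmod ((vderiv ^^ i) \<rho> z) \<le> A i" by metis
  have "\<exists>B. \<forall>x y. cmod (pderivs m n \<Phi> x y) \<le> B" for m n by (rule pderivs_bounded[OF \<Phi>, of m n]) blast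
  then obtain B where B: "\<And>m n x y. cmod (pderivs m n \<Phi> x y) \<le> B m n" by metis
  have A0: "A i \<ge> 0" for i using A[of i 0] norm_ge_zero order_trans by blast
  have B0: "B i j \<ge> 0" for i j using B[of i j 0 0] norm_ge_zero order_trans by blast
  \<comment> \<open>The derivatives of \<open>\<sigma> k\<close> up to order m + 1 are bounded by a
    multiple of \<open>\<kappa> k ^ (m + 2)\<close>. An exponentially fine partition beats this for
    every m, so one sequence serves all derivatives.\<close>
  define n where "n k = nat \<lceil>exp (\<kappa> k)\<rceil>" for k
  have n: "n k > 0" "exp (\<kappa> k) \<le> real (n k)" for k
    unfolding n_def by (auto intro: real_nat_ceiling_ge)
  define \<Delta> where "\<Delta> k = (b - a) / real (n k)" for k
  define p where "p k i = a + real i * \<Delta> k" for k i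
  have p: "a \<le> p k i" for k i using ab n(1)[of k] by (simp add: p_def \<Delta>_def)
  have p_le: "p k i \<le> b" if "i < n k" for k i
  proof -
    have "real i * \<Delta> k \<le> real (n k) * \<Delta> k" using that ab(2) by (intro mult_right_mono) (auto simp: \<Delta>_def)
    also have "\<dots> = b - a" using n(1)[of k] by (simp add: \<Delta>_def)
    finally show ?thesis by (simp add: p_def)
  qed
  define t where "t k i = (\<lambda>x y. of_real (\<Delta> k) * (\<sigma> k (x - p k i) * \<Phi> (p k i) y))" for k i
  define Q where "Q k = (\<lambda>x y. \<Sum>i<n k. t k i x y)" for k
  \<comment> \<open>The difference is written with a sum and the scalar -1, the two operations for
    which \<open>distribution2\<close> provides linearity.\<close>
  define R where "R k = (\<lambda>x y. Q k x y + (-1) * \<Phi> x y)" for k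
  have shifted: "smooth (\<lambda>x. \<sigma> k (1 * x + (- p k i)))" for k i by (rule smooth_affine[OF \<sigma>_smooth])
  have shifted_tf: "test_fun (\<lambda>x. \<sigma> k (x - p k i))" if "i < n k" for k i
  proof (rule test_funI[of _ a "b + 1"])
    show "smooth (\<lambda>x. \<sigma> k (x - p k i))" using shifted[of k i] by simp
    fix x assume x: "x \<notin> {a..b + 1}"
    have "1 / \<kappa> k \<le> 1" using \<kappa>[of k] by simp
    then show "\<sigma> k (x - p k i) = 0" using x p[of k i] p_le[OF that] by (intro \<sigma>_out) auto
  qed (use ab in auto)
  have tens_tf: "test_fun2 (\<lambda>x y. \<sigma> k (x - p k i) * \<Phi> (p k i) y)" if "i < n k" for k i
    by (rule test_fun2_tensor[OF shifted_tf[OF that] test_fun2_section2[OF \<Phi>]])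
  have t_tf: "test_fun2 (t k i)" if "i < n k" for k i
    unfolding t_def by (rule test_fun2_cmult[OF tens_tf[OF that]])
  have Q_tf: "test_fun2 (Q k)" for k unfolding Q_def by (rule test_fun2_sum[OF t_tf])
  have m\<Phi>_tf: "test_fun2 (\<lambda>x y. (-1) * \<Phi> x y)" by (rule test_fun2_cmult[OF \<Phi>])
  have R_tf: "test_fun2 (R k)" for k unfolding R_def by (rule test_fun2_add[OF Q_tf m\<Phi>_tf])
  have "S (Q k) = 0" for k
  proof -
    have "S (t k i) = 0" if "i < n k" for i
      unfolding t_def cmult[OF tens_tf[OF that]] zero[OF shifted_tf[OF that] test_fun2_section2[OF \<Phi>]] by simp
    then show ?thesis unfolding Q_def by (subst distribution2_sum[OF S t_tf]) auto
  qed
  then have SR: "S (R k) = - S \<Phi>" for k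
    unfolding R_def add[OF Q_tf m\<Phi>_tf] cmult[OF \<Phi>] by simp
  \<comment> \<open>The mollifier is supported on the right of 0 within a unit interval: the lower
    bound a is kept, hence stays positive, and the upper one grows by at most 1.\<close>
  have R_supp: "supported_in a (b + 1) (R k)" for k
    unfolding supported_in_def
  proof (intro allI impI)
    fix x y assume xy: "(x, y) \<notin> {a..b + 1} \<times> {a..b + 1}"
    have "t k i x y = 0" if i: "i < n k" for i
    proof (cases "x \<in> {a..b + 1}")
      case True
      then have "\<Phi> (p k i) y = 0" using xy ab(3) by (auto simp: supported_in_def)
      then show ?thesis by (simp add: t_def)
    next
      case False
      have "1 / \<kappa> k \<le> 1" using \<kappa>[of k] by simp
      then have "\<sigma> k (x - p k i) = 0" using False p[of k i] p_le[OF i] by (intro \<sigma>_out) auto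
      then show ?thesis by (simp add: t_def)
    qed
    moreover have "\<Phi> x y = 0" using xy ab(3) by (auto simp: supported_in_def)
    ultimately show "R k x y = 0" by (simp add: R_def Q_def)
  qed
  have R_deriv: "pderivs m j (R k) x y =
      (\<Sum>i<n k. of_real (\<Delta> k) * ((vderiv ^^ m) (\<sigma> k) (x - (a + real i * \<Delta> k)) * pderivs 0 j \<Phi> (a + real i * \<Delta> k) y)) - pderivs m j \<Phi> x y"
    for m j k x y
  proof -
    have "pderivs m j (t k i) x y = of_real (\<Delta> k) * ((vderiv ^^ m) (\<sigma> k) (x - p k i) * pderivs 0 j \<Phi> (p k i) y)" if i: "i < n k" for i
    proof -
      have "(vderiv ^^ m) (\<lambda>x. \<sigma> k (x - p k i)) = (\<lambda>x. (vderiv ^^ m) (\<sigma> k) (x - p k i))"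
        using vderiv_n_affine[OF \<sigma>_smooth, of m k 1 "- p k i"] by simp
      then show ?thesis
        unfolding t_def pderivs_cmult[OF test_fun2_smooth2[OF tens_tf[OF i]]]
          pderivs_tensor[OF test_fun_smooth[OF shifted_tf[OF i]] test_fun_smooth[OF test_fun2_section2[OF \<Phi>]]]
          test_fun2_section2_deriv[OF \<Phi>] by simp
    qed
    moreover have "pderivs m j (Q k) x y = (\<Sum>i<n k. pderivs m j (t k i) x y)"
      using pderivs_sum[of "n k" "t k" m j, OF test_fun2_smooth2[OF t_tf]] by (simp add: Q_def)
    moreover have "pderivs m j (R k) x y = pderivs m j (Q k) x y + (-1) * pderivs m j \<Phi> x y"
      unfolding R_def pderivs_add[OF test_fun2_smooth2[OF Q_tf] test_fun2_smooth2[OF m\<Phi>_tf]]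
        pderivs_cmult[OF test_fun2_smooth2[OF \<Phi>]] ..
    ultimately show ?thesis by (simp add: p_def)
  qed
  have "uniform_limit UNIV (\<lambda>k (x, y). pderivs m j (R k) x y) (\<lambda>_. 0) sequentially" for m j
  proof -
    define M where "M = (\<Sum>i\<le>Suc m. B i j)"
    define A1 where "A1 = (\<Sum>i\<le>Suc m. A i)"
    have M: "cmod (pderivs i j \<Phi> x y) \<le> M" if "i \<le> Suc m" for i x y
      unfolding M_def using that B0 by (intro order_trans[OF B] member_le_sum) auto
    have A1: "cmod ((vderiv ^^ i) \<rho> z) \<le> A1" if "i \<le> Suc m" for i z
      unfolding A1_def using that A0 by (intro order_trans[OF A] member_le_sum) auto
    have A10: "A1 \<ge> 0" using A1[of 0 0] norm_ge_zero order_trans by blast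
    have M0: "M \<ge> 0" using M[of 0 0 0] norm_ge_zero order_trans by blast
    have A2: "cmod ((vderiv ^^ i) (\<sigma> k) z) \<le> \<kappa> k ^ (m + 2) * A1" if i: "i \<le> Suc m" for i k z
    proof -
      have "cmod ((vderiv ^^ i) (\<sigma> k) z) = \<kappa> k ^ Suc i * cmod ((vderiv ^^ i) \<rho> (\<kappa> k * z + 0))"
        unfolding \<sigma>_deriv norm_mult norm_power using \<kappa>[of k] by simp
      also have "\<dots> \<le> \<kappa> k ^ (m + 2) * A1"
        using i \<kappa>[of k] by (intro mult_mono A1 power_increasing) auto
      finally show ?thesis .
    qed
    define e where "e x = (b - a) * (2 * A1 * M) * (b - a) * (x ^ (m + 2) / exp x) + M * (1 / x)" for x :: real
    have bound: "cmod (pderivs m j (R k) x y) \<le> e (\<kappa> k)" for k x y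
    proof -
      have out: "pderivs 0 j \<Phi> z y = 0" if "z \<notin> {a..b}" for z
        using pderivs_zero_outside[OF ab(3), of 0 j] that by (auto simp: supported_in_def)
      have "cmod ((\<Sum>i<n k. of_real (\<Delta> k) * ((vderiv ^^ m) (\<sigma> k) (x - (a + real i * \<Delta> k)) * pderivs 0 j \<Phi> (a + real i * \<Delta> k) y))
          - (vderiv ^^ m) (\<lambda>x. pderivs 0 j \<Phi> x y) x) \<le> (b - a) * (2 * (\<kappa> k ^ (m + 2) * A1) * M) * \<Delta> k + M * (1 / \<kappa> k)"
      proof (rule mollified_sum_error[OF \<sigma>_smooth \<sigma>_out \<sigma>_int A2 _ out ab(1,2) _ n(1) \<Delta>_def])
        show "smooth (\<lambda>x. pderivs 0 j \<Phi> x y)" using test_fun2_section1[OF \<Phi>] by (rule test_fun_smooth)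
        show "cmod ((vderiv ^^ i) (\<lambda>x. pderivs 0 j \<Phi> x y) z) \<le> M" if "i \<le> Suc m" for i z
          unfolding test_fun2_section1_deriv[OF \<Phi>] by (rule M[OF that])
      qed
      also have "(b - a) * (2 * (\<kappa> k ^ (m + 2) * A1) * M) * \<Delta> k \<le> (b - a) * (2 * (\<kappa> k ^ (m + 2) * A1) * M) * ((b - a) / exp (\<kappa> k))"
        unfolding \<Delta>_def using ab(2) n[of k] A10 M0 \<kappa>[of k] by (intro mult_left_mono divide_left_mono) auto
      also have "(b - a) * (2 * (\<kappa> k ^ (m + 2) * A1) * M) * ((b - a) / exp (\<kappa> k)) =
          (b - a) * (2 * A1 * M) * (b - a) * (\<kappa> k ^ (m + 2) / exp (\<kappa> k))" by simp
      finally show ?thesis unfolding R_deriv test_fun2_section1_deriv[OF \<Phi>] e_def by simp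
    qed
    have "((\<lambda>x. e x) \<longlongrightarrow> (b - a) * (2 * A1 * M) * (b - a) * 0 + M * 0) at_top"
      unfolding e_def by (intro tendsto_intros tendsto_power_div_exp_0 tendsto_divide_0[OF tendsto_const] filterlim_at_top_imp_at_infinity filterlim_ident)
    moreover have "filterlim \<kappa> at_top sequentially"
      unfolding \<kappa>_def by (intro filterlim_compose[OF filterlim_real_sequentially] filterlim_Suc)
    ultimately have lim: "(\<lambda>k. e (\<kappa> k)) \<longlonglongrightarrow> 0"
      using filterlim_compose[of e "nhds 0" at_top \<kappa> sequentially] by simp
    show ?thesis
    proof (rule uniform_limitI)
      fix \<epsilon> :: real assume "\<epsilon> > 0"
      then have "\<forall>\<^sub>F k in sequentially. e (\<kappa> k) < \<epsilon>" using lim by (intro order_tendstoD)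
      then show "\<forall>\<^sub>F k in sequentially. \<forall>z\<in>UNIV. dist (case z of (x, y) \<Rightarrow> pderivs m j (R k) x y) 0 < \<epsilon>"
        by eventually_elim (use bound in \<open>auto intro: le_less_trans\<close>)
    qed
  qed
  then have "(\<lambda>k. S (R k)) \<longlonglongrightarrow> 0"
    using S R_tf R_supp ab(1) unfolding distribution2_def by blast
  then show ?thesis unfolding SR by (simp add: LIMSEQ_const_iff)
qed

section \<open>The wave problem\<close>

lemma distribution2_add:
  assumes "distribution2 S" "distribution2 T" shows "distribution2 (\<lambda>\<Phi>. S \<Phi> + T \<Phi>)"
  unfolding distribution2_def
proof (intro conjI allI impI)
  fix \<Phi> :: "nat \<Rightarrow> real \<Rightarrow> real \<Rightarrow> complex"
  assume "\<forall>k. test_fun2 (\<Phi> k)" "\<exists>a>0. \<exists>b. \<forall>k. supported_in a b (\<Phi> k)"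
    "\<forall>m n. uniform_limit UNIV (\<lambda>k (x, y). pderivs m n (\<Phi> k) x y) (\<lambda>_. 0) sequentially"
  then have "(\<lambda>k. S (\<Phi> k)) \<longlonglongrightarrow> 0" "(\<lambda>k. T (\<Phi> k)) \<longlonglongrightarrow> 0"
    using assms unfolding distribution2_def by blast+
  from tendsto_add[OF this] show "(\<lambda>k. S (\<Phi> k) + T (\<Phi> k)) \<longlonglongrightarrow> 0" by simp
qed (use assms in \<open>simp_all add: distribution2_def algebra_simps\<close>)

lemma distribution2_cmult:
  assumes "distribution2 S" shows "distribution2 (\<lambda>\<Phi>. c * S \<Phi>)"
  unfolding distribution2_def
proof (intro conjI allI impI)
  fix \<Phi> :: "nat \<Rightarrow> real \<Rightarrow> real \<Rightarrow> complex"
  assume "\<forall>k. test_fun2 (\<Phi> k)" "\<exists>a>0. \<exists>b. \<forall>k. supported_in a b (\<Phi> k)"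
    "\<forall>m n. uniform_limit UNIV (\<lambda>k (x, y). pderivs m n (\<Phi> k) x y) (\<lambda>_. 0) sequentially"
  then have "(\<lambda>k. S (\<Phi> k)) \<longlonglongrightarrow> 0"
    using assms unfolding distribution2_def by blast
  from tendsto_mult_left[OF this, of c] show "(\<lambda>k. c * S (\<Phi> k)) \<longlonglongrightarrow> 0" by simp
qed (use assms in \<open>simp_all add: distribution2_def algebra_simps\<close>)

lemma distribution2_diff:
  assumes "distribution2 S" "distribution2 T" shows "distribution2 (\<lambda>\<Phi>. S \<Phi> - T \<Phi>)"
  using distribution2_add[OF assms(1) distribution2_cmult[OF assms(2), of "-1"]] by simp

text \<open>The values of T are prescribed on test functions only; these values are all that being a
  distribution depends on.\<close>

lemma distribution2_cong:
  assumes S: "distribution2 S" and eq: "\<And>\<Phi>. test_fun2 \<Phi> \<Longrightarrow> T \<Phi> = S \<Phi>"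
  shows "distribution2 T"
  unfolding distribution2_def
proof (intro conjI allI impI)
  fix \<Phi> :: "nat \<Rightarrow> real \<Rightarrow> real \<Rightarrow> complex"
  assume *: "\<forall>k. test_fun2 (\<Phi> k)" "\<exists>a>0. \<exists>b. \<forall>k. supported_in a b (\<Phi> k)"
    "\<forall>m n. uniform_limit UNIV (\<lambda>k (x, y). pderivs m n (\<Phi> k) x y) (\<lambda>_. 0) sequentially"
  then have "(\<lambda>k. S (\<Phi> k)) \<longlonglongrightarrow> 0"
    using S unfolding distribution2_def by blast
  then show "(\<lambda>k. T (\<Phi> k)) \<longlonglongrightarrow> 0" using * by (simp add: eq)
qed (use S in \<open>simp_all add: distribution2_def eq test_fun2_add test_fun2_cmult\<close>)

text \<open>Distributions of order zero: with a bound by the supremum norm and a support condition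
  in x, uniform convergence of the functions themselves already gives continuity.\<close>

lemma distribution2_integral:
  assumes add: "\<And>\<Phi> \<Psi> x. test_fun2 \<Phi> \<Longrightarrow> test_fun2 \<Psi> \<Longrightarrow> P (\<lambda>x y. \<Phi> x y + \<Psi> x y) x = P \<Phi> x + P \<Psi> x"
    and cmult: "\<And>c \<Phi> x. test_fun2 \<Phi> \<Longrightarrow> P (\<lambda>x y. c * \<Phi> x y) x = c * P \<Phi> x"
    and meas: "\<And>\<Phi>. test_fun2 \<Phi> \<Longrightarrow> P \<Phi> \<in> borel_measurable borel"
    and bound: "\<And>\<Phi> B x. test_fun2 \<Phi> \<Longrightarrow> (\<And>x y. cmod (\<Phi> x y) \<le> B) \<Longrightarrow> cmod (P \<Phi> x) \<le> K * B"
    and supp: "\<And>\<Phi> a b x. supported_in a b \<Phi> \<Longrightarrow> x \<notin> {a..b} \<Longrightarrow> P \<Phi> x = 0"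
  shows "distribution2 (\<lambda>\<Phi>. LBINT x:{0<..}. P \<Phi> x)"
proof -
  have i: "integrable lborel (\<lambda>x. K * B * indicator {a..b} x)" for B and a b :: real
    using borel_integrable_atLeastAtMost'[of a b "\<lambda>_. 1 :: real"] by (simp add: set_integrable_def)
  have b: "norm (indicator {0<..} x *\<^sub>R P \<Phi> x) \<le> K * B * indicator {a..b} x"
    if "test_fun2 \<Phi>" "supported_in a b \<Phi>" "\<And>x y. cmod (\<Phi> x y) \<le> B" for \<Phi> a b B x
    using bound[OF that(1,3), of x] supp[OF that(2), of x] order_trans[OF norm_ge_zero bound[OF that(1,3), of x]]
    by (auto simp: indicator_def)
  have integrable: "integrable lborel (\<lambda>x. indicator {0<..} x *\<^sub>R P \<Phi> x)" if \<Phi>: "test_fun2 \<Phi>" for \<Phi>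
  proof -
    note [measurable] = meas[OF \<Phi>]
    obtain a b where ab: "supported_in a b \<Phi>" using test_fun2_supportE[OF \<Phi>] by blast
    obtain B where B: "\<And>x y. cmod (pderivs 0 0 \<Phi> x y) \<le> B" by (rule pderivs_bounded[OF \<Phi>, of 0 0]) blast
    show ?thesis
    proof (rule Bochner_Integration.integrable_bound[OF i[of B a b]])
      show "AE x in lborel. norm (indicator {0<..} x *\<^sub>R P \<Phi> x) \<le> norm (K * B * indicator {a..b} x)"
        using b[OF \<Phi> ab B[unfolded pderivs_0]] by (intro AE_I2) (simp add: order_trans[OF _ abs_ge_self])
    qed measurable
  qed
  show ?thesis unfolding distribution2_def
  proof (intro conjI allI impI)
    fix \<Phi> \<Psi> assume "test_fun2 \<Phi>" "test_fun2 \<Psi>"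
    then show "(LBINT x:{0<..}. P (\<lambda>x y. \<Phi> x y + \<Psi> x y) x) = (LBINT x:{0<..}. P \<Phi> x) + (LBINT x:{0<..}. P \<Psi> x)"
      unfolding set_lebesgue_integral_def by (simp add: add integrable scaleR_add_right)
  next
    fix c \<Phi> assume "test_fun2 \<Phi>"
    then show "(LBINT x:{0<..}. P (\<lambda>x y. c * \<Phi> x y) x) = c * (LBINT x:{0<..}. P \<Phi> x)"
      by (simp add: cmult)
  next
    fix \<Phi> :: "nat \<Rightarrow> real \<Rightarrow> real \<Rightarrow> complex"
    assume t: "\<forall>k. test_fun2 (\<Phi> k)" and "\<exists>a>0. \<exists>b. \<forall>k. supported_in a b (\<Phi> k)"
      and u: "\<forall>m n. uniform_limit UNIV (\<lambda>k (x, y). pderivs m n (\<Phi> k) x y) (\<lambda>_. 0) sequentially"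
    then obtain a b where ab: "\<And>k. supported_in a b (\<Phi> k)" by blast
    define C where "C = (LBINT x. K * indicator {a..b} x)"
    have C: "cmod (LBINT x:{0<..}. P (\<Phi> k) x) \<le> C * B" if B: "\<And>x y. cmod (\<Phi> k x y) \<le> B" for k B
    proof -
      have "cmod (LBINT x:{0<..}. P (\<Phi> k) x) \<le> (LBINT x. norm (indicator {0<..} x *\<^sub>R P (\<Phi> k) x))"
        unfolding set_lebesgue_integral_def by (rule integral_norm_bound)
      also have "\<dots> \<le> (LBINT x. K * B * indicator {a..b} x)"
        using t by (intro integral_mono integrable_norm integrable i b ab B) auto
      also have "\<dots> = C * B" unfolding C_def by simp
      finally show ?thesis .
    qed
    show "(\<lambda>k. LBINT x:{0<..}. P (\<Phi> k) x) \<longlonglongrightarrow> 0"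
    proof (rule tendstoI)
      fix e :: real assume e: "e > 0"
      define d where "d = e / (\<bar>C\<bar> + 1)"
      have d: "d > 0" using e by (simp add: d_def add_nonneg_pos)
      have "uniform_limit UNIV (\<lambda>k (x, y). \<Phi> k x y) (\<lambda>_. 0) sequentially" using u[rule_format, of 0 0] by simp
      then have "\<forall>\<^sub>F k in sequentially. \<forall>z\<in>UNIV. dist (case z of (x, y) \<Rightarrow> \<Phi> k x y) 0 < d"
        using d by (rule uniform_limitD)
      then show "\<forall>\<^sub>F k in sequentially. dist (LBINT x:{0<..}. P (\<Phi> k) x) 0 < e"
      proof eventually_elim
        case (elim k)
        then have "cmod (\<Phi> k x y) \<le> d" for x y by (force intro: less_imp_le)
        then have "cmod (LBINT x:{0<..}. P (\<Phi> k) x) \<le> C * d" by (rule C)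
        also have "\<dots> \<le> \<bar>C\<bar> * d" using d by (intro mult_right_mono) auto
        also have "\<dots> < (\<bar>C\<bar> + 1) * d" using d by simp
        also have "\<dots> = e" by (simp add: d_def add_nonneg_pos)
        finally show ?case by simp
      qed
    qed
  qed
qed

lemma distribution2_star_formula_wave:
  assumes N: "N \<ge> 1" and \<alpha>: "\<alpha> > 0"
  shows "distribution2 (star_formula_dist N \<alpha> wave_line j l t)"
proof -
  define \<kappa> where "\<kappa> = \<alpha> / real N"
  have \<kappa>: "\<kappa> > 0" using N \<alpha> by (simp add: \<kappa>_def)
  have cont: "continuous_on UNIV (\<lambda>z. \<Phi> (p z) (q z))"
    if "test_fun2 \<Phi>" "continuous_on UNIV p" "continuous_on UNIV q" for \<Phi> and p q :: "'a::topological_space \<Rightarrow> real"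
    using continuous_on_compose2[OF smooth2D(1)[OF test_fun2_smooth2[OF that(1)], of 0 0] continuous_on_Pair[OF that(2,3)]]
    by simp
  have c: "continuous_on UNIV (\<lambda>x. (\<Phi> x (p x) + \<Phi> x (q x)) / 2)"
    if "test_fun2 \<Phi>" "continuous_on UNIV p" "continuous_on UNIV q" for \<Phi> and p q :: "real \<Rightarrow> real"
    by (intro continuous_intros cont that) auto
  have avg: "cmod ((u + v) / 2) \<le> B" if "cmod u \<le> B" "cmod v \<le> B" for u v B
    using norm_triangle_mono[OF that] by (simp add: norm_divide)
  have simple: "distribution2 (\<lambda>\<Phi>. LBINT x:{0<..}. (\<Phi> x (p x) + \<Phi> x (q x)) / 2)"
    if "continuous_on UNIV p" "continuous_on UNIV q" for p q :: "real \<Rightarrow> real"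
  proof (rule distribution2_integral[where K = 1])
    show "(\<lambda>x. (\<Phi> x (p x) + \<Phi> x (q x)) / 2) \<in> borel_measurable borel" if "test_fun2 \<Phi>" for \<Phi>
      by (rule borel_measurable_continuous_onI[OF c]) fact+
    show "cmod ((\<Phi> x (p x) + \<Phi> x (q x)) / 2) \<le> 1 * B" if "\<And>x y. cmod (\<Phi> x y) \<le> B" for \<Phi> B x
      unfolding mult_1 by (rule avg[OF that that])
    show "(\<Phi> x (p x) + \<Phi> x (q x)) / 2 = 0" if "supported_in a b \<Phi>" "x \<notin> {a..b}" for \<Phi> a b x
    proof -
      have "\<Phi> x y = 0" for y using that by (auto simp: supported_in_def)
      then show ?thesis by simp
    qed
  qed (simp_all add: add_divide_distrib algebra_simps)
  have D1: "distribution2 (\<lambda>\<Phi>. LBINT x:{0<..}. wave_line t (\<lambda>z. \<Phi> x (x - z)))"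
    unfolding wave_line_def by (intro simple continuous_intros)
  have D2: "distribution2 (\<lambda>\<Phi>. LBINT x:{0<..}. wave_line t (\<lambda>z. \<Phi> x (z - x)))"
    unfolding wave_line_def by (intro simple continuous_intros)
  define E where "E \<Phi> x s = (\<Phi> x (t - s) + \<Phi> x (- t - s)) / (2 :: complex)" for \<Phi> and x s :: real
  define P where "P \<Phi> x = (LBINT s:{x..}. of_real (exp (- (\<kappa> * (s - x)))) * E \<Phi> x s)" for \<Phi> x
  have E_meas: "(\<lambda>s. E \<Phi> x s) \<in> borel_measurable borel" if "test_fun2 \<Phi>" for \<Phi> x
    unfolding E_def by (intro borel_measurable_continuous_onI continuous_intros cont that) auto
  have si: "set_integrable lborel {x..} (\<lambda>s. of_real (exp (- (\<kappa> * (s - x)))) * E \<Phi> x s)" if \<Phi>: "test_fun2 \<Phi>" for \<Phi> x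
  proof -
    obtain B where B: "\<And>x y. cmod (pderivs 0 0 \<Phi> x y) \<le> B" by (rule pderivs_bounded[OF \<Phi>, of 0 0]) blast
    have "cmod (E \<Phi> x s) \<le> B" for s unfolding E_def using B[unfolded pderivs_0] by (intro avg)
    with E_meas[OF \<Phi>] show ?thesis by (rule exp_weighted_integrable(1)[OF \<kappa>])
  qed
  have D3: "distribution2 (\<lambda>\<Phi>. LBINT x:{0<..}. P \<Phi> x)"
  proof (rule distribution2_integral[where K = "LBINT s:{0..}. exp (- (\<kappa> * s))"])
    fix \<Phi> \<Psi> x assume t: "test_fun2 \<Phi>" "test_fun2 \<Psi>"
    have "E (\<lambda>x y. \<Phi> x y + \<Psi> x y) x s = E \<Phi> x s + E \<Psi> x s" for s
      by (simp add: E_def add_divide_distrib)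
    then show "P (\<lambda>x y. \<Phi> x y + \<Psi> x y) x = P \<Phi> x + P \<Psi> x"
      using set_integral_add(2)[OF si[OF t(1)] si[OF t(2)]] by (simp add: P_def distrib_left)
  next
    fix c \<Phi> x
    have "of_real (exp (- (\<kappa> * (s - x)))) * E (\<lambda>x y. c * \<Phi> x y) x s = c * (of_real (exp (- (\<kappa> * (s - x)))) * E \<Phi> x s)" for s
      by (simp add: E_def algebra_simps)
    then show "P (\<lambda>x y. c * \<Phi> x y) x = c * P \<Phi> x"
      unfolding P_def by (simp only: set_integral_mult_right)
  next
    fix \<Phi> assume \<Phi>: "test_fun2 \<Phi>"
    \<comment> \<open>Measurability of the inner integral in x is drawn from joint measurability of
      the integrand, with the half-line written as an indicator of s - x.\<close>
    define W where "W z = of_real (exp (- (\<kappa> * (snd z - fst z)))) * E \<Phi> (fst z) (snd z)" for z :: "real \<times> real"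
    have "W \<in> borel_measurable borel"
      unfolding W_def E_def by (intro borel_measurable_continuous_onI continuous_intros cont \<Phi>) auto
    then have [measurable]: "W \<in> borel_measurable (borel \<Otimes>\<^sub>M borel)" by (simp add: borel_prod)
    have "P \<Phi> x = (LBINT s. indicator {0..} (s - x) *\<^sub>R W (x, s))" for x
      unfolding P_def set_lebesgue_integral_def W_def
      by (intro Bochner_Integration.integral_cong refl) (simp add: indicator_def)
    then have "P \<Phi> = (\<lambda>x. LBINT s. indicator {0..} (s - x) *\<^sub>R W (x, s))" by (rule ext)
    moreover have "(\<lambda>x. LBINT s. indicator {0..} (s - x) *\<^sub>R W (x, s)) \<in> borel_measurable borel"
      unfolding measurable_lborel1[symmetric] by measurable
    ultimately show "P \<Phi> \<in> borel_measurable borel" by simp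
  next
    fix \<Phi> B x assume \<Phi>: "test_fun2 \<Phi>" and B: "\<And>x y. cmod (\<Phi> x y) \<le> B"
    have "cmod (E \<Phi> x s) \<le> B" for s unfolding E_def using B by (intro avg)
    from exp_weighted_integrable(2)[OF \<kappa> E_meas[OF \<Phi>] this]
    show "cmod (P \<Phi> x) \<le> (LBINT s:{0..}. exp (- (\<kappa> * s))) * B" by (simp add: P_def mult.commute)
  next
    fix \<Phi> a b x assume "supported_in a b \<Phi>" "x \<notin> {a..b}"
    then have "\<Phi> x y = 0" for y by (auto simp: supported_in_def)
    then have "E \<Phi> x s = 0" for s by (simp add: E_def)
    then show "P \<Phi> x = 0" by (simp add: P_def set_lebesgue_integral_def)
  qed
  have "P = (\<lambda>\<Phi> x. LBINT s:{x..}. of_real (exp (- \<alpha> * (s - x) / real N)) * wave_line t (\<lambda>z. \<Phi> x (z - s)))"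
    unfolding exp_weighted_eq \<kappa>_def[symmetric] by (intro ext) (simp add: P_def E_def wave_line_def)
  note D3 = D3[unfolded this]
  show ?thesis
    unfolding star_formula_dist_def[abs_def]
    by (intro distribution2_diff distribution2_add distribution2_cmult D1 D2 D3)
qed

text \<open>With a point mass in place of a kernel the exponential integral is a tail of f itself,
  by the substitution r = p - s. The wave formula uses this at p = t and p = -t.\<close>

lemma exp_weighted_exp_tail:
  "(LBINT s:{x..}. of_real (exp (- (\<kappa> * (s - x)))) * f (p - s)) = exp_tail \<kappa> f (p - x)"
proof -
  have "(LBINT s:{x..}. of_real (exp (- (\<kappa> * (s - x)))) * f (p - s)) =
      (LBINT r. indicator {x..} (p + - 1 * r) *\<^sub>R (of_real (exp (- (\<kappa> * (p + - 1 * r - x)))) * f (p - (p + - 1 * r))))"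
    unfolding set_lebesgue_integral_def
    by (subst lborel_integral_real_affine[where c = "- 1" and t = p]) auto
  also have "\<dots> = (LBINT r. of_real (exp (- \<kappa> * (p - x))) * (indicator {..p - x} r *\<^sub>R (of_real (exp (\<kappa> * r)) * f r)))"
  proof (rule Bochner_Integration.integral_cong[OF refl])
    fix r
    have "- (\<kappa> * (p + - 1 * r - x)) = - \<kappa> * (p - x) + \<kappa> * r" by (simp add: algebra_simps)
    then have "complex_of_real (exp (- (\<kappa> * (p + - 1 * r - x)))) = of_real (exp (- \<kappa> * (p - x))) * of_real (exp (\<kappa> * r))"
      by (simp only: exp_add of_real_mult)
    then show "indicator {x..} (p + - 1 * r) *\<^sub>R (of_real (exp (- (\<kappa> * (p + - 1 * r - x)))) * f (p - (p + - 1 * r))) =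
        of_real (exp (- \<kappa> * (p - x))) * (indicator {..p - x} r *\<^sub>R (of_real (exp (\<kappa> * r)) * f r))"
      by (auto simp: indicator_def)
  qed
  also have "\<dots> = exp_tail \<kappa> f (p - x)"
    unfolding exp_tail_def set_lebesgue_integral_def by (rule integral_mult_right_zero)
  finally show ?thesis .
qed

text \<open>The counterpart of \<open>conv_star_ext\<close> for d'Alembert's formula: A, B and E are
  the averages over both directions of travel of the data, the reflected data and the reflected
  tail.\<close>

lemma wave_star_ext:
  assumes N: "N \<ge> 1" and \<alpha>: "\<alpha> > 0" and f: "\<forall>l\<in>{1..N}. test_fun (f l)" and j: "j \<in> {1..N}" and \<phi>: "test_fun \<phi>"
  shows "(LBINT x:{0<..}. wave_ev (star_ext N \<alpha> f j) t x * \<phi> x) =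
    (\<Sum>l=1..N. star_formula_dist N \<alpha> wave_line j l t (\<lambda>x y. \<phi> x * f l y))"
proof -
  define \<kappa> where "\<kappa> = \<alpha> / real N"
  have \<kappa>: "\<kappa> > 0" using N \<alpha> by (simp add: \<kappa>_def)
  define A B E where "A l x = (f l (x - t) + f l (x + t)) / 2" and "B l x = (f l (t - x) + f l (- t - x)) / 2"
    and "E l x = (exp_tail \<kappa> (f l) (t - x) + exp_tail \<kappa> (f l) (- t - x)) / 2" for l x
  have int: "integrable lborel (\<lambda>x. (h (p x) + h (q x)) / 2 * \<phi> x)"
    if h: "schwartz h" and m: "p \<in> borel_measurable borel" "q \<in> borel_measurable borel" for h p q
  proof -
    note [measurable] = schwartz_borel[OF h] m
    obtain C where C: "\<And>z. cmod (h z) \<le> C" by (rule schwartz_bounded[OF h]) blast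
    show ?thesis
    proof (rule test_fun_times_integrable[OF \<phi>])
      show "cmod ((h (p x) + h (q x)) / 2) \<le> C" for x
        using norm_triangle_mono[OF C C, of "p x" "q x"] by (simp add: norm_divide)
    qed measurable
  qed
  have i: "integrable lborel (\<lambda>x. A l x * \<phi> x)" "integrable lborel (\<lambda>x. B l x * \<phi> x)" "integrable lborel (\<lambda>x. E l x * \<phi> x)"
    if l: "l \<in> {1..N}" for l
  proof -
    have tf: "test_fun (f l)" using f l by blast
    show "integrable lborel (\<lambda>x. A l x * \<phi> x)" "integrable lborel (\<lambda>x. B l x * \<phi> x)"
      unfolding A_def B_def by (rule int[OF test_fun_schwartz[OF tf]]; measurable)+
    show "integrable lborel (\<lambda>x. E l x * \<phi> x)"
      unfolding E_def by (rule int[OF exp_tail_schwartz[OF \<kappa> tf]]; measurable)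
  qed
  define W where "W l x = of_bool (j = l) * (A l x * \<phi> x) + (2 / of_nat N - of_bool (j = l)) * (B l x * \<phi> x)
      - of_real (2 * \<alpha> / (real N)\<^sup>2) * (E l x * \<phi> x)" for l x
  have W_int: "integrable lborel (W l)" if "l \<in> {1..N}" for l
    unfolding W_def[abs_def] using i[OF that] by auto
  have dist: "star_formula_dist N \<alpha> wave_line j l t (\<lambda>x y. \<phi> x * f l y) = (LBINT x. W l x)" if l: "l \<in> {1..N}" for l
  proof -
    have tf: "test_fun (f l)" using f l by blast
    have 1: "wave_line t (\<lambda>z. \<phi> x * f l (x - z)) = A l x * \<phi> x" for x
      by (simp add: wave_line_def A_def algebra_simps)
    have 2: "wave_line t (\<lambda>z. \<phi> x * f l (z - x)) = B l x * \<phi> x" for x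
      by (simp add: wave_line_def B_def algebra_simps)
    have 3: "(LBINT s:{x..}. of_real (exp (- \<alpha> * (s - x) / real N)) * wave_line t (\<lambda>z. \<phi> x * f l (z - s))) = E l x * \<phi> x" for x
    proof -
      have si: "set_integrable lborel {x..} (\<lambda>s. of_real (exp (- (\<kappa> * (s - x)))) * f l (p - s))" for p
      proof -
        note [measurable] = schwartz_borel[OF test_fun_schwartz[OF tf]]
        obtain C where C: "\<And>z. cmod (f l z) \<le> C" by (rule schwartz_bounded[OF test_fun_schwartz[OF tf]]) blast
        show ?thesis by (rule exp_weighted_integrable(1)[OF \<kappa> _ C]) measurable
      qed
      have "(LBINT s:{x..}. of_real (exp (- (\<kappa> * (s - x)))) * wave_line t (\<lambda>z. \<phi> x * f l (z - s))) =
          (LBINT s:{x..}. (\<phi> x / 2) * (of_real (exp (- (\<kappa> * (s - x)))) * f l (t - s) + of_real (exp (- (\<kappa> * (s - x)))) * f l (- t - s)))"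
        by (simp add: wave_line_def algebra_simps add_divide_distrib)
      also have "\<dots> = (\<phi> x / 2) * (exp_tail \<kappa> (f l) (t - x) + exp_tail \<kappa> (f l) (- t - x))"
        unfolding set_integral_mult_right set_integral_add(2)[OF si si] exp_weighted_exp_tail ..
      finally show ?thesis unfolding exp_weighted_eq \<kappa>_def[symmetric] by (simp add: E_def)
    qed
    show ?thesis
      unfolding star_formula_dist_def 1 2 3 W_def test_fun_half_line[OF \<phi>] using i[OF l] by simp
  qed
  have "wave_ev (star_ext N \<alpha> f j) t x * \<phi> x = (\<Sum>l=1..N. W l x)" for x
  proof -
    define Z where "Z z = (\<Sum>l=1..N. f l (- z) - of_real \<kappa> * exp_tail \<kappa> (f l) (- z))" for z
    define c where "c = complex_of_real (2 / N)"
    have ext: "star_ext N \<alpha> f j z = (f j z - f j (- z)) + c * Z z" for z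
      by (simp only: star_ext_def \<kappa>_def Z_def c_def)
    have "(\<Sum>l=1..N. of_bool (j = l) * ((A l x - B l x) * \<phi> x)) = (\<Sum>l=1..N. if j = l then (A l x - B l x) * \<phi> x else 0)"
      by (intro sum.cong) auto
    also have "\<dots> = (A j x - B j x) * \<phi> x"
      using j by (simp only: sum.delta' finite_atLeastAtMost if_True)
    finally have single: "(\<Sum>l=1..N. of_bool (j = l) * ((A l x - B l x) * \<phi> x)) = (A j x - B j x) * \<phi> x" .
    have "(\<Sum>l=1..N. W l x) = (\<Sum>l=1..N. of_bool (j = l) * ((A l x - B l x) * \<phi> x) + of_real (2 / N) * ((B l x - of_real \<kappa> * E l x) * \<phi> x))"
      by (intro sum.cong) (auto simp: W_def \<kappa>_def power2_eq_square algebra_simps)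
    also have "\<dots> = (A j x - B j x) * \<phi> x + of_real (2 / N) * (\<Sum>l=1..N. B l x - of_real \<kappa> * E l x) * \<phi> x"
      unfolding sum.distrib single by (simp only: sum_distrib_left sum_distrib_right mult.assoc)
    also have "(\<Sum>l=1..N. B l x - of_real \<kappa> * E l x) =
        (Z (x - t) + Z (x + t)) / 2"
      unfolding Z_def sum.distrib[symmetric] sum_divide_distrib
      by (intro sum.cong refl) (simp add: B_def E_def field_simps)
    finally have eq: "(\<Sum>l=1..N. W l x) = (A j x - B j x) * \<phi> x + of_real (2 / N) * ((Z (x - t) + Z (x + t)) / 2) * \<phi> x" .
    show ?thesis
      unfolding eq wave_ev_def ext c_def[symmetric] by (simp add: A_def B_def field_simps)
  qed
  then have "(LBINT x:{0<..}. wave_ev (star_ext N \<alpha> f j) t x * \<phi> x) = (LBINT x. \<Sum>l=1..N. W l x)"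
    unfolding test_fun_half_line[OF \<phi>] by simp
  also have "\<dots> = (\<Sum>l=1..N. LBINT x. W l x)"
    by (rule Bochner_Integration.integral_sum[OF W_int])
  also have "\<dots> = (\<Sum>l=1..N. star_formula_dist N \<alpha> wave_line j l t (\<lambda>x y. \<phi> x * f l y))"
    by (intro sum.cong refl) (simp only: dist)
  finally show ?thesis .
qed

lemma wave_green_distribution:
  assumes N: "N \<ge> 1" and \<alpha>: "\<alpha> > 0"
  shows "green_distribution N (wave_solution N \<alpha>) T \<longleftrightarrow>
    (\<forall>j\<in>{1..N}. \<forall>l\<in>{1..N}. \<forall>t>0. \<forall>\<Phi>. test_fun2 \<Phi> \<longrightarrow> T j l t \<Phi> = star_formula_dist N \<alpha> wave_line j l t \<Phi>)"
proof -
  interpret E: wave_evolution wave_ev wave_evt N \<alpha> by (rule wave_evolution[OF N \<alpha>])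
  define T0 where "T0 = star_formula_dist N \<alpha> wave_line"
  have dist0: "distribution2 (T0 j l t)" for j l t
    unfolding T0_def by (rule distribution2_star_formula_wave[OF N \<alpha>])
  have ex: "\<exists>u. wave_solution N \<alpha> f u" if "\<forall>l\<in>{1..N}. test_fun (f l)" for f
    using E.solution_sol[OF that] by blast
  have rep: "(LBINT x:{0<..}. u t j x * \<phi> x) = (\<Sum>l=1..N. T0 j l t (\<lambda>x y. \<phi> x * f l y))"
    if f: "\<forall>l\<in>{1..N}. test_fun (f l)" and u: "wave_solution N \<alpha> f u" and t: "t > 0" and j: "j \<in> {1..N}" and \<phi>: "test_fun \<phi>"
    for f u t j \<phi>
  proof -
    note [measurable] = smooth_borel[OF test_fun_smooth[OF \<phi>]]
    have "in_L2N N (u t)" using u t by (auto simp: wave_solution_def L2_has_deriv_def)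
    then have [measurable]: "(\<lambda>x. indicator {0<..} x *\<^sub>R u t j x) \<in> borel_measurable borel"
      using j in_L2_measurable unfolding in_L2N_def by blast
    have [measurable]: "(\<lambda>x. indicator {0<..} x *\<^sub>R E.sol f t j x) \<in> borel_measurable borel"
      using E.sol_in_L2N[OF f t] j in_L2_measurable unfolding in_L2N_def by blast
    have "(LBINT x:{0<..}. u t j x * \<phi> x) = (LBINT x. (indicator {0<..} x *\<^sub>R u t j x) * \<phi> x)"
      by (simp add: set_lebesgue_integral_def)
    also have "\<dots> = (LBINT x. (indicator {0<..} x *\<^sub>R E.sol f t j x) * \<phi> x)"
    proof (rule integral_cong_AE)
      show "AE x in lborel. (indicator {0<..} x *\<^sub>R u t j x) * \<phi> x = (indicator {0<..} x *\<^sub>R E.sol f t j x) * \<phi> x"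
        using E.solution_unique[OF u f t j] by eventually_elim (auto simp: indicator_def)
    qed measurable
    also have "\<dots> = (LBINT x:{0<..}. wave_ev (star_ext N \<alpha> f j) t x * \<phi> x)"
      by (simp add: set_lebesgue_integral_def E.sol_def)
    finally show ?thesis unfolding T0_def wave_star_ext[OF N \<alpha> f j \<phi>] .
  qed
  have "green_distribution N (wave_solution N \<alpha>) T \<longleftrightarrow>
    (\<forall>j\<in>{1..N}. \<forall>l\<in>{1..N}. \<forall>t>0. \<forall>\<Phi>. test_fun2 \<Phi> \<longrightarrow> T j l t \<Phi> = T0 j l t \<Phi>)"
  proof
    assume eq: "\<forall>j\<in>{1..N}. \<forall>l\<in>{1..N}. \<forall>t>0. \<forall>\<Phi>. test_fun2 \<Phi> \<longrightarrow> T j l t \<Phi> = T0 j l t \<Phi>"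
    show "green_distribution N (wave_solution N \<alpha>) T"
      unfolding green_distribution_def
    proof (intro conjI ballI allI impI)
      fix j l and t :: real assume "j \<in> {1..N}" "l \<in> {1..N}" "t > 0"
      then show "distribution2 (T j l t)" using eq by (intro distribution2_cong[OF dist0]) auto
    next
      fix f assume f: "\<forall>l\<in>{1..N}. test_fun (f l)"
      show "\<exists>u. wave_solution N \<alpha> f u" using ex[OF f] .
      fix u and t :: real and j \<phi>
      assume u: "wave_solution N \<alpha> f u" and t: "t > 0" and j: "j \<in> {1..N}" and \<phi>: "test_fun \<phi>"
      have "T j l t (\<lambda>x y. \<phi> x * f l y) = T0 j l t (\<lambda>x y. \<phi> x * f l y)" if l: "l \<in> {1..N}" for l
        using eq j l t test_fun2_tensor[OF \<phi>, of "f l"] f by blast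
      then show "(LBINT x:{0<..}. u t j x * \<phi> x) = (\<Sum>l=1..N. T j l t (\<lambda>x y. \<phi> x * f l y))"
        unfolding rep[OF f u t j \<phi>] by (intro sum.cong refl) simp
    qed
  next
    assume G: "green_distribution N (wave_solution N \<alpha>) T"
    show "\<forall>j\<in>{1..N}. \<forall>l\<in>{1..N}. \<forall>t>0. \<forall>\<Phi>. test_fun2 \<Phi> \<longrightarrow> T j l t \<Phi> = T0 j l t \<Phi>"
    proof (intro ballI allI impI)
      fix j l and t :: real and \<Phi> assume j: "j \<in> {1..N}" and l: "l \<in> {1..N}" and t: "t > 0" and \<Phi>: "test_fun2 \<Phi>"
      have dist: "distribution2 (T j l t)" if "l \<in> {1..N}" for l
        using G j that t unfolding green_distribution_def by blast
      have "T j l t \<Phi> - T0 j l t \<Phi> = 0"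
      proof (rule distribution2_tensor_density[OF distribution2_diff[OF dist[OF l] dist0] _ \<Phi>])
        fix \<phi> \<psi> assume \<phi>: "test_fun \<phi>" and \<psi>: "test_fun \<psi>"
        define f where "f i = (if i = l then \<psi> else (\<lambda>_. 0))" for i
        have f: "\<forall>l\<in>{1..N}. test_fun (f l)" using \<psi> by (simp add: f_def)
        have single: "(\<Sum>i=1..N. S i (\<lambda>x y. \<phi> x * f i y)) = S l (\<lambda>x y. \<phi> x * \<psi> y)"
          if S: "\<And>i. i \<in> {1..N} \<Longrightarrow> distribution2 (S i)" for S
        proof -
          \<comment> \<open>The data vanish on the other edges, and a distribution is 0 at the zero
            function by linearity; the empty sum in \<open>distribution2_sum\<close> expresses
            this.\<close>
          have "S i (\<lambda>x y. 0) = 0" if "i \<in> {1..N}" for i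
            using distribution2_sum[OF S[OF that], of 0] by simp
          then have "(\<Sum>i=1..N. S i (\<lambda>x y. \<phi> x * f i y)) = (\<Sum>i=1..N. if l = i then S i (\<lambda>x y. \<phi> x * \<psi> y) else 0)"
            by (intro sum.cong refl) (auto simp: f_def)
          also have "\<dots> = S l (\<lambda>x y. \<phi> x * \<psi> y)"
            using l by (simp only: sum.delta' finite_atLeastAtMost if_True)
          finally show ?thesis .
        qed
        obtain u where u: "wave_solution N \<alpha> f u" using ex[OF f] by blast
        have "(LBINT x:{0<..}. u t j x * \<phi> x) = (\<Sum>l=1..N. T j l t (\<lambda>x y. \<phi> x * f l y))"
          using G f u t j \<phi> unfolding green_distribution_def by blast
        moreover have "(\<Sum>i=1..N. T j i t (\<lambda>x y. \<phi> x * f i y)) = T j l t (\<lambda>x y. \<phi> x * \<psi> y)"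
          by (rule single[of "\<lambda>i. T j i t", OF dist])
        moreover have "(\<Sum>i=1..N. T0 j i t (\<lambda>x y. \<phi> x * f i y)) = T0 j l t (\<lambda>x y. \<phi> x * \<psi> y)"
          by (rule single[of "\<lambda>i. T0 j i t", OF dist0])
        ultimately have "T j l t (\<lambda>x y. \<phi> x * \<psi> y) = T0 j l t (\<lambda>x y. \<phi> x * \<psi> y)"
          using rep[OF f u t j \<phi>] by (simp only:)
        then show "T j l t (\<lambda>x y. \<phi> x * \<psi> y) - T0 j l t (\<lambda>x y. \<phi> x * \<psi> y) = 0" by simp
      qed
      then show "T j l t \<Phi> = T0 j l t \<Phi>" by simp
    qed
  qed
  then show ?thesis unfolding T0_def .
qed

theorem mainTheorem2:
  fixes N :: nat and \<alpha> :: real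
  assumes "N \<ge> 1" and "\<alpha> > 0"
  shows
    "(\<forall>T. green_distribution N (wave_solution N \<alpha>) T \<longleftrightarrow>
        (\<forall>j\<in>{1..N}. \<forall>l\<in>{1..N}. \<forall>t>0. \<forall>\<Phi>. test_fun2 \<Phi> \<longrightarrow>
           T j l t \<Phi> = star_formula_dist N \<alpha> wave_line j l t \<Phi>)) \<and>
     (\<forall>G. green_function N (heat_solution N \<alpha>) G \<longleftrightarrow>
        (\<forall>j\<in>{1..N}. \<forall>l\<in>{1..N}. \<forall>t>0. \<forall>x>0. \<forall>y>0.
           G j l t x y = star_formula N \<alpha> heat_line j l t x y)) \<and>
     (\<forall>G. green_function N (quantum_solution N \<alpha>) G \<longleftrightarrow>
        (\<forall>j\<in>{1..N}. \<forall>l\<in>{1..N}. \<forall>t>0. \<forall>x>0. \<forall>y>0.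
           G j l t x y = star_formula N \<alpha> quantum_line j l t x y)) \<and>
     (\<forall>G. green_function N (cylinder_solution N \<alpha>) G \<longleftrightarrow>
        (\<forall>j\<in>{1..N}. \<forall>l\<in>{1..N}. \<forall>t>0. \<forall>x>0. \<forall>y>0.
           G j l t x y = star_formula N \<alpha> cylinder_line j l t x y))"
  using wave_green_distribution[OF assms] heat_green_function[OF assms]
    quantum_green_function[OF assms] cylinder_green_function[OF assms] by blast

end
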